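(* Let $(C,b,T_{\mathsf d},T_{\mathsf u},G)$ be a twist oriented quantum coalgebra over the field $k$, let $\mathsf c$ be a $T_{\mathsf d}\circ T_{\mathsf u}$-invariant cocommutative element of $C$, and let $\mathbf f_{C,\mathsf c}:\mathcal K\to k$ be the function on oriented knot diagrams defined in the context. (a) Suppose that $\mathbf K,\mathbf K'\in\mathcal K$ are regularly isotopic. Then $\mathbf f_{C,\mathsf c}(\mathbf K)=\mathbf f_{C,\mathsf c}(\mathbf K')$. (b) Suppose that $\mathbf K\in\mathcal K$ and that $\mathbf K$ is regularly isotopic to $\mathbf K(\mathbf T)$ for some $\mathbf T\in\mathbf{Tang}$. Then $$\mathbf f_{C,\mathsf c}(\mathbf K)=(G^d\,\mathbf{Inv}_C(\mathbf T))(\mathsf c),$$ where $d$ is the Whitney degree of $\mathbf K$ and the product is that of the dual algebra $C^*$. (c) $\mathbf f_{C,\mathsf c}(\mathbf K^{op})=\mathbf f_{C^{cop},\mathsf c}(\mathbf K)$ for all $\mathbf K\in\mathcal K$, where $\mathbf K^{op}$ is $\mathbf K$ with the opposite orientation and $C^{cop}$ stands for the twist oriented quantum coalgebra $(C^{cop},b,T_{\mathsf d},T_{\mathsf u},G^{-1})$.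
   Context: $k$ is a field. For a coalgebra $(C,\Delta,\epsilon)$ over $k$ write $\Delta(c)=c_{(1)}\otimes c_{(2)}$ and $\Delta^{(m-1)}(c)=c_{(1)}\otimes\cdots\otimes c_{(m)}$ (summation understood); $C^{cop}$ is $C$ with coproduct $c\mapsto c_{(2)}\otimes c_{(1)}$. $C^*$ is the dual algebra: $(c^*d^* )(c)=c^*(c_{(1)})d^*(c_{(2)})$, unit $\epsilon$; and $c^*\rightharpoonup c=c_{(1)}c^*(c_{(2)})$, $c\leftharpoonup c^*=c^*(c_{(1)})c_{(2)}$. An element $\mathsf c\in C$ is cocommutative if $\mathsf c_{(1)}\otimes\mathsf c_{(2)}=\mathsf c_{(2)}\otimes\mathsf c_{(1)}$, and $T$-invariant if $T(\mathsf c)=\mathsf c$. A bilinear form $b:C\times C\to k$ is invertible, with inverse $b^{-1}$, if $b^{-1}(c_{(1)},d_{(1)})b(c_{(2)},d_{(2)})=\epsilon(c)\epsilon(d)=b(c_{(1)},d_{(1)})b^{-1}(c_{(2)},d_{(2)})$. A strict oriented quantum coalgebra over $k$ is a quadruple $(C,b,T_{\mathsf d},T_{\mathsf u})$ where $C$ is a coalgebra over $k$, $b:C\times C\to k$ is an invertible bilinear form and $T_{\mathsf d},T_{\mathsf u}$ are commuting coalgebra automorphisms of $C$ such that for all $c,d,e\in C$: $b(c_{(1)},T_{\mathsf u}(d_{(2)}))b^{-1}(T_{\mathsf d}(c_{(2)}),d_{(1)})=\epsilon(c)\epsilon(d)$ and $b^{-1}(T_{\mathsf d}(c_{(1)}),d_{(2)})b(c_{(2)},T_{\mathsf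 u}(d_{(1)}))=\epsilon(c)\epsilon(d)$; $b(c,d)=b(T_{\mathsf d}(c),T_{\mathsf d}(d))=b(T_{\mathsf u}(c),T_{\mathsf u}(d))$; $b(c_{(1)},d_{(1)})b(c_{(2)},e_{(1)})b(d_{(2)},e_{(2)})=b(c_{(2)},d_{(2)})b(c_{(1)},e_{(2)})b(d_{(1)},e_{(1)})$. A twist oriented quantum coalgebra over $k$ is a quintuple $(C,b,T_{\mathsf d},T_{\mathsf u},G)$ where $(C,b,T_{\mathsf d},T_{\mathsf u})$ is a strict oriented quantum coalgebra and $G\in C^*$ is invertible with $T_{\mathsf d}^*(G)=T_{\mathsf u}^*(G)=G$ and $T_{\mathsf d}\circ T_{\mathsf u}(c)=G^{-1}\rightharpoonup c\leftharpoonup G$ for all $c\in C$. Diagrams. $\mathcal K$ is the set of oriented knot diagrams in the plane drawn with respect to the vertical direction, and $\mathbf{Tang}$ is the set of oriented $1$--$1$ tangle diagrams (a single oriented strand contained in a box except for two protruding vertical end segments, one at the top and one at the bottom). All are composed of crossings, local maxima, local minima and vertical lines. Each crossing consists of two crossing lines, one joining its SW and NE corners and the other its NW and SE corners; one is the over line and the other the under line. Types of oriented local extrema: $(\mathsf u_-)$ local maximum traversed left to right (clockwise); $(\mathsf u_+)$ local minimum traversed left to right (counterclockwise); $(\mathsf d_+)$ local maximum traversed right to left (counterclockwise); $(\mathsf d_-)$ local minimum traversed right to left (clockwise). The Whitney degree $d$ of $\mathbf K\in\mathcal K$ is defined by: $2d$ is the number of local extrema with clockwise orientation minus the number with counterclockwise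 orientation. $\mathbf K(\mathbf T)$ is the oriented knot diagram obtained from $\mathbf T\in\mathbf{Tang}$ by joining its top end to its bottom end by an arc to the left of $\mathbf T$ consisting of one local maximum, one vertical line and one local minimum, with the orientation extending that of $\mathbf T$. Crossing algorithm. Suppose a traversal in the direction of orientation is given: for $\mathbf T\in\mathbf{Tang}$ from its beginning to its end; for $\mathbf K\in\mathcal K$ from a chosen starting point $P$ on a vertical line of $\mathbf K$ once around back to $P$. If there are no crossings the associated functional is $\epsilon$. If there are $n\ge1$ crossings, label the crossing lines $1,\dots,2n$ in the order encountered; let $u_{\mathsf d}(\imath)$ be the number of extrema of type $(\mathsf d_+)$ minus the number of type $(\mathsf d_-)$ on the portion of the traversal from line $\imath$ to the end of the traversal, and $u_{\mathsf u}(\imath)$ likewise with $(\mathsf u_+),(\mathsf u_-)$. Write $[\imath;p,q]=T_{\mathsf d}^{u_{\mathsf d}(\imath)+p}\circ T_{\mathsf u}^{u_{\mathsf u}(\imath)+q}(c_{(\imath)})$. The associated functional sends $c\in C$, with $\Delta^{(2n-1)}(c)=c_{(1)}\otimes\cdots\otimes c_{(2n)}$, to the (Sweedler sum of the) product over all crossings of the following factors ($\imath$ labels the over line, $\jmath$ the under line): - over line SW--NE, both lines directed upward, or both downward: $b([\imath;0,0],[\jmath;0,0])$; - over line SW--NE, both directed left to right: $b^{-1}([\imath;0,1],[\jmath;0,0])$; - over line SW--NE, both directed right to left: $b^{-1}([\imath;1,0],[\jmath;0,0])$; - over line NW--SE, both directed upward, or both downward: $b^{-1}([\imath;0,0],[\jmath;0,0])$;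 - over line NW--SE, both directed left to right: $b([\imath;0,0],[\jmath;0,1])$; - over line NW--SE, both directed right to left: $b([\imath;0,0],[\jmath;1,0])$. For $\mathbf T\in\mathbf{Tang}$ this functional is $\mathbf{Inv}_C(\mathbf T)\in C^*$. For $\mathbf K\in\mathcal K$ with starting point $P$, call it $\mathbf f\in C^*$; then $\mathbf f_{C,\mathsf c}(\mathbf K)=(G^d\mathbf f)(\mathsf c)=G^d(\mathsf c_{(1)})\mathbf f(\mathsf c_{(2)})$, where $d$ is the Whitney degree of $\mathbf K$. (This scalar does not depend on $P$.) Regular isotopy. Diagrams are considered up to planar isotopies which create or cancel no local extrema and do not change the position of crossings relative to the vertical. Two oriented diagrams are regularly isotopic if they are related by a finite sequence of the following local replacements (in either direction, with any compatible orientations): (M.1) a vertical arc is replaced by an arc having the same ends and one adjacent local maximum/local minimum pair (an "S" shape or its mirror image); (M.2) two vertical lines are replaced by two strands crossing twice, one crossing directly above the other, the strand starting at the bottom left being the over strand at both crossings; (M.2rev) the same with that strand being the under strand at both crossings; (M.3) for three strands in positions $1,2,3$ from left to right: reading upward, a crossing of positions $1,2$, then $2,3$, then $1,2$ is replaced by a crossing of positions $2,3$, then $1,2$, then $2,3$, where all over lines run NW--SE; (M.3rev) the same with all over lines running SW--NE; (M.4) a strand running from the bottom to the top which passes under the left leg of a local maximum arc (and then to the left of and above the maximum) is replaced by one which passes under the right leg (and to the right of and above the maximum); likewise, for a local minimum arc, a strand coming from below the minimum and passing under its left leg is replaced by one passing under its right leg; (M.4rev) the same with the strand passing over instead of under.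 *)

theory Defs
  imports Complex_Main
begin

section \<open>Tensor powers\<close>

text \<open>
  An element of an \<open>m\<close>-fold tensor power of a vector space (scalar multiplication \<open>scl\<close>)
  is written as a formal sum (a list) of \<open>m\<close>-tuples (lists of length \<open>m\<close>).  Two formal sums denote
  the same tensor iff they are related by the congruence generated by the defining relations of
  the tensor product.
\<close>

inductive tensor_eq :: "('k::field \<Rightarrow> 'c::ab_group_add \<Rightarrow> 'c) \<Rightarrow> 'c list list \<Rightarrow> 'c list list \<Rightarrow> bool"
  for scl where
  refl: "tensor_eq scl xs xs"
| sym: "tensor_eq scl xs ys \<Longrightarrow> tensor_eq scl ys xs"
| trans: "tensor_eq scl xs ys \<Longrightarrow> tensor_eq scl ys zs \<Longrightarrow> tensor_eq scl xs zs"
| cong: "tensor_eq scl xs xs' \<Longrightarrow> tensor_eq scl ys ys' \<Longrightarrow> tensor_eq scl (xs @ ys) (xs' @ ys')"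
| comm: "tensor_eq scl (xs @ ys) (ys @ xs)"
| add: "tensor_eq scl [us @ (x + y) # vs] [us @ x # vs, us @ y # vs]"
| zero: "tensor_eq scl [us @ 0 # vs] []"
| scale: "tensor_eq scl [us @ scl a x # vs @ y # ws] [us @ x # vs @ scl a y # ws]"

definition tensor2_eq ::
  "('k::field \<Rightarrow> 'c::ab_group_add \<Rightarrow> 'c) \<Rightarrow> ('c \<times> 'c) list \<Rightarrow> ('c \<times> 'c) list \<Rightarrow> bool" where
  "tensor2_eq scl xs ys \<longleftrightarrow>
     tensor_eq scl (map (\<lambda>(x, y). [x, y]) xs) (map (\<lambda>(x, y). [x, y]) ys)"


section \<open>Coalgebras and twist oriented quantum coalgebras\<close>

text \<open>
  \<open>comult C c\<close> is a Sweedler presentation of \<open>\<Delta>(c)\<close>: the list of the pairs \<open>(c\<^sub>1, c\<^sub>2)\<close> summed over.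
  Only its class modulo \<^const>\<open>tensor2_eq\<close> is meaningful, and all axioms are stated for that class.
\<close>

record ('k, 'c) coalgebra =
  scl :: "'k \<Rightarrow> 'c \<Rightarrow> 'c"
  comult :: "'c \<Rightarrow> ('c \<times> 'c) list"
  counit :: "'c \<Rightarrow> 'k"

record ('k, 'c) oriented_quantum_coalgebra = "('k, 'c) coalgebra" +
  br :: "'c \<Rightarrow> 'c \<Rightarrow> 'k"
  Td :: "'c \<Rightarrow> 'c"
  Tu :: "'c \<Rightarrow> 'c"

record ('k, 'c) twist_quantum_coalgebra = "('k, 'c) oriented_quantum_coalgebra" +
  tw :: "'c \<Rightarrow> 'k"

definition linear_form :: "('k::field, 'c::ab_group_add, 'z) coalgebra_scheme \<Rightarrow> ('c \<Rightarrow> 'k) \<Rightarrow> bool" where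
  "linear_form C f \<longleftrightarrow> Vector_Spaces.linear (scl C) (*) f"

definition bilinear_form ::
  "('k::field, 'c::ab_group_add, 'z) coalgebra_scheme \<Rightarrow> ('c \<Rightarrow> 'c \<Rightarrow> 'k) \<Rightarrow> bool" where
  "bilinear_form C b \<longleftrightarrow> (\<forall>c. linear_form C (b c)) \<and> (\<forall>d. linear_form C (\<lambda>c. b c d))"

definition is_coalgebra :: "('k::field, 'c::ab_group_add, 'z) coalgebra_scheme \<Rightarrow> bool" where
  "is_coalgebra C \<longleftrightarrow>
     vector_space (scl C) \<and>
     (\<forall>x y. tensor2_eq (scl C) (comult C (x + y)) (comult C x @ comult C y)) \<and>
     (\<forall>a x. tensor2_eq (scl C) (comult C (scl C a x)) (map (\<lambda>(u, v). (scl C a u, v)) (comult C x))) \<and>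
     linear_form C (counit C) \<and>
     (\<forall>c. tensor_eq (scl C)
            [[c11, c12, c2]. (c1, c2) \<leftarrow> comult C c, (c11, c12) \<leftarrow> comult C c1]
            [[c1, c21, c22]. (c1, c2) \<leftarrow> comult C c, (c21, c22) \<leftarrow> comult C c2]) \<and>
     (\<forall>c. (\<Sum>(c1, c2)\<leftarrow>comult C c. scl C (counit C c1) c2) = c) \<and>
     (\<forall>c. (\<Sum>(c1, c2)\<leftarrow>comult C c. scl C (counit C c2) c1) = c)"

definition coalgebra_automorphism ::
  "('k::field, 'c::ab_group_add, 'z) coalgebra_scheme \<Rightarrow> ('c \<Rightarrow> 'c) \<Rightarrow> bool" where
  "coalgebra_automorphism C T \<longleftrightarrow>
     Vector_Spaces.linear (scl C) (scl C) T \<and> bij T \<and>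
     (\<forall>c. tensor2_eq (scl C) (comult C (T c)) (map (\<lambda>(c1, c2). (T c1, T c2)) (comult C c))) \<and>
     (\<forall>c. counit C (T c) = counit C c)"

definition cocommutative :: "('k::field, 'c::ab_group_add, 'z) coalgebra_scheme \<Rightarrow> 'c \<Rightarrow> bool" where
  "cocommutative C c \<longleftrightarrow> tensor2_eq (scl C) (comult C c) (map prod.swap (comult C c))"

text \<open>The presentation of \<open>\<Delta>\<^sup>(\<^sup>n\<^sup>)(c)\<close> by tuples of length \<open>n + 1\<close>.\<close>

primrec iter_comult :: "('k, 'c, 'z) coalgebra_scheme \<Rightarrow> nat \<Rightarrow> 'c \<Rightarrow> 'c list list" where
  "iter_comult C 0 c = [[c]]"
| "iter_comult C (Suc n) c = [c1 # cs. (c1, c2) \<leftarrow> comult C c, cs \<leftarrow> iter_comult C n c2]"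

text \<open>The dual algebra, with unit \<^const>\<open>counit\<close>, and its actions on the coalgebra.\<close>

definition conv ::
  "('k::field, 'c, 'z) coalgebra_scheme \<Rightarrow> ('c \<Rightarrow> 'k) \<Rightarrow> ('c \<Rightarrow> 'k) \<Rightarrow> 'c \<Rightarrow> 'k" where
  "conv C f g c = (\<Sum>(c1, c2)\<leftarrow>comult C c. f c1 * g c2)"

definition is_dual_inverse ::
  "('k::field, 'c::ab_group_add, 'z) coalgebra_scheme \<Rightarrow> ('c \<Rightarrow> 'k) \<Rightarrow> ('c \<Rightarrow> 'k) \<Rightarrow> bool" where
  "is_dual_inverse C g h \<longleftrightarrow> linear_form C h \<and> conv C g h = counit C \<and> conv C h g = counit C"

definition dual_inverse ::
  "('k::field, 'c::ab_group_add, 'z) coalgebra_scheme \<Rightarrow> ('c \<Rightarrow> 'k) \<Rightarrow> 'c \<Rightarrow> 'k" where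
  "dual_inverse C g = (THE h. is_dual_inverse C g h)"

definition dual_power ::
  "('k::field, 'c::ab_group_add, 'z) coalgebra_scheme \<Rightarrow> ('c \<Rightarrow> 'k) \<Rightarrow> int \<Rightarrow> 'c \<Rightarrow> 'k" where
  "dual_power C g n =
     (if 0 \<le> n then (conv C g ^^ nat n) (counit C)
      else (conv C (dual_inverse C g) ^^ nat (- n)) (counit C))"

definition hit_left ::
  "('k::field, 'c::ab_group_add, 'z) coalgebra_scheme \<Rightarrow> ('c \<Rightarrow> 'k) \<Rightarrow> 'c \<Rightarrow> 'c" where
  "hit_left C f c = (\<Sum>(c1, c2)\<leftarrow>comult C c. scl C (f c2) c1)"

definition hit_right ::
  "('k::field, 'c::ab_group_add, 'z) coalgebra_scheme \<Rightarrow> 'c \<Rightarrow> ('c \<Rightarrow> 'k) \<Rightarrow> 'c" where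
  "hit_right C c f = (\<Sum>(c1, c2)\<leftarrow>comult C c. scl C (f c1) c2)"

definition is_form_inverse ::
  "('k::field, 'c::ab_group_add, 'z) coalgebra_scheme \<Rightarrow>
   ('c \<Rightarrow> 'c \<Rightarrow> 'k) \<Rightarrow> ('c \<Rightarrow> 'c \<Rightarrow> 'k) \<Rightarrow> bool" where
  "is_form_inverse C b b' \<longleftrightarrow>
     bilinear_form C b' \<and>
     (\<forall>c d. (\<Sum>(c1, c2)\<leftarrow>comult C c. \<Sum>(d1, d2)\<leftarrow>comult C d. b' c1 d1 * b c2 d2)
              = counit C c * counit C d) \<and>
     (\<forall>c d. (\<Sum>(c1, c2)\<leftarrow>comult C c. \<Sum>(d1, d2)\<leftarrow>comult C d. b c1 d1 * b' c2 d2)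
              = counit C c * counit C d)"

definition form_inverse ::
  "('k::field, 'c::ab_group_add, 'z) coalgebra_scheme \<Rightarrow> ('c \<Rightarrow> 'c \<Rightarrow> 'k) \<Rightarrow> 'c \<Rightarrow> 'c \<Rightarrow> 'k" where
  "form_inverse C b = (THE b'. is_form_inverse C b b')"

definition strict_oqc ::
  "('k::field, 'c::ab_group_add, 'z) oriented_quantum_coalgebra_scheme \<Rightarrow> bool" where
  "strict_oqc C \<longleftrightarrow>
     is_coalgebra C \<and>
     bilinear_form C (br C) \<and> (\<exists>b'. is_form_inverse C (br C) b') \<and>
     coalgebra_automorphism C (Td C) \<and> coalgebra_automorphism C (Tu C) \<and>
     Td C \<circ> Tu C = Tu C \<circ> Td C \<and>
     (let b = br C; b' = form_inverse C b in
       (\<forall>c d. (\<Sum>(c1, c2)\<leftarrow>comult C c. \<Sum>(d1, d2)\<leftarrow>comult C d.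
                 b c1 (Tu C d2) * b' (Td C c2) d1) = counit C c * counit C d) \<and>
       (\<forall>c d. (\<Sum>(c1, c2)\<leftarrow>comult C c. \<Sum>(d1, d2)\<leftarrow>comult C d.
                 b' (Td C c1) d2 * b c2 (Tu C d1)) = counit C c * counit C d) \<and>
       (\<forall>c d. b c d = b (Td C c) (Td C d) \<and> b c d = b (Tu C c) (Tu C d)) \<and>
       (\<forall>c d e.
          (\<Sum>(c1, c2)\<leftarrow>comult C c. \<Sum>(d1, d2)\<leftarrow>comult C d. \<Sum>(e1, e2)\<leftarrow>comult C e.
             b c1 d1 * b c2 e1 * b d2 e2)
        = (\<Sum>(c1, c2)\<leftarrow>comult C c. \<Sum>(d1, d2)\<leftarrow>comult C d. \<Sum>(e1, e2)\<leftarrow>comult C e.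
             b c2 d2 * b c1 e2 * b d1 e1)))"

definition twist_oqc ::
  "('k::field, 'c::ab_group_add, 'z) twist_quantum_coalgebra_scheme \<Rightarrow> bool" where
  "twist_oqc C \<longleftrightarrow>
     strict_oqc C \<and>
     linear_form C (tw C) \<and> (\<exists>h. is_dual_inverse C (tw C) h) \<and>
     tw C \<circ> Td C = tw C \<and> tw C \<circ> Tu C = tw C \<and>
     (\<forall>c. Td C (Tu C c) = hit_left C (dual_inverse C (tw C)) (hit_right C c (tw C)))"

text \<open>\<open>(C\<^sup>c\<^sup>o\<^sup>p, b, T\<^sub>d, T\<^sub>u, G\<^sup>-\<^sup>1)\<close>\<close>

definition cop ::
  "('k::field, 'c::ab_group_add, 'z) twist_quantum_coalgebra_scheme \<Rightarrow>
   ('k, 'c, 'z) twist_quantum_coalgebra_scheme" where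
  "cop C = C\<lparr>comult := \<lambda>c. map prod.swap (comult C c), tw := dual_inverse C (tw C)\<rparr>"


section \<open>Oriented diagrams\<close>

text \<open>
  A diagram is cut by horizontal lines into layers, listed from bottom to top.  Each layer \<open>(p, g)\<close>
  consists of one crossing or local extremum \<open>g\<close>, exactly \<open>p\<close> vertical lines to its left, and any
  number of vertical lines to its right.  \<open>Up\<close>/\<open>Down\<close> is the direction of a strand with
  respect to the vertical; \<open>LR\<close>/\<open>RL\<close> says whether an extremum is traversed left to right
  or right to left.
\<close>

datatype dir = Up | Down
datatype hdir = LR | RL
datatype crossing_line = SWNE | NWSE

text \<open>
  \<open>Crossing l s n\<close>: \<open>l\<close> is the over line, \<open>s\<close> and \<open>n\<close> are the
  directions of the \<open>SWNE\<close> line and of the \<open>NWSE\<close> line.  Thus \<open>s = n\<close> means both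
  lines are directed upward or both downward, \<open>s = Up\<close>, \<open>n = Down\<close> means both are directed left
  to right, and \<open>s = Down\<close>, \<open>n = Up\<close> means both are directed right to left.  The types of local
  extrema are \<open>Maximum LR = u\<^sub>-\<close>, \<open>Minimum LR = u\<^sub>+\<close>, \<open>Maximum RL = d\<^sub>+\<close>,
  \<open>Minimum RL = d\<^sub>-\<close>.
\<close>

datatype piece = Maximum hdir | Minimum hdir | Crossing crossing_line dir dir

type_synonym layer = "nat \<times> piece"

text \<open>Directions of the strands at the lower and upper boundary of a piece, left to right.\<close>

fun lower :: "piece \<Rightarrow> dir list" where
  "lower (Maximum LR) = [Up, Down]"
| "lower (Maximum RL) = [Down, Up]"
| "lower (Minimum h) = []"
| "lower (Crossing l s n) = [s, n]"

fun upper :: "piece \<Rightarrow> dir list" where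
  "upper (Maximum h) = []"
| "upper (Minimum LR) = [Down, Up]"
| "upper (Minimum RL) = [Up, Down]"
| "upper (Crossing l s n) = [n, s]"

text \<open>
  A pair \<open>(s, w)\<close>: strand directions \<open>s\<close> at the bottom boundary, layers \<open>w\<close> above it.
\<close>

type_synonym diagram = "dir list \<times> layer list"

definition apply_layer :: "layer \<Rightarrow> dir list \<Rightarrow> dir list" where
  "apply_layer x s = (case x of (p, g) \<Rightarrow> take p s @ upper g @ drop (p + length (lower g)) s)"

text \<open>Directions of the strands on the horizontal line above the first \<open>i\<close> layers.\<close>

definition level :: "diagram \<Rightarrow> nat \<Rightarrow> dir list" where
  "level D i = fold apply_layer (take i (snd D)) (fst D)"

definition layers_fit :: "diagram \<Rightarrow> bool" where
  "layers_fit D \<longleftrightarrow>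
     (\<forall>i < length (snd D). case snd D ! i of (p, g) \<Rightarrow>
        p \<le> length (level D i) \<and> take (length (lower g)) (drop p (level D i)) = lower g)"

text \<open>
  The points \<open>(i, j)\<close> of a diagram: its intersections with the horizontal cutting lines
  (\<open>j\<close>-th strand from the left at level \<open>i\<close>, counted from 0).  Every arc that joins two
  pieces contains at least one of them.
\<close>

type_synonym point = "nat \<times> nat"

definition points :: "diagram \<Rightarrow> point set" where
  "points D = {(i, j). i \<le> length (snd D) \<and> j < length (level D i)}"

definition other :: "nat \<Rightarrow> nat \<Rightarrow> nat" where
  "other p j = (if j = p then p + 1 else p)"

text \<open>
  The point that follows a given one when the diagram is traversed in the direction of
  orientation.
\<close>

fun next_point :: "diagram \<Rightarrow> point \<Rightarrow> point" where
  "next_point D (i, j) =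
     (case level D i ! j of
        Up \<Rightarrow>
          (case snd D ! i of (p, g) \<Rightarrow>
             if j < p then (i + 1, j)
             else if j \<ge> p + length (lower g) then (i + 1, j - length (lower g) + length (upper g))
             else case g of Crossing l s n \<Rightarrow> (i + 1, other p j) | _ \<Rightarrow> (i, other p j))
      | Down \<Rightarrow>
          (case snd D ! (i - 1) of (p, g) \<Rightarrow>
             if j < p then (i - 1, j)
             else if j \<ge> p + length (upper g) then (i - 1, j - length (upper g) + length (lower g))
             else case g of Crossing l s n \<Rightarrow> (i - 1, other p j) | _ \<Rightarrow> (i, other p j)))"

text \<open>
  What is met between a point and the following one: nothing, an extremum, or a line of the
  crossing in layer number \<open>i\<close>.
\<close>

datatype event = Extremum piece | Line nat crossing_line

fun events_at :: "diagram \<Rightarrow> point \<Rightarrow> event list" where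
  "events_at D (i, j) =
     (case level D i ! j of
        Up \<Rightarrow>
          (case snd D ! i of (p, g) \<Rightarrow>
             if p \<le> j \<and> j < p + length (lower g) then
               (case g of Crossing l s n \<Rightarrow> [Line i (if j = p then SWNE else NWSE)]
                | _ \<Rightarrow> [Extremum g])
             else [])
      | Down \<Rightarrow>
          (case snd D ! (i - 1) of (p, g) \<Rightarrow>
             if p \<le> j \<and> j < p + length (upper g) then
               (case g of Crossing l s n \<Rightarrow> [Line (i - 1) (if j = p then NWSE else SWNE)]
                | _ \<Rightarrow> [Extremum g])
             else []))"

text \<open>The strand starting at \<open>P\<close> is the whole diagram.\<close>

definition single_strand :: "diagram \<Rightarrow> point \<Rightarrow> bool" where
  "single_strand D P \<longleftrightarrow>
     P \<in> points D \<and> (\<lambda>m. (next_point D ^^ m) P) ` {..<card (points D)} = points D"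

text \<open>
  The events in order of a traversal from \<open>P\<close>.  For a closed diagram the last point
  visited is followed by \<open>P\<close> again; for a tangle \<open>P\<close> is the beginning of the strand and the last
  point visited is its end, which has no event of its own.
\<close>

definition traversal :: "diagram \<Rightarrow> point \<Rightarrow> event list" where
  "traversal D P =
     concat (map (\<lambda>m. events_at D ((next_point D ^^ m) P))
                 [0..<(if fst D = [] then card (points D) else card (points D) - 1)])"

text \<open>Oriented knot diagrams; a knot diagram is a closed diagram, so only its layers are recorded.\<close>

definition knot_diagrams :: "layer list set" where
  "knot_diagrams =
     {K. layers_fit ([], K) \<and> level ([], K) (length K) = [] \<and> (\<exists>P. single_strand ([], K) P)}"

text \<open>Oriented 1--1 tangle diagrams: the direction of the two end segments, and the layers.\<close>

type_synonym tangle = "dir \<times> layer list"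

definition tangle_diagram :: "tangle \<Rightarrow> diagram" where
  "tangle_diagram T = ([fst T], snd T)"

definition tangle_start :: "tangle \<Rightarrow> point" where
  "tangle_start T = (case fst T of Up \<Rightarrow> (0, 0) | Down \<Rightarrow> (length (snd T), 0))"

definition tangles :: "tangle set" where
  "tangles =
     {T. layers_fit (tangle_diagram T) \<and>
         level (tangle_diagram T) (length (snd T)) = [fst T] \<and>
         single_strand (tangle_diagram T) (tangle_start T)}"

definition shift :: "nat \<Rightarrow> layer list \<Rightarrow> layer list" where
  "shift q w = map (\<lambda>(p, g). (q + p, g)) w"

text \<open>The closure by an arc to the left.\<close>

fun closure_of :: "tangle \<Rightarrow> layer list" where
  "closure_of (Up, w) = [(0, Minimum LR)] @ shift 1 w @ [(0, Maximum RL)]"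
| "closure_of (Down, w) = [(0, Minimum RL)] @ shift 1 w @ [(0, Maximum LR)]"

fun flip :: "dir \<Rightarrow> dir" where
  "flip Up = Down"
| "flip Down = Up"

fun hflip :: "hdir \<Rightarrow> hdir" where
  "hflip LR = RL"
| "hflip RL = LR"

fun reverse_piece :: "piece \<Rightarrow> piece" where
  "reverse_piece (Maximum h) = Maximum (hflip h)"
| "reverse_piece (Minimum h) = Minimum (hflip h)"
| "reverse_piece (Crossing l s n) = Crossing l (flip s) (flip n)"

definition reverse_orientation :: "layer list \<Rightarrow> layer list" where
  "reverse_orientation K = map (\<lambda>(p, g). (p, reverse_piece g)) K"


section \<open>Regular isotopy\<close>

text \<open>
  Local replacements, for tangle words whose leftmost strand is at position 0.  The first rule is
  planar isotopy: pieces at a distance, with \<open>r\<close> strands between them, exchange heights.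
  Compatibility of the orientations is enforced by requiring both diagrams to be
  well-formed in \<open>regular_step\<close>.  In the \<open>M4\<close> rules, \<open>l\<close> and \<open>r\<close> are the directions of
  the left and the right leg and \<open>x\<close> that of the strand.
\<close>

inductive local_move :: "layer list \<Rightarrow> layer list \<Rightarrow> bool" where
  exchange: "local_move [(0, g), (length (upper g) + r, h)] [(length (lower g) + r, h), (0, g)]"
| M1: "local_move [] [(1, Minimum h), (0, Maximum h)]"
| M1_mirror: "local_move [] [(0, Minimum h), (1, Maximum h)]"
| M2: "local_move [] [(0, Crossing SWNE x y), (0, Crossing NWSE y x)]"
| M2rev: "local_move [] [(0, Crossing NWSE x y), (0, Crossing SWNE y x)]"
| M3: "local_move
         [(0, Crossing NWSE x y), (1, Crossing NWSE x z), (0, Crossing NWSE y z)]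
         [(1, Crossing NWSE y z), (0, Crossing NWSE x z), (1, Crossing NWSE x y)]"
| M3rev: "local_move
         [(0, Crossing SWNE x y), (1, Crossing SWNE x z), (0, Crossing SWNE y z)]
         [(1, Crossing SWNE y z), (0, Crossing SWNE x z), (1, Crossing SWNE x y)]"
| M4_max: "lower (Maximum h) = [l, r] \<Longrightarrow> local_move
         [(0, Crossing SWNE l x), (1, Maximum h)]
         [(1, Crossing NWSE x r), (0, Maximum h)]"
| M4_min: "upper (Minimum h) = [l, r] \<Longrightarrow> local_move
         [(1, Minimum h), (0, Crossing NWSE x l)]
         [(0, Minimum h), (1, Crossing SWNE r x)]"
| M4rev_max: "lower (Maximum h) = [l, r] \<Longrightarrow> local_move
         [(0, Crossing NWSE l x), (1, Maximum h)]
         [(1, Crossing SWNE x r), (0, Maximum h)]"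
| M4rev_min: "upper (Minimum h) = [l, r] \<Longrightarrow> local_move
         [(1, Minimum h), (0, Crossing SWNE x l)]
         [(0, Minimum h), (1, Crossing NWSE r x)]"

inductive regular_step :: "layer list \<Rightarrow> layer list \<Rightarrow> bool" where
  "local_move v w \<Longrightarrow> pre @ shift p v @ post \<in> knot_diagrams \<Longrightarrow>
   pre @ shift p w @ post \<in> knot_diagrams \<Longrightarrow>
   regular_step (pre @ shift p v @ post) (pre @ shift p w @ post)"

definition regularly_isotopic :: "layer list \<Rightarrow> layer list \<Rightarrow> bool" where
  "regularly_isotopic = equivclp regular_step"


section \<open>The invariants\<close>

fun weight_d :: "event \<Rightarrow> int" where
  "weight_d (Extremum (Maximum RL)) = 1"
| "weight_d (Extremum (Minimum RL)) = - 1"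
| "weight_d _ = 0"

fun weight_u :: "event \<Rightarrow> int" where
  "weight_u (Extremum (Minimum LR)) = 1"
| "weight_u (Extremum (Maximum LR)) = - 1"
| "weight_u _ = 0"

text \<open>
  The crossing lines in the order encountered, each with the numbers \<open>u\<^sub>d\<close> and \<open>u\<^sub>u\<close>
  for the remaining portion of the traversal.
\<close>

fun labelled_lines :: "event list \<Rightarrow> ((nat \<times> crossing_line) \<times> int \<times> int) list" where
  "labelled_lines [] = []"
| "labelled_lines (Line i l # es) =
     ((i, l), sum_list (map weight_d es), sum_list (map weight_u es)) # labelled_lines es"
| "labelled_lines (Extremum g # es) = labelled_lines es"

definition fun_power_int :: "('a \<Rightarrow> 'a) \<Rightarrow> int \<Rightarrow> 'a \<Rightarrow> 'a" where
  "fun_power_int f n = (if 0 \<le> n then f ^^ nat n else inv f ^^ nat (- n))"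

text \<open>
  \<open>[\<iota>; p, q]\<close> for the line \<open>x\<close> with label \<open>\<iota>\<close>, where \<open>E\<close> is the traversal and \<open>cs\<close> the tuple
  \<open>c\<^sub>1, \<dots>, c\<^sub>2\<^sub>n\<close>.
\<close>

definition line_value ::
  "('k, 'c, 'z) oriented_quantum_coalgebra_scheme \<Rightarrow> event list \<Rightarrow> 'c list \<Rightarrow>
   nat \<times> crossing_line \<Rightarrow> int \<Rightarrow> int \<Rightarrow> 'c" where
  "line_value C E cs x p q =
     (case the (map_of (zip (map fst (labelled_lines E)) (zip cs (map snd (labelled_lines E)))) x) of
        (c, ud, uu) \<Rightarrow> fun_power_int (Td C) (ud + p) (fun_power_int (Tu C) (uu + q) c))"

fun crossing_factor ::
  "('k::field, 'c::ab_group_add, 'z) oriented_quantum_coalgebra_scheme \<Rightarrow>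
   (crossing_line \<Rightarrow> int \<Rightarrow> int \<Rightarrow> 'c) \<Rightarrow> piece \<Rightarrow> 'k" where
  "crossing_factor C v (Crossing SWNE Up Up) = br C (v SWNE 0 0) (v NWSE 0 0)"
| "crossing_factor C v (Crossing SWNE Down Down) = br C (v SWNE 0 0) (v NWSE 0 0)"
| "crossing_factor C v (Crossing SWNE Up Down) =
     form_inverse C (br C) (v SWNE 0 1) (v NWSE 0 0)"
| "crossing_factor C v (Crossing SWNE Down Up) =
     form_inverse C (br C) (v SWNE 1 0) (v NWSE 0 0)"
| "crossing_factor C v (Crossing NWSE Up Up) =
     form_inverse C (br C) (v NWSE 0 0) (v SWNE 0 0)"
| "crossing_factor C v (Crossing NWSE Down Down) =
     form_inverse C (br C) (v NWSE 0 0) (v SWNE 0 0)"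
| "crossing_factor C v (Crossing NWSE Up Down) = br C (v NWSE 0 0) (v SWNE 0 1)"
| "crossing_factor C v (Crossing NWSE Down Up) = br C (v NWSE 0 0) (v SWNE 1 0)"
| "crossing_factor C v (Maximum h) = 1"
| "crossing_factor C v (Minimum h) = 1"

text \<open>The functional obtained from the traversal of \<open>D\<close> that starts at \<open>P\<close>.\<close>

definition functional ::
  "('k::field, 'c::ab_group_add, 'z) oriented_quantum_coalgebra_scheme \<Rightarrow>
   diagram \<Rightarrow> point \<Rightarrow> 'c \<Rightarrow> 'k" where
  "functional C D P c =
     (let E = traversal D P; m = length (labelled_lines E) in
      if m = 0 then counit C c
      else (\<Sum>cs\<leftarrow>iter_comult C (m - 1) c.
              \<Prod>i<length (snd D). crossing_factor C (\<lambda>l. line_value C E cs (i, l)) (snd (snd D ! i))))"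

definition Inv ::
  "('k::field, 'c::ab_group_add, 'z) oriented_quantum_coalgebra_scheme \<Rightarrow> tangle \<Rightarrow> 'c \<Rightarrow> 'k" where
  "Inv C T = functional C (tangle_diagram T) (tangle_start T)"

text \<open>Clockwise extrema count \<open>1\<close>, counterclockwise ones \<open>- 1\<close>.\<close>

fun clockwise :: "piece \<Rightarrow> int" where
  "clockwise (Maximum LR) = 1"
| "clockwise (Minimum RL) = 1"
| "clockwise (Maximum RL) = - 1"
| "clockwise (Minimum LR) = - 1"
| "clockwise (Crossing l s n) = 0"

text \<open>
  The division is exact for knot diagrams, which have as many maxima as minima.
\<close>

definition whitney_degree :: "layer list \<Rightarrow> int" where
  "whitney_degree K = (\<Sum>(p, g)\<leftarrow>K. clockwise g) div 2"

text \<open>The scalar computed for the knot diagram \<open>K\<close> from the starting point \<open>P\<close>.\<close>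

definition knot_scalar ::
  "('k::field, 'c::ab_group_add, 'z) twist_quantum_coalgebra_scheme \<Rightarrow> 'c \<Rightarrow>
   layer list \<Rightarrow> point \<Rightarrow> 'k" where
  "knot_scalar C c K P =
     conv C (dual_power C (tw C) (whitney_degree K)) (functional C ([], K) P) c"

end

theory Submission
  imports Defs
begin

text \<open>
  Since \<open>T\<^sub>d T\<^sub>u\<close> is conjugation by \<open>G\<close>, the powers of \<open>T\<^sub>d\<close> and \<open>T\<^sub>u\<close> on the crossing lines can be traded
  for one bead \<open>G\<close> or \<open>G\<^sup>-\<^sup>1\<close> at each extremum traversed from left to right, the factor \<open>G\<^sup>d\<close> being
  what makes this balance; after that each crossing contributes a factor that depends
  on the crossing only.  The scalar of a knot is now read off from a cyclic word of beads, so that for cocommutative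
  \<open>c\<close> the starting point is irrelevant.

  (a) Write \<open>c = \<Sum> a\<^sub>i\<^sub>j t\<^sub>i\<^sub>j\<close> with matrix coefficients \<open>t\<^sub>i\<^sub>j\<close> of a finite-dimensional comodule.  The scalar
  becomes a state sum, that is a product of transfer matrices of the layers with \<open>a\<close> inserted at one point, and it
  suffices to compare the transfer matrices of the two sides of each move.  \<open>M1\<close> is \<open>G G\<^sup>-\<^sup>1 = \<epsilon>\<close>, \<open>M2\<close>
  is the invertibility of \<open>b\<close> together with the two mixed axioms, \<open>M4\<close> follows from the invariance of \<open>b\<close>
  and the conjugation formula, and \<open>M3\<close> for the various orientations is obtained from the Yang-Baxter equation
  by conjugating with inverse matrices.

  (b) With a starting point on the closing arc the traversals of the tangle and of its closure differ by two
  extrema at the end, which twist all crossing lines by the same power of \<open>T\<^sub>d T\<^sub>u\<close>; the form \<open>b\<close> is invariant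
  under it.

  (c) Reversing the orientation reverses the order of the beads, hence amounts to the opposite coproduct; the
  exponents change by a common constant and by the direction of each line, which is what turns each
  crossing factor into the one of the reversed crossing.
\<close>

section \<open>Sweedler calculus\<close>

text \<open>The functional orders the tensor factors along the strand, while a move replaces a few
  layers. A single move relabels crossing lines, changes the number of tensor factors and shifts
  exponents of lines far away, so the two functionals cannot be compared factor by factor. A sum
  over states of all points may be carried out in any order: taken along the strand it is the
  original scalar, taken level by level it is a product of matrices in which a move really is local.

  That the exponents can be traded for beads rests on a parity: an extremum switches between up and
  down, so the difference of the two exponents over a portion of the strand is the difference of the
  directions at its ends. Up to a common power of T_d, invisible to b, a line carries a power of T_d
  T_u and one more T_d if it goes upward.

  The cut is made on an upward strand, which exists on every nonempty level because a closed diagram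
  has there as many strands going up as down. For M3, flipping a single strand inverts one or two of
  the three matrices. This reaches half of the orientations for each kind of crossing; the other
  half follow by inverting the braid words of the other kind.\<close>

lemma sum_list_tensor_eq:
  fixes f :: "'c::ab_group_add list \<Rightarrow> 'm::ab_group_add"
  assumes "tensor_eq s xs ys"
    and add: "\<And>us x y vs. f (us @ (x + y) # vs) = f (us @ x # vs) + f (us @ y # vs)"
    and scale: "\<And>us a x vs y ws. f (us @ s a x # vs @ y # ws) = f (us @ x # vs @ s a y # ws)"
  shows "sum_list (map f xs) = sum_list (map f ys)"
  using assms(1)
proof induction
  case (zero us vs)
  have "f (us @ 0 # vs) = f (us @ 0 # vs) + f (us @ 0 # vs)"
    using add[of us 0 0 vs] by simp
  then show ?case by simp
qed (simp_all add: add scale add.commute)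

text \<open>Weaker than bilinearity: only additivity and the passage of scalars between the two
  slots, which are the relations generating \<open>tensor_eq\<close>. The values may lie in any
  abelian group.\<close>

definition balanced :: "('k \<Rightarrow> 'c \<Rightarrow> 'c) \<Rightarrow> ('c::ab_group_add \<Rightarrow> 'c \<Rightarrow> 'm::ab_group_add) \<Rightarrow> bool" where
  "balanced s B \<longleftrightarrow>
     (\<forall>x x' y. B (x + x') y = B x y + B x' y) \<and> (\<forall>x y y'. B x (y + y') = B x y + B x y') \<and>
     (\<forall>a x y. B (s a x) y = B x (s a y))"

lemma tensor2_eq_sum:
  assumes "tensor2_eq s xs ys" and "balanced s B"
  shows "(\<Sum>(x, y)\<leftarrow>xs. B x y) = (\<Sum>(x, y)\<leftarrow>ys. B x y)"
proof -
  \<comment> \<open>\<open>tensor_eq\<close> is stated for tuples of every length, and its relations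
    never turn a tuple into one of another length, so the extension of \<open>B\<close> by 0 keeps
    additivity and balance.\<close>
  let ?f = "\<lambda>us. case us of [x, y] \<Rightarrow> B x y | _ \<Rightarrow> 0"
  have "sum_list (map ?f (map (\<lambda>(x, y). [x, y]) xs)) = sum_list (map ?f (map (\<lambda>(x, y). [x, y]) ys))"
  proof (rule sum_list_tensor_eq[of s])
    show "tensor_eq s (map (\<lambda>(x, y). [x, y]) xs) (map (\<lambda>(x, y). [x, y]) ys)"
      using assms(1) by (simp add: tensor2_eq_def)
  next
    fix us x y vs
    show "?f (us @ (x + y) # vs) = ?f (us @ x # vs) + ?f (us @ y # vs)"
      using assms(2) by (auto simp: balanced_def Cons_eq_append_conv append_eq_Cons_conv split: list.splits)
  next
    fix us a x vs y ws
    show "?f (us @ s a x # vs @ y # ws) = ?f (us @ x # vs @ s a y # ws)"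
      using assms(2) by (auto simp: balanced_def Cons_eq_append_conv append_eq_Cons_conv split: list.splits)
  qed
  then show ?thesis by (simp add: comp_def case_prod_unfold)
qed

lemma tensor3_eq_sum:
  assumes "tensor_eq s (map (\<lambda>(x, y, z). [x, y, z]) xs) (map (\<lambda>(x, y, z). [x, y, z]) ys)"
    and "\<And>z. balanced s (\<lambda>x y. B x y z)" and "\<And>x. balanced s (B x)"
  shows "(\<Sum>(x, y, z)\<leftarrow>xs. B x y z) = (\<Sum>(x, y, z)\<leftarrow>ys. B x y z)"
proof -
  let ?f = "\<lambda>us. case us of [x, y, z] \<Rightarrow> B x y z | _ \<Rightarrow> 0"
  have *: "B x (y + y') z = B x y z + B x y' z" "B (x + x') y z = B x y z + B x' y z"
    "B x y (z + z') = B x y z + B x y z'" "B (s a x) y z = B x (s a y) z" "B x (s a y) z = B x y (s a z)"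
    for x x' y y' z z' a
    using assms(2)[of z] assms(3)[of x] by (auto simp: balanced_def)
  have "sum_list (map ?f (map (\<lambda>(x, y, z). [x, y, z]) xs)) = sum_list (map ?f (map (\<lambda>(x, y, z). [x, y, z]) ys))"
  proof (rule sum_list_tensor_eq[of s, OF assms(1)])
    fix us x y vs
    show "?f (us @ (x + y) # vs) = ?f (us @ x # vs) + ?f (us @ y # vs)"
      by (auto simp: * Cons_eq_append_conv append_eq_Cons_conv split: list.splits)
  next
    fix us a x vs y ws
    show "?f (us @ s a x # vs @ y # ws) = ?f (us @ x # vs @ s a y # ws)"
      by (auto simp: * Cons_eq_append_conv append_eq_Cons_conv split: list.splits)
  qed
  then show ?thesis by (simp add: comp_def case_prod_unfold)
qed

definition sweedler ::
  "('k::field, 'c, 'z) coalgebra_scheme \<Rightarrow> ('c \<Rightarrow> 'c \<Rightarrow> 'm::ab_group_add) \<Rightarrow> 'c \<Rightarrow> 'm" where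
  "sweedler C B c = (\<Sum>(c1, c2)\<leftarrow>comult C c. B c1 c2)"

lemma sweedler_add: "sweedler C (\<lambda>x y. A x y + B x y) c = sweedler C A c + sweedler C B c"
  unfolding sweedler_def by (simp add: case_prod_unfold sum_list_addf)

lemma sweedler_zero [simp]: "sweedler C (\<lambda>x y. 0) c = 0"
  unfolding sweedler_def by (simp add: case_prod_unfold)

lemma sweedler_mult:
  fixes B :: "'c \<Rightarrow> 'c \<Rightarrow> 'k::field"
  shows
  "a * sweedler C B c = sweedler C (\<lambda>x y. a * B x y) c"
  "sweedler C B c * a = sweedler C (\<lambda>x y. B x y * a) c"
proof -
  have "a * sum_list (map f xs) = sum_list (map (\<lambda>x. a * f x) xs)"
    "sum_list (map f xs) * a = sum_list (map (\<lambda>x. f x * a) xs)" for f :: "'c \<times> 'c \<Rightarrow> 'k" and xs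
    by (induction xs) (simp_all add: algebra_simps)
  then show "a * sweedler C B c = sweedler C (\<lambda>x y. a * B x y) c"
    "sweedler C B c * a = sweedler C (\<lambda>x y. B x y * a) c"
    unfolding sweedler_def by (simp_all add: case_prod_unfold)
qed

lemma sweedler_swap:
  "sweedler C (\<lambda>x y. sweedler C' (\<lambda>u v. F x y u v) d) c = sweedler C' (\<lambda>u v. sweedler C (\<lambda>x y. F x y u v) c) d"
proof -
  have "sum_list (map (\<lambda>p. sum_list (map (\<lambda>q. F (fst p) (snd p) (fst q) (snd q)) ys)) xs) =
    sum_list (map (\<lambda>q. sum_list (map (\<lambda>p. F (fst p) (snd p) (fst q) (snd q)) xs)) ys)" for xs ys
    by (induction xs) (simp_all add: sum_list_addf)
  then show ?thesis unfolding sweedler_def case_prod_unfold .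
qed

lemma sweedler_sum:
  "sweedler C (\<lambda>x y. \<Sum>i\<in>A. F i x y) c = (\<Sum>i\<in>A. sweedler C (F i) c)"
  by (induction A rule: infinite_finite_induct) (simp_all add: sweedler_add)

locale coalg =
  fixes C :: "('k::field, 'c::ab_group_add, 'z) coalgebra_scheme"
  assumes coalg: "is_coalgebra C"
begin

abbreviation "lin \<equiv> linear_form C"

lemma vs: "vector_space (scl C)"
  using coalg by (simp add: is_coalgebra_def)

sublocale vector_space "scl C" by (rule vs)

lemma lin_iff: "lin f \<longleftrightarrow> (\<forall>x y. f (x + y) = f x + f y) \<and> (\<forall>a x. f (scl C a x) = a * f x)"
proof -
  have "vector_space ((*) :: 'k \<Rightarrow> 'k \<Rightarrow> 'k)"
    by unfold_locales (simp_all add: algebra_simps)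
  then show ?thesis
    using vs by (auto simp: linear_form_def Vector_Spaces.linear_iff)
qed

lemma linI: "(\<And>x y. f (x + y) = f x + f y) \<Longrightarrow> (\<And>a x. f (scl C a x) = a * f x) \<Longrightarrow> lin f"
  by (simp add: lin_iff)

lemma lin_add: "lin f \<Longrightarrow> f (x + y) = f x + f y"
  and lin_scale: "lin f \<Longrightarrow> f (scl C a x) = a * f x"
  by (simp_all add: lin_iff)

lemma lin_zero: "lin f \<Longrightarrow> f 0 = 0"
  using lin_scale[of f 0 0] by simp

lemma lin_sum: "lin f \<Longrightarrow> f (sum g A) = (\<Sum>x\<in>A. f (g x))"
  by (induction A rule: infinite_finite_induct) (simp_all add: lin_zero lin_add)

lemma lin_sum_list: "lin f \<Longrightarrow> f (sum_list xs) = sum_list (map f xs)"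
  by (induction xs) (simp_all add: lin_zero lin_add)

lemma lin_mult_left: "lin f \<Longrightarrow> lin (\<lambda>x. a * f x)"
  and lin_mult_right: "lin f \<Longrightarrow> lin (\<lambda>x. f x * a)"
  and lin_const_zero: "lin (\<lambda>x. 0)"
  by (simp_all add: lin_iff algebra_simps)

lemma lin_plus: "lin f \<Longrightarrow> lin g \<Longrightarrow> lin (\<lambda>x. f x + g x)"
  by (simp add: lin_iff algebra_simps)

lemma lin_sum_intro: "(\<And>i. i \<in> A \<Longrightarrow> lin (f i)) \<Longrightarrow> lin (\<lambda>x. \<Sum>i\<in>A. f i x)"
  by (induction A rule: infinite_finite_induct) (simp_all add: lin_const_zero lin_plus)

lemma lin_counit: "lin (counit C)"
  using coalg by (simp add: is_coalgebra_def)

lemma lin_sweedler_param: "(\<And>x y. lin (\<lambda>z. f x y z)) \<Longrightarrow> lin (\<lambda>z. sweedler C (\<lambda>x y. f x y z) c)"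
  unfolding lin_iff by (simp add: sweedler_add sweedler_mult)

lemma bilin_balanced: "bilinear_form C B \<Longrightarrow> balanced (scl C) B"
  by (auto simp: bilinear_form_def balanced_def lin_iff)

lemma bilinI: "(\<And>c. lin (B c)) \<Longrightarrow> (\<And>d. lin (\<lambda>c. B c d)) \<Longrightarrow> bilinear_form C B"
  by (simp add: bilinear_form_def)

lemma sweedler_plus: "balanced (scl C) B \<Longrightarrow> sweedler C B (x + y) = sweedler C B x + sweedler C B y"
  unfolding sweedler_def
  using coalg tensor2_eq_sum[of "scl C" "comult C (x + y)" "comult C x @ comult C y" B]
  by (simp add: is_coalgebra_def)

lemma sweedler_scale: "balanced (scl C) B \<Longrightarrow> sweedler C B (scl C a x) = sweedler C (\<lambda>u v. B (scl C a u) v) x"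
  unfolding sweedler_def
  using coalg tensor2_eq_sum[of "scl C" "comult C (scl C a x)" "map (\<lambda>(u, v). (scl C a u, v)) (comult C x)" B]
  by (simp add: is_coalgebra_def comp_def case_prod_unfold)

lemma lin_sweedler:
  assumes "\<And>x. lin (B x)" and "\<And>y. lin (\<lambda>x. B x y)"
  shows "lin (sweedler C B)"
proof -
  have B: "balanced (scl C) B" by (rule bilin_balanced) (simp add: bilinI assms)
  have "sweedler C (\<lambda>u v. B (scl C a u) v) x = a * sweedler C B x" for a x
    using assms(2) by (simp add: lin_iff sweedler_mult)
  then show ?thesis by (simp add: linI sweedler_plus[OF B] sweedler_scale[OF B])
qed

lemma sweedler_coassoc_balanced:
  fixes f :: "'c \<Rightarrow> 'c \<Rightarrow> 'c \<Rightarrow> 'd::ab_group_add"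
  assumes "\<And>z. balanced (scl C) (\<lambda>x y. f x y z)" and "\<And>x. balanced (scl C) (f x)"
  shows "sweedler C (\<lambda>u z. sweedler C (\<lambda>x y. f x y z) u) c = sweedler C (\<lambda>x u. sweedler C (f x) u) c"
proof -
  let ?l = "[(c11, c12, c2). (c1, c2) \<leftarrow> comult C c, (c11, c12) \<leftarrow> comult C c1]"
  let ?r = "[(c1, c21, c22). (c1, c2) \<leftarrow> comult C c, (c21, c22) \<leftarrow> comult C c2]"
  have "tensor_eq (scl C) (map (\<lambda>(x, y, z). [x, y, z]) ?l) (map (\<lambda>(x, y, z). [x, y, z]) ?r)"
    using coalg by (simp add: is_coalgebra_def map_concat comp_def case_prod_unfold)
  moreover have "sum_list (concat xs) = sum_list (map sum_list xs)" for xs :: "'d list list"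
    by (induction xs) simp_all
  ultimately show ?thesis
    using tensor3_eq_sum[OF _ assms, of ?l ?r]
    by (simp add: sweedler_def map_concat comp_def case_prod_unfold)
qed

lemma sweedler_coassoc:
  assumes "\<And>x y. lin (f x y)" and "\<And>x z. lin (\<lambda>y. f x y z)" and "\<And>y z. lin (\<lambda>x. f x y z)"
  shows "sweedler C (\<lambda>u z. sweedler C (\<lambda>x y. f x y z) u) c = sweedler C (\<lambda>x u. sweedler C (f x) u) c"
  by (intro sweedler_coassoc_balanced bilin_balanced bilinI assms)

lemma counit_left_vec: "sweedler C (\<lambda>x y. scl C (counit C x) y) c = c"
  and counit_right_vec: "sweedler C (\<lambda>x y. scl C (counit C y) x) c = c"
  using coalg by (simp_all add: is_coalgebra_def sweedler_def)

lemma lin_sweedler_vec: "lin F \<Longrightarrow> F (sweedler C B c) = sweedler C (\<lambda>x y. F (B x y)) c"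
  by (simp add: sweedler_def lin_sum_list comp_def case_prod_unfold)

lemma sweedler_counit_left: "lin F \<Longrightarrow> sweedler C (\<lambda>x y. counit C x * F y) c = F c"
  using lin_sweedler_vec[of F "\<lambda>x y. scl C (counit C x) y" c]
  by (simp add: counit_left_vec lin_scale)

lemma sweedler_counit_right: "lin F \<Longrightarrow> sweedler C (\<lambda>x y. F x * counit C y) c = F c"
  using lin_sweedler_vec[of F "\<lambda>x y. scl C (counit C y) x" c]
  by (simp add: counit_right_vec lin_scale mult.commute)

lemma conv_sweedler: "conv C f g c = sweedler C (\<lambda>x y. f x * g y) c"
  by (simp add: conv_def sweedler_def)

lemma lin_conv: "lin f \<Longrightarrow> lin g \<Longrightarrow> lin (conv C f g)"
  unfolding conv_sweedler[abs_def] by (intro lin_sweedler lin_mult_left lin_mult_right)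

lemma conv_assoc: "lin f \<Longrightarrow> lin g \<Longrightarrow> lin h \<Longrightarrow> conv C (conv C f g) h = conv C f (conv C g h)"
  using sweedler_coassoc[of "\<lambda>x y z. f x * g y * h z"]
  by (auto simp: fun_eq_iff conv_sweedler sweedler_mult mult.assoc lin_mult_left lin_mult_right)

lemma conv_counit_left: "lin f \<Longrightarrow> conv C (counit C) f = f"
  and conv_counit_right: "lin f \<Longrightarrow> conv C f (counit C) = f"
  by (simp_all add: fun_eq_iff conv_sweedler sweedler_counit_left sweedler_counit_right)

lemma dual_inverse_unique:
  assumes "lin g" "is_dual_inverse C g h" "is_dual_inverse C g h'" shows "h = h'"
proof -
  have h: "lin h" "lin h'" "conv C h g = counit C" "conv C g h' = counit C"
    using assms by (auto simp: is_dual_inverse_def)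
  have "conv C h (conv C g h') = conv C (conv C h g) h'" by (rule conv_assoc[OF h(1) assms(1) h(2), symmetric])
  then show ?thesis
    unfolding h(3,4) conv_counit_left[OF h(2)] conv_counit_right[OF h(1)] .
qed

lemma dual_inverse_eq:
  assumes "lin g" "is_dual_inverse C g h" shows "dual_inverse C g = h"
  unfolding dual_inverse_def by (rule the_equality) (use assms dual_inverse_unique in blast)+

text \<open>Multiplication in the dual of \<open>C \<otimes> C\<close>.\<close>

definition conv2 :: "('c \<Rightarrow> 'c \<Rightarrow> 'k) \<Rightarrow> ('c \<Rightarrow> 'c \<Rightarrow> 'k) \<Rightarrow> 'c \<Rightarrow> 'c \<Rightarrow> 'k" where
  "conv2 f g c d = sweedler C (\<lambda>c1 c2. sweedler C (\<lambda>d1 d2. f c1 d1 * g c2 d2) d) c"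

text \<open>Coassociativity is used once in each variable: for \<open>d\<close> inside
  (\<open>FG\<close>), and for \<open>c\<close> after the sums over the two variables have been
  interchanged. Inverse forms are then unique by the usual monoid argument.\<close>

lemma conv2_assoc:
  assumes f: "bilinear_form C f" and g: "bilinear_form C g" and h: "bilinear_form C h"
  shows "conv2 (conv2 f g) h c d = conv2 f (conv2 g h) c d"
proof -
  note l = f[unfolded bilinear_form_def] g[unfolded bilinear_form_def] h[unfolded bilinear_form_def]
  let ?F = "\<lambda>x y z. sweedler C (\<lambda>u1 u2. sweedler C (\<lambda>u v. f x u * g y v * h z u2) u1) d"
  let ?G = "\<lambda>x y z. sweedler C (\<lambda>u1 u2. sweedler C (\<lambda>u v. f x u1 * (g y u * h z v)) u2) d"
  have FG: "?F x y z = ?G x y z" for x y z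
    by (subst sweedler_coassoc) (use l in \<open>auto intro!: lin_mult_left lin_mult_right simp: mult.assoc\<close>)
  have swap: "sweedler C (\<lambda>d1 d2. sweedler C (\<lambda>x y. K x y z d1 d2) u) d =
    sweedler C (\<lambda>x y. sweedler C (\<lambda>d1 d2. K x y z d1 d2) d) u" for K :: "'c \<Rightarrow> 'c \<Rightarrow> 'c \<Rightarrow> 'c \<Rightarrow> 'c \<Rightarrow> 'k" and z u
    by (rule sweedler_swap)
  have "conv2 (conv2 f g) h c d = sweedler C (\<lambda>u z. sweedler C (\<lambda>x y. ?F x y z) u) c"
    unfolding conv2_def sweedler_mult by (simp only: swap[of "\<lambda>x y z u z'. sweedler C (\<lambda>u v. f x u * g y v * h z z') u"])
  also have "\<dots> = sweedler C (\<lambda>x u. sweedler C (\<lambda>y z. ?F x y z) u) c"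
    by (subst sweedler_coassoc)
      (use l in \<open>auto intro!: lin_mult_left lin_mult_right lin_sweedler_param\<close>)
  also have "\<dots> = conv2 f (conv2 g h) c d"
    unfolding conv2_def FG sweedler_mult
    by (simp only: swap[of "\<lambda>y z x u z'. sweedler C (\<lambda>u' v. f x u * (g y u' * h z v)) z'"])
  finally show ?thesis .
qed

lemma conv2_counit:
  assumes "bilinear_form C f"
  shows "conv2 f (\<lambda>c d. counit C c * counit C d) c d = f c d"
    and "conv2 (\<lambda>c d. counit C c * counit C d) f c d = f c d"
proof -
  have l: "lin (f c)" "lin (\<lambda>c. f c d)" for c d
    using assms by (auto simp: bilinear_form_def)
  have "conv2 f (\<lambda>c d. counit C c * counit C d) c d =
    sweedler C (\<lambda>c1 c2. sweedler C (\<lambda>d1 d2. f c1 d1 * counit C d2) d * counit C c2) c"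
    unfolding conv2_def sweedler_mult by (simp add: mult_ac)
  then show "conv2 f (\<lambda>c d. counit C c * counit C d) c d = f c d"
    by (simp add: sweedler_counit_right l)
  have "conv2 (\<lambda>c d. counit C c * counit C d) f c d =
    sweedler C (\<lambda>c1 c2. counit C c1 * sweedler C (\<lambda>d1 d2. counit C d1 * f c2 d2) d) c"
    unfolding conv2_def sweedler_mult by (simp add: mult_ac)
  then show "conv2 (\<lambda>c d. counit C c * counit C d) f c d = f c d"
    by (simp add: sweedler_counit_left l)
qed

lemma is_form_inverse_iff: "is_form_inverse C f g \<longleftrightarrow> bilinear_form C g \<and>
    conv2 g f = (\<lambda>c d. counit C c * counit C d) \<and> conv2 f g = (\<lambda>c d. counit C c * counit C d)"
  by (simp add: is_form_inverse_def conv2_def sweedler_def fun_eq_iff)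

lemma form_inverse_unique:
  assumes "bilinear_form C f" "is_form_inverse C f g" "is_form_inverse C f h" shows "g = h"
proof (intro ext)
  fix c d
  have g: "bilinear_form C g" "bilinear_form C h" using assms by (simp_all add: is_form_inverse_iff)
  have "g c d = conv2 g (conv2 f h) c d"
    using assms(3) g by (simp add: is_form_inverse_iff conv2_counit)
  also have "\<dots> = conv2 (conv2 g f) h c d" using g assms(1) by (simp add: conv2_assoc)
  also have "\<dots> = h c d" using assms(2) g by (simp add: is_form_inverse_iff conv2_counit)
  finally show "g c d = h c d" .
qed

lemma form_inverse_eq: "bilinear_form C f \<Longrightarrow> is_form_inverse C f g \<Longrightarrow> form_inverse C f = g"
  unfolding form_inverse_def by (rule the_equality) (use form_inverse_unique in blast)+

lemma coalgebra_automorphism_sweedler: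
  assumes "coalgebra_automorphism C S" "bilinear_form C B"
  shows "sweedler C B (S c) = sweedler C (\<lambda>x y. B (S x) (S y)) c"
  using assms tensor2_eq_sum[of "scl C" "comult C (S c)" "map (\<lambda>(c1, c2). (S c1, S c2)) (comult C c)" B]
  by (simp add: sweedler_def coalgebra_automorphism_def bilin_balanced comp_def case_prod_unfold)

lemma lin_comp_automorphism:
  assumes "coalgebra_automorphism C S" "lin f" shows "lin (\<lambda>x. f (S x))"
  using assms by (auto simp: coalgebra_automorphism_def lin_iff Vector_Spaces.linear_iff)

lemma cocommutative_sweedler:
  assumes "cocommutative C c" "bilinear_form C B"
  shows "sweedler C (\<lambda>x y. B y x) c = sweedler C B c"
  using assms(1) tensor2_eq_sum[of "scl C" "comult C c" "map prod.swap (comult C c)" B] assms(2)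
  by (simp add: sweedler_def cocommutative_def bilin_balanced comp_def case_prod_unfold)

end

section \<open>Matrix coefficients\<close>

context coalg
begin

lemma lin_representation:
  assumes "independent E" "span E = UNIV" shows "lin (\<lambda>v. representation E v e)"
  using assms by (intro linI) (simp_all add: representation_add representation_scale)

text \<open>The coordinates with respect to a basis are linear forms. Through this, identities
  between vectors, such as those for the two hit actions, are proved in the dual algebra.\<close>

lemma lin_separates:
  assumes "\<And>F. lin F \<Longrightarrow> F u = F v" shows "u = v"
proof -
  let ?E = "extend_basis {}"
  have E: "independent ?E" "span ?E = UNIV"
    using independent_extend_basis[OF independent_empty] span_extend_basis[OF independent_empty] by auto
  have eq: "representation ?E u = representation ?E v"
    using assms[OF lin_representation[OF E]] by auto
  have "w = (\<Sum>b | representation ?E w b \<noteq> 0. scl C (representation ?E w b) b)" for w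
    using sum_nonzero_representation_eq[OF E(1), of w] E(2) by simp
  from this[of u, unfolded eq] this[of v] show ?thesis by (rule HOL.trans[OF _ HOL.sym])
qed

lemma hit_left_eq: "hit_left C f c = sweedler C (\<lambda>x y. scl C (f y) x) c"
  and hit_right_eq: "hit_right C c f = sweedler C (\<lambda>x y. scl C (f x) y) c"
  by (simp_all add: hit_left_def hit_right_def sweedler_def)

lemma lin_hit_left: "lin F \<Longrightarrow> F (hit_left C f c) = conv C F f c"
  and lin_hit_right: "lin F \<Longrightarrow> F (hit_right C c f) = conv C f F c"
  by (simp_all add: hit_left_eq hit_right_eq lin_sweedler_vec lin_scale conv_sweedler mult.commute)

text \<open>Matrix coefficients of a finite-dimensional comodule; the comultiplication is only tested
  on bilinear forms.\<close>

definition comatrix :: "nat \<Rightarrow> (nat \<Rightarrow> nat \<Rightarrow> 'c) \<Rightarrow> bool" where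
  "comatrix n t \<longleftrightarrow> (\<forall>i<n. \<forall>j<n.
     (\<forall>B. bilinear_form C B \<longrightarrow> sweedler C B (t i j) = (\<Sum>k<n. B (t i k) (t k j))) \<and>
     counit C (t i j) = (if i = j then 1 else 0))"

text \<open>The comodule is the one generated by \<open>c\<close>, consisting of the \<open>f \<rightharpoonup> c\<close>.\<close>

lemma comatrix_exists:
  "\<exists>n t a. comatrix n t \<and> (\<forall>F. lin F \<longrightarrow> F c = (\<Sum>i<n. \<Sum>j<n. a i j * F (t i j)))"
proof -
  \<comment> \<open>The orbit of \<open>c\<close> under the left action of the dual algebra.\<close>
  define V where "V = {hit_left C f c |f. lin f}"
  have VI: "lin f \<Longrightarrow> hit_left C f c \<in> V" for f by (auto simp: V_def)
  have hit_V: "hit_left C g v \<in> V" if v: "v \<in> V" and g: "lin g" for g v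
  proof -
    obtain f where f: "lin f" "v = hit_left C f c" using v by (auto simp: V_def)
    have "hit_left C g v = hit_left C (conv C g f) c"
      by (rule lin_separates) (simp add: f lin_hit_left lin_conv conv_assoc g)
    then show ?thesis using VI[OF lin_conv[OF g f(1)]] by simp
  qed
  \<comment> \<open>Every element of \<open>V\<close> is a combination of the left factors of one
    fixed presentation of \<Delta>(c); this is what makes \<open>V\<close>
    finite-dimensional.\<close>
  have "V \<subseteq> span (fst ` set (comult C c))"
  proof
    fix v assume "v \<in> V"
    then obtain f where v: "v = hit_left C f c" by (auto simp: V_def)
    have "sum_list (map (\<lambda>p. scl C (f (snd p)) (fst p)) xs) \<in> span (fst ` set (comult C c))"
      if "set xs \<subseteq> set (comult C c)" for xs
      using that
    proof (induction xs)
      case Nil then show ?case by (simp add: span_zero)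
    next
      case (Cons p xs)
      then have "fst p \<in> fst ` set (comult C c)" by auto
      with Cons show ?case by (simp add: span_add span_scale span_base)
    qed
    then show "v \<in> span (fst ` set (comult C c))"
      by (simp add: v hit_left_def case_prod_unfold)
  qed
  moreover obtain B where B: "B \<subseteq> V" "independent B" "V \<subseteq> span B" "card B = dim V"
    by (rule basis_exists)
  ultimately have "B \<subseteq> span (fst ` set (comult C c))" by (meson order_trans)
  then have finB: "finite B"
    using independent_span_bound[of "fst ` set (comult C c)" B, OF _ B(2)] by simp
  \<comment> \<open>Extending the basis of \<open>V\<close> to one of the whole coalgebra turns its
    coordinates into linear forms defined everywhere.\<close>
  define E where "E = extend_basis B"
  have E: "independent E" "span E = UNIV" "B \<subseteq> E"
    using independent_extend_basis[OF B(2)] span_extend_basis[OF B(2)] extend_basis_superset[OF B(2)]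
    by (auto simp: E_def)
  define \<phi> where "\<phi> e v = representation E v e" for e v
  have lin_\<phi>: "lin (\<phi> e)" for e
    using lin_representation[OF E(1,2)] by (simp add: \<phi>_def[abs_def])
  have \<phi>_B: "\<phi> b b' = (if b = b' then 1 else 0)" if "b \<in> B" "b' \<in> B" for b b'
    using that E by (auto simp: \<phi>_def representation_basis)
  have V_eq: "v = (\<Sum>b\<in>B. scl C (\<phi> b v) b)" if "v \<in> V" for v
  proof -
    have "v \<in> span B" using that B(3) by auto
    then have "representation E v = representation B v"
      using representation_extend[OF E(1) _ E(3)] by simp
    moreover have "(\<Sum>b\<in>B. scl C (representation B v b) b) = v"
      by (rule sum_representation_eq[OF B(2) \<open>v \<in> span B\<close> finB subset_refl])
    ultimately show ?thesis by (simp add: \<phi>_def)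
  qed
  \<comment> \<open>This is \<Delta>(v) = \<Sum> b \<otimes> (v hit by \<phi>_b), tested on \<beta>.
    The difference \<open>D\<close> of the two integrands vanishes as soon as its first argument is
    in \<open>V\<close>. Expanding the right factors of \<Delta>(v) in the basis \<open>E\<close>
    makes the left factors elements of the orbit of \<open>v\<close>, which stays in
    \<open>V\<close>.\<close>
  have K: "sweedler C \<beta> v = (\<Sum>b\<in>B. \<beta> b (hit_right C v (\<phi> b)))"
    if \<beta>: "bilinear_form C \<beta>" and v: "v \<in> V" for \<beta> v
  proof -
    define D where "D x y = \<beta> x y - (\<Sum>b\<in>B. \<phi> b x * \<beta> b y)" for x y
    have l: "lin (\<beta> x)" "lin (\<lambda>x. \<beta> x y)" for x y using \<beta> by (auto simp: bilinear_form_def)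
    have lD1: "lin (D x)" for x
      unfolding D_def by (intro linI)
        (simp_all add: lin_add[OF l(1)] lin_scale[OF l(1)] sum.distrib algebra_simps sum_distrib_left)
    have lD2: "lin (\<lambda>x. D x y)" for y
      unfolding D_def by (intro linI)
        (simp_all add: lin_add[OF lin_\<phi>] lin_scale[OF lin_\<phi>] lin_add[OF l(2)] lin_scale[OF l(2)]
          sum.distrib algebra_simps sum_distrib_left)
    have D0: "D x y = 0" if "x \<in> V" for x y
    proof -
      have "\<beta> x y = \<beta> (\<Sum>b\<in>B. scl C (\<phi> b x) b) y" using V_eq[OF that] by simp
      also have "\<dots> = (\<Sum>b\<in>B. \<phi> b x * \<beta> b y)"
        by (simp add: lin_sum[OF l(2)] lin_scale[OF l(2)])
      finally show ?thesis by (simp add: D_def)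
    qed
    \<comment> \<open>The finitely many basis vectors that occur in the right factors of the
      presentation of \<Delta>(v).\<close>
    define E0 where "E0 = (\<Union>p\<in>set (comult C v). {e. representation E (snd p) e \<noteq> 0})"
    have fE0: "finite E0" unfolding E0_def by (simp add: finite_representation)
    have "D x y = (\<Sum>e\<in>E0. \<phi> e y * D x e)" if "(x, y) \<in> set (comult C v)" for x y
    proof -
      have "{e. representation E y e \<noteq> 0} \<subseteq> E0" using that by (force simp: E0_def)
      then have "(\<Sum>e\<in>E0. scl C (representation E y e) e) = y"
        using E(2) by (subst sum.mono_neutral_right[OF fE0])
          (auto simp: sum_nonzero_representation_eq[OF E(1)])
      then have "D x y = D x (\<Sum>e\<in>E0. scl C (\<phi> e y) e)" by (simp add: \<phi>_def)
      then show ?thesis by (simp add: lin_sum[OF lD1] lin_scale[OF lD1])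
    qed
    then have "sweedler C D v = sweedler C (\<lambda>x y. \<Sum>e\<in>E0. \<phi> e y * D x e) v"
      unfolding sweedler_def by (intro arg_cong[of _ _ sum_list] map_cong) auto
    also have "\<dots> = (\<Sum>e\<in>E0. D (hit_left C (\<phi> e) v) e)"
      by (simp add: sweedler_sum lin_hit_left[OF lD2] conv_sweedler mult.commute)
    also have "\<dots> = 0" using D0[OF hit_V[OF v lin_\<phi>]] by simp
    finally have "sweedler C (\<lambda>x y. D x y + (\<Sum>b\<in>B. \<phi> b x * \<beta> b y)) v =
      sweedler C (\<lambda>x y. \<Sum>b\<in>B. \<phi> b x * \<beta> b y) v"
      by (simp add: sweedler_add)
    then show ?thesis
      by (simp add: D_def sweedler_sum lin_hit_right[OF l(1)] conv_sweedler)
  qed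
  obtain h where h: "bij_betw h {..<card B} B"
    using ex_bij_betw_nat_finite[OF finB] by (auto simp: atLeast0LessThan)
  have hB: "h i \<in> B" if "i < card B" for i using h that by (auto simp: bij_betw_def)
  have h_inj: "h i = h j \<longleftrightarrow> i = j" if "i < card B" "j < card B" for i j
    using h that by (auto simp: bij_betw_def inj_on_def)
  \<comment> \<open>Chosen such that \<Delta>(h_j) = \<Sum> h_k \<otimes> t_kj, which is
    \<open>K'\<close>.\<close>
  define t where "t i j = hit_right C (h j) (\<phi> (h i))" for i j
  have K': "sweedler C \<beta> (h j) = (\<Sum>k<card B. \<beta> (h k) (t k j))"
    if "bilinear_form C \<beta>" "j < card B" for \<beta> j
  proof -
    have "h j \<in> V" using hB[OF that(2)] B(1) by auto
    then show ?thesis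
      by (simp only: K[OF that(1)] t_def sum.reindex_bij_betw[OF h, symmetric])
  qed
  have com: "sweedler C \<beta> (t i j) = (\<Sum>k<card B. \<beta> (t i k) (t k j))"
    if \<beta>: "bilinear_form C \<beta>" and ij: "i < card B" "j < card B" for \<beta> i j
  proof -
    have l: "lin (\<beta> x)" "lin (\<lambda>x. \<beta> x y)" for x y using \<beta> by (auto simp: bilinear_form_def)
    have l': "lin (\<lambda>x. \<phi> i x * \<beta> y z)" "lin (\<lambda>x. \<phi> i y * \<beta> x z)" "lin (\<lambda>x. \<phi> i y * \<beta> z x)" for y z i
      by (intro lin_mult_left lin_mult_right lin_\<phi> l)+
    have "sweedler C \<beta> (t i j) = sweedler C (\<lambda>x u. sweedler C (\<lambda>y z. \<phi> (h i) x * \<beta> y z) u) (h j)"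
      by (simp add: t_def lin_hit_right[OF lin_sweedler[OF l]] conv_sweedler sweedler_mult)
    also have "\<dots> = sweedler C (\<lambda>u z. sweedler C (\<lambda>x y. \<phi> (h i) x * \<beta> y z) u) (h j)"
      by (subst sweedler_coassoc) (use l' in auto)
    also have "\<dots> = (\<Sum>k<card B. sweedler C (\<lambda>x y. \<phi> (h i) x * \<beta> y (t k j)) (h k))"
      by (rule K'[OF bilinI ij(2)]) (use l' in \<open>auto intro!: lin_sweedler lin_sweedler_param\<close>)
    also have "\<dots> = (\<Sum>k<card B. \<beta> (t i k) (t k j))"
      by (simp add: t_def lin_hit_right[OF l(2)] conv_sweedler)
    finally show ?thesis .
  qed
  have "counit C (t i j) = (if i = j then 1 else 0)" if "i < card B" "j < card B" for i j
  proof -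
    have "counit C (t i j) = \<phi> (h i) (h j)"
      by (simp add: t_def lin_hit_right lin_counit conv_counit_right lin_\<phi>)
    then show ?thesis using that by (simp add: \<phi>_B hB h_inj)
  qed
  with com have comat: "comatrix (card B) t" by (simp add: comatrix_def)
  have cV: "c \<in> V"
    using VI[OF lin_counit] counit_right_vec[of c] by (simp add: hit_left_eq)
  \<comment> \<open>The coefficients come from c = \<Sum> \<phi>_j(c) h_j, valid because
    \<open>c\<close> is in \<open>V\<close>, and from h_j = \<Sum> \<epsilon>(h_i) t_ij, obtained by
    applying the counit to the left factor of \<Delta>(h_j).\<close>
  have "F c = (\<Sum>i<card B. \<Sum>j<card B. (counit C (h i) * \<phi> (h j) c) * F (t i j))" if F: "lin F" for F
  proof -
    have "F (h j) = (\<Sum>i<card B. counit C (h i) * F (t i j))" if "j < card B" for j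
      using K'[OF bilinI that, of "\<lambda>x y. counit C x * F y"]
      by (simp add: sweedler_counit_left[OF F] lin_mult_left[OF F] lin_mult_right[OF lin_counit])
    then have "(\<Sum>j<card B. \<phi> (h j) c * F (h j)) =
        (\<Sum>j<card B. \<Sum>i<card B. (counit C (h i) * \<phi> (h j) c) * F (t i j))"
      by (simp add: sum_distrib_left mult_ac)
    moreover have "F c = (\<Sum>j<card B. \<phi> (h j) c * F (h j))"
      using arg_cong[OF V_eq[OF cV], of F]
      by (simp only: lin_sum[OF F] lin_scale[OF F] sum.reindex_bij_betw[OF h, symmetric])
    ultimately show ?thesis by (subst sum.swap) simp
  qed
  with comat show ?thesis
    by (intro exI[of _ "card B"] exI[of _ t] exI[of _ "\<lambda>i j. counit C (h i) * \<phi> (h j) c"]) simp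
qed

end

section \<open>Integer powers of bijections\<close>

lemma fun_power_int_0 [simp]: "fun_power_int f 0 x = x"
  and fun_power_int_1 [simp]: "fun_power_int f 1 x = f x"
  by (simp_all add: fun_power_int_def)

lemma fun_power_int_succ:
  assumes "bij f" shows "fun_power_int f (n + 1) x = f (fun_power_int f n x)"
proof (cases "0 \<le> n")
  case True
  then have "nat (n + 1) = Suc (nat n)" by simp
  with True show ?thesis by (simp add: fun_power_int_def)
next
  case False
  then obtain k where k: "n = - int (Suc k)"
    using negD[of n] by auto
  have "f (inv f y) = y" for y
    using assms by (simp add: bij_is_surj surj_f_inv_f)
  then show ?thesis
    by (cases k) (simp_all add: fun_power_int_def k nat_add_distrib)
qed

lemma fun_power_int_pred:
  assumes "bij f" shows "f (fun_power_int f (n - 1) x) = fun_power_int f n x"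
  using fun_power_int_succ[OF assms, of "n - 1" x] by simp

lemma bij_cancel: "bij f \<Longrightarrow> f x = f y \<Longrightarrow> x = y"
  by (simp add: bij_is_inj inj_eq)

lemma fun_power_int_add:
  assumes "bij f" shows "fun_power_int f (m + n) x = fun_power_int f m (fun_power_int f n x)"
proof (induction m rule: int_induct[where k = 0])
  case (step1 i)
  have "i + 1 + n = i + n + 1" by simp
  then show ?case
    using step1 by (simp only: fun_power_int_succ[OF assms])
next
  case (step2 i)
  have "i - 1 + n = i + n - 1" by simp
  then have "f (fun_power_int f (i - 1 + n) x) = f (fun_power_int f (i - 1) (fun_power_int f n x))"
    by (simp only: step2(2) fun_power_int_pred[OF assms])
  then show ?case by (rule bij_cancel[OF assms])
qed simp

lemma fun_power_int_commute:
  assumes "bij f" "\<And>x. f (g x) = g (f x)" shows "fun_power_int f n (g x) = g (fun_power_int f n x)"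
proof (induction n rule: int_induct[where k = 0])
  case (step1 i)
  then show ?case by (simp only: fun_power_int_succ[OF assms(1)] assms(2))
next
  case (step2 i)
  have "f (fun_power_int f (i - 1) (g x)) = g (f (fun_power_int f (i - 1) x))"
    by (simp only: step2(2) fun_power_int_pred[OF assms(1)])
  also have "\<dots> = f (g (fun_power_int f (i - 1) x))" by (simp only: assms(2))
  finally show ?case by (rule bij_cancel[OF assms(1)])
qed simp

lemma fun_power_int_comp:
  assumes "bij f" "bij g" "\<And>x. f (g x) = g (f x)"
  shows "fun_power_int (\<lambda>x. f (g x)) n x = fun_power_int f n (fun_power_int g n x)"
proof -
  let ?h = "\<lambda>x. f (g x)"
  have h: "bij ?h" using bij_comp[OF assms(2,1)] by (simp add: comp_def)
  note c = fun_power_int_commute[of f g, OF assms(1,3)]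
  show ?thesis
  proof (induction n rule: int_induct[where k = 0])
    case (step1 i)
    then show ?case
      by (simp only: fun_power_int_succ[OF h] fun_power_int_succ[OF assms(1)] fun_power_int_succ[OF assms(2)] c)
        (simp only: assms(3))
  next
    case (step2 i)
    have "?h (fun_power_int ?h (i - 1) x) = fun_power_int f i (fun_power_int g i x)"
      by (simp only: fun_power_int_pred[OF h] step2(2))
    also have "\<dots> = f (fun_power_int f (i - 1) (g (fun_power_int g (i - 1) x)))"
      by (simp only: fun_power_int_pred[OF assms(1)] fun_power_int_pred[OF assms(2)])
    also have "\<dots> = ?h (fun_power_int f (i - 1) (fun_power_int g (i - 1) x))" by (simp only: c)
    finally show ?case by (rule bij_cancel[OF h])
  qed simp
qed

section \<open>Twist oriented quantum coalgebras\<close>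

text \<open>What is left of a crossing factor when each line carries a power of T = T_d T_u and, if
  it goes upward, one more T_d. \<open>x\<close> belongs to the SW-NE line and \<open>y\<close> to
  the NW-SE line, whichever is over. For s = Up, n = Down the extra T_d of the upward line meets the
  T_u prescribed for that line, so a T remains; for s = Down, n = Up the prescribed T_d and the
  extra one sit on different lines and cancel.\<close>

fun reduced_factor ::
  "('k::field, 'c::ab_group_add, 'z) oriented_quantum_coalgebra_scheme \<Rightarrow> piece \<Rightarrow> 'c \<Rightarrow> 'c \<Rightarrow> 'k" where
  "reduced_factor C (Crossing SWNE Up Up) x y = br C x y"
| "reduced_factor C (Crossing SWNE Down Down) x y = br C x y"
| "reduced_factor C (Crossing SWNE Up Down) x y = form_inverse C (br C) (Td C (Tu C x)) y"
| "reduced_factor C (Crossing SWNE Down Up) x y = form_inverse C (br C) x y"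
| "reduced_factor C (Crossing NWSE Up Up) x y = form_inverse C (br C) y x"
| "reduced_factor C (Crossing NWSE Down Down) x y = form_inverse C (br C) y x"
| "reduced_factor C (Crossing NWSE Up Down) x y = br C y (Td C (Tu C x))"
| "reduced_factor C (Crossing NWSE Down Up) x y = br C y x"
| "reduced_factor C (Maximum h) x y = 1"
| "reduced_factor C (Minimum h) x y = 1"

text \<open>The direction as an exponent: the number of extra factors T_d on a line.\<close>

definition upness :: "dir \<Rightarrow> int" where
  "upness d = (if d = Up then 1 else 0)"

fun line_dir :: "piece \<Rightarrow> crossing_line \<Rightarrow> dir" where
  "line_dir (Crossing l s n) m = (if m = SWNE then s else n)"
| "line_dir _ m = Up"

locale twist =
  fixes C :: "('k::field, 'c::ab_group_add, 'z) twist_quantum_coalgebra_scheme"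
  assumes twist: "twist_oqc C"
begin

lemma strict: "strict_oqc C" using twist by (simp add: twist_oqc_def)

sublocale coalg C
  using strict by unfold_locales (simp add: strict_oqc_def)

abbreviation "b \<equiv> br C"
abbreviation "b' \<equiv> form_inverse C (br C)"
abbreviation "G \<equiv> tw C"
abbreviation "H \<equiv> dual_inverse C (tw C)"
abbreviation "T x \<equiv> Td C (Tu C x)"
abbreviation "\<epsilon> \<equiv> counit C"

lemma bilin_b: "bilinear_form C b" using strict by (simp add: strict_oqc_def)

lemma form_inverse: "is_form_inverse C b b'"
proof -
  obtain g where g: "is_form_inverse C b g" using strict by (auto simp: strict_oqc_def)
  then show ?thesis using form_inverse_eq[OF bilin_b g] by simp
qed

lemma bilin_b': "bilinear_form C b'" using form_inverse by (simp add: is_form_inverse_iff)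

lemma lin_b: "lin (b x)" "lin (\<lambda>x. b x y)" "lin (b' x)" "lin (\<lambda>x. b' x y)"
  using bilin_b bilin_b' by (simp_all add: bilinear_form_def)

lemma auto_Td: "coalgebra_automorphism C (Td C)" and auto_Tu: "coalgebra_automorphism C (Tu C)"
  using strict by (simp_all add: strict_oqc_def)

lemma bij_Td: "bij (Td C)" and bij_Tu: "bij (Tu C)"
  using auto_Td auto_Tu by (simp_all add: coalgebra_automorphism_def)

lemma bij_T: "bij (\<lambda>x. T x)" using bij_comp[OF bij_Tu bij_Td] by (simp add: comp_def)

lemma Td_Tu: "Td C (Tu C x) = Tu C (Td C x)"
  using strict by (auto simp: strict_oqc_def fun_eq_iff)

lemma b_Td: "b (Td C x) (Td C y) = b x y" and b_Tu: "b (Tu C x) (Tu C y) = b x y"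
  using strict by (auto simp: strict_oqc_def Let_def)

lemma counit_Td: "\<epsilon> (Td C x) = \<epsilon> x" and counit_Tu: "\<epsilon> (Tu C x) = \<epsilon> x"
  using auto_Td auto_Tu by (simp_all add: coalgebra_automorphism_def)

text \<open>The pullback of \<open>b'\<close> along \<open>S\<close> is again an inverse of
  \<open>b\<close>, and the inverse is unique. The axioms state the invariance for \<open>b\<close>
  only.\<close>

lemma b'_automorphism:
  assumes S: "coalgebra_automorphism C S" and inv: "\<And>x y. b (S x) (S y) = b x y"
  shows "b' (S x) (S y) = b' x y"
proof -
  have l: "lin (\<lambda>x. b' (S x) y)" "lin (\<lambda>x. b' y (S x))" for y
    by (rule lin_comp_automorphism[OF S, OF lin_b(4)] lin_comp_automorphism[OF S, OF lin_b(3)])+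
  have cS: "\<epsilon> (S x) = \<epsilon> x" for x using S by (simp add: coalgebra_automorphism_def)
  have conv2_S: "conv2 f g (S c) (S d) = conv2 (\<lambda>x y. f (S x) (S y)) (\<lambda>x y. g (S x) (S y)) c d"
    if "bilinear_form C f" "bilinear_form C g" for f g c d
  proof -
    have l: "lin (f x)" "lin (\<lambda>x. f x y)" "lin (g x)" "lin (\<lambda>x. g x y)" for x y
      using that by (auto simp: bilinear_form_def)
    have "conv2 f g (S c) (S d) = sweedler C (\<lambda>x y. sweedler C (\<lambda>u v. f (S x) u * g (S y) v) (S d)) c"
      unfolding conv2_def
      by (rule coalgebra_automorphism_sweedler[OF S])
        (intro bilinI lin_sweedler_param lin_mult_left lin_mult_right l)
    also have "\<dots> = conv2 (\<lambda>x y. f (S x) (S y)) (\<lambda>x y. g (S x) (S y)) c d"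
      unfolding conv2_def
      by (subst coalgebra_automorphism_sweedler[OF S]) (auto intro!: bilinI lin_mult_left lin_mult_right l)
    finally show ?thesis .
  qed
  have fi: "conv2 b' b = (\<lambda>c d. \<epsilon> c * \<epsilon> d)" "conv2 b b' = (\<lambda>c d. \<epsilon> c * \<epsilon> d)"
    using form_inverse by (simp_all add: is_form_inverse_iff)
  have "is_form_inverse C b (\<lambda>x y. b' (S x) (S y))"
    unfolding is_form_inverse_iff
    using conv2_S[OF bilin_b bilin_b', unfolded inv fi cS] conv2_S[OF bilin_b' bilin_b, unfolded inv fi cS]
    by (intro conjI bilinI ext l) simp_all
  then have "(\<lambda>x y. b' (S x) (S y)) = b'"
    using form_inverse_unique[OF bilin_b _ form_inverse] by blast
  then show ?thesis by (simp add: fun_eq_iff)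
qed

lemma b'_Td: "b' (Td C x) (Td C y) = b' x y" and b'_Tu: "b' (Tu C x) (Tu C y) = b' x y"
  by (simp_all add: b'_automorphism auto_Td auto_Tu b_Td b_Tu)

lemma sweedler_Td: "bilinear_form C B \<Longrightarrow> sweedler C B (Td C c) = sweedler C (\<lambda>x y. B (Td C x) (Td C y)) c"
  by (rule coalgebra_automorphism_sweedler[OF auto_Td])

lemma lin_Td: "lin f \<Longrightarrow> lin (\<lambda>x. f (Td C x))" and lin_Tu: "lin f \<Longrightarrow> lin (\<lambda>x. f (Tu C x))"
  by (rule lin_comp_automorphism[OF auto_Td] lin_comp_automorphism[OF auto_Tu], assumption)+

lemma lin_T: "lin f \<Longrightarrow> lin (\<lambda>x. f (T x))"
  using lin_Tu[OF lin_Td[of f]] by simp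

lemma sweedler_T:
  assumes "bilinear_form C B" shows "sweedler C B (T c) = sweedler C (\<lambda>x y. B (T x) (T y)) c"
proof -
  have "bilinear_form C (\<lambda>x y. B (Td C x) (Td C y))"
    using assms by (auto intro!: bilinI lin_Td simp: bilinear_form_def)
  then show ?thesis
    using coalgebra_automorphism_sweedler[OF auto_Tu] by (simp add: sweedler_Td[OF assms])
qed

text \<open>The mixed axioms in terms of T alone. Since T_d is bijective, write c = T_d(c0); then
  T_d cancels from both arguments of \<open>b\<close>.\<close>

lemma mixed_inverse:
  "sweedler C (\<lambda>c1 c2. sweedler C (\<lambda>d1 d2. b c1 (T d2) * b' c2 d1) d) c = \<epsilon> c * \<epsilon> d"
  "sweedler C (\<lambda>c1 c2. sweedler C (\<lambda>d1 d2. b' c1 d2 * b c2 (T d1)) d) c = \<epsilon> c * \<epsilon> d"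
proof -
  have ax: "sweedler C (\<lambda>c1 c2. sweedler C (\<lambda>d1 d2. b c1 (Tu C d2) * b' (Td C c2) d1) d) c = \<epsilon> c * \<epsilon> d"
    "sweedler C (\<lambda>c1 c2. sweedler C (\<lambda>d1 d2. b' (Td C c1) d2 * b c2 (Tu C d1)) d) c = \<epsilon> c * \<epsilon> d" for c d
    using strict by (simp_all add: strict_oqc_def Let_def sweedler_def)
  obtain c0 where c0: "c = Td C c0" using bij_Td by (metis bij_pointE)
  show "sweedler C (\<lambda>c1 c2. sweedler C (\<lambda>d1 d2. b c1 (T d2) * b' c2 d1) d) c = \<epsilon> c * \<epsilon> d"
    unfolding c0
    by (subst sweedler_Td) (auto intro!: bilinI lin_sweedler_param lin_mult_left lin_mult_right lin_b
        simp: b_Td ax counit_Td)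
  show "sweedler C (\<lambda>c1 c2. sweedler C (\<lambda>d1 d2. b' c1 d2 * b c2 (T d1)) d) c = \<epsilon> c * \<epsilon> d"
    unfolding c0
    by (subst sweedler_Td) (auto intro!: bilinI lin_sweedler_param lin_mult_left lin_mult_right lin_b
        simp: b_Td ax counit_Td)
qed

lemma yang_baxter:
  "sweedler C (\<lambda>c1 c2. sweedler C (\<lambda>d1 d2. sweedler C (\<lambda>e1 e2. b c1 d1 * b c2 e1 * b d2 e2) e) d) c =
   sweedler C (\<lambda>c1 c2. sweedler C (\<lambda>d1 d2. sweedler C (\<lambda>e1 e2. b c2 d2 * b c1 e2 * b d1 e1) e) d) c"
  using strict by (simp add: strict_oqc_def Let_def sweedler_def)

lemma lin_G: "lin G" using twist by (simp add: twist_oqc_def)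

lemma dual_inverse_G: "is_dual_inverse C G H"
proof -
  obtain h where h: "is_dual_inverse C G h" using twist by (auto simp: twist_oqc_def)
  then show ?thesis using dual_inverse_eq[OF lin_G h] by simp
qed

lemma lin_H: "lin H" and conv_G_H: "conv C G H = \<epsilon>" and conv_H_G: "conv C H G = \<epsilon>"
  using dual_inverse_G by (simp_all add: is_dual_inverse_def)

text \<open>The hit actions become multiplications in the dual algebra, so the axiom on T_d T_u says
  that composition with T is conjugation by G. The two rules that follow move a form past G and past
  its inverse.\<close>

lemma lin_comp_T:
  assumes F: "lin F" shows "(\<lambda>x. F (T x)) = conv C G (conv C F H)"
proof
  fix c
  have "T c = hit_left C H (hit_right C c G)" using twist by (simp add: twist_oqc_def)
  then show "F (T c) = conv C G (conv C F H) c"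
    by (simp add: lin_hit_left[OF F] lin_hit_right lin_conv F lin_H)
qed

lemma conv_T_G: "lin F \<Longrightarrow> conv C (\<lambda>x. F (T x)) G = conv C G F"
  by (simp add: lin_comp_T conv_assoc lin_G lin_H lin_conv conv_H_G conv_counit_right)

lemma conv_H_T: "lin F \<Longrightarrow> conv C H (\<lambda>x. F (T x)) = conv C F H"
  by (simp add: lin_comp_T conv_assoc[symmetric] lin_G lin_H lin_conv conv_H_G conv_counit_left)

abbreviation "Tp a c x \<equiv> fun_power_int (Td C) a (fun_power_int (Tu C) c x)"

lemma Tp_add: "Tp (m + a) (n + c) x = Tp m n (Tp a c x)"
proof -
  have "fun_power_int (Tu C) n (fun_power_int (Td C) a y) = fun_power_int (Td C) a (fun_power_int (Tu C) n y)" for y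
    using fun_power_int_commute[OF bij_Td, of "fun_power_int (Tu C) n" a y]
      fun_power_int_commute[OF bij_Tu, of "Td C" n] Td_Tu by metis
  then show ?thesis by (simp add: fun_power_int_add bij_Td bij_Tu)
qed

lemma fun_power_int_invariant:
  assumes f: "bij f" and inv: "\<And>x y. \<beta> (f x) (f y) = \<beta> x y"
  shows "\<beta> (fun_power_int f n x) (fun_power_int f n y) = \<beta> x y"
proof (induction n rule: int_induct[where k = 0])
  case (step1 i)
  then show ?case by (simp add: fun_power_int_succ[OF f] inv)
next
  case (step2 i)
  then show ?case
    using inv[of "fun_power_int f (i - 1) x" "fun_power_int f (i - 1) y"] by (simp add: fun_power_int_pred[OF f])
qed simp

lemma b_Tp: "b (Tp m n x) (Tp m n y) = b x y" and b'_Tp: "b' (Tp m n x) (Tp m n y) = b' x y"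
  by (simp_all add: fun_power_int_invariant bij_Td bij_Tu b_Td b_Tu b'_Td b'_Tu)

abbreviation "Tn n x \<equiv> fun_power_int (\<lambda>x. T x) n x"

lemma Tn_Tp: "Tn n x = Tp n n x"
  by (rule fun_power_int_comp[OF bij_Td bij_Tu Td_Tu])

lemma T_Tp: "T (Tp m n x) = Tp (m + 1) (n + 1) x"
  using Tp_add[of 1 m 1 n x] by (simp add: add.commute)

text \<open>Both arguments of \<open>b\<close> or \<open>b'\<close> are twisted alike. This disposes
  of the constant that depends on the starting point and, later, of the effect of the closing arc of
  a tangle.\<close>

lemma crossing_factor_Tp:
  "crossing_factor C (\<lambda>l p q. Tp m n (v l p q)) g = crossing_factor C v g"
  by (cases "(C, v, g)" rule: crossing_factor.cases) (simp_all add: b_Tp b'_Tp)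

text \<open>The hypothesis is the parity relation along a strand; in its applications \<kappa> is
  the upness of the starting point. The common T_d^(-\<kappa>) drops out by invariance.\<close>

lemma crossing_factor_reduced:
  assumes "\<And>l. ud l = uu l + upness (line_dir g l) - \<kappa>"
  shows "crossing_factor C (\<lambda>l p q. Tp (ud l + p) (uu l + q) (x l)) g =
    reduced_factor C g (Tn (uu SWNE) (x SWNE)) (Tn (uu NWSE) (x NWSE))"
proof -
  have "(\<lambda>l p q. Tp (ud l + p) (uu l + q) (x l)) =
    (\<lambda>l p q. Tp (- \<kappa>) 0 (Tp (uu l + upness (line_dir g l) + p) (uu l + q) (x l)))"
    using Tp_add[of "- \<kappa>" _ 0] by (simp add: fun_eq_iff assms algebra_simps)
  then have "crossing_factor C (\<lambda>l p q. Tp (ud l + p) (uu l + q) (x l)) g =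
    crossing_factor C (\<lambda>l p q. Tp (uu l + upness (line_dir g l) + p) (uu l + q) (x l)) g"
    by (simp only: crossing_factor_Tp)
  also have "\<dots> = reduced_factor C g (Tn (uu SWNE) (x SWNE)) (Tn (uu NWSE) (x NWSE))"
  proof -
    have sh: "b (Tp (m + 1) k y) (Tp (m' + 1) k' z) = b (Tp m k y) (Tp m' k' z)"
      "b' (Tp (m + 1) k y) (Tp (m' + 1) k' z) = b' (Tp m k y) (Tp m' k' z)" for m m' k k' y z
      using b_Tp[of 1 0 "Tp m k y" "Tp m' k' z"] b'_Tp[of 1 0 "Tp m k y" "Tp m' k' z"]
        Tp_add[of 1 m 0 k y] Tp_add[of 1 m' 0 k' z] by (simp_all add: add.commute)
    show ?thesis
    proof (cases g)
      case (Crossing l s n)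
      then show ?thesis
        by (cases l; cases s; cases n) (simp_all add: Tn_Tp T_Tp upness_def sh)
    qed simp_all
  qed
  finally show ?thesis .
qed

lemma dual_power_0 [simp]: "dual_power C G 0 = \<epsilon>" by (simp add: dual_power_def)

lemma lin_dual_power: "lin (dual_power C G n)"
proof -
  have "lin ((conv C F ^^ m) \<epsilon>)" if "lin F" for F m
    by (induction m) (simp_all add: lin_counit lin_conv that)
  then show ?thesis by (simp add: dual_power_def lin_G lin_H)
qed

lemma dual_power_succ: "dual_power C G (n + 1) = conv C G (dual_power C G n)"
proof (cases "0 \<le> n")
  case True
  then have "nat (n + 1) = Suc (nat n)" by simp
  with True show ?thesis by (simp add: dual_power_def)
next
  case False
  then obtain k where k: "n = - int (Suc k)"
    using negD[of n] by auto
  have l: "lin ((conv C H ^^ m) \<epsilon>)" for m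
    by (induction m) (simp_all add: lin_counit lin_conv lin_H)
  have "conv C G (conv C H ((conv C H ^^ k) \<epsilon>)) = (conv C H ^^ k) \<epsilon>"
    by (simp add: conv_assoc[symmetric] lin_G lin_H l conv_G_H conv_counit_left)
  then show ?thesis
    by (cases k) (simp_all add: dual_power_def k nat_add_distrib)
qed

lemma dual_power_pred: "dual_power C G (n - 1) = conv C H (dual_power C G n)"
  using dual_power_succ[of "n - 1"]
  by (simp add: conv_assoc[symmetric] lin_G lin_H lin_dual_power conv_H_G conv_counit_left)

lemma dual_power_commute:
  "conv C G (dual_power C G n) = conv C (dual_power C G n) G"
  "conv C H (dual_power C G n) = conv C (dual_power C G n) H"
proof -
  show G: "conv C G (dual_power C G n) = conv C (dual_power C G n) G" for n
  proof (induction n rule: int_induct[where k = 0])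
    case base
    then show ?case by (simp add: conv_counit_left conv_counit_right lin_G)
  next
    case (step1 i)
    then show ?case
      by (simp add: dual_power_succ) (simp add: conv_assoc[symmetric] lin_G lin_dual_power)
  next
    case (step2 i)
    have "conv C (conv C H (dual_power C G i)) G = conv C H (conv C G (dual_power C G i))"
      using step2 by (simp add: conv_assoc lin_G lin_H lin_dual_power)
    also have "\<dots> = dual_power C G i"
      by (simp add: conv_assoc[symmetric] lin_G lin_H lin_dual_power conv_H_G conv_counit_left)
    finally show ?case using dual_power_succ[of "i - 1"] by (simp add: dual_power_pred)
  qed
  have "conv C H (conv C (conv C G (dual_power C G n)) H) = conv C H (conv C (conv C (dual_power C G n) G) H)"
    by (simp add: G)
  then show "conv C H (dual_power C G n) = conv C (dual_power C G n) H"
    by (simp add: conv_assoc lin_G lin_H lin_dual_power lin_conv conv_G_H conv_counit_right)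
      (simp add: conv_assoc[symmetric] lin_G lin_H lin_dual_power lin_conv conv_H_G conv_counit_left)
qed

text \<open>The negative powers are the point: linearity passes to the inverse of T by writing
  vectors as images under T.\<close>

lemma lin_Tn: "lin F \<Longrightarrow> lin (\<lambda>x. F (Tn u x))"
proof (induction u arbitrary: F rule: int_induct[where k = 0])
  case (step1 i)
  have e: "Tn (i + 1) x = Tn i (T x)" for x using fun_power_int_add[OF bij_T, of i 1] by simp
  have "lin (\<lambda>x. F (Tn i (T x)))" by (rule lin_T[OF step1(2)[OF step1(3)]])
  then show ?case by (simp only: e)
next
  case (step2 i)
  show ?case
  proof (intro linI)
    fix x y a
    obtain x0 where x: "x = T x0" by (rule surjE[OF bij_is_surj[OF bij_T], of x])
    obtain y0 where y: "y = T y0" by (rule surjE[OF bij_is_surj[OF bij_T], of y])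
    note xy = x y
    have s: "T x0 + T y0 = T (x0 + y0)" "scl C a (T x0) = T (scl C a x0)"
      using auto_Td auto_Tu by (simp_all add: coalgebra_automorphism_def Vector_Spaces.linear_iff)
    have e: "Tn (i - 1) (T z) = Tn i z" for z using fun_power_int_add[OF bij_T, of "i - 1" 1 z] by simp
    show "F (Tn (i - 1) (x + y)) = F (Tn (i - 1) x) + F (Tn (i - 1) y)"
      by (simp only: xy s e lin_add[OF step2(2)[OF step2(3)]])
    show "F (Tn (i - 1) (scl C a x)) = a * F (Tn (i - 1) x)"
      by (simp only: xy s e lin_scale[OF step2(2)[OF step2(3)]])
  qed
qed simp

text \<open>Iterates \<open>conv_H_T\<close>, and \<open>conv_T_G\<close> for negative
  \<open>u\<close>: carrying the power of G from the left of \<open>F\<close> to its right removes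
  \<open>u\<close> twists.\<close>

lemma conv_dual_power_Tn:
  "lin F \<Longrightarrow> conv C (dual_power C G (- u)) (\<lambda>x. F (Tn u x)) = conv C F (dual_power C G (- u))"
proof (induction u arbitrary: F rule: int_induct[where k = 0])
  case base
  then show ?case by (simp add: conv_counit_left conv_counit_right)
next
  case (step1 i)
  note l = lin_dual_power lin_G lin_H lin_Tn[OF step1(3), of i] lin_T[OF lin_Tn[OF step1(3), of i]] lin_conv step1(3)
  have e: "Tn (i + 1) x = Tn i (T x)" for x using fun_power_int_add[OF bij_T, of i 1] by simp
  have p: "dual_power C G (- (i + 1)) = conv C (dual_power C G (- i)) H"
  proof -
    have "- (i + 1) = - i - 1" by simp
    then show ?thesis by (simp only: dual_power_pred dual_power_commute(2))
  qed
  have "conv C (dual_power C G (- (i + 1))) (\<lambda>x. F (Tn (i + 1) x)) =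
      conv C (dual_power C G (- i)) (conv C H (\<lambda>x. F (Tn i (T x))))"
    unfolding p e by (simp add: conv_assoc l)
  also have "\<dots> = conv C (conv C (dual_power C G (- i)) (\<lambda>x. F (Tn i x))) H"
    by (simp only: conv_H_T[OF l(4)]) (simp add: conv_assoc l)
  also have "\<dots> = conv C F (dual_power C G (- (i + 1)))"
    unfolding step1(2)[OF step1(3)] p by (simp add: conv_assoc l)
  finally show ?case .
next
  case (step2 i)
  note l = lin_dual_power lin_G lin_H lin_Tn[OF step2(3), of "i - 1"]
    lin_T[OF lin_Tn[OF step2(3), of "i - 1"]] lin_conv step2(3)
  have e: "Tn i x = Tn (i - 1) (T x)" for x using fun_power_int_add[OF bij_T, of "i - 1" 1] by simp
  have p: "dual_power C G (- (i - 1)) = conv C (dual_power C G (- i)) G"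
  proof -
    have "- (i - 1) = - i + 1" by simp
    then show ?thesis by (simp only: dual_power_succ dual_power_commute(1))
  qed
  have "conv C (dual_power C G (- (i - 1))) (\<lambda>x. F (Tn (i - 1) x)) =
      conv C (dual_power C G (- i)) (conv C G (\<lambda>x. F (Tn (i - 1) x)))"
    unfolding p by (simp add: conv_assoc l)
  also have "\<dots> = conv C (conv C (dual_power C G (- i)) (\<lambda>x. F (Tn i x))) G"
    unfolding e conv_T_G[OF l(4), symmetric] by (simp add: conv_assoc l)
  also have "\<dots> = conv C F (dual_power C G (- (i - 1)))"
    unfolding step2(2)[OF step2(3)] p by (simp add: conv_assoc l)
  finally show ?case .
qed

end

section \<open>Beads along a traversal\<close>

type_synonym line = "nat \<times> crossing_line"

definition event_lines :: "event list \<Rightarrow> line list" where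
  "event_lines E = map fst (labelled_lines E)"

lemma event_lines_simps [simp]:
  "event_lines [] = []" "event_lines (Line i l # E) = (i, l) # event_lines E"
  "event_lines (Extremum g # E) = event_lines E"
  by (simp_all add: event_lines_def)

lemma event_lines_append [simp]: "event_lines (E @ F) = event_lines E @ event_lines F"
  by (induction E rule: labelled_lines.induct) simp_all

definition total_u :: "event list \<Rightarrow> int" where "total_u E = sum_list (map weight_u E)"
definition total_d :: "event list \<Rightarrow> int" where "total_d E = sum_list (map weight_d E)"

definition rest_d :: "event list \<Rightarrow> line \<Rightarrow> int" where
  "rest_d E x = fst (the (map_of (labelled_lines E) x))"
definition rest_u :: "event list \<Rightarrow> line \<Rightarrow> int" where
  "rest_u E x = snd (the (map_of (labelled_lines E) x))"

lemma rest_simps [simp]: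
  "rest_d (Extremum g # E) x = rest_d E x" "rest_u (Extremum g # E) x = rest_u E x"
  "rest_d (Line i l # E) x = (if x = (i, l) then total_d E else rest_d E x)"
  "rest_u (Line i l # E) x = (if x = (i, l) then total_u E else rest_u E x)"
  by (auto simp: rest_d_def rest_u_def total_d_def total_u_def)

text \<open>The tuple of tensor factors as a function on crossing lines. It replaces the positional
  lookup in \<open>line_value\<close>, so that linearity in one line becomes a statement about
  function updates.\<close>

fun assign :: "('l \<Rightarrow> 'c) \<Rightarrow> 'l list \<Rightarrow> 'c list \<Rightarrow> 'l \<Rightarrow> 'c" where
  "assign v (l # ls) (c # cs) = assign (v(l := c)) ls cs"
| "assign v _ _ = v"

lemma assign_other: "x \<notin> set ls \<Longrightarrow> assign v ls cs x = v x"
  by (induction v ls cs rule: assign.induct) auto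

lemma assign_lookup:
  "distinct ls \<Longrightarrow> length cs = length ls \<Longrightarrow> x \<in> set ls \<Longrightarrow> map_of (zip ls cs) x = Some (assign v ls cs x)"
  by (induction v ls cs rule: assign.induct) (auto simp: assign_other)

lemma line_value_eq:
  fixes cs :: "'c list"
  assumes "distinct (event_lines E)" "length cs = length (event_lines E)" "x \<in> set (event_lines E)"
  shows "line_value C E cs x p q = fun_power_int (Td C) (rest_d E x + p)
    (fun_power_int (Tu C) (rest_u E x + q) (assign v (event_lines E) cs x))"
proof -
  have z: "map_of (zip (map fst L) (zip cs (map snd L))) x =
    (case map_of (zip (map fst L) cs) x of None \<Rightarrow> None | Some c \<Rightarrow> Some (c, the (map_of L x)))"
    if "length cs = length L" for L :: "(line \<times> int \<times> int) list" and cs :: "'c list"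
    using that by (induction L cs rule: list_induct2') (auto split: option.splits dest!: map_of_SomeD dest: set_zip_leftD)
  have "map_of (zip (event_lines E) cs) x = Some (assign v (event_lines E) cs x)"
    by (rule assign_lookup) (use assms in auto)
  then show ?thesis
    unfolding line_value_def using z[of cs "labelled_lines E"] assms(2)
    by (simp add: event_lines_def rest_d_def rest_u_def case_prod_unfold)
qed

lemma length_iter_comult: "cs \<in> set (iter_comult C n c) \<Longrightarrow> length cs = Suc n"
  by (induction n arbitrary: c cs) auto

definition is_crossing :: "piece \<Rightarrow> bool" where
  "is_crossing g \<longleftrightarrow> (\<exists>l s n. g = Crossing l s n)"

definition crossing_lines :: "piece list \<Rightarrow> line set" where
  "crossing_lines gs = {(i, l). i < length gs \<and> is_crossing (gs ! i)}"

context coalg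
begin

definition multilinear :: "'l set \<Rightarrow> (('l \<Rightarrow> 'c) \<Rightarrow> 'k) \<Rightarrow> bool" where
  "multilinear L \<Phi> \<longleftrightarrow> (\<forall>l\<in>L. \<forall>v. lin (\<lambda>x. \<Phi> (v(l := x))))"

text \<open>The sum over the iterated coproduct, with one further tensor factor at the end that is
  absorbed by the counit. The further factor gives the empty list a meaning, matching the functional
  \<epsilon> of a diagram without crossings.\<close>

primrec evaluate :: "'l list \<Rightarrow> (('l \<Rightarrow> 'c) \<Rightarrow> 'k) \<Rightarrow> ('l \<Rightarrow> 'c) \<Rightarrow> 'c \<Rightarrow> 'k" where
  "evaluate [] \<Phi> v c = counit C c * \<Phi> v"
| "evaluate (l # ls) \<Phi> v c = sweedler C (\<lambda>x y. evaluate ls \<Phi> (v(l := x)) y) c"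

lemma lin_evaluate_env:
  assumes "multilinear L \<Phi>" "l \<in> L" "l \<notin> set ls" shows "lin (\<lambda>x. evaluate ls \<Phi> (v(l := x)) c)"
  using assms(3)
proof (induction ls arbitrary: v c)
  case Nil
  have "lin (\<lambda>x. \<Phi> (v(l := x)))" using assms by (simp add: multilinear_def)
  then show ?case unfolding evaluate.simps by (rule lin_mult_left)
next
  case (Cons m ls)
  then have "lin (\<lambda>z. sweedler C (\<lambda>x y. evaluate ls \<Phi> ((v(m := x))(l := z)) y) c)"
    by (intro lin_sweedler_param) (simp add: fun_upd_def)
  moreover have "(v(l := z))(m := x) = (v(m := x))(l := z)" for x z
    using Cons.prems by auto
  ultimately show ?case by (simp only: evaluate.simps)
qed

lemma lin_evaluate:
  assumes "multilinear L \<Phi>" "distinct ls" "set ls \<subseteq> L" shows "lin (evaluate ls \<Phi> v)"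
  using assms(2,3)
proof (induction ls arbitrary: v)
  case Nil
  have "lin (\<lambda>c. counit C c * \<Phi> v)" by (intro lin_mult_right lin_counit)
  then show ?case by (simp add: evaluate.simps(1)[abs_def])
next
  case (Cons l ls)
  then have "lin (\<lambda>c. sweedler C (\<lambda>x y. evaluate ls \<Phi> (v(l := x)) y) c)"
    using lin_evaluate_env[OF assms(1)] by (intro lin_sweedler) auto
  then show ?case by (simp add: evaluate.simps(2)[abs_def])
qed

text \<open>By coassociativity the last tensor factor can be split off in place of the first. This
  relates evaluation over the opposite coproduct to the reversed list of lines.\<close>

lemma evaluate_snoc:
  assumes "multilinear L \<Phi>" "distinct (ls @ [l])" "set (ls @ [l]) \<subseteq> L"
  shows "evaluate (ls @ [l]) \<Phi> v c = sweedler C (\<lambda>x y. evaluate ls \<Phi> (v(l := y)) x) c"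
  using assms(2,3)
proof (induction ls arbitrary: v c)
  case Nil
  then have "lin (\<lambda>x. \<Phi> (v(l := x)))" using assms(1) by (simp add: multilinear_def)
  from sweedler_counit_left[OF this, of c] sweedler_counit_right[OF this, of c] show ?case
    by (simp add: mult.commute fun_upd_def)
next
  case (Cons m ls)
  note l = lin_evaluate_env[OF assms(1)] lin_evaluate[OF assms(1)]
  have tw: "(v(m := x))(l := z) = (v(l := z))(m := x)" for x z
    using Cons.prems by auto
  have l1: "lin (\<lambda>x. evaluate ls \<Phi> (w(m := x)) y)" "lin (\<lambda>x. evaluate ls \<Phi> (w(l := x)) y)" for w y
    by (rule l(1); use Cons.prems in auto)+
  have l2: "lin (evaluate ls \<Phi> w)" for w
    by (rule l(2)) (use Cons.prems in auto)
  have l1': "lin (\<lambda>z. evaluate ls \<Phi> ((v(l := z))(m := x)) y)" for x y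
    using l1(2)[of "v(m := x)" y] by (simp only: tw)
  have ih: "evaluate (ls @ [l]) \<Phi> w = (\<lambda>c. sweedler C (\<lambda>x y. evaluate ls \<Phi> (w(l := y)) x) c)" for w
    using Cons by (auto simp: fun_eq_iff fun_upd_def)
  have "evaluate ((m # ls) @ [l]) \<Phi> v c =
    sweedler C (\<lambda>x u. sweedler C (\<lambda>y z. evaluate ls \<Phi> ((v(m := x))(l := z)) y) u) c"
    by (simp add: ih)
  also have "\<dots> = sweedler C (\<lambda>u z. sweedler C (\<lambda>x y. evaluate ls \<Phi> ((v(m := x))(l := z)) y) u) c"
    unfolding tw by (rule sweedler_coassoc[symmetric]) (rule l1 l2 l1')+
  finally show ?case by (simp only: evaluate.simps tw)
qed

lemma iter_comult_evaluate:
  assumes "multilinear L \<Phi>" "distinct ls" "set ls \<subseteq> L" "ls \<noteq> []"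
  shows "(\<Sum>cs\<leftarrow>iter_comult C (length ls - 1) c. \<Phi> (assign v ls cs)) = evaluate ls \<Phi> v c"
  using assms(2-4)
proof (induction ls arbitrary: v c)
  case (Cons l ls)
  show ?case
  proof (cases ls)
    case Nil
    have "lin (\<lambda>x. \<Phi> (v(l := x)))" using assms(1) Cons.prems by (simp add: multilinear_def)
    from sweedler_counit_right[OF this, of c] show ?thesis by (simp add: Nil mult.commute)
  next
    case (Cons m ms)
    have c: "sum_list (concat xs) = sum_list (map sum_list xs)" for xs :: "'k list list"
      by (induction xs) simp_all
    have "(\<Sum>cs\<leftarrow>iter_comult C (length (l # ls) - 1) c. \<Phi> (assign v (l # ls) cs)) =
      sweedler C (\<lambda>x y. \<Sum>cs\<leftarrow>iter_comult C (length ls - 1) y. \<Phi> (assign (v(l := x)) ls cs)) c"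
      by (simp add: Cons sweedler_def map_concat comp_def case_prod_unfold c)
    then show ?thesis using Cons.IH Cons.prems Cons by simp
  qed
qed simp

end

context twist
begin

definition weight_product :: "piece list \<Rightarrow> (line \<Rightarrow> 'c) \<Rightarrow> 'k" where
  "weight_product gs v = (\<Prod>i<length gs. reduced_factor C (gs ! i) (v (i, SWNE)) (v (i, NWSE)))"

lemma lin_reduced_factor:
  assumes "is_crossing g"
  shows "lin (\<lambda>x. reduced_factor C g x y)" "lin (\<lambda>y. reduced_factor C g x y)"
proof -
  obtain l s n where g: "g = Crossing l s n" using assms by (auto simp: is_crossing_def)
  have lT: "lin (\<lambda>y. b x (T y))" "lin (\<lambda>x. b' (T x) y)" for x y
    by (rule lin_T lin_b)+
  show "lin (\<lambda>x. reduced_factor C g x y)" "lin (\<lambda>y. reduced_factor C g x y)"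
    unfolding g by (cases l; cases s; cases n; simp add: lT lin_b)+
qed

lemma multilinear_weight_product:
  "multilinear (crossing_lines gs) (\<lambda>v. weight_product gs (\<lambda>x. Tn (\<theta> x) (v x)))"
proof -
  have "lin (\<lambda>x. weight_product gs (\<lambda>y. Tn (\<theta> y) ((v((i, l) := x)) y)))"
    if i: "i < length gs" and g: "is_crossing (gs ! i)" for v i l
  proof -
    let ?w = "\<lambda>x y. Tn (\<theta> y) ((v((i, l) := x)) y)"
    have "weight_product gs (?w x) = reduced_factor C (gs ! i) (?w x (i, SWNE)) (?w x (i, NWSE)) *
      (\<Prod>j\<in>{..<length gs} - {i}. reduced_factor C (gs ! j) (Tn (\<theta> (j, SWNE)) (v (j, SWNE)))
        (Tn (\<theta> (j, NWSE)) (v (j, NWSE))))" for x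
      unfolding weight_product_def using i by (subst prod.remove[of _ i]) (auto intro!: prod.cong)
    then show ?thesis
      using lin_Tn[OF lin_reduced_factor(1)[OF g]] lin_Tn[OF lin_reduced_factor(2)[OF g]]
      by (cases l) (auto intro!: lin_mult_right)
  qed
  then show ?thesis by (auto simp: multilinear_def crossing_lines_def)
qed

lemma multilinear_weight_product': "multilinear (crossing_lines gs) (weight_product gs)"
  using multilinear_weight_product[of gs "\<lambda>x. 0"] by simp

lemma weight_product_no_crossing: "crossing_lines gs = {} \<Longrightarrow> weight_product gs v = 1"
proof -
  assume "crossing_lines gs = {}"
  then have "reduced_factor C (gs ! i) x y = 1" if "i < length gs" for i x y
    using that by (cases "gs ! i") (auto simp: crossing_lines_def is_crossing_def)
  then show ?thesis by (simp add: weight_product_def)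
qed

text \<open>Each crossing factor depends on its lines through u_u only, once u_d is eliminated by
  \<open>parity\<close>. The environment \<open>v0\<close> is arbitrary, because every crossing line
  is overwritten by a tensor factor.\<close>

lemma functional_evaluate:
  assumes E: "E = traversal D P" and d: "distinct (event_lines E)"
    and lines: "set (event_lines E) = crossing_lines (map snd (snd D))"
    and parity: "\<And>i l. (i, l) \<in> set (event_lines E) \<Longrightarrow>
      rest_d E (i, l) = rest_u E (i, l) + upness (line_dir (snd (snd D ! i)) l) - \<kappa>"
  shows "functional C D P c = evaluate (event_lines E)
    (\<lambda>v. weight_product (map snd (snd D)) (\<lambda>x. Tn (rest_u E x) (v x))) v0 c"
proof (cases "event_lines E = []")
  case True
  then show ?thesis
    using lines unfolding functional_def E[symmetric]
    by (simp add: event_lines_def weight_product_no_crossing)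
next
  case False
  let ?gs = "map snd (snd D)"
  have "crossing_factor C (\<lambda>l. line_value C E cs (i, l)) (?gs ! i) =
      reduced_factor C (?gs ! i) (Tn (rest_u E (i, SWNE)) (assign v0 (event_lines E) cs (i, SWNE)))
        (Tn (rest_u E (i, NWSE)) (assign v0 (event_lines E) cs (i, NWSE)))"
    if "i < length (snd D)" "length cs = length (event_lines E)" for i cs
  proof (cases "is_crossing (?gs ! i)")
    case True
    then have m: "(i, l) \<in> set (event_lines E)" for l
      using that lines by (auto simp: crossing_lines_def)
    have "(\<lambda>l. line_value C E cs (i, l)) = (\<lambda>l p q. Tp (rest_d E (i, l) + p) (rest_u E (i, l) + q)
        (assign v0 (event_lines E) cs (i, l)))"
      using line_value_eq[OF d that(2) m, where C = C and v = v0] by (simp add: fun_eq_iff)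
    then show ?thesis
      using crossing_factor_reduced[of "\<lambda>l. rest_d E (i, l)" "\<lambda>l. rest_u E (i, l)" "?gs ! i" \<kappa>
          "\<lambda>l. assign v0 (event_lines E) cs (i, l)"] parity[OF m] that
      by simp
  next
    case False
    then show ?thesis by (cases "?gs ! i") (auto simp: is_crossing_def)
  qed
  then have *: "(\<Prod>i<length (snd D). crossing_factor C (\<lambda>l. line_value C E cs (i, l)) (snd (snd D ! i))) =
      weight_product ?gs (\<lambda>x. Tn (rest_u E x) (assign v0 (event_lines E) cs x))"
    if "length cs = length (event_lines E)" for cs
    unfolding weight_product_def using that by (auto intro!: prod.cong)
  have "functional C D P c = (\<Sum>cs\<leftarrow>iter_comult C (length (event_lines E) - 1) c.
    \<Prod>i<length (snd D). crossing_factor C (\<lambda>l. line_value C E cs (i, l)) (snd (snd D ! i)))"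
    using False unfolding functional_def E[symmetric] by (simp add: event_lines_def Let_def)
  also have "\<dots> = (\<Sum>cs\<leftarrow>iter_comult C (length (event_lines E) - 1) c.
      weight_product ?gs (\<lambda>x. Tn (rest_u E x) (assign v0 (event_lines E) cs x)))"
    using * False by (intro arg_cong[of _ _ sum_list] map_cong)
      (auto dest!: length_iter_comult)
  also have "\<dots> = evaluate (event_lines E) (\<lambda>v. weight_product ?gs (\<lambda>x. Tn (rest_u E x) (v x))) v0 c"
    by (rule iter_comult_evaluate[OF multilinear_weight_product d _ False]) (simp add: lines)
  finally show ?thesis .
qed

text \<open>The exponent u_u changes only at extrema traversed from left to right, by -1 at a
  maximum and by +1 at a minimum. A total factor G^(-u_u) thus consists of one G or one G^-1 at each
  of these and of the unit at the others.\<close>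

fun extremum_form :: "piece \<Rightarrow> 'c \<Rightarrow> 'k" where
  "extremum_form (Maximum LR) = G"
| "extremum_form (Minimum LR) = H"
| "extremum_form _ = \<epsilon>"

lemma lin_extremum_form: "lin (extremum_form g)"
  by (cases g rule: extremum_form.cases) (simp_all add: lin_G lin_H lin_counit)

lemma dual_power_extremum:
  "dual_power C G (- (weight_u (Extremum g) + u)) = conv C (extremum_form g) (dual_power C G (- u))"
proof (cases "Extremum g" rule: weight_u.cases)
  case 1
  have "- (1 + u) = - u - 1" by simp
  with 1 show ?thesis by (simp only: weight_u.simps event.inject extremum_form.simps dual_power_pred)
next
  case 2
  have "- (- 1 + u) = - u + 1" by simp
  with 2 show ?thesis by (simp only: weight_u.simps event.inject extremum_form.simps dual_power_succ)
qed (auto simp: conv_counit_left lin_dual_power)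

text \<open>Every event consumes one tensor factor: an extremum feeds it to a form, a crossing line
  stores it in the environment. No exponent refers to the position in the word any more, which is
  what makes cyclic rotation possible.\<close>

fun beads :: "event list \<Rightarrow> ((line \<Rightarrow> 'c) \<Rightarrow> 'k) \<Rightarrow> (line \<Rightarrow> 'c) \<Rightarrow> 'c \<Rightarrow> 'k" where
  "beads [] \<Phi> v c = \<epsilon> c * \<Phi> v"
| "beads (Extremum g # E) \<Phi> v c = sweedler C (\<lambda>x y. extremum_form g x * beads E \<Phi> v y) c"
| "beads (Line i l # E) \<Phi> v c = sweedler C (\<lambda>x y. beads E \<Phi> (v((i, l) := x)) y) c"

lemma lin_beads_env:
  assumes "multilinear L \<Phi>" "x \<in> L" "x \<notin> set (event_lines E)"
  shows "lin (\<lambda>z. beads E \<Phi> (v(x := z)) c)"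
  using assms(3)
proof (induction E arbitrary: v c rule: labelled_lines.induct)
  case 1
  have "lin (\<lambda>z. \<Phi> (v(x := z)))" using assms by (simp add: multilinear_def)
  then show ?case unfolding beads.simps by (rule lin_mult_left)
next
  case (2 i l E)
  then have "lin (\<lambda>z. sweedler C (\<lambda>u y. beads E \<Phi> ((v((i, l) := u))(x := z)) y) c)"
    by (intro lin_sweedler_param) (simp add: fun_upd_def)
  moreover have "(v(x := z))((i, l) := u) = (v((i, l) := u))(x := z)" for u z
    using 2(2) by auto
  ultimately show ?case by (simp only: beads.simps)
next
  case (3 g E)
  then show ?case by (simp add: lin_sweedler_param lin_mult_left)
qed

lemma lin_beads:
  assumes "multilinear L \<Phi>" "distinct (event_lines E)" "set (event_lines E) \<subseteq> L"
  shows "lin (beads E \<Phi> v)"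
  using assms(2,3)
proof (induction E arbitrary: v rule: labelled_lines.induct)
  case 1
  have "lin (\<lambda>c. \<epsilon> c * \<Phi> v)" by (intro lin_mult_right lin_counit)
  then show ?case by (simp add: beads.simps(1)[abs_def])
next
  case (2 i l E)
  then have "lin (\<lambda>c. sweedler C (\<lambda>x y. beads E \<Phi> (v((i, l) := x)) y) c)"
    using lin_beads_env[OF assms(1)] by (intro lin_sweedler) auto
  then show ?case by (simp add: beads.simps(3)[abs_def])
next
  case (3 g E)
  then have "lin (\<lambda>c. sweedler C (\<lambda>x y. extremum_form g x * beads E \<Phi> v y) c)"
    by (intro lin_sweedler lin_mult_left lin_mult_right lin_extremum_form) auto
  then show ?case by (simp add: beads.simps(2)[abs_def])
qed

text \<open>The automorphism \<open>T\<^sub>d T\<^sub>u\<close> being inner, the twists of the crossing lines by its powers telescope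
  to one factor \<open>G\<close> or \<open>G\<^sup>-\<^sup>1\<close> at each extremum traversed from left to right.\<close>

lemma conv_evaluate_beads:
  assumes "distinct (event_lines E)" "set (event_lines E) \<subseteq> L" "multilinear L \<Phi>"
    and "multilinear L (\<lambda>v. \<Phi> (\<lambda>x. Tn (\<theta> x) (v x)))"
    and "\<And>x. x \<in> set (event_lines E) \<Longrightarrow> \<theta> x = rest_u E x"
  shows "conv C (dual_power C G (- total_u E))
      (evaluate (event_lines E) (\<lambda>v. \<Phi> (\<lambda>x. Tn (\<theta> x) (v x))) v) = beads E \<Phi> (\<lambda>x. Tn (\<theta> x) (v x))"
  using assms(1,2,5)
proof (induction E arbitrary: v rule: labelled_lines.induct)
  case 1
  show ?case
    by (simp add: fun_eq_iff total_u_def conv_sweedler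
        sweedler_counit_left[OF lin_mult_right[OF lin_counit]])
next
  case (2 i l E)
  let ?\<Phi> = "\<lambda>v. \<Phi> (\<lambda>x. Tn (\<theta> x) (v x))"
  let ?u = "total_u E"
  let ?P = "dual_power C G (- ?u)"
  let ?w = "\<lambda>x. Tn (\<theta> x) (v x)"
  have u: "\<theta> (i, l) = ?u" using 2(4)[of "(i, l)"] by simp
  have tot: "total_u (Line i l # E) = ?u" by (simp add: total_u_def)
  \<comment> \<open>The bead is twisted backwards in advance, so that the integrand is
    \<open>F (Tn ?u x) y\<close>; \<open>conv_dual_power_Tn\<close> then carries the power of G past
    it and removes the twist.\<close>
  define F where "F x y = evaluate (event_lines E) ?\<Phi> (v((i, l) := Tn (- ?u) x)) y" for x y
  have FT: "F (Tn ?u x) y = evaluate (event_lines E) ?\<Phi> (v((i, l) := x)) y" for x y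
    using fun_power_int_add[OF bij_T, of "- ?u" ?u] by (simp add: F_def)
  have lF: "lin (F x)" "lin (\<lambda>x. F x y)" for x y
    unfolding F_def using 2(2,3)
    by (auto intro!: lin_evaluate[OF assms(4)] lin_Tn[OF lin_evaluate_env[OF assms(4)]])
  have IH: "conv C ?P (F x) = beads E \<Phi> (?w((i, l) := x))" for x
  proof -
    have e: "(\<lambda>y. Tn (\<theta> y) ((v((i, l) := Tn (- ?u) x)) y)) = ?w((i, l) := x)"
      using fun_power_int_add[OF bij_T, of ?u "- ?u"] by (auto simp: u)
    have "conv C ?P (evaluate (event_lines E) ?\<Phi> (v((i, l) := Tn (- ?u) x))) =
        beads E \<Phi> (\<lambda>y. Tn (\<theta> y) ((v((i, l) := Tn (- ?u) x)) y))"
      by (rule 2(1)) (use 2(2-4) in \<open>auto split: if_splits\<close>)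
    then show ?thesis unfolding e by (simp add: F_def[abs_def])
  qed
  show ?case
  proof
    fix c
    have "conv C ?P (evaluate (event_lines (Line i l # E)) ?\<Phi> v) c =
      sweedler C (\<lambda>p q. sweedler C (\<lambda>x y. ?P p * F (Tn ?u x) y) q) c"
      by (simp add: conv_sweedler FT sweedler_mult)
    also have "\<dots> = sweedler C (\<lambda>q y. sweedler C (\<lambda>p x. ?P p * F (Tn ?u x) y) q) c"
      by (rule sweedler_coassoc[symmetric]) (intro lin_mult_left lin_mult_right lin_dual_power lF lin_Tn)+
    also have "\<dots> = sweedler C (\<lambda>q y. conv C ?P (\<lambda>x. F (Tn ?u x) y) q) c"
      by (simp add: conv_sweedler)
    also have "\<dots> = sweedler C (\<lambda>q y. sweedler C (\<lambda>x p. F x y * ?P p) q) c"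
      by (simp only: conv_dual_power_Tn[OF lF(2)]) (simp add: conv_sweedler)
    also have "\<dots> = sweedler C (\<lambda>x q. sweedler C (\<lambda>p y. F x y * ?P p) q) c"
      by (rule sweedler_coassoc) (intro lin_mult_left lin_mult_right lin_dual_power lF)+
    also have "\<dots> = sweedler C (\<lambda>x q. conv C ?P (F x) q) c"
      by (simp add: conv_sweedler mult.commute)
    also have "\<dots> = beads (Line i l # E) \<Phi> ?w c"
      by (simp add: IH)
    finally show "conv C (dual_power C G (- total_u (Line i l # E)))
        (evaluate (event_lines (Line i l # E)) ?\<Phi> v) c = beads (Line i l # E) \<Phi> ?w c"
      unfolding tot .
  qed
next
  case (3 g E)
  let ?\<Phi> = "\<lambda>v. \<Phi> (\<lambda>x. Tn (\<theta> x) (v x))"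
  have "total_u (Extremum g # E) = weight_u (Extremum g) + total_u E" by (simp add: total_u_def)
  then have "conv C (dual_power C G (- total_u (Extremum g # E))) (evaluate (event_lines E) ?\<Phi> v) =
    conv C (extremum_form g) (conv C (dual_power C G (- total_u E)) (evaluate (event_lines E) ?\<Phi> v))"
    using 3 by (simp only: dual_power_extremum)
      (simp add: conv_assoc lin_dual_power lin_extremum_form lin_evaluate[OF assms(4)])
  also have "\<dots> = conv C (extremum_form g) (beads E \<Phi> (\<lambda>x. Tn (\<theta> x) (v x)))"
    using 3 by simp
  finally show ?case by (simp add: fun_eq_iff conv_sweedler)
qed

lemma beads_snoc_line:
  assumes "multilinear L \<Phi>" "distinct (event_lines (E @ [Line i l]))" "set (event_lines (E @ [Line i l])) \<subseteq> L"
  shows "beads (E @ [Line i l]) \<Phi> v c = sweedler C (\<lambda>x y. beads E \<Phi> (v((i, l) := y)) x) c"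
  using assms(2,3)
proof (induction E arbitrary: v c rule: labelled_lines.induct)
  case 1
  then have "lin (\<lambda>x. \<Phi> (v((i, l) := x)))" using assms(1) by (simp add: multilinear_def)
  from sweedler_counit_left[OF this, of c] sweedler_counit_right[OF this, of c] show ?case
    by (simp add: mult.commute fun_upd_def beads.simps(1)[abs_def])
next
  case (2 j m E)
  note l = lin_beads_env[OF assms(1)] lin_beads[OF assms(1)]
  have tw: "(v((j, m) := x))((i, l) := z) = (v((i, l) := z))((j, m) := x)" for x z
    using 2(2) by auto
  have l1: "lin (\<lambda>x. beads E \<Phi> (w((j, m) := x)) y)" "lin (\<lambda>x. beads E \<Phi> (w((i, l) := x)) y)" for w y
    by (rule l(1); use 2(2,3) in auto)+
  have l2: "lin (beads E \<Phi> w)" for w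
    by (rule l(2)) (use 2(2,3) in auto)
  have l1': "lin (\<lambda>z. beads E \<Phi> ((v((i, l) := z))((j, m) := x)) y)" for x y
    using l1(2)[of "v((j, m) := x)" y] by (simp only: tw)
  have ih: "beads (E @ [Line i l]) \<Phi> w = (\<lambda>c. sweedler C (\<lambda>x y. beads E \<Phi> (w((i, l) := y)) x) c)" for w
    using 2 by (auto simp: fun_eq_iff fun_upd_def)
  have "beads ((Line j m # E) @ [Line i l]) \<Phi> v c =
    sweedler C (\<lambda>x u. sweedler C (\<lambda>y z. beads E \<Phi> ((v((j, m) := x))((i, l) := z)) y) u) c"
    using 2 by (simp add: ih)
  also have "\<dots> = sweedler C (\<lambda>u z. sweedler C (\<lambda>x y. beads E \<Phi> ((v((j, m) := x))((i, l) := z)) y) u) c"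
    unfolding tw by (rule sweedler_coassoc[symmetric]) (rule l1 l2 l1')+
  finally show ?case by (simp only: beads.simps tw append_Cons)
next
  case (3 g E)
  note l = lin_beads_env[OF assms(1)] lin_beads[OF assms(1)] lin_extremum_form
  have "beads ((Extremum g # E) @ [Line i l]) \<Phi> v c =
    sweedler C (\<lambda>x u. sweedler C (\<lambda>y z. extremum_form g x * beads E \<Phi> (v((i, l) := z)) y) u) c"
    using 3 by (simp add: sweedler_mult fun_upd_def)
  also have "\<dots> = sweedler C (\<lambda>u z. sweedler C (\<lambda>x y. extremum_form g x * beads E \<Phi> (v((i, l) := z)) y) u) c"
    by (rule sweedler_coassoc[symmetric])
      (use 3(2,3) in \<open>auto intro!: l lin_mult_left lin_mult_right\<close>)
  finally show ?case by (simp add: fun_upd_def)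
qed

lemma beads_snoc_extremum:
  assumes "multilinear L \<Phi>" "distinct (event_lines E)" "set (event_lines E) \<subseteq> L"
  shows "beads (E @ [Extremum g]) \<Phi> v c = sweedler C (\<lambda>x y. extremum_form g y * beads E \<Phi> v x) c"
  using assms(2,3)
proof (induction E arbitrary: v c rule: labelled_lines.induct)
  case 1
  from sweedler_counit_left[OF lin_mult_right[OF lin_extremum_form[of g]], of "\<Phi> v" c]
    sweedler_counit_right[OF lin_mult_right[OF lin_extremum_form[of g]], of "\<Phi> v" c] show ?case
    by (simp add: mult_ac)
next
  case (2 j m E)
  note l = lin_beads_env[OF assms(1)] lin_beads[OF assms(1)] lin_extremum_form
  have ih: "beads (E @ [Extremum g]) \<Phi> w = (\<lambda>c. sweedler C (\<lambda>x y. extremum_form g y * beads E \<Phi> w x) c)" for w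
    using 2 by (auto simp: fun_eq_iff fun_upd_def)
  have "beads ((Line j m # E) @ [Extremum g]) \<Phi> v c =
    sweedler C (\<lambda>x u. sweedler C (\<lambda>y z. extremum_form g z * beads E \<Phi> (v((j, m) := x)) y) u) c"
    using 2 by (simp add: ih)
  also have "\<dots> = sweedler C (\<lambda>u z. sweedler C (\<lambda>x y. extremum_form g z * beads E \<Phi> (v((j, m) := x)) y) u) c"
    by (rule sweedler_coassoc[symmetric])
      (use 2(2,3) in \<open>auto intro!: l lin_mult_left lin_mult_right\<close>)
  finally show ?case by (simp add: sweedler_mult)
next
  case (3 h E)
  note l = lin_beads[OF assms(1)] lin_extremum_form
  have "beads ((Extremum h # E) @ [Extremum g]) \<Phi> v c =
    sweedler C (\<lambda>x u. sweedler C (\<lambda>y z. extremum_form h x * (extremum_form g z * beads E \<Phi> v y)) u) c"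
    using 3 by (simp add: sweedler_mult)
  also have "\<dots> = sweedler C (\<lambda>u z. sweedler C (\<lambda>x y. extremum_form h x * (extremum_form g z * beads E \<Phi> v y)) u) c"
    by (rule sweedler_coassoc[symmetric])
      (use 3(2,3) in \<open>auto intro!: l lin_mult_left lin_mult_right\<close>)
  finally show ?case by (simp add: sweedler_mult mult_ac)
qed

text \<open>Putting an event last instead of first exchanges the two factors of \<Delta>(c) between
  this event and the rest of the word, which a cocommutative element does not notice.\<close>

lemma beads_rotate1:
  assumes "multilinear L \<Phi>" "distinct (event_lines (e # E))" "set (event_lines (e # E)) \<subseteq> L"
    and c: "cocommutative C c"
  shows "beads (E @ [e]) \<Phi> v c = beads (e # E) \<Phi> v c"
proof (cases e)
  case (Extremum g)
  have "bilinear_form C (\<lambda>x y. extremum_form g x * beads E \<Phi> v y)"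
    using assms Extremum
    by (intro bilinI lin_mult_left lin_mult_right lin_extremum_form lin_beads[OF assms(1)]) auto
  from cocommutative_sweedler[OF c this] show ?thesis
    using assms Extremum by (simp add: beads_snoc_extremum[OF assms(1)])
next
  case (Line i l)
  have "bilinear_form C (\<lambda>x y. beads E \<Phi> (v((i, l) := x)) y)"
    using assms Line
    by (intro bilinI lin_beads[OF assms(1)] lin_beads_env[OF assms(1)]) auto
  from cocommutative_sweedler[OF c this] show ?thesis
    using assms Line by (simp add: beads_snoc_line[OF assms(1)])
qed

lemma beads_rotate:
  assumes "multilinear L \<Phi>" "distinct (event_lines (E @ F))" "set (event_lines (E @ F)) \<subseteq> L"
    and c: "cocommutative C c"
  shows "beads (F @ E) \<Phi> v c = beads (E @ F) \<Phi> v c"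
  using assms(2,3)
proof (induction E arbitrary: F)
  case (Cons e E)
  have ev: "set (event_lines (e # X)) = set (event_lines [e]) \<union> set (event_lines X)" for X
    by (cases e) auto
  have d: "distinct (event_lines (E @ (F @ [e])))"
    using Cons.prems(1) by (cases e) auto
  have "beads ((F @ [e]) @ E) \<Phi> v c = beads (E @ (F @ [e])) \<Phi> v c"
    by (rule Cons.IH[OF d]) (use Cons.prems(2) in \<open>auto simp: ev[of E] ev[of "E @ F"]\<close>)
  also have "\<dots> = beads (e # E @ F) \<Phi> v c"
    using beads_rotate1[OF assms(1) _ _ c, of e "E @ F"] Cons.prems by simp
  finally show ?case by simp
qed simp

end

section \<open>Traversals of closed diagrams\<close>

lemma level_0 [simp]: "level D 0 = fst D"
  by (simp add: level_def)

lemma level_Suc: "i < length (snd D) \<Longrightarrow> level D (Suc i) = apply_layer (snd D ! i) (level D i)"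
  by (simp add: level_def take_Suc_conv_app_nth)

text \<open>The arcs inside layer \<open>i\<close> with their ends, in the form (left or lower end, right or upper end,
  whether traversed from the former to the latter, events).\<close>

type_synonym arc = "point \<times> point \<times> bool \<times> event list"

fun piece_arcs :: "nat \<Rightarrow> nat \<Rightarrow> piece \<Rightarrow> arc list" where
  "piece_arcs i p (Maximum h) = [((i, p), (i, p + 1), h = LR, [Extremum (Maximum h)])]"
| "piece_arcs i p (Minimum h) = [((Suc i, p), (Suc i, p + 1), h = LR, [Extremum (Minimum h)])]"
| "piece_arcs i p (Crossing l s n) =
     [((i, p), (Suc i, p + 1), s = Up, [Line i SWNE]), ((i, p + 1), (Suc i, p), n = Up, [Line i NWSE])]"

definition arcs :: "diagram \<Rightarrow> nat \<Rightarrow> arc list" where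
  "arcs D i = (case snd D ! i of (p, g) \<Rightarrow>
     map (\<lambda>j. ((i, j), (Suc i, j), level D i ! j = Up, [])) [0..<p] @
     map (\<lambda>k. ((i, p + length (lower g) + k), (Suc i, p + length (upper g) + k),
         level D i ! (p + length (lower g) + k) = Up, []))
       [0..<length (level D i) - (p + length (lower g))] @ piece_arcs i p g)"

fun directed :: "arc \<Rightarrow> point \<times> point \<times> event list" where
  "directed (x, y, f, ev) = (if f then (x, y, ev) else (y, x, ev))"

definition up :: "diagram \<Rightarrow> point \<Rightarrow> int" where
  "up D x = upness (level D (fst x) ! snd x)"

fun reverse_event :: "event \<Rightarrow> event" where
  "reverse_event (Extremum g) = Extremum (reverse_piece g)"
| "reverse_event (Line i l) = Line i l"

lemma upness_simps [simp]: "upness Up = 1" "upness Down = 0"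
  by (simp_all add: upness_def)

lemma flip_flip [simp]: "flip (flip d) = d" and flip_neq [simp]: "flip d \<noteq> d" "d \<noteq> flip d"
  and flip_eq [simp]: "flip d = Up \<longleftrightarrow> d = Down" "flip d = Down \<longleftrightarrow> d = Up"
  by (cases d; simp)+

lemma dir_neq [simp]: "d \<noteq> Up \<longleftrightarrow> d = Down" "d \<noteq> Down \<longleftrightarrow> d = Up"
  by (cases d; simp)+

lemma hdir_neq [simp]: "h \<noteq> LR \<longleftrightarrow> h = RL" "h \<noteq> RL \<longleftrightarrow> h = LR"
  by (cases h; simp)+

lemma hflip_eq [simp]: "hflip h = LR \<longleftrightarrow> h = RL" "hflip h = RL \<longleftrightarrow> h = LR"
  by (cases h; simp)+

lemma lower_reverse [simp]: "lower (reverse_piece g) = map flip (lower g)"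
  and upper_reverse [simp]: "upper (reverse_piece g) = map flip (upper g)"
  by (cases g rule: lower.cases; simp) (cases g rule: upper.cases; simp)

locale fitting_diagram =
  fixes D :: diagram
  assumes fit: "layers_fit D"
begin

abbreviation "lev \<equiv> level D"
abbreviation "len \<equiv> length (snd D)"

lemma fitD:
  assumes "i < len" "snd D ! i = (p, g)"
  shows "p + length (lower g) \<le> length (lev i)"
    and "\<And>j. j < length (lower g) \<Longrightarrow> lev i ! (p + j) = lower g ! j"
    and "lev (Suc i) = take p (lev i) @ upper g @ drop (p + length (lower g)) (lev i)"
    and "length (lev (Suc i)) = length (lev i) - length (lower g) + length (upper g)"
proof -
  have f: "p \<le> length (lev i)" "take (length (lower g)) (drop p (lev i)) = lower g"
    using fit assms by (force simp: layers_fit_def)+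
  from arg_cong[OF f(2), of length] f(1) show le: "p + length (lower g) \<le> length (lev i)" by simp
  show "lev i ! (p + j) = lower g ! j" if "j < length (lower g)" for j
    using arg_cong[OF f(2), of "\<lambda>xs. xs ! j"] that le by simp
  show l: "lev (Suc i) = take p (lev i) @ upper g @ drop (p + length (lower g)) (lev i)"
    using assms by (simp add: level_Suc apply_layer_def)
  show "length (lev (Suc i)) = length (lev i) - length (lower g) + length (upper g)"
    using le by (simp add: l)
qed

lemma lev_Suc_nth:
  assumes "i < len" "snd D ! i = (p, g)"
  shows "j < p \<Longrightarrow> lev (Suc i) ! j = lev i ! j"
    and "j < length (upper g) \<Longrightarrow> lev (Suc i) ! (p + j) = upper g ! j"
    and "k < length (lev i) - (p + length (lower g)) \<Longrightarrow>
      lev (Suc i) ! (p + length (upper g) + k) = lev i ! (p + length (lower g) + k)"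
  using fitD[OF assms] by (simp_all add: nth_append)

text \<open>The case analysis over pieces behind the local facts about a traversal. The claim on
  \<open>total_d ev - total_u ev\<close> is the source of the parity relation; the last claim
  recovers the starting point of a crossing line from its name, so that each line is met only
  once.\<close>

lemma directed_arc:
  assumes i: "i < len" and a: "a \<in> set (arcs D i)" and d: "directed a = (x, y, ev)"
  shows "x \<in> points D" "y \<in> points D" "next_point D x = y" "events_at D x = ev"
    "fst x = (if up D x = 1 then i else Suc i)" "length ev \<le> 1"
    "total_d ev - total_u ev = up D x - up D y"
    "Line m l \<in> set ev \<Longrightarrow> m = i \<and> is_crossing (snd (snd D ! i)) \<and> up D x = upness (line_dir (snd (snd D ! i)) l) \<and> up D y = up D x \<and>
       snd x = fst (snd D ! i) + (if (l = SWNE) = (up D x = 1) then 0 else 1)"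
proof -
  obtain p g where pg: "snd D ! i = (p, g)" by fastforce
  note f = fitD[OF i pg] and n = lev_Suc_nth[OF i pg]
  have pts: "(i, j) \<in> points D \<longleftrightarrow> j < length (lev i)" "(Suc i, j) \<in> points D \<longleftrightarrow> j < length (lev (Suc i))" for j
    using i by (simp_all add: points_def)
  note simps = next_point.simps events_at.simps up_def pts pg i total_d_def total_u_def is_crossing_def
  consider (left) j where "j < p" "a = ((i, j), (Suc i, j), lev i ! j = Up, [])"
    | (right) k where "k < length (lev i) - (p + length (lower g))"
        "a = ((i, p + length (lower g) + k), (Suc i, p + length (upper g) + k),
          lev i ! (p + length (lower g) + k) = Up, [])"
    | (piece) "a \<in> set (piece_arcs i p g)"
    using a pg by (auto simp: arcs_def)
  then have "x \<in> points D \<and> y \<in> points D \<and> next_point D x = y \<and> events_at D x = ev \<and>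
    fst x = (if up D x = 1 then i else Suc i) \<and> length ev \<le> 1 \<and>
    total_d ev - total_u ev = up D x - up D y \<and>
    (Line m l \<in> set ev \<longrightarrow> m = i \<and> is_crossing (snd (snd D ! i)) \<and> up D x = upness (line_dir (snd (snd D ! i)) l) \<and> up D y = up D x \<and>
       snd x = fst (snd D ! i) + (if (l = SWNE) = (up D x = 1) then 0 else 1))"
  proof cases
    case left
    then show ?thesis
      using d f(1,4) n(1)[of j] by (cases "lev i ! j") (auto simp: simps)
  next
    case right
    then show ?thesis
      using d f(1,4) n(3)[of k] by (cases "lev i ! (p + length (lower g) + k)") (auto simp: simps)
  next
    case piece
    show ?thesis
    proof (cases g)
      case (Maximum h)
      then show ?thesis
        using piece d f(1,4) f(2)[of 0] f(2)[of 1] by (cases h) (auto simp: simps other_def)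
    next
      case (Minimum h)
      then show ?thesis
        using piece d f(1,4) n(2)[of 0] n(2)[of 1] by (cases h) (auto simp: simps other_def)
    next
      case (Crossing l s n')
      then show ?thesis
        using piece d f(1,4) f(2)[of 0] f(2)[of 1] n(2)[of 0] n(2)[of 1]
        by (cases s; cases n') (auto simp: simps other_def)
    qed
  qed
  then show "x \<in> points D" "y \<in> points D" "next_point D x = y" "events_at D x = ev"
    "fst x = (if up D x = 1 then i else Suc i)" "length ev \<le> 1"
    "total_d ev - total_u ev = up D x - up D y"
    "Line m l \<in> set ev \<Longrightarrow> m = i \<and> is_crossing (snd (snd D ! i)) \<and> up D x = upness (line_dir (snd (snd D ! i)) l) \<and> up D y = up D x \<and>
       snd x = fst (snd D ! i) + (if (l = SWNE) = (up D x = 1) then 0 else 1)"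
    by blast+
qed

lemma arc_from:
  assumes "i < len" "j < length (lev i)" "lev i ! j = Up"
  shows "\<exists>a\<in>set (arcs D i). fst (directed a) = (i, j)"
proof -
  obtain p g where pg: "snd D ! i = (p, g)" by fastforce
  note f = fitD[OF assms(1) pg]
  consider "j < p" | "p + length (lower g) \<le> j" | "p \<le> j" "j < p + length (lower g)" by linarith
  then show ?thesis
  proof cases
    case 1
    then have "((i, j), (Suc i, j), lev i ! j = Up, []) \<in> set (arcs D i)" by (auto simp: arcs_def pg)
    then show ?thesis using assms(3) by force
  next
    case 2
    then obtain k where k: "j = p + length (lower g) + k" using le_Suc_ex by blast
    then have "((i, j), (Suc i, p + length (upper g) + k), lev i ! j = Up, []) \<in> set (arcs D i)"
      using assms(2) by (auto simp: arcs_def pg)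
    then show ?thesis using assms(3) by force
  next
    case 3
    have sub: "set (piece_arcs i p g) \<subseteq> set (arcs D i)"
      unfolding arcs_def pg prod.case set_append by blast
    have "\<exists>a\<in>set (piece_arcs i p g). fst (directed a) = (i, j)"
    proof (cases g)
      case (Maximum h)
      then show ?thesis using 3 assms(3) f(2)[of "j - p"] by (cases h) (auto simp: less_Suc_eq nth_Cons split: nat.splits)
    next
      case (Crossing l s n)
      then show ?thesis using 3 assms(3) f(2)[of "j - p"] by (auto simp: less_Suc_eq nth_Cons split: nat.splits)
    qed (use 3 in simp)
    then show ?thesis using sub by blast
  qed
qed

lemma arc_from_Down:
  assumes "i < len" "j < length (lev (Suc i))" "lev (Suc i) ! j = Down"
  shows "\<exists>a\<in>set (arcs D i). fst (directed a) = (Suc i, j)"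
proof -
  obtain p g where pg: "snd D ! i = (p, g)" by fastforce
  note f = fitD[OF assms(1) pg] and n = lev_Suc_nth[OF assms(1) pg]
  consider "j < p" | "p + length (upper g) \<le> j" | "p \<le> j" "j < p + length (upper g)" by linarith
  then show ?thesis
  proof cases
    case 1
    then have "((i, j), (Suc i, j), lev i ! j = Up, []) \<in> set (arcs D i)" by (auto simp: arcs_def pg)
    then show ?thesis using assms(3) n(1)[OF 1] by force
  next
    case 2
    then obtain k where k: "j = p + length (upper g) + k" using le_Suc_ex by blast
    then have k': "k < length (lev i) - (p + length (lower g))" using assms(2) f(1,4) by linarith
    then have "((i, p + length (lower g) + k), (Suc i, j), lev i ! (p + length (lower g) + k) = Up, []) \<in> set (arcs D i)"
      by (auto simp: arcs_def pg k)
    then show ?thesis using assms(3) n(3)[OF k'] k by force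
  next
    case 3
    have sub: "set (piece_arcs i p g) \<subseteq> set (arcs D i)"
      unfolding arcs_def pg prod.case set_append by blast
    have "\<exists>a\<in>set (piece_arcs i p g). fst (directed a) = (Suc i, j)"
    proof (cases g)
      case (Minimum h)
      then show ?thesis using 3 assms(3) n(2)[of "j - p"] by (cases h) (auto simp: less_Suc_eq nth_Cons split: nat.splits)
    next
      case (Crossing l s n')
      then show ?thesis using 3 assms(3) n(2)[of "j - p"] by (auto simp: less_Suc_eq nth_Cons split: nat.splits)
    qed (use 3 in simp)
    then show ?thesis using sub by blast
  qed
qed

lemma distinct_arcs:
  assumes "i < len" shows "distinct (map (\<lambda>a. fst (directed a)) (arcs D i))"
proof -
  obtain p g where pg: "snd D ! i = (p, g)" by fastforce
  note f = fitD[OF assms pg]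
  let ?A = "map (\<lambda>j. ((i, j), (Suc i, j), lev i ! j = Up, [])) [0..<p] :: arc list"
  let ?B = "map (\<lambda>k. ((i, p + length (lower g) + k), (Suc i, p + length (upper g) + k),
    lev i ! (p + length (lower g) + k) = Up, [])) [0..<length (lev i) - (p + length (lower g))] :: arc list"
  let ?C = "piece_arcs i p g"
  have A: "distinct (map (\<lambda>a. fst (directed a)) ?A)" "distinct (map (\<lambda>a. fst (directed a)) ?B)"
    by (auto simp: distinct_map inj_on_def split: if_splits)
  have C: "distinct (map (\<lambda>a. fst (directed a)) ?C)"
    by (cases "(i, p, g)" rule: piece_arcs.cases) auto
  have A': "snd (fst (directed a)) < p" if "a \<in> set ?A" for a using that by auto
  have B': "fst (fst (directed a)) = i \<and> snd (fst (directed a)) \<ge> p + length (lower g) \<or>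
     fst (fst (directed a)) = Suc i \<and> snd (fst (directed a)) \<ge> p + length (upper g)" if "a \<in> set ?B" for a
    using that by (auto split: if_splits)
  have C': "fst (fst (directed a)) = i \<and> snd (fst (directed a)) \<ge> p \<and> snd (fst (directed a)) < p + length (lower g) \<or>
     fst (fst (directed a)) = Suc i \<and> snd (fst (directed a)) \<ge> p \<and> snd (fst (directed a)) < p + length (upper g)" if "a \<in> set ?C" for a
    using that by (cases "(i, p, g)" rule: piece_arcs.cases; cases g rule: lower.cases; cases g rule: upper.cases) (auto split: if_splits)
  have eq: "arcs D i = ?A @ ?B @ ?C" by (simp add: arcs_def pg)
  have AB: False if "a \<in> set ?A" "b \<in> set ?B" "fst (directed a) = fst (directed b)" for a b
    using A'[OF that(1)] B'[OF that(2)] unfolding that(3) by auto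
  have AC: False if "a \<in> set ?A" "b \<in> set ?C" "fst (directed a) = fst (directed b)" for a b
    using A'[OF that(1)] C'[OF that(2)] unfolding that(3) by auto
  have BC: False if "a \<in> set ?B" "b \<in> set ?C" "fst (directed a) = fst (directed b)" for a b
    using B'[OF that(1)] C'[OF that(2)] unfolding that(3) by auto
  have disj: "f ` X \<inter> f ` Y = {}" if "\<And>a b. a \<in> X \<Longrightarrow> b \<in> Y \<Longrightarrow> f a = f b \<Longrightarrow> False"
    for f :: "arc \<Rightarrow> point" and X Y
    using that by blast
  have "(\<lambda>a. fst (directed a)) ` set ?A \<inter> (\<lambda>a. fst (directed a)) ` set ?B = {}"
    "(\<lambda>a. fst (directed a)) ` set ?A \<inter> (\<lambda>a. fst (directed a)) ` set ?C = {}"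
    "(\<lambda>a. fst (directed a)) ` set ?B \<inter> (\<lambda>a. fst (directed a)) ` set ?C = {}"
    by (rule disj, (rule AB AC BC; assumption))+
  with A C show ?thesis
    unfolding eq map_append distinct_append set_map[of "\<lambda>a. fst (directed a)"] set_append image_Un by blast
qed

lemma finite_points: "finite (points D)"
proof -
  have "points D \<subseteq> (\<Union>i\<le>len. {i} \<times> {..<length (lev i)})" by (auto simp: points_def)
  then show ?thesis by (rule finite_subset) simp
qed

end

locale closed_diagram =
  fixes K :: "layer list"
  assumes fit_K: "layers_fit ([], K)" and closed: "level ([], K) (length K) = []"
begin

abbreviation "D \<equiv> ([], K)"

sublocale fitting_diagram "([], K)" by unfold_locales (rule fit_K)

abbreviation "pts \<equiv> points D"
abbreviation "next \<equiv> next_point D"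
abbreviation "ev \<equiv> events_at D"

text \<open>A strand going up leaves through the layer above its point, one going down through the
  layer below. That layer exists because the lowest and the highest level of a closed diagram are
  empty.\<close>

lemma point_arc:
  assumes "x \<in> pts" shows "\<exists>i<length K. \<exists>a\<in>set (arcs D i). fst (directed a) = x"
proof -
  obtain i j where x: "x = (i, j)" by (cases x)
  have ij: "i \<le> length K" "j < length (lev i)" using assms by (auto simp: x points_def)
  show ?thesis
  proof (cases "lev i ! j")
    case Up
    have "i < length K" using ij closed by (cases "i = length K") auto
    then have "\<exists>a\<in>set (arcs D i). fst (directed a) = x" using arc_from[of i j] ij Up x by simp
    with \<open>i < length K\<close> show ?thesis by blast
  next
    case Down
    have "i \<noteq> 0" using ij by (cases i) auto
    then obtain m where m: "i = Suc m" by (cases i) auto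
    then have "\<exists>a\<in>set (arcs D m). fst (directed a) = x"
      using arc_from_Down[of m j] ij Down x by simp
    moreover have "m < length K" using ij m by simp
    ultimately show ?thesis by blast
  qed
qed

lemma directed_arc':
  assumes "i < length K" "a \<in> set (arcs D i)"
  shows "directed a = (fst (directed a), next (fst (directed a)), ev (fst (directed a)))"
  using directed_arc(3,4)[of i a "fst (directed a)" "fst (snd (directed a))" "snd (snd (directed a))"] assms
  by simp

lemma point_arcE:
  assumes "x \<in> pts"
  obtains i a where "i < length K" "a \<in> set (arcs D i)" "directed a = (x, next x, ev x)"
  using point_arc[OF assms] directed_arc' by metis

lemma next_in: "x \<in> pts \<Longrightarrow> next x \<in> pts"
  by (rule point_arcE) (auto dest!: directed_arc(2)[rotated])

lemma length_ev: "x \<in> pts \<Longrightarrow> length (ev x) \<le> 1"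
  by (rule point_arcE) (auto dest!: directed_arc(6)[rotated])

lemma up_next: "x \<in> pts \<Longrightarrow> total_d (ev x) - total_u (ev x) = up D x - up D (next x)"
  by (rule point_arcE) (auto dest!: directed_arc(7)[rotated])

lemma line_ev:
  assumes "x \<in> pts" "Line i l \<in> set (ev x)"
  shows "i < length K" "is_crossing (snd (K ! i))" "up D x = upness (line_dir (snd (K ! i)) l)"
    "up D (next x) = up D x"
    "x = (if up D x = 1 then i else Suc i, fst (K ! i) + (if (l = SWNE) = (up D x = 1) then 0 else 1))"
proof -
  obtain m a where a: "m < length K" "a \<in> set (arcs D m)" "directed a = (x, next x, ev x)"
    using point_arcE[OF assms(1)] .
  note d = directed_arc[OF _ a(2,3)]
  have c: "m = i \<and> is_crossing (snd (K ! m)) \<and> up D x = upness (line_dir (snd (K ! m)) l) \<and>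
      up D (next x) = up D x \<and> snd x = fst (K ! m) + (if (l = SWNE) = (up D x = 1) then 0 else 1)"
    using d(8)[OF _ assms(2)] a(1) by simp
  have f: "fst x = (if up D x = 1 then m else Suc m)" using d(5) a(1) by simp
  have "x = (if up D x = 1 then m else Suc m, fst (K ! m) + (if (l = SWNE) = (up D x = 1) then 0 else 1))"
    using f c by (intro prod_eqI) auto
  with c a(1) show "i < length K" "is_crossing (snd (K ! i))" "up D x = upness (line_dir (snd (K ! i)) l)"
    "up D (next x) = up D x"
    "x = (if up D x = 1 then i else Suc i, fst (K ! i) + (if (l = SWNE) = (up D x = 1) then 0 else 1))"
    by blast+
qed

lemma line_ev_unique: "x \<in> pts \<Longrightarrow> y \<in> pts \<Longrightarrow> Line i l \<in> set (ev x) \<Longrightarrow> Line i l \<in> set (ev y) \<Longrightarrow> x = y"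
  using line_ev(3,5) by metis

text \<open>The layer through which the strand leaves the point.\<close>

definition layer_of :: "point \<Rightarrow> nat" where
  "layer_of x = (if up D x = 1 then fst x else fst x - 1)"

lemma arcs_points:
  "(\<Union>i<length K. (\<lambda>a. fst (directed a)) ` set (arcs D i)) = pts"
proof (intro equalityI subsetI)
  fix x assume "x \<in> (\<Union>i<length K. (\<lambda>a. fst (directed a)) ` set (arcs D i))"
  then obtain i a where "i < length K" "a \<in> set (arcs D i)" "x = fst (directed a)" by blast
  then show "x \<in> pts" using directed_arc(1)[OF _ _ directed_arc'] by simp
next
  fix x assume "x \<in> pts"
  from point_arc[OF this] show "x \<in> (\<Union>i<length K. (\<lambda>a. fst (directed a)) ` set (arcs D i))" by blast
qed

lemma layer_of_arc: "i < length K \<Longrightarrow> a \<in> set (arcs D i) \<Longrightarrow> layer_of (fst (directed a)) = i"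
  using directed_arc(5)[OF _ _ directed_arc', of i a] by (simp add: layer_of_def split: if_splits)

lemma layers_disjoint:
  assumes "i < length K" "j < length K" "i \<noteq> j"
  shows "(\<lambda>a. fst (directed a)) ` set (arcs D i) \<inter> (\<lambda>a. fst (directed a)) ` set (arcs D j) = {}"
proof -
  have "layer_of x = m" if "m < length K" "x \<in> (\<lambda>a. fst (directed a)) ` set (arcs D m)" for x m
    using that(2) layer_of_arc[OF that(1)] by (elim imageE) simp
  then show ?thesis using assms by blast
qed

text \<open>Every point is the source of exactly one arc of exactly one layer. This is the bridge
  from products along the strand to products over layers.\<close>

lemma regroup:
  "(\<Prod>x\<in>pts. F (x, next x, ev x)) = (\<Prod>i<length K. prod_list (map (\<lambda>a. F (directed a)) (arcs D i)))"
  for F :: "_ \<Rightarrow> 'm::comm_monoid_mult"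
proof -
  let ?S = "\<lambda>i. (\<lambda>a. fst (directed a)) ` set (arcs D i)"
  have "(\<Prod>x\<in>pts. F (x, next x, ev x)) = (\<Prod>i<length K. \<Prod>x\<in>?S i. F (x, next x, ev x))"
    unfolding arcs_points[symmetric]
    using layers_disjoint by (intro prod.UNION_disjoint) (simp_all del: split_paired_All)
  also have "\<dots> = (\<Prod>i<length K. prod_list (map (\<lambda>a. F (directed a)) (arcs D i)))"
  proof (rule prod.cong[OF HOL.refl])
    fix i assume "i \<in> {..<length K}"
    then have i: "i < length K" by simp
    have "(\<Prod>x\<in>?S i. F (x, next x, ev x)) =
      prod_list (map (\<lambda>x. F (x, next x, ev x)) (map (\<lambda>a. fst (directed a)) (arcs D i)))"
      using prod.distinct_set_conv_list[OF distinct_arcs, of i "\<lambda>x. F (x, next x, ev x)"] i by simp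
    also have "\<dots> = prod_list (map (\<lambda>a. F (directed a)) (arcs D i))"
      using directed_arc'[OF i] by (intro arg_cong[of _ _ prod_list]) auto
    finally show "(\<Prod>x\<in>?S i. F (x, next x, ev x)) = prod_list (map (\<lambda>a. F (directed a)) (arcs D i))" .
  qed
  finally show ?thesis .
qed

lemma regroup_sum:
  "(\<Sum>x\<in>pts. F (x, next x, ev x)) = (\<Sum>i<length K. sum_list (map (\<lambda>a. F (directed a)) (arcs D i)))"
  for F :: "_ \<Rightarrow> int"
proof -
  let ?S = "\<lambda>i. (\<lambda>a. fst (directed a)) ` set (arcs D i)"
  have "(\<Sum>x\<in>pts. F (x, next x, ev x)) = (\<Sum>i<length K. \<Sum>x\<in>?S i. F (x, next x, ev x))"
    unfolding arcs_points[symmetric]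
    using layers_disjoint by (intro sum.UNION_disjoint) (simp_all del: split_paired_All)
  also have "\<dots> = (\<Sum>i<length K. sum_list (map (\<lambda>a. F (directed a)) (arcs D i)))"
  proof (rule sum.cong[OF HOL.refl])
    fix i assume "i \<in> {..<length K}"
    then have i: "i < length K" by simp
    have "(\<Sum>x\<in>?S i. F (x, next x, ev x)) =
      sum_list (map (\<lambda>x. F (x, next x, ev x)) (map (\<lambda>a. fst (directed a)) (arcs D i)))"
      using sum.distinct_set_conv_list[OF distinct_arcs, of i "\<lambda>x. F (x, next x, ev x)"] i by simp
    also have "\<dots> = sum_list (map (\<lambda>a. F (directed a)) (arcs D i))"
      using directed_arc'[OF i] by (intro arg_cong[of _ _ sum_list]) auto
    finally show "(\<Sum>x\<in>?S i. F (x, next x, ev x)) = sum_list (map (\<lambda>a. F (directed a)) (arcs D i))" .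
  qed
  finally show ?thesis .
qed

lemma clockwise_sum:
  "(\<Sum>(p, g)\<leftarrow>K. clockwise g) = - (\<Sum>x\<in>pts. total_d (ev x) + total_u (ev x))"
proof -
  let ?F = "\<lambda>t :: point \<times> point \<times> event list. - (total_d (snd (snd t)) + total_u (snd (snd t)))"
  have "sum_list (map (\<lambda>a. ?F (directed a)) (arcs D i)) = clockwise (snd (K ! i))" for i
  proof -
    obtain p g where pg: "K ! i = (p, g)" by fastforce
    have z: "snd (snd (directed (x, y, q, e))) = e" for x y q e by simp
    have z': "total_d [] = 0" "total_u [] = 0" by (simp_all add: total_d_def total_u_def)
    have "sum_list (map (\<lambda>a. ?F (directed a)) (piece_arcs i p g)) = clockwise g"
      by (cases "(i, p, g)" rule: piece_arcs.cases; cases g rule: clockwise.cases)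
        (auto simp: total_d_def total_u_def)
    then show ?thesis by (simp add: arcs_def pg comp_def z z' del: directed.simps)
  qed
  then have "(\<Sum>x\<in>pts. ?F (x, next x, ev x)) = (\<Sum>i<length K. clockwise (snd (K ! i)))"
    by (subst regroup_sum[of ?F]) simp
  also have "\<dots> = (\<Sum>(p, g)\<leftarrow>K. clockwise g)"
    by (simp add: sum_list_sum_nth case_prod_unfold atLeast0LessThan)
  finally show ?thesis unfolding fst_conv snd_conv sum_negf by simp
qed

end

section \<open>Closed diagrams with the opposite orientation\<close>

lemma reverse_snd: "length (reverse_orientation K) = length K"
  "i < length K \<Longrightarrow> reverse_orientation K ! i = (fst (K ! i), reverse_piece (snd (K ! i)))"
  by (simp_all add: reverse_orientation_def case_prod_unfold)

lemma level_reverse: "i \<le> length K \<Longrightarrow> level ([], reverse_orientation K) i = map flip (level ([], K) i)"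
proof (induction i)
  case (Suc i)
  obtain p g where "K ! i = (p, g)" by fastforce
  with Suc show ?case
    by (simp add: level_Suc reverse_snd apply_layer_def take_map drop_map)
qed simp

lemma points_reverse: "points ([], reverse_orientation K) = points ([], K)"
  by (auto simp: points_def reverse_snd level_reverse)

context closed_diagram
begin

lemma closed_reverse: "closed_diagram (reverse_orientation K)"
proof
  show "layers_fit ([], reverse_orientation K)"
    unfolding layers_fit_def
  proof (intro allI impI)
    fix i assume "i < length (snd ([] :: dir list, reverse_orientation K))"
    then have i: "i < length K" by (simp add: reverse_snd)
    obtain p g where pg: "K ! i = (p, g)" by fastforce
    have "p \<le> length (lev i)" "take (length (lower g)) (drop p (lev i)) = lower g"
      using fit_K i pg by (auto simp: layers_fit_def)
    then show "case snd ([] :: dir list, reverse_orientation K) ! i of (p, g) \<Rightarrow>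
        p \<le> length (level ([], reverse_orientation K) i) \<and>
        take (length (lower g)) (drop p (level ([], reverse_orientation K) i)) = lower g"
      using i by (simp add: reverse_snd level_reverse pg take_map drop_map)
  qed
  show "level ([], reverse_orientation K) (length (reverse_orientation K)) = []"
    using closed by (simp add: level_reverse reverse_snd)
qed

lemma arcs_reverse:
  assumes "i < length K"
  shows "arcs ([], reverse_orientation K) i = map (\<lambda>(x, y, f, e). (x, y, \<not> f, map reverse_event e)) (arcs D i)"
proof -
  obtain p g where pg: "K ! i = (p, g)" by fastforce
  have "piece_arcs i p (reverse_piece g) = map (\<lambda>(x, y, f, e). (x, y, \<not> f, map reverse_event e)) (piece_arcs i p g)"
    by (cases g) auto
  moreover have "p + length (lower g) \<le> length (lev i)" using fitD(1)[of i p g] assms pg by simp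
  ultimately show ?thesis
    using assms by (auto simp: arcs_def pg reverse_snd level_reverse)
qed

lemma next_reverse:
  assumes "x \<in> pts"
  shows "next_point ([], reverse_orientation K) (next x) = x"
    "events_at ([], reverse_orientation K) (next x) = map reverse_event (ev x)"
proof -
  interpret R: closed_diagram "reverse_orientation K" by (rule closed_reverse)
  obtain i a where a: "i < length K" "a \<in> set (arcs D i)" "directed a = (x, next x, ev x)"
    by (rule point_arcE[OF assms])
  let ?a = "(\<lambda>(x, y, f, e). (x, y, \<not> f, map reverse_event e)) a"
  have "?a \<in> set (arcs ([], reverse_orientation K) i)" using a by (simp add: arcs_reverse)
  moreover have "directed ?a = (next x, x, map reverse_event (ev x))"
    using a(3) by (cases a) (auto split: if_splits)
  ultimately show "next_point ([], reverse_orientation K) (next x) = x"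
    "events_at ([], reverse_orientation K) (next x) = map reverse_event (ev x)"
    using R.directed_arc(3,4) a(1) by (simp_all add: reverse_snd)
qed

text \<open>The successor map of the reversed diagram is a left inverse.\<close>

lemma inj_next: "inj_on next pts"
  using next_reverse(1) by (metis inj_onI)

lemma traversal_eq:
  "traversal D P = concat (map (\<lambda>m. ev ((next ^^ m) P)) [0..<card pts])"
  by (simp add: traversal_def)

lemma length_le_1_cases: "length xs \<le> 1 \<Longrightarrow> xs = [] \<or> (\<exists>x. xs = [x])"
  by (cases xs) auto

end

section \<open>The cyclic traversal of a knot diagram\<close>

locale traversed_diagram = closed_diagram +
  fixes P :: point
  assumes single: "single_strand ([], K) P"
begin

abbreviation "N \<equiv> card pts"
definition "pt m = (next ^^ m) P"

lemma pt_0 [simp]: "pt 0 = P" and pt_Suc: "pt (Suc m) = next (pt m)"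
  by (simp_all add: pt_def)

lemma pt_image: "pt ` {..<N} = pts"
  using single by (simp add: single_strand_def pt_def[abs_def])

lemma P_in: "P \<in> pts" using single by (simp add: single_strand_def)

lemma N_pos: "0 < N" using P_in finite_points card_gt_0_iff by blast

lemma pt_in: "pt m \<in> pts"
  by (induction m) (simp_all add: P_in pt_Suc next_in)

lemma pt_inj: "inj_on pt {..<N}"
  by (rule eq_card_imp_inj_on) (simp_all add: pt_image)

text \<open>\<open>pt N\<close> is one of the \<open>N\<close> points met before. If it were
  \<open>pt (Suc k)\<close>, injectivity of the successor map would identify \<open>pt k\<close>
  with \<open>pt (N - 1)\<close>, two different points.\<close>

lemma pt_N: "pt N = P"
proof -
  obtain m where m: "m < N" "pt m = pt N" using pt_in[of N] pt_image by (metis imageE lessThan_iff)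
  show ?thesis
  proof (cases m)
    case 0
    then show ?thesis using m by simp
  next
    case (Suc k)
    obtain M where M: "N = Suc M" using N_pos by (cases N) auto
    have "pt k = pt M"
      using m(2) inj_next pt_in unfolding Suc M pt_Suc by (auto dest: inj_onD)
    moreover have "k < N" "M < N" "k \<noteq> M" using m(1) Suc M by auto
    ultimately show ?thesis using pt_inj by (auto dest: inj_onD)
  qed
qed

lemma pt_add_N: "pt (m + N) = pt m"
  by (induction m) (simp_all add: pt_N pt_Suc)

definition "seg m n = concat (map (\<lambda>k. ev (pt k)) [m..<n])"

lemma seg_step: "m < n \<Longrightarrow> seg m n = ev (pt m) @ seg (Suc m) n"
  by (simp add: seg_def upt_conv_Cons)

lemma seg_split: "m \<le> k \<Longrightarrow> k \<le> n \<Longrightarrow> seg m n = seg m k @ seg k n"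
  unfolding seg_def using upt_add_eq_append[of m k "n - k"] by simp

lemma traversal_seg: "traversal D P = seg 0 N"
  by (simp add: traversal_eq seg_def pt_def)

lemma traversed_from:
  assumes "Q \<in> pts" shows "traversed_diagram K Q"
proof
  obtain m where m: "m < N" "Q = pt m" using assms pt_image by (metis imageE lessThan_iff)
  have e: "(next ^^ k) Q = pt (k + m)" for k by (simp add: m pt_def funpow_add)
  have "pts \<subseteq> (\<lambda>k. (next ^^ k) Q) ` {..<N}"
  proof
    fix x assume "x \<in> pts"
    then obtain j where j: "j < N" "x = pt j" using pt_image by (metis imageE lessThan_iff)
    show "x \<in> (\<lambda>k. (next ^^ k) Q) ` {..<N}"
    proof (cases "m \<le> j")
      case True
      then have "j - m + m = j" by simp
      then have "x = (next ^^ (j - m)) Q" by (simp only: e j(2))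
      moreover have "j - m < N" using j(1) by simp
      ultimately show ?thesis by blast
    next
      case False
      have "j + N - m + m = j + N" using m(1) by simp
      then have "x = (next ^^ (j + N - m)) Q" by (simp only: e pt_add_N j(2))
      moreover have "j + N - m < N" using False j(1) by simp
      ultimately show ?thesis by blast
    qed
  qed
  moreover have "(\<lambda>k. (next ^^ k) Q) ` {..<N} \<subseteq> pts" using pt_in by (auto simp: e simp del: split_paired_All)
  ultimately show "single_strand ([], K) Q" using assms by (simp add: single_strand_def)
qed

lemma traversal_rotate:
  assumes "Q \<in> pts"
  shows "\<exists>E F. traversal D P = E @ F \<and> traversal D Q = F @ E"
proof -
  obtain m where m: "m < N" "Q = pt m" using assms pt_image by (metis imageE lessThan_iff)
  have e: "(next ^^ k) Q = pt (k + m)" for k by (simp add: m pt_def funpow_add)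
  have "traversal D Q = concat (map (\<lambda>k. ev (pt (k + m))) [0..<N])"
    by (simp add: traversal_eq e)
  also have "\<dots> = concat (map (\<lambda>k. ev (pt k)) (map (\<lambda>k. k + m) [0..<N]))"
    by (simp add: comp_def)
  also have "\<dots> = seg m (N + m)" by (simp add: seg_def map_add_upt)
  also have "\<dots> = seg m N @ seg N (N + m)" using m by (intro seg_split) auto
  also have "seg N (N + m) = concat (map (\<lambda>k. ev (pt k)) (map (\<lambda>k. k + N) [0..<m]))"
    by (simp add: seg_def map_add_upt add.commute)
  also have "\<dots> = seg 0 m" by (simp add: seg_def comp_def pt_add_N)
  finally show ?thesis using traversal_seg seg_split[of 0 m N] m by auto
qed

lemma mem_event_lines: "x \<in> set (event_lines E) \<longleftrightarrow> Line (fst x) (snd x) \<in> set E"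
  by (induction E rule: labelled_lines.induct) auto

text \<open>A crossing line determines the point from which it is entered, and no point is visited
  twice in \<open>N\<close> steps.\<close>

lemma distinct_seg: "n \<le> N \<Longrightarrow> distinct (event_lines (seg m n))"
proof (induction "n - m" arbitrary: m)
  case 0
  then show ?case by (simp add: seg_def)
next
  case (Suc d)
  then have mn: "m < n" by simp
  have "distinct (event_lines (ev (pt m)))"
  proof (cases "ev (pt m)")
    case (Cons e es)
    then have "ev (pt m) = [e]" using length_ev[OF pt_in[of m]] by simp
    then show ?thesis by (cases e) simp_all
  qed simp
  moreover have "set (event_lines (ev (pt m))) \<inter> set (event_lines (seg (Suc m) n)) = {}"
  proof (rule ccontr)
    assume "\<not> ?thesis"
    then obtain x where x: "x \<in> set (event_lines (ev (pt m)))" "x \<in> set (event_lines (seg (Suc m) n))" by blast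
    then obtain k where k: "Suc m \<le> k" "k < n" "Line (fst x) (snd x) \<in> set (ev (pt k))"
      by (auto simp: mem_event_lines seg_def)
    have "pt m = pt k" using line_ev_unique[OF pt_in pt_in _ k(3), of m] x(1) by (simp add: mem_event_lines)
    then have "m = k" using pt_inj k mn Suc.prems by (auto dest!: inj_onD)
    then show False using k by simp
  qed
  moreover have "distinct (event_lines (seg (Suc m) n))" using Suc by simp
  ultimately show ?case by (simp add: seg_step[OF mn])
qed

lemma distinct_lines: "distinct (event_lines (traversal D P))"
  by (simp add: traversal_seg distinct_seg)

lemma set_traversal: "set (traversal D P) = (\<Union>x\<in>pts. set (ev x))"
proof -
  have "set (seg 0 N) = (\<Union>x\<in>pt ` {..<N}. set (ev x))"
    by (simp add: seg_def atLeast0LessThan)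
  then show ?thesis by (simp only: traversal_seg pt_image)
qed

lemma crossing_line_source:
  assumes "i < length K" "is_crossing (snd (K ! i))"
  shows "\<exists>x\<in>pts. ev x = [Line i l]"
proof -
  obtain p k s n where g: "K ! i = (p, Crossing k s n)"
    using assms(2) by (cases "K ! i") (auto simp: is_crossing_def)
  have "\<exists>a\<in>set (arcs D i). \<exists>x y. directed a = (x, y, [Line i l])"
    by (cases l) (auto simp: arcs_def g)
  then obtain a x y where a: "a \<in> set (arcs D i)" "directed a = (x, y, [Line i l])" by blast
  then show ?thesis using directed_arc(1,4)[OF _ a] assms(1) by auto
qed

lemma set_lines: "set (event_lines (traversal D P)) = crossing_lines (map snd K)"
proof (intro equalityI subsetI)
  fix x assume "x \<in> set (event_lines (traversal D P))"
  then obtain y where "y \<in> pts" "Line (fst x) (snd x) \<in> set (ev y)"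
    by (auto simp: mem_event_lines set_traversal)
  then show "x \<in> crossing_lines (map snd K)"
    using line_ev(1,2) by (cases x) (auto simp: crossing_lines_def)
next
  fix x assume "x \<in> crossing_lines (map snd K)"
  then have "fst x < length K" "is_crossing (snd (K ! fst x))"
    by (auto simp: crossing_lines_def)
  from crossing_line_source[OF this, of "snd x"] obtain y where "y \<in> pts" "ev y = [Line (fst x) (snd x)]" by blast
  then show "x \<in> set (event_lines (traversal D P))"
    by (auto simp: mem_event_lines set_traversal intro!: bexI[of _ y])
qed

lemma total_append [simp]: "total_u (E @ F) = total_u E + total_u F"
  by (simp add: total_u_def)

text \<open>Induction backwards from the end of the traversal. The changes of direction telescope,
  so the difference of the exponents is the upness at the current point minus that at
  \<open>P\<close>; at a crossing line the upness is that of the line itself.\<close>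

lemma seg_parity:
  "m \<le> N \<Longrightarrow> total_d (seg m N) - total_u (seg m N) = up D (pt m) - up D P \<and>
    (\<forall>i l. (i, l) \<in> set (event_lines (seg m N)) \<longrightarrow>
      rest_d (seg m N) (i, l) = rest_u (seg m N) (i, l) + upness (line_dir (snd (K ! i)) l) - up D P)"
proof (induction "N - m" arbitrary: m)
  case 0
  then have "m = N" by simp
  then show ?case by (simp add: seg_def pt_N total_d_def total_u_def)
next
  case (Suc d)
  then have mN: "m < N" by simp
  have IH: "total_d (seg (Suc m) N) - total_u (seg (Suc m) N) = up D (pt (Suc m)) - up D P"
    "\<And>i l. (i, l) \<in> set (event_lines (seg (Suc m) N)) \<Longrightarrow>
      rest_d (seg (Suc m) N) (i, l) = rest_u (seg (Suc m) N) (i, l) + upness (line_dir (snd (K ! i)) l) - up D P"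
    using Suc by auto
  have u: "total_d (ev (pt m)) - total_u (ev (pt m)) = up D (pt m) - up D (pt (Suc m))"
    using up_next[OF pt_in] by (simp add: pt_Suc)
  show ?case
  proof (cases "\<exists>i l. ev (pt m) = [Line i l]")
    case True
    then obtain i l where il: "ev (pt m) = [Line i l]" by blast
    note le = line_ev(3,4)[OF pt_in, of i l m]
    show ?thesis
      using IH u le unfolding seg_step[OF mN] il
      by (auto simp: pt_Suc total_d_def total_u_def)
  next
    case False
    then consider "ev (pt m) = []" | g where "ev (pt m) = [Extremum g]"
      using length_le_1_cases[OF length_ev[OF pt_in]] by (metis event.exhaust)
    then show ?thesis
      by cases (use IH u in \<open>auto simp: seg_step[OF mN] total_d_def total_u_def\<close>)
  qed
qed

lemma parity:
  assumes "(i, l) \<in> set (event_lines (traversal D P))"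
  shows "rest_d (traversal D P) (i, l) = rest_u (traversal D P) (i, l) + upness (line_dir (snd (K ! i)) l) - up D P"
  using seg_parity[of 0] assms by (simp add: traversal_seg)

lemma total_d_u: "total_d (traversal D P) = total_u (traversal D P)"
  using seg_parity[of 0] by (simp add: traversal_seg)

text \<open>For a closed traversal the totals of u_d and u_u agree, so the signed count of extrema
  is -2 u_u and the division by 2 is exact.\<close>

lemma whitney: "whitney_degree K = - total_u (traversal D P)"
proof -
  have *: "total_d (concat (map f xs)) + total_u (concat (map f xs)) = (\<Sum>m\<leftarrow>xs. total_d (f m) + total_u (f m))"
    for f and xs :: "nat list"
    by (induction xs) (simp_all add: total_d_def total_u_def)
  have "total_d (traversal D P) + total_u (traversal D P) = (\<Sum>m\<leftarrow>[0..<N]. total_d (ev (pt m)) + total_u (ev (pt m)))"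
    unfolding traversal_seg seg_def by (rule *)
  also have "\<dots> = (\<Sum>m<N. total_d (ev (pt m)) + total_u (ev (pt m)))"
    by (simp add: interv_sum_list_conv_sum_set_nat atLeast0LessThan)
  also have "\<dots> = (\<Sum>x\<in>pts. total_d (ev x) + total_u (ev x))"
    using sum.reindex[OF pt_inj, of "\<lambda>x. total_d (ev x) + total_u (ev x)"]
    by (simp add: pt_image)
  finally show ?thesis
    by (simp add: whitney_degree_def clockwise_sum total_d_u)
qed

lemma traversed_reverse: "traversed_diagram (reverse_orientation K) P"
  and traversal_reverse: "traversal ([], reverse_orientation K) P = rev (map reverse_event (traversal D P))"
proof -
  interpret R: closed_diagram "reverse_orientation K" by (rule closed_reverse)
  let ?next = "next_point ([], reverse_orientation K)"
  let ?ev = "events_at ([], reverse_orientation K)"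
  have step: "?next (pt (Suc m)) = pt m" "?ev (pt (Suc m)) = map reverse_event (ev (pt m))" for m
    using next_reverse[OF pt_in] by (simp_all add: pt_Suc)
  have it: "m \<le> N \<Longrightarrow> (?next ^^ m) P = pt (N - m)" for m
  proof (induction m)
    case (Suc m)
    then have "N - m = Suc (N - Suc m)" by simp
    then show ?case using Suc step(1) by simp
  qed (simp add: pt_N)
  have img: "(\<lambda>m. (?next ^^ m) P) ` {..<N} = pts"
  proof -
    have "(\<lambda>m. (?next ^^ m) P) ` {..<N} = pt ` (\<lambda>m. N - m) ` {..<N}"
      unfolding image_image by (rule image_cong) (simp_all add: it)
    also have "(\<lambda>m. N - m) ` {..<N} = {0<..N}"
    proof (intro equalityI subsetI)
      fix x assume "x \<in> {0<..N}"
      then show "x \<in> (\<lambda>m. N - m) ` {..<N}" by (intro image_eqI[of _ _ "N - x"]) auto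
    qed auto
    also have "pt ` {0<..N} = pt ` {..<N}"
    proof -
      have "{0<..N} = insert N ({..<N} - {0})" "{..<N} = insert 0 ({..<N} - {0})" using N_pos by auto
      then show ?thesis using pt_N pt_0 by (metis image_insert)
    qed
    finally show ?thesis using pt_image by simp
  qed
  show "traversed_diagram (reverse_orientation K) P"
    by unfold_locales (use P_in img in \<open>simp add: single_strand_def points_reverse\<close>)
  have r1: "rev (ev x) = ev x" if "x \<in> pts" for x
    using length_le_1_cases[OF length_ev[OF that]] by auto
  have "traversal ([], reverse_orientation K) P = concat (map (\<lambda>m. ?ev ((?next ^^ m) P)) [0..<N])"
    by (simp add: R.traversal_eq points_reverse)
  also have "\<dots> = concat (map (\<lambda>m. map reverse_event (ev (pt m))) (rev [0..<N]))"
  proof (rule arg_cong[of _ _ concat], rule nth_equalityI)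
    fix i assume "i < length (map (\<lambda>m. ?ev ((?next ^^ m) P)) [0..<N])"
    then have i: "i < N" by simp
    then have "N - i = Suc (N - Suc i)" by simp
    then show "map (\<lambda>m. ?ev ((?next ^^ m) P)) [0..<N] ! i = map (\<lambda>m. map reverse_event (ev (pt m))) (rev [0..<N]) ! i"
      using i it[of i] step(2) by (simp add: rev_nth)
  qed simp
  also have "\<dots> = rev (map reverse_event (traversal D P))"
    unfolding traversal_seg seg_def
    by (simp add: rev_concat rev_map map_concat comp_def r1 pt_in)
  finally show "traversal ([], reverse_orientation K) P = rev (map reverse_event (traversal D P))" .
qed

end

lemma event_lines_rev: "event_lines (rev (map reverse_event E)) = rev (event_lines E)"
  by (induction E rule: labelled_lines.induct) simp_all

lemma rest_u_append:
  "rest_u (E @ F) x = (if x \<in> set (event_lines E) then rest_u E x + total_u F else rest_u F x)"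
  by (induction E rule: labelled_lines.induct) (auto simp: total_u_def)

lemma weight_u_reverse: "weight_u (reverse_event e) = - weight_d e"
  by (cases e rule: weight_d.cases) simp_all

lemma total_u_reverse: "total_u (rev (map reverse_event E)) = - total_d E"
  unfolding total_u_def total_d_def by (induction E) (simp_all add: weight_u_reverse)

text \<open>What follows a line in the reversed traversal is what preceded it before, and reversal
  turns an extremum of type d into one of type u with the opposite sign.\<close>

lemma rest_u_reverse:
  assumes "distinct (event_lines E)" "x \<in> set (event_lines E)"
  shows "rest_u (rev (map reverse_event E)) x = rest_d E x - total_d E"
  using assms
proof (induction E rule: labelled_lines.induct)
  case (2 i l E)
  then show ?case
    using total_u_reverse[of E] by (auto simp: rest_u_append event_lines_rev total_u_def total_d_def)
next
  case (3 g E)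
  then show ?case
    using weight_u_reverse[of "Extremum g"]
    by (simp add: rest_u_append event_lines_rev) (simp add: total_u_def total_d_def)
qed simp

section \<open>State sums\<close>

text \<open>Sum over all states below \<open>n\<close> of the listed points; other points keep their
  value under \<open>s\<close>. Listing the points allows partial sums along the strand or level by
  level, and \<open>state_total_perm\<close> identifies the results.\<close>

primrec state_total :: "nat \<Rightarrow> 'p list \<Rightarrow> (('p \<Rightarrow> nat) \<Rightarrow> 'k::comm_semiring_1) \<Rightarrow> ('p \<Rightarrow> nat) \<Rightarrow> 'k" where
  "state_total n [] F s = F s"
| "state_total n (q # qs) F s = (\<Sum>k<n. state_total n qs F (s(q := k)))"

lemma state_total_append: "state_total n (qs @ rs) F s = state_total n qs (state_total n rs F) s"
  by (induction qs arbitrary: s) simp_all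

lemma state_total_cong:
  assumes "\<And>s'. (\<And>x. x \<notin> set qs \<Longrightarrow> s' x = s x) \<Longrightarrow> (\<And>x. x \<in> set qs \<Longrightarrow> s' x < n) \<Longrightarrow> F s' = F' s'"
  shows "state_total n qs F s = state_total n qs F' s"
  using assms
proof (induction qs arbitrary: s)
  case (Cons q qs)
  have "state_total n qs F (s(q := k)) = state_total n qs F' (s(q := k))" if k: "k < n" for k
  proof (rule Cons.IH)
    fix s' assume s': "\<And>x. x \<notin> set qs \<Longrightarrow> s' x = (s(q := k)) x" "\<And>x. x \<in> set qs \<Longrightarrow> s' x < n"
    show "F s' = F' s'"
    proof (rule Cons.prems)
      show "s' x = s x" if "x \<notin> set (q # qs)" for x using s'(1)[of x] that by simp
      show "s' x < n" if "x \<in> set (q # qs)" for x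
        using s'(1)[of x] s'(2)[of x] that k by (cases "x \<in> set qs") auto
    qed
  qed
  then show ?case by simp
qed simp

lemma state_total_mult: "state_total n qs (\<lambda>s. c * F s) s = c * state_total n qs F s"
  by (induction qs arbitrary: s) (simp_all add: sum_distrib_left)

lemma state_total_factor:
  assumes "\<And>s'. (\<And>x. x \<notin> set qs \<Longrightarrow> s' x = s x) \<Longrightarrow> c s' = c0"
  shows "state_total n qs (\<lambda>s. c s * F s) s = c0 * state_total n qs F s"
proof -
  have "state_total n qs (\<lambda>s. c s * F s) s = state_total n qs (\<lambda>s. c0 * F s) s"
    by (rule state_total_cong) (simp add: assms)
  then show ?thesis by (simp add: state_total_mult)
qed

lemma state_total_sum: "state_total n qs (\<lambda>s. \<Sum>i\<in>A. F i s) s = (\<Sum>i\<in>A. state_total n qs (F i) s)"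
  by (induction qs arbitrary: s) (simp_all add: sum.swap[of _ A])

lemma state_total_upd: "q \<notin> set qs \<Longrightarrow> state_total n qs F (s(q := k)) = state_total n qs (\<lambda>s. F (s(q := k))) s"
  by (induction qs arbitrary: s) (auto simp: fun_upd_twist intro!: sum.cong)

lemma state_total_remove:
  assumes "distinct qs" "q \<in> set qs" shows "state_total n qs F s = state_total n (q # remove1 q qs) F s"
  using assms
proof (induction qs arbitrary: s)
  case (Cons r qs)
  show ?case
  proof (cases "q = r")
    case False
    then have "state_total n (r # qs) F s = (\<Sum>k<n. \<Sum>l<n. state_total n (remove1 q qs) F (s(r := k, q := l)))"
      using Cons by simp
    also have "\<dots> = (\<Sum>l<n. \<Sum>k<n. state_total n (remove1 q qs) F (s(r := k, q := l)))"
      by (rule sum.swap)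
    also have "\<dots> = (\<Sum>l<n. \<Sum>k<n. state_total n (remove1 q qs) F (s(q := l, r := k)))"
      using False by (simp add: fun_upd_twist)
    finally show ?thesis using False by simp
  qed simp
qed simp

lemma state_total_perm:
  assumes "distinct qs" "distinct rs" "set qs = set rs" shows "state_total n qs F s = state_total n rs F s"
  using assms
proof (induction rs arbitrary: qs s)
  case (Cons r rs)
  have "state_total n qs F s = state_total n (r # remove1 r qs) F s"
    using Cons.prems by (intro state_total_remove) auto
  moreover have "state_total n (remove1 r qs) F s' = state_total n rs F s'" for s'
    using Cons.prems by (intro Cons.IH) (auto simp: set_remove1_eq)
  ultimately show ?case by simp
qed simp

section \<open>States and transfer matrices\<close>

locale coefficients = twist C for C :: "('k::field, 'c::ab_group_add, 'z) twist_quantum_coalgebra_scheme" +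
  fixes n :: nat and t :: "nat \<Rightarrow> nat \<Rightarrow> 'c"
  assumes comatrix: "comatrix n t"
begin

text \<open>\<open>i\<close> and \<open>j\<close> are the states at the lower and the upper end. The
  indices of \<open>t\<close> follow the orientation, hence the transposition for a downward
  line.\<close>

definition bead :: "dir \<Rightarrow> nat \<Rightarrow> nat \<Rightarrow> 'c" where
  "bead d i j = (if d = Up then t i j else t j i)"

fun weight :: "piece \<Rightarrow> nat list \<Rightarrow> nat list \<Rightarrow> 'k" where
  "weight (Maximum h) xs ys =
     extremum_form (Maximum h) (if h = LR then t (xs ! 0) (xs ! 1) else t (xs ! 1) (xs ! 0))"
| "weight (Minimum h) xs ys =
     extremum_form (Minimum h) (if h = LR then t (ys ! 0) (ys ! 1) else t (ys ! 1) (ys ! 0))"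
| "weight (Crossing l s m) xs ys =
     reduced_factor C (Crossing l s m) (bead s (xs ! 0) (ys ! 1)) (bead m (xs ! 1) (ys ! 0))"

definition layer_matrix :: "layer \<Rightarrow> nat list \<Rightarrow> nat list \<Rightarrow> 'k" where
  "layer_matrix L X Y = (case L of (p, g) \<Rightarrow>
     if take p X = take p Y \<and> drop (p + length (lower g)) X = drop (p + length (upper g)) Y
     then weight g (take (length (lower g)) (drop p X)) (take (length (upper g)) (drop p Y)) else 0)"

definition states :: "nat \<Rightarrow> nat list set" where
  "states l = {xs. length xs = l \<and> set xs \<subseteq> {..<n}}"

fun transfer :: "layer list \<Rightarrow> nat list \<Rightarrow> nat list \<Rightarrow> 'k" where
  "transfer [] X Y = (if X = Y then 1 else 0)"
| "transfer ((p, g) # w) X Y = (\<Sum>Z\<in>states (length X - length (lower g) + length (upper g)).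
     layer_matrix (p, g) X Z * transfer w Z Y)"

lemma finite_states [simp]: "finite (states l)"
  using finite_lists_length_eq[of "{..<n}" l] by (simp add: states_def conj_commute)

lemma states_0 [simp]: "states 0 = {[]}" by (auto simp: states_def)

lemma sum_states_Suc: "(\<Sum>Z\<in>states (Suc l). f Z) = (\<Sum>k<n. \<Sum>Z\<in>states l. f (k # Z))"
proof -
  have "states (Suc l) = (\<lambda>(k, Z). k # Z) ` ({..<n} \<times> states l)"
    by (auto simp: states_def length_Suc_conv image_iff)
  moreover have "inj_on (\<lambda>(k, Z). k # Z) ({..<n} \<times> states l)" by (auto simp: inj_on_def)
  ultimately show ?thesis by (simp add: sum.reindex sum.cartesian_product case_prod_unfold)
qed

text \<open>At the point \<open>(i, j)\<close>, lying on an upward line, the strand is cut: there the coefficients \<open>a\<close>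
  of the element of the coalgebra replace the identity matrix.\<close>

definition cut_sum :: "(nat \<Rightarrow> nat \<Rightarrow> 'k) \<Rightarrow> layer list \<Rightarrow> nat \<Rightarrow> nat \<Rightarrow> nat \<Rightarrow> 'k" where
  "cut_sum a K l i j = (\<Sum>X\<in>states l. transfer (take i K) [] X *
     (\<Sum>m<n. a m (X ! j) * transfer (drop i K) (X[j := m]) []))"

lemma sum_states_sums:
  "(\<Sum>Z\<in>states l. f Z) = state_total n (map (Pair m) [a..<a + l]) (\<lambda>s. f (map (\<lambda>j. s (m, j)) [a..<a + l])) s"
proof (induction l arbitrary: a f s)
  case (Suc l)
  have u: "[a..<a + Suc l] = a # [Suc a..<Suc a + l]" by (simp add: upt_conv_Cons)
  have "(\<Sum>Z\<in>states (Suc l). f Z) = (\<Sum>k<n. \<Sum>Z\<in>states l. f (k # Z))" by (rule sum_states_Suc)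
  also have "\<dots> = (\<Sum>k<n. state_total n (map (Pair m) [Suc a..<Suc a + l])
      (\<lambda>s'. f (k # map (\<lambda>j. s' (m, j)) [Suc a..<Suc a + l])) (s((m, a) := k)))"
    by (intro sum.cong HOL.refl Suc.IH)
  also have "\<dots> = (\<Sum>k<n. state_total n (map (Pair m) [Suc a..<Suc a + l])
      (\<lambda>s'. f (s' (m, a) # map (\<lambda>j. s' (m, j)) [Suc a..<Suc a + l])) (s((m, a) := k)))"
  proof (rule sum.cong[OF HOL.refl], rule state_total_cong)
    fix k s'
    assume "\<And>x. x \<notin> set (map (Pair m) [Suc a..<Suc a + l]) \<Longrightarrow> s' x = (s((m, a) := k)) x"
    moreover have "(m, a) \<notin> set (map (Pair m) [Suc a..<Suc a + l])" by auto
    ultimately have "s' (m, a) = (s((m, a) := k)) (m, a)" by blast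
    then have "s' (m, a) = k" by simp
    then show "f (k # map (\<lambda>j. s' (m, j)) [Suc a..<Suc a + l]) =
      f (s' (m, a) # map (\<lambda>j. s' (m, j)) [Suc a..<Suc a + l])" by simp
  qed
  finally show ?case by (simp only: u list.map state_total.simps)
qed simp

lemma beads_Line_t:
  assumes "i < n" "j < n" "multilinear L \<Phi>" "distinct (event_lines (Line m l # E))"
    "set (event_lines (Line m l # E)) \<subseteq> L"
  shows "beads (Line m l # E) \<Phi> v (t i j) = (\<Sum>k<n. beads E \<Phi> (v((m, l) := t i k)) (t k j))"
proof -
  have "bilinear_form C (\<lambda>x y. beads E \<Phi> (v((m, l) := x)) y)"
    using assms by (intro bilinI lin_beads[OF assms(3)] lin_beads_env[OF assms(3)]) auto
  then show ?thesis using comatrix assms(1,2) by (simp add: comatrix_def)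
qed

lemma beads_Extremum_t:
  assumes "i < n" "j < n" "multilinear L \<Phi>" "distinct (event_lines E)" "set (event_lines E) \<subseteq> L"
  shows "beads (Extremum g # E) \<Phi> v (t i j) = (\<Sum>k<n. extremum_form g (t i k) * beads E \<Phi> v (t k j))"
proof -
  have "bilinear_form C (\<lambda>x y. extremum_form g x * beads E \<Phi> v y)"
    using assms by (intro bilinI lin_beads[OF assms(3)] lin_mult_left lin_mult_right lin_extremum_form) auto
  then show ?thesis using comatrix assms(1,2) by (simp add: comatrix_def)
qed

lemma counit_t: "i < n \<Longrightarrow> j < n \<Longrightarrow> \<epsilon> (t i j) = (if i = j then 1 else 0)"
  using comatrix by (simp add: comatrix_def)

end

section \<open>The bead word as a state sum along the strand\<close>

locale state_sum = coefficients C n t + traversed_diagram K P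
  for C :: "('k::field, 'c::ab_group_add, 'z) twist_quantum_coalgebra_scheme"
    and n t K P +
  assumes P_up: "lev (fst P) ! snd P = Up"
begin

abbreviation "\<Phi> \<equiv> weight_product (map snd K)"
abbreviation "lines \<equiv> crossing_lines (map snd K)"

definition level_state :: "(point \<Rightarrow> nat) \<Rightarrow> nat \<Rightarrow> nat list" where
  "level_state s m = map (\<lambda>j. s (m, j)) [0..<length (lev m)]"

text \<open>In a state \<open>s\<close> the strand arrives at the point \<open>x\<close> in state \<open>s x\<close> and leaves it in the same
  state, except for the cut point \<open>P\<close>, which it leaves in state \<open>i\<close>.\<close>

definition env :: "nat \<Rightarrow> (point \<Rightarrow> nat) \<Rightarrow> line \<Rightarrow> 'c" where
  "env i s x = (case x of (m, l) \<Rightarrow> case K ! m of (p, g) \<Rightarrow>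
     if l = SWNE then bead (line_dir g SWNE) ((s(P := i)) (m, p)) (s (Suc m, p + 1))
     else bead (line_dir g NWSE) ((s(P := i)) (m, p + 1)) (s (Suc m, p)))"

text \<open>A crossing line has weight 1 because its matrix coefficient enters through the
  environment, in the product of crossing factors.\<close>

fun event_weight :: "event list \<Rightarrow> nat \<Rightarrow> nat \<Rightarrow> 'k" where
  "event_weight [Extremum g] i j = extremum_form g (t i j)"
| "event_weight [] i j = (if i = j then 1 else 0)"
| "event_weight _ i j = 1"

lemma Down_not_P: "lev m ! j = Down \<Longrightarrow> (m, j) \<noteq> P"
  using P_up by auto

lemma Down_upd: "lev m ! j = Down \<Longrightarrow> (s(P := i)) (m, j) = s (m, j)"
  using Down_not_P by auto

text \<open>\<open>env\<close> speaks of lower and upper ends, as the layers require, whereas the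
  right-hand side speaks of source and target. They agree at the cut because \<open>P\<close> is on
  an upward strand: the state \<open>i\<close> replaces the old one only at a lower end that is also
  a source.\<close>

lemma env_line:
  assumes "x \<in> pts" "Line m l \<in> set (ev x)"
  shows "env i s (m, l) = t ((s(P := i)) x) (s (next x))"
proof -
  note m = line_ev(1,2)[OF assms]
  obtain p k sd nd where g: "K ! m = (p, Crossing k sd nd)"
    using m(2) by (cases "K ! m") (auto simp: is_crossing_def)
  have up: "lev m ! p = sd" "lev m ! (p + 1) = nd" "lev (Suc m) ! p = nd" "lev (Suc m) ! (p + 1) = sd"
    using fitD(2)[of m p "Crossing k sd nd" 0] fitD(2)[of m p "Crossing k sd nd" 1]
      lev_Suc_nth(2)[of m p "Crossing k sd nd" 0] lev_Suc_nth(2)[of m p "Crossing k sd nd" 1] m(1) g by auto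
  let ?a = "if l = SWNE then ((m, p), (Suc m, p + 1), sd = Up, [Line m SWNE])
    else ((m, p + 1), (Suc m, p), nd = Up, [Line m NWSE])"
  have a: "?a \<in> set (arcs D m)" by (simp add: arcs_def g)
  obtain x0 y0 e where d': "directed ?a = (x0, y0, e)" by (rule prod_cases3)
  have "snd (snd (directed ?a)) = [Line m l]" by (cases l) auto
  with d' have d: "directed ?a = (x0, y0, [Line m l])" by simp
  note da = directed_arc[OF _ a d]
  have x: "x = x0" "next x = y0"
    using da(1,3,4) m(1) line_ev_unique[OF assms(1) _ assms(2), of x0] by auto
  have "env i s (m, l) = t ((s(P := i)) x0) (s y0)"
  proof (cases l)
    case SWNE
    then show ?thesis
      using d up Down_upd[of m p s i] Down_upd[of "Suc m" "p + 1" s i]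
      by (cases sd) (auto simp: env_def g bead_def simp del: fun_upd_apply)
  next
    case NWSE
    then show ?thesis
      using d up Down_upd[of m "p + 1" s i] Down_upd[of "Suc m" p s i]
      by (cases nd) (auto simp: env_def g bead_def simp del: fun_upd_apply)
  qed
  then show ?thesis unfolding x(2) unfolding x(1) .
qed

lemma prod_list_delta: "prod_list (map (\<lambda>j. if Q j then 1 else 0) xs) = (if \<forall>j\<in>set xs. Q j then 1 else (0::'k))"
  by (induction xs) auto

lemma layer_weight:
  assumes m: "m < length K"
  shows "prod_list (map (\<lambda>a. case directed a of (x, y, e) \<Rightarrow> event_weight e ((s(P := i)) x) (s y)) (arcs D m)) *
    reduced_factor C (snd (K ! m)) (env i s (m, SWNE)) (env i s (m, NWSE)) =
    layer_matrix (K ! m) (level_state (s(P := i)) m) (level_state s (Suc m))"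
proof -
  obtain p g where pg: "K ! m = (p, g)" by fastforce
  have pg': "snd D ! m = (p, g)" "m < len" using pg m by simp_all
  note f = fitD[OF pg'(2,1)] and nn = lev_Suc_nth[OF pg'(2,1)]
  let ?X = "level_state (s(P := i)) m" and ?Y = "level_state s (Suc m)"
  let ?F = "\<lambda>a. case directed a of (x, y, e) \<Rightarrow> event_weight e ((s(P := i)) x) (s y)"
  have X: "length ?X = length (lev m)" "\<And>j. j < length (lev m) \<Longrightarrow> ?X ! j = (s(P := i)) (m, j)"
    by (simp_all add: level_state_def)
  have Y: "length ?Y = length (lev (Suc m))" "\<And>j. j < length (lev (Suc m)) \<Longrightarrow> ?Y ! j = s (Suc m, j)"
    by (simp_all add: level_state_def)
  have left: "?F ((m, j), (Suc m, j), lev m ! j = Up, []) = (if ?X ! j = ?Y ! j then 1 else 0)" if "j < p" for j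
    using that f(1,4) nn(1)[OF that] X(2)[of j] Y(2)[of j] Down_upd[of m j s i] Down_upd[of "Suc m" j s i]
    by (cases "lev m ! j") auto
  have right: "?F ((m, p + length (lower g) + k), (Suc m, p + length (upper g) + k),
      lev m ! (p + length (lower g) + k) = Up, []) =
      (if ?X ! (p + length (lower g) + k) = ?Y ! (p + length (upper g) + k) then 1 else 0)"
    if "k < length (lev m) - (p + length (lower g))" for k
    using that f(1,4) nn(3)[OF that] X(2)[of "p + length (lower g) + k"] Y(2)[of "p + length (upper g) + k"]
      Down_upd[of m "p + length (lower g) + k" s i] Down_upd[of "Suc m" "p + length (upper g) + k" s i]
    by (cases "lev m ! (p + length (lower g) + k)") auto
  have "prod_list (map ?F (arcs D m)) =
    prod_list (map (\<lambda>j. if ?X ! j = ?Y ! j then 1 else 0) [0..<p]) *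
    prod_list (map (\<lambda>k. if ?X ! (p + length (lower g) + k) = ?Y ! (p + length (upper g) + k) then 1 else 0)
      [0..<length (lev m) - (p + length (lower g))]) *
    prod_list (map ?F (piece_arcs m p g))"
  proof -
    have "map (\<lambda>j. ?F ((m, j), (Suc m, j), lev m ! j = Up, [])) [0..<p] =
        map (\<lambda>j. if ?X ! j = ?Y ! j then 1 else 0) [0..<p]"
      by (rule map_cong[OF HOL.refl], rule left) simp
    moreover have "map (\<lambda>k. ?F ((m, p + length (lower g) + k), (Suc m, p + length (upper g) + k),
        lev m ! (p + length (lower g) + k) = Up, [])) [0..<length (lev m) - (p + length (lower g))] =
        map (\<lambda>k. if ?X ! (p + length (lower g) + k) = ?Y ! (p + length (upper g) + k) then 1 else 0)
          [0..<length (lev m) - (p + length (lower g))]"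
      by (rule map_cong[OF HOL.refl], rule right) simp
    ultimately show ?thesis
      by (simp only: arcs_def snd_conv pg prod.case map_append map_map comp_def prod_list.append mult.assoc)
  qed
  also have "prod_list (map (\<lambda>j. if ?X ! j = ?Y ! j then 1 else 0) [0..<p]) =
      (if take p ?X = take p ?Y then 1 else (0::'k))"
    unfolding prod_list_delta using f(1,4) X(1) Y(1) by (auto simp: list_eq_iff_nth_eq)
  also have "prod_list (map (\<lambda>k. if ?X ! (p + length (lower g) + k) = ?Y ! (p + length (upper g) + k) then 1 else 0)
      [0..<length (lev m) - (p + length (lower g))]) =
      (if drop (p + length (lower g)) ?X = drop (p + length (upper g)) ?Y then 1 else (0::'k))"
    unfolding prod_list_delta using f(1,4) X(1) Y(1) by (auto simp: list_eq_iff_nth_eq)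
  finally have A: "prod_list (map ?F (arcs D m)) =
    (if take p ?X = take p ?Y \<and> drop (p + length (lower g)) ?X = drop (p + length (upper g)) ?Y then 1 else 0) *
    prod_list (map ?F (piece_arcs m p g))"
    by (auto simp del: fun_upd_apply)
  have B: "prod_list (map ?F (piece_arcs m p g)) *
      reduced_factor C g (env i s (m, SWNE)) (env i s (m, NWSE)) =
    weight g (take (length (lower g)) (drop p ?X)) (take (length (upper g)) (drop p ?Y))"
  proof (cases g)
    case (Maximum h)
    then show ?thesis
      using f(1) f(2)[of 0] f(2)[of 1] X Down_upd[of m p s i] Down_upd[of m "Suc p" s i]
      by (cases h) (auto simp del: fun_upd_apply)
  next
    case (Minimum h)
    then show ?thesis
      using f(1,4) nn(2)[of 0] nn(2)[of 1] Y Down_upd[of "Suc m" p s i] Down_upd[of "Suc m" "Suc p" s i]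
      by (cases h) (auto simp del: fun_upd_apply)
  next
    case (Crossing k sd nd)
    then show ?thesis
      using f(1,4) X Y by (simp add: env_def pg del: fun_upd_apply)
  qed
  show ?thesis unfolding A mult.assoc pg snd_conv B by (simp add: layer_matrix_def)
qed

lemma weight_product_cong:
  assumes "\<And>x. x \<in> crossing_lines gs \<Longrightarrow> v x = w x" shows "weight_product gs v = weight_product gs w"
  unfolding weight_product_def
proof (rule prod.cong[OF HOL.refl])
  fix i assume i: "i \<in> {..<length gs}"
  show "reduced_factor C (gs ! i) (v (i, SWNE)) (v (i, NWSE)) = reduced_factor C (gs ! i) (w (i, SWNE)) (w (i, NWSE))"
  proof (cases "is_crossing (gs ! i)")
    case True
    then show ?thesis using i assms by (simp add: crossing_lines_def)
  next
    case False
    then show ?thesis by (cases "gs ! i") (auto simp: is_crossing_def)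
  qed
qed

text \<open>The points are now listed with \<open>P\<close> at the end instead of the beginning: the
  state of \<open>P\<close> that is summed over is the one on arrival.\<close>

lemma pt_inj': "inj_on pt {1..N}"
proof (rule inj_onI)
  fix x y assume xy: "x \<in> {1..N}" "y \<in> {1..N}" "pt x = pt y"
  let ?r = "\<lambda>x. if x = N then 0 else x"
  have "pt (?r z) = pt z" for z by (simp add: pt_N)
  then have "?r x = ?r y" using inj_onD[OF pt_inj, of "?r x" "?r y"] xy N_pos by auto
  then show "x = y" using xy by (auto split: if_splits)
qed

lemma pt_eq_P: "0 < k \<Longrightarrow> k < N \<Longrightarrow> pt k \<noteq> P"
  using inj_onD[OF pt_inj, of k 0] N_pos by auto

definition path_weight :: "nat \<Rightarrow> nat \<Rightarrow> (point \<Rightarrow> nat) \<Rightarrow> 'k" where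
  "path_weight i m s = (\<Prod>k\<in>{m..<N}. event_weight (ev (pt k)) ((s(P := i)) (pt k)) (s (pt (Suc k))))"

lemma event_lines_seg: "set (event_lines (seg m N)) \<subseteq> lines"
proof (cases "m \<le> N")
  case True
  then show ?thesis using set_lines traversal_seg seg_split[of 0 m N] by auto
qed (simp add: seg_def)

text \<open>Induction backwards along the strand, with the states up to \<open>pt m\<close> fixed
  and the beads already read recorded in \<open>v\<close>. \<open>P\<close> occurs twice: the strand
  departs in state \<open>i\<close> and arrives in the state that is paired with \<open>i\<close> by
  the coefficient \<open>a\<close>. Hence \<open>s P = i\<close> is required only before the
  arrival.\<close>

lemma beads_path:
  assumes "m \<le> N" "i < n" "s (pt m) < n" "m < N \<Longrightarrow> s P = i"
    and "\<And>k a l. k < m \<Longrightarrow> Line a l \<in> set (ev (pt k)) \<Longrightarrow> v (a, l) = t ((s(P := i)) (pt k)) (s (pt (Suc k)))"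
  shows "(\<Sum>j<n. a i j * beads (seg m N) \<Phi> v (t (s (pt m)) j)) =
    state_total n (map pt [Suc m..<Suc N]) (\<lambda>s. a i (s P) * path_weight i m s * \<Phi> (env i s)) s"
  using assms
proof (induction "N - m" arbitrary: m s v)
  case 0
  then have m: "m = N" by simp
  have "\<Phi> v = \<Phi> (env i s)"
  proof (rule weight_product_cong)
    fix x assume "x \<in> lines"
    then have "Line (fst x) (snd x) \<in> set (traversal D P)"
      using set_lines by (metis mem_event_lines)
    then obtain k where k: "k < N" "Line (fst x) (snd x) \<in> set (ev (pt k))"
      by (auto simp: traversal_seg seg_def)
    then show "v x = env i s x"
      using 0(6)[of k "fst x" "snd x"] env_line[OF pt_in k(2)] m by (simp add: pt_Suc)
  qed
  then have "a i j * beads (seg m N) \<Phi> v (t (s (pt m)) j) = (if s P = j then a i j * \<Phi> (env i s) else 0)"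
    if "j < n" for j
    using 0(4) that by (simp add: m seg_def counit_t pt_N)
  then show ?case
    using 0(4) by (simp add: m pt_N path_weight_def)
next
  case (Suc d)
  then have mN: "m < N" by simp
  let ?k0 = "s (pt m)"
  let ?r = "map pt [Suc (Suc m)..<Suc N]"
  have upt: "map pt [Suc m..<Suc N] = pt (Suc m) # ?r"
    using mN by (subst upt_conv_Cons) (simp_all del: upt_Suc)
  have neq: "pt k \<noteq> pt (Suc m)" if "0 < k" "k \<le> m" for k
    using inj_onD[OF pt_inj', of k "Suc m"] that mN by auto
  have k0: "(s(P := i)) (pt m) = ?k0" using Suc.prems(4)[OF mN] by auto
  have pw: "path_weight i m s = event_weight (ev (pt m)) ((s(P := i)) (pt m)) (s (pt (Suc m))) * path_weight i (Suc m) s" for s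
    unfolding path_weight_def using mN by (subst prod.atLeast_Suc_lessThan) auto
  have rest: "state_total n ?r (\<lambda>s. a i (s P) * path_weight i m s * \<Phi> (env i s)) (s(pt (Suc m) := k)) =
      event_weight (ev (pt m)) ?k0 k *
      state_total n ?r (\<lambda>s. a i (s P) * path_weight i (Suc m) s * \<Phi> (env i s)) (s(pt (Suc m) := k))" for k
  proof -
    have "state_total n ?r (\<lambda>s. a i (s P) * path_weight i m s * \<Phi> (env i s)) (s(pt (Suc m) := k)) =
      state_total n ?r (\<lambda>s. event_weight (ev (pt m)) ((s(P := i)) (pt m)) (s (pt (Suc m))) *
        (a i (s P) * path_weight i (Suc m) s * \<Phi> (env i s))) (s(pt (Suc m) := k))"
      by (simp add: pw mult_ac)
    also have "\<dots> = event_weight (ev (pt m)) ?k0 k *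
      state_total n ?r (\<lambda>s. a i (s P) * path_weight i (Suc m) s * \<Phi> (env i s)) (s(pt (Suc m) := k))"
    proof (rule state_total_factor)
      fix s' assume s': "\<And>x. x \<notin> set ?r \<Longrightarrow> s' x = (s(pt (Suc m) := k)) x"
      have "pt (Suc m) \<notin> set ?r"
      proof
        assume "pt (Suc m) \<in> set ?r"
        then obtain q where "Suc (Suc m) \<le> q" "q \<le> N" "pt (Suc m) = pt q" by auto
        then show False using inj_onD[OF pt_inj', of "Suc m" q] by simp
      qed
      then have 1: "s' (pt (Suc m)) = k" using s' by simp
      have 2: "(s'(P := i)) (pt m) = ?k0"
      proof (cases "m = 0")
        case True
        then show ?thesis using Suc.prems(4)[OF mN] by simp
      next
        case False
        have "pt m \<notin> set ?r"
        proof
          assume "pt m \<in> set ?r"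
          then obtain q where "Suc (Suc m) \<le> q" "q \<le> N" "pt m = pt q" by auto
          then show False using inj_onD[OF pt_inj', of m q] False by simp
        qed
        then show ?thesis using s' neq[of m] False pt_eq_P[of m] mN by simp
      qed
      show "event_weight (ev (pt m)) ((s'(P := i)) (pt m)) (s' (pt (Suc m))) = event_weight (ev (pt m)) ?k0 k"
        unfolding 1 2 ..
    qed
    finally show ?thesis .
  qed
  have IH: "(\<Sum>j<n. a i j * beads (seg (Suc m) N) \<Phi> v' (t k j)) =
      state_total n ?r (\<lambda>s. a i (s P) * path_weight i (Suc m) s * \<Phi> (env i s)) (s(pt (Suc m) := k))"
    if k: "k < n" and v': "\<And>q a l. q \<le> m \<Longrightarrow> Line a l \<in> set (ev (pt q)) \<Longrightarrow>
      v' (a, l) = (if q = m then t ?k0 k else v (a, l))" for k v'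
  proof -
    let ?s = "s(pt (Suc m) := k)"
    have "(\<Sum>j<n. a i j * beads (seg (Suc m) N) \<Phi> v' (t (?s (pt (Suc m))) j)) =
      state_total n ?r (\<lambda>s. a i (s P) * path_weight i (Suc m) s * \<Phi> (env i s)) ?s"
    proof (rule Suc.hyps(1))
      show "d = N - Suc m" using Suc.hyps(2) by simp
      show "Suc m < N \<Longrightarrow> ?s P = i"
        using Suc.prems(4)[OF mN] pt_eq_P[of "Suc m"] by auto
      fix q a l assume q: "q < Suc m" "Line a l \<in> set (ev (pt q))"
      have u: "(?s(P := i)) (pt q) = (s(P := i)) (pt q)"
        using neq[of q] q by (cases "q = 0") auto
      show "v' (a, l) = t ((?s(P := i)) (pt q)) (?s (pt (Suc q)))"
      proof (cases "q = m")
        case True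
        then show ?thesis using v'[of q a l] q k0 u by simp
      next
        case False
        then have "?s (pt (Suc q)) = s (pt (Suc q))" using neq[of "Suc q"] q by simp
        then show ?thesis using v'[of q a l] q False Suc.prems(5)[of q a l] u by simp
      qed
    qed (use mN k Suc.prems in auto)
    then show ?thesis by simp
  qed
  \<comment> \<open>A line is met only once, so a bead stored now does not overwrite an earlier
    one.\<close>
  have lk: "\<not> (Line a l \<in> set (ev (pt q)))" if "Line a l \<in> set (ev (pt m))" "q < m" for q a l
    using line_ev_unique[OF pt_in pt_in that(1), of q] inj_onD[OF pt_inj, of q m] that mN by auto
  note tm = multilinear_weight_product'[of "map snd K"]
  have dm: "distinct (event_lines (ev (pt m) @ seg (Suc m) N))" "set (event_lines (ev (pt m) @ seg (Suc m) N)) \<subseteq> lines"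
    using distinct_seg[of N m] event_lines_seg[of m] by (simp_all add: seg_step[OF mN])
  have k0n: "?k0 < n" using Suc.prems by simp
  have step: "(\<Sum>j<n. a i j * beads (ev (pt m) @ seg (Suc m) N) \<Phi> v (t ?k0 j)) =
    (\<Sum>k<n. event_weight (ev (pt m)) ?k0 k * state_total n ?r (\<lambda>s. a i (s P) * path_weight i (Suc m) s * \<Phi> (env i s)) (s(pt (Suc m) := k)))"
  proof -
    consider "ev (pt m) = []" | g where "ev (pt m) = [Extremum g]" | q l where "ev (pt m) = [Line q l]"
      using length_le_1_cases[OF length_ev[OF pt_in, of m]] by (metis event.exhaust)
    then show ?thesis
    proof cases
      case 1
      have "(\<Sum>k<n. event_weight [] ?k0 k * state_total n ?r (\<lambda>s. a i (s P) * path_weight i (Suc m) s * \<Phi> (env i s)) (s(pt (Suc m) := k))) =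
        state_total n ?r (\<lambda>s. a i (s P) * path_weight i (Suc m) s * \<Phi> (env i s)) (s(pt (Suc m) := ?k0))"
        using k0n by (subst sum.remove[of _ ?k0]) auto
      moreover have "(\<Sum>j<n. a i j * beads (seg (Suc m) N) \<Phi> v (t ?k0 j)) =
        state_total n ?r (\<lambda>s. a i (s P) * path_weight i (Suc m) s * \<Phi> (env i s)) (s(pt (Suc m) := ?k0))"
        by (rule IH[OF k0n]) (use 1 in auto)
      ultimately show ?thesis by (simp only: 1 append_Nil)
    next
      case (2 g)
      have "(\<Sum>j<n. a i j * beads (ev (pt m) @ seg (Suc m) N) \<Phi> v (t ?k0 j)) =
        (\<Sum>j<n. \<Sum>k<n. extremum_form g (t ?k0 k) * (a i j * beads (seg (Suc m) N) \<Phi> v (t k j)))"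
        using beads_Extremum_t[OF k0n _ tm] dm 2 by (simp add: sum_distrib_left mult_ac)
      also have "\<dots> = (\<Sum>k<n. extremum_form g (t ?k0 k) * (\<Sum>j<n. a i j * beads (seg (Suc m) N) \<Phi> v (t k j)))"
        by (subst sum.swap) (simp add: sum_distrib_left)
      also have "\<dots> = (\<Sum>k<n. extremum_form g (t ?k0 k) *
          state_total n ?r (\<lambda>s. a i (s P) * path_weight i (Suc m) s * \<Phi> (env i s)) (s(pt (Suc m) := k)))"
        by (intro sum.cong[OF HOL.refl] arg_cong2[where f = "(*)"] HOL.refl IH) (use 2 in auto)
      finally show ?thesis by (simp only: 2 event_weight.simps)
    next
      case (3 q l)
      have "(\<Sum>j<n. a i j * beads (ev (pt m) @ seg (Suc m) N) \<Phi> v (t ?k0 j)) =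
        (\<Sum>j<n. \<Sum>k<n. a i j * beads (seg (Suc m) N) \<Phi> (v((q, l) := t ?k0 k)) (t k j))"
        using beads_Line_t[OF k0n _ tm] dm 3 by (simp add: sum_distrib_left)
      also have "\<dots> = (\<Sum>k<n. \<Sum>j<n. a i j * beads (seg (Suc m) N) \<Phi> (v((q, l) := t ?k0 k)) (t k j))"
        by (rule sum.swap)
      also have "\<dots> = (\<Sum>k<n. state_total n ?r (\<lambda>s. a i (s P) * path_weight i (Suc m) s * \<Phi> (env i s)) (s(pt (Suc m) := k)))"
      proof (rule sum.cong[OF HOL.refl], rule IH)
        fix k q' a' l' assume q': "q' \<le> m" "Line a' l' \<in> set (ev (pt q'))"
        show "(v((q, l) := t ?k0 k)) (a', l') = (if q' = m then t ?k0 k else v (a', l'))"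
        proof (cases "q' = m")
          case True
          then show ?thesis using q' 3 by auto
        next
          case False
          then have "(a', l') \<noteq> (q, l)" using lk[of q l q'] q' 3 by auto
          then show ?thesis using False by auto
        qed
      qed simp
      finally show ?thesis by (simp only: 3 event_weight.simps mult_1_left)
    qed
  qed
  show ?case unfolding seg_step[OF mN] upt state_total.simps rest by (rule step)
qed

end

lemma state_total_upd_mem:
  assumes "distinct qs" "q \<in> set qs" shows "state_total n qs F (s(q := k)) = state_total n qs F s"
  by (simp add: state_total_remove[OF assms])

section \<open>The same state sum taken level by level\<close>

context state_sum
begin

abbreviation "layer_points m \<equiv> map (Pair m) [0..<length (lev m)]"
abbreviation "points_from m m' \<equiv> concat (map layer_points [m..<m'])"

lemma level_state_upd: "fst P \<noteq> m \<Longrightarrow> level_state (s(P := i)) m = level_state s m"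
  by (auto simp: level_state_def)

lemma level_state_cong: "(\<And>x. fst x = m \<Longrightarrow> s x = s' x) \<Longrightarrow> level_state s m = level_state s' m"
  by (simp add: level_state_def)

lemma length_level_state [simp]: "length (level_state s m) = length (lev m)"
  by (simp add: level_state_def)

lemma set_points_from: "set (points_from m m') = {x. m \<le> fst x \<and> fst x < m' \<and> snd x < length (lev (fst x))}"
  by (auto simp: image_iff)

text \<open>The function \<open>f\<close> stands for whatever is above level \<open>m'\<close>, so
  the expansion into states can stop at the level of the cut.\<close>

lemma transfer_total:
  assumes "m \<le> m'" "m' \<le> length K" "level_state s m \<in> states (length (lev m))"
  shows "(\<Sum>Y\<in>states (length (lev m')). transfer (drop m (take m' K)) (level_state s m) Y * f Y) =
    state_total n (points_from (Suc m) (Suc m'))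
      (\<lambda>s. (\<Prod>k\<in>{m..<m'}. layer_matrix (K ! k) (level_state s k) (level_state s (Suc k))) * f (level_state s m')) s"
  using assms
proof (induction "m' - m" arbitrary: m s)
  case 0
  then have "m = m'" by simp
  with 0 show ?case
    by (simp add: if_distrib[of "\<lambda>x. x * _"] sum.delta' cong: if_cong)
next
  case (Suc d)
  then have mm: "m < m'" "m < length K" by auto
  obtain p g where pg: "K ! m = (p, g)" by fastforce
  have dr: "drop m (take m' K) = (p, g) # drop (Suc m) (take m' K)"
    using mm pg by (metis Cons_nth_drop_Suc Suc.prems(2) length_take min.absorb2 nth_take)
  have len: "length (lev m) - length (lower g) + length (upper g) = length (lev (Suc m))"
    using fitD(4)[of m p g] mm pg by simp
  let ?S = "states (length (lev (Suc m)))"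
  let ?Fs = "\<lambda>s. (\<Prod>k\<in>{Suc m..<m'}. layer_matrix (K ! k) (level_state s k) (level_state s (Suc k))) * f (level_state s m')"
  have pf: "points_from (Suc m) (Suc m') = layer_points (Suc m) @ points_from (Suc (Suc m)) (Suc m')"
    using mm by (subst upt_conv_Cons) (simp_all del: upt_Suc)
  have "(\<Sum>Y\<in>states (length (lev m')). transfer (drop m (take m' K)) (level_state s m) Y * f Y) =
    (\<Sum>Y\<in>states (length (lev m')). \<Sum>Z\<in>?S. layer_matrix (p, g) (level_state s m) Z *
      (transfer (drop (Suc m) (take m' K)) Z Y * f Y))"
    by (simp add: dr len sum_distrib_right mult.assoc)
  also have "\<dots> = (\<Sum>Z\<in>?S. layer_matrix (p, g) (level_state s m) Z *
      (\<Sum>Y\<in>states (length (lev m')). transfer (drop (Suc m) (take m' K)) Z Y * f Y))"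
    by (subst sum.swap) (simp add: sum_distrib_left)
  also have "\<dots> = state_total n (layer_points (Suc m)) (\<lambda>s'. layer_matrix (p, g) (level_state s m) (level_state s' (Suc m)) *
      (\<Sum>Y\<in>states (length (lev m')). transfer (drop (Suc m) (take m' K)) (level_state s' (Suc m)) Y * f Y)) s"
    using sum_states_sums[where l = "length (lev (Suc m))" and m = "Suc m" and a = 0 and s = s] by (simp add: level_state_def)
  also have "\<dots> = state_total n (layer_points (Suc m)) (state_total n (points_from (Suc (Suc m)) (Suc m'))
      (\<lambda>s. layer_matrix (p, g) (level_state s m) (level_state s (Suc m)) * ?Fs s)) s"
  proof (rule state_total_cong)
    fix s' assume s': "\<And>x. x \<notin> set (layer_points (Suc m)) \<Longrightarrow> s' x = s x"
      "\<And>x. x \<in> set (layer_points (Suc m)) \<Longrightarrow> s' x < n"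
    have in_states: "level_state s' (Suc m) \<in> states (length (lev (Suc m)))"
      using s'(2) by (auto simp: level_state_def states_def)
    have "layer_matrix (p, g) (level_state s m) (level_state s' (Suc m)) *
      state_total n (points_from (Suc (Suc m)) (Suc m')) ?Fs s' =
      state_total n (points_from (Suc (Suc m)) (Suc m'))
      (\<lambda>s. layer_matrix (p, g) (level_state s m) (level_state s (Suc m)) * ?Fs s) s'"
    proof (rule state_total_factor[symmetric])
      fix s2 assume s2: "\<And>x. x \<notin> set (points_from (Suc (Suc m)) (Suc m')) \<Longrightarrow> s2 x = s' x"
      have "level_state s2 m = level_state s m"
      proof (rule level_state_cong)
        fix x :: point assume "fst x = m"
        then have "x \<notin> set (points_from (Suc (Suc m)) (Suc m'))" "x \<notin> set (layer_points (Suc m))"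
          unfolding set_points_from by (cases x; force)+
        then show "s2 x = s x" using s2 s'(1) by simp
      qed
      moreover have "level_state s2 (Suc m) = level_state s' (Suc m)"
      proof (rule level_state_cong)
        fix x :: point assume "fst x = Suc m"
        then have "x \<notin> set (points_from (Suc (Suc m)) (Suc m'))"
          unfolding set_points_from by auto
        then show "s2 x = s' x" using s2 by simp
      qed
      ultimately show "layer_matrix (p, g) (level_state s2 m) (level_state s2 (Suc m)) =
        layer_matrix (p, g) (level_state s m) (level_state s' (Suc m))" by simp
    qed
    moreover have "(\<Sum>Y\<in>states (length (lev m')). transfer (drop (Suc m) (take m' K)) (level_state s' (Suc m)) Y * f Y) =
      state_total n (points_from (Suc (Suc m)) (Suc m')) ?Fs s'"
      by (rule Suc.hyps(1)) (use Suc.hyps(2) Suc.prems mm in_states in auto)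
    ultimately show "layer_matrix (p, g) (level_state s m) (level_state s' (Suc m)) *
      (\<Sum>Y\<in>states (length (lev m')). transfer (drop (Suc m) (take m' K)) (level_state s' (Suc m)) Y * f Y) =
      state_total n (points_from (Suc (Suc m)) (Suc m'))
      (\<lambda>s. layer_matrix (p, g) (level_state s m) (level_state s (Suc m)) * ?Fs s) s'" by simp
  qed
  also have "\<dots> = state_total n (points_from (Suc m) (Suc m'))
    (\<lambda>s. (\<Prod>k\<in>{m..<m'}. layer_matrix (K ! k) (level_state s k) (level_state s (Suc k))) * f (level_state s m')) s"
    unfolding pf state_total_append using mm pg
    by (simp add: prod.atLeast_Suc_lessThan[of m m'] mult.assoc)
  finally show ?case .
qed

definition total_weight :: "nat \<Rightarrow> (point \<Rightarrow> nat) \<Rightarrow> 'k" where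
  "total_weight i s = (\<Prod>k<length K. layer_matrix (K ! k) (level_state (s(P := i)) k) (level_state s (Suc k)))"

text \<open>One product over all arcs, read along the strand on the left and by layers on the right;
  \<open>regroup\<close> passes from one to the other.\<close>

lemma path_total_weight: "path_weight i 0 s * \<Phi> (env i s) = total_weight i s"
proof -
  let ?F = "\<lambda>(x, y, e). event_weight e ((s(P := i)) x) (s y)"
  have "path_weight i 0 s = (\<Prod>k\<in>{..<N}. ?F (pt k, next (pt k), ev (pt k)))"
    by (simp add: path_weight_def pt_Suc atLeast0LessThan)
  also have "\<dots> = (\<Prod>x\<in>pts. ?F (x, next x, ev x))"
    using prod.reindex[OF pt_inj, of "\<lambda>x. ?F (x, next x, ev x)"] by (simp only: pt_image comp_def)
  also have "\<dots> = (\<Prod>m<length K. prod_list (map (\<lambda>a. ?F (directed a)) (arcs D m)))"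
    by (rule regroup)
  finally have "path_weight i 0 s * \<Phi> (env i s) = (\<Prod>m<length K. prod_list (map (\<lambda>a. ?F (directed a)) (arcs D m)) *
      reduced_factor C (snd (K ! m)) (env i s (m, SWNE)) (env i s (m, NWSE)))"
    by (simp add: weight_product_def prod.distrib)
  also have "\<dots> = total_weight i s"
    unfolding total_weight_def by (rule prod.cong[OF HOL.refl]) (simp only: lessThan_iff layer_weight)
  finally show ?thesis .
qed

lemma set_points_from_all: "set (points_from (Suc 0) (Suc (length K))) = pts"
proof -
  have "lev 0 = []" by simp
  then have "0 < i" if "j < length (lev i)" for i j using that by (cases i) auto
  then show ?thesis unfolding set_points_from points_def by fastforce
qed

lemma distinct_points_from: "distinct (points_from m m')"
proof (induction m')
  case (Suc m')
  show ?case
  proof (cases "m \<le> m'")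
    case True
    have "points_from m (Suc m') = points_from m m' @ layer_points m'" using True by simp
    moreover have "set (points_from m m') \<inter> set (layer_points m') = {}"
      unfolding set_points_from by auto
    moreover have "distinct (layer_points m')" by (simp add: distinct_map inj_on_def)
    ultimately show ?thesis using Suc by (simp only: distinct_append)
  qed simp
qed simp

lemma P_bounds: "0 < fst P" "fst P < length K" "snd P < length (lev (fst P))"
proof -
  show 1: "snd P < length (lev (fst P))" using P_in by (cases P) (simp add: points_def)
  show "0 < fst P" using 1 by (cases "fst P") auto
  have "fst P \<le> length K" using P_in by (cases P) (simp add: points_def)
  then show "fst P < length K" using 1 closed by (cases "fst P = length K") auto
qed

text \<open>Both sides are a sum over the states of all points. Summation along the strand gives the
  bead word. Summation by levels splits at the level of \<open>P\<close>: the part below sees the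
  state on arrival, the part above the state on departure.\<close>

theorem beads_cut_sum:
  "(\<Sum>i<n. \<Sum>j<n. a i j * beads (traversal D P) \<Phi> v (t i j)) =
    cut_sum a K (length (lev (fst P))) (fst P) (snd P)"
proof -
  let ?ip = "fst P" and ?jp = "snd P" and ?L = "length K"
  define s :: "point \<Rightarrow> nat" where "s x = 0" for x
  let ?all = "points_from (Suc 0) (Suc ?L)"
  have path: "(\<Sum>j<n. a i j * beads (traversal D P) \<Phi> v (t i j)) =
      state_total n ?all (\<lambda>s. a i (s P) * total_weight i s) s" if i: "i < n" for i
  proof -
    have "(\<Sum>j<n. a i j * beads (seg 0 N) \<Phi> v (t ((s(P := i)) (pt 0)) j)) =
      state_total n (map pt [Suc 0..<Suc N]) (\<lambda>s. a i (s P) * path_weight i 0 s * \<Phi> (env i s)) (s(P := i))"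
      by (rule beads_path) (use i in auto)
    also have "\<dots> = state_total n (map pt [Suc 0..<Suc N]) (\<lambda>s. a i (s P) * total_weight i s) (s(P := i))"
      by (simp only: mult.assoc path_total_weight)
    also have "\<dots> = state_total n ?all (\<lambda>s. a i (s P) * total_weight i s) (s(P := i))"
    proof (rule state_total_perm)
      show "distinct (map pt [Suc 0..<Suc N])"
        using pt_inj' by (simp add: distinct_map atLeastLessThanSuc_atLeastAtMost del: upt_Suc)
      show "distinct ?all" by (rule distinct_points_from)
      have "pt ` {Suc 0..N} = pts"
      proof -
        have "pt ` {Suc 0..N} \<subseteq> pts" using pt_in by blast
        moreover have "card (pt ` {Suc 0..N}) = N" using card_image[OF pt_inj'] by simp
        ultimately show ?thesis using card_subset_eq[OF finite_points] by blast
      qed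
      then show "set (map pt [Suc 0..<Suc N]) = set ?all"
        unfolding set_points_from_all by (simp add: atLeastLessThanSuc_atLeastAtMost del: upt_Suc)
    qed
    also have "\<dots> = state_total n ?all (\<lambda>s. a i (s P) * total_weight i s) s"
      by (rule state_total_upd_mem[OF distinct_points_from]) (simp only: set_points_from_all P_in)
    finally show ?thesis by (simp add: traversal_seg)
  qed
  let ?lo = "points_from (Suc 0) (Suc ?ip)" and ?hi = "points_from (Suc ?ip) (Suc ?L)"
  have all: "?all = ?lo @ ?hi"
  proof -
    have "[Suc 0..<Suc ?L] = [Suc 0..<Suc ?ip] @ [Suc ?ip..<Suc ?L]"
      using P_bounds upt_add_eq_append[of "Suc 0" "Suc ?ip" "?L - ?ip"] by simp
    then show ?thesis by (simp only: map_append concat_append)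
  qed
  let ?low = "\<lambda>s. \<Prod>k\<in>{0..<?ip}. layer_matrix (K ! k) (level_state s k) (level_state s (Suc k))"
  let ?high = "\<lambda>s. \<Prod>k\<in>{?ip..<?L}. layer_matrix (K ! k) (level_state s k) (level_state s (Suc k))"
  \<comment> \<open>Layers below \<open>P\<close> never use the departure state; in the layers
    above, the replaced value may be used at both ends, since \<open>P\<close> is not an upper end
    there.\<close>
  have split: "total_weight i s = ?low s * (\<Prod>k\<in>{?ip..<?L}. layer_matrix (K ! k) (level_state (s(P := i)) k) (level_state (s(P := i)) (Suc k)))" for i s
  proof -
    have "total_weight i s = (\<Prod>k\<in>{0..<?ip}. layer_matrix (K ! k) (level_state (s(P := i)) k) (level_state s (Suc k))) *
      (\<Prod>k\<in>{?ip..<?L}. layer_matrix (K ! k) (level_state (s(P := i)) k) (level_state s (Suc k)))"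
      unfolding total_weight_def using P_bounds by (simp add: prod.atLeastLessThan_concat lessThan_atLeast0)
    also have "(\<Prod>k\<in>{0..<?ip}. layer_matrix (K ! k) (level_state (s(P := i)) k) (level_state s (Suc k))) = ?low s"
      by (rule prod.cong) (simp_all add: level_state_upd)
    also have "(\<Prod>k\<in>{?ip..<?L}. layer_matrix (K ! k) (level_state (s(P := i)) k) (level_state s (Suc k))) =
      (\<Prod>k\<in>{?ip..<?L}. layer_matrix (K ! k) (level_state (s(P := i)) k) (level_state (s(P := i)) (Suc k)))"
      by (rule prod.cong) (simp_all add: level_state_upd[of "Suc _"])
    finally show ?thesis .
  qed
  have P_hi: "P \<notin> set ?hi" unfolding set_points_from by simp
  have upper: "transfer (drop ?ip K) ((level_state s ?ip)[?jp := i]) [] = state_total n ?hi (\<lambda>s. ?high (s(P := i))) s"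
    if "level_state s ?ip \<in> states (length (lev ?ip))" "i < n" for s i
  proof -
    have e: "(level_state s ?ip)[?jp := i] = level_state (s(P := i)) ?ip"
      using P_bounds by (intro nth_equalityI) (auto simp: level_state_def nth_list_update prod_eq_iff)
    have "level_state (s(P := i)) ?ip \<in> states (length (lev ?ip))"
      using that set_update_subset_insert[of "level_state s ?ip" ?jp i] unfolding e[symmetric] states_def by auto
    from transfer_total[OF _ order_refl this, of "\<lambda>_. 1"] P_bounds
    have "transfer (drop ?ip K) (level_state (s(P := i)) ?ip) [] = state_total n ?hi ?high (s(P := i))"
      by (simp add: closed)
    then show ?thesis unfolding e state_total_upd[OF P_hi] .
  qed
  have "cut_sum a K (length (lev ?ip)) ?ip ?jp =
    (\<Sum>X\<in>states (length (lev ?ip)). transfer (drop 0 (take ?ip K)) (level_state s 0) X *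
      (\<Sum>m<n. a m (X ! ?jp) * transfer (drop ?ip K) (X[?jp := m]) []))"
    by (simp add: cut_sum_def level_state_def)
  also have "\<dots> = state_total n ?lo (\<lambda>s. ?low s *
      (\<Sum>m<n. a m (level_state s ?ip ! ?jp) * transfer (drop ?ip K) ((level_state s ?ip)[?jp := m]) [])) s"
    by (rule transfer_total) (use P_bounds in \<open>auto simp: level_state_def\<close>)
  also have "\<dots> = state_total n ?lo (\<lambda>s. \<Sum>m<n. state_total n ?hi (\<lambda>s. a m (s P) * total_weight m s) s) s"
  proof (rule state_total_cong)
    fix s' assume s': "\<And>x. x \<in> set ?lo \<Longrightarrow> s' x < n"
    have in_st: "level_state s' ?ip \<in> states (length (lev ?ip))"
      using s' P_bounds unfolding set_points_from level_state_def states_def by auto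
    have lP: "level_state s' ?ip ! ?jp = s' P" using P_bounds by (simp add: level_state_def)
    have "?low s' * (a m (s' P) * state_total n ?hi (\<lambda>s. ?high (s(P := m))) s') =
      state_total n ?hi (\<lambda>s. a m (s P) * total_weight m s) s'" for m
    proof -
      have "state_total n ?hi (\<lambda>s. a m (s P) * total_weight m s) s' =
        state_total n ?hi (\<lambda>s. (a m (s P) * ?low s) * ?high (s(P := m))) s'"
        unfolding split by (simp only: mult.assoc)
      also have "\<dots> = (a m (s' P) * ?low s') * state_total n ?hi (\<lambda>s. ?high (s(P := m))) s'"
      proof (rule state_total_factor)
        fix s2 assume s2: "\<And>x. x \<notin> set ?hi \<Longrightarrow> s2 x = s' x"
        have "level_state s2 k = level_state s' k" if "k \<le> ?ip" for k
        proof (rule level_state_cong)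
          fix x :: point assume "fst x = k"
          then have "x \<notin> set ?hi" using that unfolding set_points_from by simp
          then show "s2 x = s' x" by (rule s2)
        qed
        then have "?low s2 = ?low s'" by (intro prod.cong) simp_all
        then show "a m (s2 P) * ?low s2 = a m (s' P) * ?low s'" using s2[OF P_hi] by simp
      qed
      finally show ?thesis by (simp add: mult_ac)
    qed
    then show "?low s' * (\<Sum>m<n. a m (level_state s' ?ip ! ?jp) * transfer (drop ?ip K) ((level_state s' ?ip)[?jp := m]) []) =
      (\<Sum>m<n. state_total n ?hi (\<lambda>s. a m (s P) * total_weight m s) s')"
      unfolding sum_distrib_left lP by (intro sum.cong[OF HOL.refl]) (simp only: upper[OF in_st] lessThan_iff)
  qed
  also have "\<dots> = (\<Sum>m<n. state_total n ?all (\<lambda>s. a m (s P) * total_weight m s) s)"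
    unfolding all state_total_append state_total_sum ..
  finally show ?thesis using path by simp
qed

end

section \<open>Local moves\<close>

context twist
begin

text \<open>T is a coalgebra automorphism. A T inside a crossing factor can therefore be absorbed
  into the matrix coefficients.\<close>

lemma comatrix_T:
  assumes "comatrix n t" shows "comatrix n (\<lambda>i j. T (t i j))"
proof -
  have "sweedler C B (T (t i j)) = (\<Sum>k<n. B (T (t i k)) (T (t k j)))"
    if "i < n" "j < n" "bilinear_form C B" for i j B
  proof -
    have "bilinear_form C (\<lambda>x y. B (T x) (T y))"
      using that(3) by (intro bilinI lin_T[of "B _"] lin_T[of "\<lambda>x. B x _"]) (auto simp: bilinear_form_def)
    then show ?thesis
      unfolding sweedler_T[OF that(3)] using assms that by (simp add: comatrix_def)
  qed
  then show ?thesis using assms by (simp add: comatrix_def counit_Td counit_Tu)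
qed

lemma sweedler2_comatrix:
  assumes "comatrix n u" "comatrix n v" "i < n" "j < n" "p < n" "q < n"
    and l: "\<And>x x' y'. lin (\<lambda>y. f x x' y y')" "\<And>x x' y. lin (\<lambda>y'. f x x' y y')"
      "\<And>x' y y'. lin (\<lambda>x. f x x' y y')" "\<And>x y y'. lin (\<lambda>x'. f x x' y y')"
  shows "sweedler C (\<lambda>x x'. sweedler C (\<lambda>y y'. f x x' y y') (v p q)) (u i j) =
    (\<Sum>a<n. \<Sum>b<n. f (u i a) (u a j) (v p b) (v b q))"
proof -
  have "bilinear_form C (\<lambda>x x'. sweedler C (\<lambda>y y'. f x x' y y') (v p q))"
    by (intro bilinI lin_sweedler_param l)
  then have "sweedler C (\<lambda>x x'. sweedler C (\<lambda>y y'. f x x' y y') (v p q)) (u i j) =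
    (\<Sum>a<n. sweedler C (\<lambda>y y'. f (u i a) (u a j) y y') (v p q))"
    using assms(1,3,4) by (simp add: comatrix_def)
  also have "\<dots> = (\<Sum>a<n. \<Sum>b<n. f (u i a) (u a j) (v p b) (v b q))"
    using assms(2,5,6) l by (intro sum.cong[OF HOL.refl]) (simp add: comatrix_def bilinear_form_def)
  finally show ?thesis .
qed

definition delta2 :: "nat \<Rightarrow> nat \<Rightarrow> nat \<Rightarrow> nat \<Rightarrow> 'k" where
  "delta2 i j p q = (if i = j then 1 else 0) * (if p = q then 1 else 0)"

text \<open>The first two identities are the invertibility of \<open>b\<close>, the last two the
  mixed axioms. In the latter the two transitions of the second strand are composed in the opposite
  order, so it is a partial transpose that gets inverted.\<close>

lemma form_inverse_comatrix:
  assumes "comatrix n u" "comatrix n v" "i < n" "j < n" "p < n" "q < n"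
  shows "(\<Sum>a<n. \<Sum>c<n. b (u i a) (v p c) * b' (u a j) (v c q)) = delta2 i j p q"
    "(\<Sum>a<n. \<Sum>c<n. b' (u i a) (v p c) * b (u a j) (v c q)) = delta2 i j p q"
    "(\<Sum>a<n. \<Sum>c<n. b (u i a) (T (v c q)) * b' (u a j) (v p c)) = delta2 i j p q"
    "(\<Sum>a<n. \<Sum>c<n. b' (u i a) (v c q) * b (u a j) (T (v p c))) = delta2 i j p q"
proof -
  have e: "\<epsilon> (u i j) * \<epsilon> (v p q) = delta2 i j p q"
    using assms by (simp add: comatrix_def delta2_def)
  have fi: "conv2 b' b (u i j) (v p q) = \<epsilon> (u i j) * \<epsilon> (v p q)" "conv2 b b' (u i j) (v p q) = \<epsilon> (u i j) * \<epsilon> (v p q)"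
    using form_inverse by (simp_all add: is_form_inverse_iff)
  have lT: "lin (\<lambda>x. b y (T x))" "lin (\<lambda>x. b (T x) y)" for y by (rule lin_T[OF lin_b(1)] lin_T[OF lin_b(2)])+
  note l = lin_mult_left lin_mult_right lin_b lT
  show "(\<Sum>a<n. \<Sum>c<n. b (u i a) (v p c) * b' (u a j) (v c q)) = delta2 i j p q"
    using fi(2)[unfolded conv2_def] unfolding e
    by (subst (asm) sweedler2_comatrix[OF assms(1,2,3-6)]) (auto intro!: l)
  show "(\<Sum>a<n. \<Sum>c<n. b' (u i a) (v p c) * b (u a j) (v c q)) = delta2 i j p q"
    using fi(1)[unfolded conv2_def] unfolding e
    by (subst (asm) sweedler2_comatrix[OF assms(1,2,3-6)]) (auto intro!: l)
  show "(\<Sum>a<n. \<Sum>c<n. b (u i a) (T (v c q)) * b' (u a j) (v p c)) = delta2 i j p q"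
    using mixed_inverse(1)[where c = "u i j" and d = "v p q"] unfolding e
    by (subst (asm) sweedler2_comatrix[OF assms(1,2,3-6)]) (auto intro!: l simp del: b_Td b_Tu)
  show "(\<Sum>a<n. \<Sum>c<n. b' (u i a) (v c q) * b (u a j) (T (v p c))) = delta2 i j p q"
    using mixed_inverse(2)[where c = "u i j" and d = "v p q"] unfolding e
    by (subst (asm) sweedler2_comatrix[OF assms(1,2,3-6)]) (auto intro!: l simp del: b_Td b_Tu)
qed

lemma yang_baxter_comatrix:
  assumes c: "comatrix n u" "comatrix n v" "comatrix n w"
    and i: "i < n" "j < n" "p < n" "q < n" "x < n" "y < n"
  shows "(\<Sum>a<n. \<Sum>c<n. \<Sum>e<n. b (u i a) (v p c) * b (u a j) (w x e) * b (v c q) (w e y)) =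
    (\<Sum>a<n. \<Sum>c<n. \<Sum>e<n. b (u a j) (v c q) * b (u i a) (w e y) * b (v p c) (w x e))"
proof -
  note l = lin_mult_left lin_mult_right lin_b
  have w: "sweedler C (\<lambda>e1 e2. F e1 e2) (w x y) = (\<Sum>e<n. F (w x e) (w e y))"
    if "\<And>e1. lin (F e1)" "\<And>e2. lin (\<lambda>e1. F e1 e2)" for F
    using c(3) i(5,6) that by (simp add: comatrix_def bilinear_form_def)
  have 1: "sweedler C (\<lambda>c1 c2. sweedler C (\<lambda>d1 d2. sweedler C (\<lambda>e1 e2. b c1 d1 * b c2 e1 * b d2 e2) (w x y)) (v p q)) (u i j) =
    (\<Sum>a<n. \<Sum>c<n. \<Sum>e<n. b (u i a) (v p c) * b (u a j) (w x e) * b (v c q) (w e y))"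
    by (subst sweedler2_comatrix[OF c(1,2) i(1-4)])
      (auto intro!: l lin_sum_intro sum.cong simp: w l)
  have 2: "sweedler C (\<lambda>c1 c2. sweedler C (\<lambda>d1 d2. sweedler C (\<lambda>e1 e2. b c2 d2 * b c1 e2 * b d1 e1) (w x y)) (v p q)) (u i j) =
    (\<Sum>a<n. \<Sum>c<n. \<Sum>e<n. b (u a j) (v c q) * b (u i a) (w e y) * b (v p c) (w x e))"
    by (subst sweedler2_comatrix[OF c(1,2) i(1-4)])
      (auto intro!: l lin_sum_intro sum.cong simp: w l)
  show ?thesis using yang_baxter[of "w x y" "v p q" "u i j"] unfolding 1 2 .
qed

end

text \<open>Matrices acting on two strands, with entries \<open>A i j p q\<close> for the transitions \<open>i \<rightarrow> j\<close> of the first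
  and \<open>p \<rightarrow> q\<close> of the second strand.\<close>

type_synonym 'k matrix2 = "nat \<Rightarrow> nat \<Rightarrow> nat \<Rightarrow> nat \<Rightarrow> 'k"

section \<open>Yang-Baxter equations under reversal of single strands\<close>

locale two_strands =
  fixes n :: nat and scalars :: "'k::field itself"
begin

definition mult2 :: "'k matrix2 \<Rightarrow> 'k matrix2 \<Rightarrow> 'k matrix2" where
  "mult2 A B i j p q = (\<Sum>a<n. \<Sum>b<n. A i a p b * B a j b q)"

definition one2 :: "'k matrix2" where
  "one2 i j p q = (if i = j then 1 else 0) * (if p = q then 1 else 0)"

definition eq2 :: "'k matrix2 \<Rightarrow> 'k matrix2 \<Rightarrow> bool" where
  "eq2 A B \<longleftrightarrow> (\<forall>i<n. \<forall>j<n. \<forall>p<n. \<forall>q<n. A i j p q = B i j p q)"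

definition inverse2 :: "'k matrix2 \<Rightarrow> 'k matrix2 \<Rightarrow> bool" where
  "inverse2 A B \<longleftrightarrow> eq2 (mult2 A B) one2 \<and> eq2 (mult2 B A) one2"

lemma mult2_assoc: "mult2 (mult2 A B) E = mult2 A (mult2 B E)"
proof (intro ext)
  fix i j p q
  have "mult2 (mult2 A B) E i j p q = (\<Sum>c<n. \<Sum>d<n. \<Sum>a<n. \<Sum>b<n. A i a p b * B a c b d * E c j d q)"
    by (simp add: mult2_def sum_distrib_right)
  also have "\<dots> = (\<Sum>c<n. \<Sum>a<n. \<Sum>b<n. \<Sum>d<n. A i a p b * B a c b d * E c j d q)"
    by (rule sum.cong[OF HOL.refl]) (subst sum.swap, rule sum.cong[OF HOL.refl], rule sum.swap)
  also have "\<dots> = (\<Sum>a<n. \<Sum>b<n. \<Sum>c<n. \<Sum>d<n. A i a p b * B a c b d * E c j d q)"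
    by (subst sum.swap, rule sum.cong[OF HOL.refl], rule sum.swap)
  also have "\<dots> = mult2 A (mult2 B E) i j p q"
    by (simp add: mult2_def sum_distrib_left mult.assoc)
  finally show "mult2 (mult2 A B) E i j p q = mult2 A (mult2 B E) i j p q" .
qed

lemma mult2_cong: "eq2 A A' \<Longrightarrow> eq2 B B' \<Longrightarrow> eq2 (mult2 A B) (mult2 A' B')"
  by (simp add: eq2_def mult2_def)

lemma mult2_one: "eq2 (mult2 A one2) A" "eq2 (mult2 one2 A) A"
  by (simp_all add: eq2_def mult2_def one2_def if_distrib[of "\<lambda>x. x * _"] if_distrib[of "\<lambda>x. _ * x"]
      sum.delta sum.delta' cong: if_cong)

lemma eq2_refl: "eq2 A A" and eq2_sym: "eq2 A B \<Longrightarrow> eq2 B A" and eq2_trans [trans]: "eq2 A B \<Longrightarrow> eq2 B E \<Longrightarrow> eq2 A E"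
  by (simp_all add: eq2_def)

lemma conjugate2:
  assumes "eq2 (mult2 A M) (mult2 M' A)" "inverse2 A B" shows "eq2 (mult2 B M') (mult2 M B)"
proof -
  have i: "eq2 (mult2 A B) one2" "eq2 (mult2 B A) one2" using assms(2) by (simp_all add: inverse2_def)
  have "eq2 (mult2 B M') (mult2 B (mult2 M' (mult2 A B)))"
    by (intro mult2_cong eq2_refl eq2_sym[OF eq2_trans[OF mult2_cong[OF eq2_refl i(1)] mult2_one(1)]])
  also have "mult2 B (mult2 M' (mult2 A B)) = mult2 B (mult2 (mult2 M' A) B)" by (simp add: mult2_assoc)
  also have "eq2 (mult2 B (mult2 (mult2 M' A) B)) (mult2 B (mult2 (mult2 A M) B))"
    by (intro mult2_cong eq2_refl eq2_sym[OF assms(1)])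
  also have "mult2 B (mult2 (mult2 A M) B) = mult2 (mult2 B A) (mult2 M B)" by (simp add: mult2_assoc)
  also have "eq2 (mult2 (mult2 B A) (mult2 M B)) (mult2 M B)"
    by (rule eq2_trans[OF mult2_cong[OF i(2) eq2_refl] mult2_one(2)])
  finally show ?thesis .
qed

text \<open>The Yang-Baxter equation \<open>A\<^sub>1\<^sub>2 B\<^sub>1\<^sub>3 E\<^sub>2\<^sub>3 = E\<^sub>2\<^sub>3 B\<^sub>1\<^sub>3 A\<^sub>1\<^sub>2\<close> on three strands.\<close>

definition yang_baxter3 :: "'k matrix2 \<Rightarrow> 'k matrix2 \<Rightarrow> 'k matrix2 \<Rightarrow> bool" where
  "yang_baxter3 A B E \<longleftrightarrow> (\<forall>i<n. \<forall>j<n. \<forall>p<n. \<forall>q<n. \<forall>x<n. \<forall>y<n.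
     (\<Sum>a<n. \<Sum>b<n. \<Sum>c<n. A i a p b * B a j x c * E b q c y) =
     (\<Sum>a<n. \<Sum>b<n. \<Sum>c<n. E p b x c * B i a c y * A a j b q))"

lemma yang_baxter3_transpose:
  assumes "yang_baxter3 A B E"
  shows "yang_baxter3 (\<lambda>i j p q. A j i q p) (\<lambda>i j p q. B j i q p) (\<lambda>i j p q. E j i q p)"
  unfolding yang_baxter3_def
proof (intro allI impI)
  fix i j p q x y assume "i < n" "j < n" "p < n" "q < n" "x < n" "y < n"
  then have "(\<Sum>a<n. \<Sum>b<n. \<Sum>c<n. A j a q b * B a i y c * E b p c x) =
     (\<Sum>a<n. \<Sum>b<n. \<Sum>c<n. E q b y c * B j a c x * A a i b p)"
    using assms by (simp add: yang_baxter3_def)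
  then show "(\<Sum>a<n. \<Sum>b<n. \<Sum>c<n. A a i b p * B j a c x * E q b y c) =
     (\<Sum>a<n. \<Sum>b<n. \<Sum>c<n. E b p c x * B a i y c * A j a q b)"
    by (simp add: mult_ac)
qed

lemma sum3_rotate: "(\<Sum>a<n. \<Sum>b<n. \<Sum>c<n. F a b c) = (\<Sum>b<n. \<Sum>c<n. \<Sum>a<n. F a b c)"
  for F :: "nat \<Rightarrow> nat \<Rightarrow> nat \<Rightarrow> 'k"
  by (subst sum.swap, rule sum.cong[OF HOL.refl], rule sum.swap)

text \<open>For a fixed transition of the third strand the equation says that \<open>A\<close>
  intertwines two matrices on strands 1 and 2; for a fixed transition of the first strand, that
  \<open>E\<close> intertwines two matrices on strands 2 and 3. In this form
  \<open>conjugate2\<close> can replace \<open>A\<close> or \<open>E\<close> by its inverse.\<close>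

lemma yang_baxter3_iff:
  "yang_baxter3 A B E \<longleftrightarrow> (\<forall>x<n. \<forall>y<n.
    eq2 (mult2 A (\<lambda>i j p q. \<Sum>c<n. B i j x c * E p q c y)) (mult2 (\<lambda>i j p q. \<Sum>c<n. E p q x c * B i j c y) A))"
  "yang_baxter3 A B E \<longleftrightarrow> (\<forall>i<n. \<forall>j<n.
    eq2 (mult2 E (\<lambda>p q x y. \<Sum>a<n. B i a x y * A a j p q)) (mult2 (\<lambda>p q x y. \<Sum>a<n. A i a p q * B a j x y) E))"
proof -
  have q1: "(\<forall>i<n. \<forall>j<n. \<forall>p<n. \<forall>q<n. \<forall>x<n. \<forall>y<n. f i j p q x y = g i j p q x y) \<longleftrightarrow>
    (\<forall>x<n. \<forall>y<n. \<forall>i<n. \<forall>j<n. \<forall>p<n. \<forall>q<n. f i j p q x y = g i j p q x y)" for f g :: "nat \<Rightarrow> nat \<Rightarrow> nat \<Rightarrow> nat \<Rightarrow> nat \<Rightarrow> nat \<Rightarrow> 'k"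
    by (intro iffI allI impI; simp)
  have q2: "(\<forall>i<n. \<forall>j<n. \<forall>p<n. \<forall>q<n. \<forall>x<n. \<forall>y<n. f i j p q x y = g i j p q x y) \<longleftrightarrow>
    (\<forall>i<n. \<forall>j<n. \<forall>p<n. \<forall>q<n. \<forall>x<n. \<forall>y<n. g i j p q x y = f i j p q x y)" for f g :: "nat \<Rightarrow> nat \<Rightarrow> nat \<Rightarrow> nat \<Rightarrow> nat \<Rightarrow> nat \<Rightarrow> 'k"
    by (intro iffI allI impI; simp)
  show "yang_baxter3 A B E \<longleftrightarrow> (\<forall>x<n. \<forall>y<n.
    eq2 (mult2 A (\<lambda>i j p q. \<Sum>c<n. B i j x c * E p q c y)) (mult2 (\<lambda>i j p q. \<Sum>c<n. E p q x c * B i j c y) A))"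
  proof -
    have "mult2 A (\<lambda>i j p q. \<Sum>c<n. B i j x c * E p q c y) i j p q =
      (\<Sum>a<n. \<Sum>b<n. \<Sum>c<n. A i a p b * B a j x c * E b q c y)"
      "mult2 (\<lambda>i j p q. \<Sum>c<n. E p q x c * B i j c y) A i j p q =
      (\<Sum>a<n. \<Sum>b<n. \<Sum>c<n. E p b x c * B i a c y * A a j b q)" for i j p q x y
      unfolding mult2_def sum_distrib_left sum_distrib_right by (simp_all only: mult.assoc)
    then show ?thesis
      unfolding yang_baxter3_def eq2_def
      by (simp only:) (rule q1)
  qed
  have 1: "mult2 E (\<lambda>p q x y. \<Sum>a<n. B i a x y * A a j p q) p q x y =
    (\<Sum>a<n. \<Sum>b<n. \<Sum>c<n. E p b x c * B i a c y * A a j b q)" for i j p q x y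
    unfolding mult2_def sum_distrib_left by (subst sum3_rotate) (simp only: mult.assoc)
  have 2: "mult2 (\<lambda>p q x y. \<Sum>a<n. A i a p q * B a j x y) E p q x y =
    (\<Sum>a<n. \<Sum>b<n. \<Sum>c<n. A i a p b * B a j x c * E b q c y)" for i j p q x y
    unfolding mult2_def sum_distrib_right by (subst sum3_rotate) (simp only: mult.assoc)
  show "yang_baxter3 A B E \<longleftrightarrow> (\<forall>i<n. \<forall>j<n.
    eq2 (mult2 E (\<lambda>p q x y. \<Sum>a<n. B i a x y * A a j p q)) (mult2 (\<lambda>p q x y. \<Sum>a<n. A i a p q * B a j x y) E))"
    unfolding yang_baxter3_def eq2_def 1 2 by (rule q2)
qed

text \<open>Transposition on the third strand reverses the order in which \<open>B\<close> and
  \<open>E\<close> act on it. It thereby interchanges the two matrices that \<open>A\<close>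
  intertwines, and the inverse of \<open>A\<close> intertwines them in the new order.\<close>

lemma yang_baxter3_flip3:
  assumes "yang_baxter3 A B E" "inverse2 A A'"
  shows "yang_baxter3 A' (\<lambda>i j x y. B i j y x) (\<lambda>i j x y. E i j y x)"
  unfolding yang_baxter3_iff(1)
proof (intro allI impI)
  fix x y assume xy: "x < n" "y < n"
  have "eq2 (mult2 A' (\<lambda>i j p q. \<Sum>c<n. E p q y c * B i j c x)) (mult2 (\<lambda>i j p q. \<Sum>c<n. B i j y c * E p q c x) A')"
    using assms xy by (intro conjugate2[OF _ assms(2)]) (simp add: yang_baxter3_iff(1))
  then show "eq2 (mult2 A' (\<lambda>i j p q. \<Sum>c<n. B i j c x * E p q y c)) (mult2 (\<lambda>i j p q. \<Sum>c<n. E p q c x * B i j y c) A')"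
    by (simp add: mult.commute)
qed

lemma yang_baxter3_flip1:
  assumes "yang_baxter3 A B E" "inverse2 E E'"
  shows "yang_baxter3 (\<lambda>i j p q. A j i p q) (\<lambda>i j p q. B j i p q) E'"
  unfolding yang_baxter3_iff(2)
proof (intro allI impI)
  fix i j assume ij: "i < n" "j < n"
  have "eq2 (mult2 E' (\<lambda>p q x y. \<Sum>a<n. A j a p q * B a i x y)) (mult2 (\<lambda>p q x y. \<Sum>a<n. B j a x y * A a i p q) E')"
    using assms ij by (intro conjugate2[OF _ assms(2)]) (simp add: yang_baxter3_iff(2))
  then show "eq2 (mult2 E' (\<lambda>p q x y. \<Sum>a<n. B a i x y * A j a p q)) (mult2 (\<lambda>p q x y. \<Sum>a<n. A a i p q * B j a x y) E')"
    by (simp add: mult.commute)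
qed

text \<open>The middle strand takes part in both \<open>A\<close> and \<open>E\<close>, so both are
  inverted: \<open>E\<close> directly, and \<open>A\<close> after transposition on the middle
  strand. In the applications the mixed axioms supply the second inverse.\<close>

lemma yang_baxter3_flip2:
  assumes yb: "yang_baxter3 A B E" and V: "inverse2 E V" and P: "inverse2 (\<lambda>i j p q. A i j q p) P"
  shows "yang_baxter3 P B (\<lambda>p q x y. V q p x y)"
  unfolding yang_baxter3_iff(1)
proof (intro allI impI)
  fix x y assume xy: "x < n" "y < n"
  let ?N = "\<lambda>i j p q. \<Sum>c<n. V q p x c * B i j c y" and ?M = "\<lambda>i j p q. \<Sum>c<n. B i j x c * V q p c y"
  have "eq2 (mult2 (\<lambda>i j p q. A i j q p) ?N) (mult2 ?M (\<lambda>i j p q. A i j q p))"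
    unfolding eq2_def
  proof (intro allI impI)
    fix i j p q assume ij: "i < n" "j < n" "p < n" "q < n"
    have "eq2 (mult2 V (\<lambda>p q x y. \<Sum>a<n. A i a p q * B a j x y)) (mult2 (\<lambda>p q x y. \<Sum>a<n. B i a x y * A a j p q) V)"
      using yb ij by (intro conjugate2[OF _ V]) (simp add: yang_baxter3_iff(2))
    then have "mult2 V (\<lambda>p q x y. \<Sum>a<n. A i a p q * B a j x y) q p x y =
        mult2 (\<lambda>p q x y. \<Sum>a<n. B i a x y * A a j p q) V q p x y"
      using ij xy by (simp add: eq2_def)
    moreover have "mult2 V (\<lambda>p q x y. \<Sum>a<n. A i a p q * B a j x y) q p x y =
        mult2 (\<lambda>i j p q. A i j q p) ?N i j p q"
      unfolding mult2_def sum_distrib_left by (subst (2) sum3_rotate) (simp only: mult_ac)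
    moreover have "mult2 (\<lambda>p q x y. \<Sum>a<n. B i a x y * A a j p q) V q p x y =
        mult2 ?M (\<lambda>i j p q. A i j q p) i j p q"
      unfolding mult2_def sum_distrib_right by (subst (2) sum3_rotate) (simp only: mult_ac)
    ultimately show "mult2 (\<lambda>i j p q. A i j q p) ?N i j p q = mult2 ?M (\<lambda>i j p q. A i j q p) i j p q" by simp
  qed
  from conjugate2[OF this P]
  show "eq2 (mult2 P ?M) (mult2 ?N P)" .
qed

end

section \<open>Transfer matrices of words of layers\<close>

fun fits :: "nat \<Rightarrow> layer list \<Rightarrow> bool" where
  "fits l [] \<longleftrightarrow> True"
| "fits l ((p, g) # w) \<longleftrightarrow> p + length (lower g) \<le> l \<and> fits (l - length (lower g) + length (upper g)) w"

text \<open>Like \<open>fits\<close>, it counts strands and ignores their directions; the index sets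
  of the transfer matrices depend on nothing else.\<close>

fun width_after :: "nat \<Rightarrow> layer list \<Rightarrow> nat" where
  "width_after l [] = l"
| "width_after l ((p, g) # w) = width_after (l - length (lower g) + length (upper g)) w"

lemma length_lower_upper [simp]:
  "length (lower (Maximum h)) = 2" "length (upper (Minimum h)) = 2"
  by (cases h; simp)+

sublocale coefficients \<subseteq> two_strands n "TYPE('k)" .

context coefficients
begin

lemma states_length: "X \<in> states l \<Longrightarrow> length X = l"
  by (simp add: states_def)

lemma states_append [simp]: "length X = l \<Longrightarrow> length Y = l' \<Longrightarrow>
    X @ Y \<in> states (l + l') \<longleftrightarrow> X \<in> states l \<and> Y \<in> states l'"
  by (auto simp: states_def)

lemma sum_states_add: "(\<Sum>Z\<in>states (l + l'). f Z) = (\<Sum>X\<in>states l. \<Sum>Y\<in>states l'. f (X @ Y))"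
  by (induction l arbitrary: f) (simp_all add: sum_states_Suc)

lemma sum_states_2: "(\<Sum>Z\<in>states 2. f Z) = (\<Sum>a<n. \<Sum>c<n. f [a, c])"
  by (simp add: numeral_2_eq_2 sum_states_Suc)

text \<open>The vertical lines force all states of the next level except those at the upper end of
  the piece, so only these are summed over.\<close>

lemma transfer_step:
  assumes a: "\<alpha> \<in> states p" and x: "length x = length (lower g)" and b: "\<beta> \<in> states l"
  shows "transfer ((p, g) # w) (\<alpha> @ x @ \<beta>) Y = (\<Sum>z\<in>states (length (upper g)). weight g x z * transfer w (\<alpha> @ z @ \<beta>) Y)"
proof -
  have la: "length \<alpha> = p" and lb: "length \<beta> = l" using a b by (simp_all add: states_def)
  have lm: "layer_matrix (p, g) (\<alpha> @ x @ \<beta>) (\<alpha>' @ z @ \<beta>') = (if \<alpha>' = \<alpha> \<and> \<beta>' = \<beta> then weight g x z else 0)"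
    if "\<alpha>' \<in> states p" "z \<in> states (length (upper g))" for \<alpha>' z \<beta>'
    using that la x by (auto simp: layer_matrix_def states_def)
  have "length (\<alpha> @ x @ \<beta>) - length (lower g) + length (upper g) = p + (length (upper g) + l)"
    using la lb x by simp
  then have "transfer ((p, g) # w) (\<alpha> @ x @ \<beta>) Y =
    (\<Sum>\<alpha>'\<in>states p. \<Sum>z\<in>states (length (upper g)). \<Sum>\<beta>'\<in>states l.
      layer_matrix (p, g) (\<alpha> @ x @ \<beta>) (\<alpha>' @ z @ \<beta>') * transfer w (\<alpha>' @ z @ \<beta>') Y)"
    by (simp only: transfer.simps sum_states_add)
  also have "\<dots> = (\<Sum>\<alpha>'\<in>states p. if \<alpha>' = \<alpha> then
      (\<Sum>z\<in>states (length (upper g)). weight g x z * transfer w (\<alpha> @ z @ \<beta>) Y) else 0)"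
  proof (rule sum.cong[OF HOL.refl])
    fix \<alpha>' assume a': "\<alpha>' \<in> states p"
    have "(\<Sum>\<beta>'\<in>states l. layer_matrix (p, g) (\<alpha> @ x @ \<beta>) (\<alpha>' @ z @ \<beta>') * transfer w (\<alpha>' @ z @ \<beta>') Y) =
        (if \<alpha>' = \<alpha> then weight g x z * transfer w (\<alpha> @ z @ \<beta>) Y else 0)"
      if z: "z \<in> states (length (upper g))" for z
    proof -
      have "(\<Sum>\<beta>'\<in>states l. layer_matrix (p, g) (\<alpha> @ x @ \<beta>) (\<alpha>' @ z @ \<beta>') * transfer w (\<alpha>' @ z @ \<beta>') Y) =
        (\<Sum>\<beta>'\<in>states l. if \<beta>' = \<beta> then (if \<alpha>' = \<alpha> then weight g x z * transfer w (\<alpha> @ z @ \<beta>) Y else 0) else 0)"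
        by (rule sum.cong) (auto simp: lm[OF a' z])
      then show ?thesis using b by simp
    qed
    then show "(\<Sum>z\<in>states (length (upper g)). \<Sum>\<beta>'\<in>states l.
        layer_matrix (p, g) (\<alpha> @ x @ \<beta>) (\<alpha>' @ z @ \<beta>') * transfer w (\<alpha>' @ z @ \<beta>') Y) =
      (if \<alpha>' = \<alpha> then \<Sum>z\<in>states (length (upper g)). weight g x z * transfer w (\<alpha> @ z @ \<beta>) Y else 0)"
      by simp
  qed
  also have "\<dots> = (\<Sum>z\<in>states (length (upper g)). weight g x z * transfer w (\<alpha> @ z @ \<beta>) Y)"
    using a by simp
  finally show ?thesis .
qed

lemma split_states:
  assumes "X \<in> states l" "p + m \<le> l"
  obtains \<alpha> x \<beta> where "X = \<alpha> @ x @ \<beta>" "\<alpha> \<in> states p" "x \<in> states m" "\<beta> \<in> states (l - p - m)"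
proof
  show "X = take p X @ take m (drop p X) @ drop m (drop p X)" by (simp only: append_take_drop_id)
  show "take p X \<in> states p" "take m (drop p X) \<in> states m" "drop m (drop p X) \<in> states (l - p - m)"
    using assms by (auto simp: states_def dest: in_set_takeD in_set_dropD)
qed

lemma transfer_append:
  assumes "X \<in> states l" "fits l v"
  shows "transfer (v @ w) X Y = (\<Sum>Z\<in>states (width_after l v). transfer v X Z * transfer w Z Y)"
  using assms
proof (induction v arbitrary: X l)
  case Nil
  then show ?case by (simp add: if_distrib[of "\<lambda>x. x * _"] cong: if_cong)
next
  case (Cons L v)
  obtain p g where L: "L = (p, g)" by fastforce
  let ?l = "l - length (lower g) + length (upper g)"
  have "transfer ((L # v) @ w) X Y = (\<Sum>Z\<in>states ?l. layer_matrix (p, g) X Z * transfer (v @ w) Z Y)"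
    using Cons.prems by (simp add: L states_length)
  also have "\<dots> = (\<Sum>Z\<in>states ?l. \<Sum>Z'\<in>states (width_after ?l v). layer_matrix (p, g) X Z * transfer v Z Z' * transfer w Z' Y)"
  proof (rule sum.cong[OF HOL.refl])
    fix Z assume Z: "Z \<in> states ?l"
    have "fits ?l v" using Cons.prems(2) by (simp only: L fits.simps)
    from Cons.IH[OF Z this] show "layer_matrix (p, g) X Z * transfer (v @ w) Z Y =
      (\<Sum>Z'\<in>states (width_after ?l v). layer_matrix (p, g) X Z * transfer v Z Z' * transfer w Z' Y)"
      by (simp only: sum_distrib_left mult.assoc)
  qed
  also have "\<dots> = (\<Sum>Z'\<in>states (width_after ?l v). \<Sum>Z\<in>states ?l. layer_matrix (p, g) X Z * transfer v Z Z' * transfer w Z' Y)"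
    by (rule sum.swap)
  also have "\<dots> = (\<Sum>Z\<in>states (width_after l (L # v)). transfer (L # v) X Z * transfer w Z Y)"
    using Cons.prems by (simp add: L states_length sum_distrib_right)
  finally show ?case .
qed

text \<open>Vertical lines beside a word act as the identity. It is this that allows a move to be
  checked on its own strands only.\<close>

lemma transfer_shift:
  assumes "\<alpha> \<in> states p" "\<beta> \<in> states m" "X \<in> states l" "fits l w"
  shows "transfer (shift p w) (\<alpha> @ X @ \<beta>) Y =
    (\<Sum>Z\<in>states (width_after l w). transfer w X Z * (if \<alpha> @ Z @ \<beta> = Y then 1 else 0))"
  using assms(3,4)
proof (induction w arbitrary: X l)
  case Nil
  then show ?case by (simp add: shift_def if_distrib[of "\<lambda>x. x * _"] cong: if_cong)
next
  case (Cons L w)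
  obtain q g where L: "L = (q, g)" by fastforce
  let ?l = "l - length (lower g) + length (upper g)"
  have "q + length (lower g) \<le> l" using Cons.prems(2) by (simp add: L)
  then obtain \<xi> x \<eta> where X: "X = \<xi> @ x @ \<eta>" "\<xi> \<in> states q" "x \<in> states (length (lower g))"
    "\<eta> \<in> states (l - q - length (lower g))"
    by (rule split_states[OF Cons.prems(1)])
  have s1: "\<alpha> @ \<xi> \<in> states (p + q)" "\<eta> @ \<beta> \<in> states (l - q - length (lower g) + m)"
    using assms(1,2) X by (simp_all add: states_length)
  have st: "\<xi> @ z @ \<eta> \<in> states ?l" if "z \<in> states (length (upper g))" for z
    using that X \<open>q + length (lower g) \<le> l\<close> by (auto simp: states_def)
  have "transfer (shift p (L # w)) (\<alpha> @ X @ \<beta>) Y = transfer ((p + q, g) # shift p w) ((\<alpha> @ \<xi>) @ x @ (\<eta> @ \<beta>)) Y"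
    by (simp add: L X(1) shift_def)
  also have "\<dots> = (\<Sum>z\<in>states (length (upper g)). weight g x z * transfer (shift p w) ((\<alpha> @ \<xi>) @ z @ (\<eta> @ \<beta>)) Y)"
    using s1 X(3) by (intro transfer_step) (simp_all add: states_length)
  also have "\<dots> = (\<Sum>z\<in>states (length (upper g)). \<Sum>Z\<in>states (width_after ?l w).
      weight g x z * transfer w (\<xi> @ z @ \<eta>) Z * (if \<alpha> @ Z @ \<beta> = Y then 1 else 0))"
  proof (rule sum.cong[OF HOL.refl])
    fix z assume z: "z \<in> states (length (upper g))"
    have "transfer (shift p w) (\<alpha> @ (\<xi> @ z @ \<eta>) @ \<beta>) Y =
      (\<Sum>Z\<in>states (width_after ?l w). transfer w (\<xi> @ z @ \<eta>) Z * (if \<alpha> @ Z @ \<beta> = Y then 1 else 0))"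
      by (rule Cons.IH[OF st[OF z]]) (use Cons.prems(2) in \<open>simp only: L fits.simps\<close>)
    then show "weight g x z * transfer (shift p w) ((\<alpha> @ \<xi>) @ z @ (\<eta> @ \<beta>)) Y =
      (\<Sum>Z\<in>states (width_after ?l w). weight g x z * transfer w (\<xi> @ z @ \<eta>) Z * (if \<alpha> @ Z @ \<beta> = Y then 1 else 0))"
      by (simp add: sum_distrib_left mult.assoc)
  qed
  also have "\<dots> = (\<Sum>Z\<in>states (width_after ?l w). \<Sum>z\<in>states (length (upper g)).
      weight g x z * transfer w (\<xi> @ z @ \<eta>) Z * (if \<alpha> @ Z @ \<beta> = Y then 1 else 0))"
    by (rule sum.swap)
  also have "\<dots> = (\<Sum>Z\<in>states (width_after l (L # w)). transfer (L # w) X Z * (if \<alpha> @ Z @ \<beta> = Y then 1 else 0))"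
  proof -
    have tr: "transfer ((q, g) # w) X Z = (\<Sum>z\<in>states (length (upper g)). weight g x z * transfer w (\<xi> @ z @ \<eta>) Z)" for Z
      unfolding X(1) using X by (intro transfer_step) (simp_all add: states_length)
    show ?thesis by (simp only: L width_after.simps tr sum_distrib_right)
  qed
  finally show ?case .
qed

definition equivalent :: "nat \<Rightarrow> nat \<Rightarrow> layer list \<Rightarrow> layer list \<Rightarrow> bool" where
  "equivalent l l' v w \<longleftrightarrow> (\<forall>X\<in>states l. \<forall>Y\<in>states l'. transfer v X Y = transfer w X Y)"

lemma equivalent_shift:
  assumes "equivalent l l' v w" "fits l v" "fits l w" "width_after l v = l'" "width_after l w = l'"
    and "X \<in> states m" "p + l \<le> m"
  shows "transfer (shift p v) X Y = transfer (shift p w) X Y"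
proof -
  obtain \<alpha> x \<beta> where X: "X = \<alpha> @ x @ \<beta>" "\<alpha> \<in> states p" "x \<in> states l" "\<beta> \<in> states (m - p - l)"
    by (rule split_states[OF assms(6,7)])
  show ?thesis
    unfolding X(1) transfer_shift[OF X(2,4,3) assms(2)] transfer_shift[OF X(2,4,3) assms(3)] assms(4,5)
    using assms(1) X(3) by (simp add: equivalent_def)
qed

lemma equivalent_sym: "equivalent l l' v w \<Longrightarrow> equivalent l l' w v"
  and equivalent_trans: "equivalent l l' u v \<Longrightarrow> equivalent l l' v w \<Longrightarrow> equivalent l l' u w"
  by (simp_all add: equivalent_def)

lemma equivalent_append:
  assumes "equivalent l l' v v'" "equivalent l' l'' w w'" "fits l v" "fits l v'"
    "width_after l v = l'" "width_after l v' = l'"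
  shows "equivalent l l'' (v @ w) (v' @ w')"
  using assms by (simp add: equivalent_def transfer_append)

text \<open>The two pieces act on disjoint positions, and their weights are scalars that
  commute.\<close>

lemma equivalent_exchange:
  "equivalent (length (lower g) + (r + length (lower h))) (length (upper g) + (r + length (upper h)))
     [(0, g), (length (upper g) + r, h)] [(length (lower g) + r, h), (0, g)]"
  unfolding equivalent_def
proof (intro ballI)
  fix X Y assume X: "X \<in> states (length (lower g) + (r + length (lower h)))"
  obtain e x X' where X': "X = e @ x @ X'" "e \<in> states 0" "x \<in> states (length (lower g))" "X' \<in> states (r + length (lower h))"
    by (rule split_states[OF X, of 0 "length (lower g)"]) auto
  obtain \<rho> x' e' where X'': "X' = \<rho> @ x' @ e'" "\<rho> \<in> states r" "x' \<in> states (length (lower h))" "e' \<in> states 0"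
    by (rule split_states[OF X'(4), of r "length (lower h)"]) auto
  have Xe: "X = [] @ x @ (\<rho> @ x')" "X = (x @ \<rho>) @ x' @ []" using X' X'' by simp_all
  note l = states_length[OF X'(3)] states_length[OF X''(2)] states_length[OF X''(3)]
  have s1: "\<rho> @ x' \<in> states (r + length (lower h))" "x @ \<rho> \<in> states (length (lower g) + r)" "[] \<in> states 0"
    "\<And>z. z \<in> states (length (upper g)) \<Longrightarrow> z @ \<rho> \<in> states (length (upper g) + r)"
    "\<And>z. z \<in> states (length (upper h)) \<Longrightarrow> \<rho> @ z \<in> states (r + length (upper h))"
    using X'(3) X''(2,3) by (simp_all add: states_length)
  have 1: "transfer [(length (upper g) + r, h)] ((z @ \<rho>) @ x' @ []) Y =
      (\<Sum>z'\<in>states (length (upper h)). weight h x' z' * transfer [] ((z @ \<rho>) @ z' @ []) Y)"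
    if "z \<in> states (length (upper g))" for z
    by (rule transfer_step[OF s1(4)[OF that] l(3) s1(3)])
  have 2: "transfer [(0, g)] ([] @ x @ (\<rho> @ z')) Y =
      (\<Sum>z\<in>states (length (upper g)). weight g x z * transfer [] ([] @ z @ (\<rho> @ z')) Y)"
    if "z' \<in> states (length (upper h))" for z'
    by (rule transfer_step[OF s1(3) l(1) s1(5)[OF that]])
  have "transfer [(0, g), (length (upper g) + r, h)] X Y =
    (\<Sum>z\<in>states (length (upper g)). weight g x z * transfer [(length (upper g) + r, h)] ([] @ z @ (\<rho> @ x')) Y)"
    unfolding Xe(1) by (rule transfer_step[OF s1(3) l(1) s1(1)])
  also have "\<dots> = (\<Sum>z\<in>states (length (upper g)). \<Sum>z'\<in>states (length (upper h)).
      weight g x z * (weight h x' z' * transfer [] (z @ \<rho> @ z') Y))"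
    using 1 by (intro sum.cong[OF HOL.refl]) (simp add: sum_distrib_left del: transfer.simps)
  also have "\<dots> = (\<Sum>z'\<in>states (length (upper h)). \<Sum>z\<in>states (length (upper g)).
      weight g x z * (weight h x' z' * transfer [] (z @ \<rho> @ z') Y))"
    by (rule sum.swap)
  also have "\<dots> = (\<Sum>z'\<in>states (length (upper h)). weight h x' z' * transfer [(0, g)] ((x @ \<rho>) @ z' @ []) Y)"
    using 2 by (intro sum.cong[OF HOL.refl]) (simp add: sum_distrib_left mult_ac del: transfer.simps)
  also have "\<dots> = transfer [(length (lower g) + r, h), (0, g)] X Y"
    unfolding Xe(2) by (rule transfer_step[OF s1(2) l(3) s1(3), symmetric])
  finally show "transfer [(0, g), (length (upper g) + r, h)] X Y = transfer [(length (lower g) + r, h), (0, g)] X Y" .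
qed

lemma states_1E: "X \<in> states (Suc 0) \<Longrightarrow> \<exists>x<n. X = [x]"
  and states_2E: "X \<in> states 2 \<Longrightarrow> \<exists>x<n. \<exists>y<n. X = [x, y]"
  and states_3E: "X \<in> states 3 \<Longrightarrow> \<exists>x<n. \<exists>y<n. \<exists>z<n. X = [x, y, z]"
  by (auto simp: states_def numeral_2_eq_2 numeral_3_eq_3 length_Suc_conv)

lemma states_intros [simp]: "[] \<in> states 0" "x < n \<Longrightarrow> [x] \<in> states (Suc 0)"
  "x < n \<Longrightarrow> y < n \<Longrightarrow> [x, y] \<in> states 2"
  by (auto simp: states_def)

lemma crossing_left:
  "z < n \<Longrightarrow> transfer ((0, Crossing k s m) # w) [x, y, z] Y =
    (\<Sum>a<n. \<Sum>c<n. weight (Crossing k s m) [x, y] [a, c] * transfer w [a, c, z] Y)"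
  using transfer_step[of "[]" 0 "[x, y]" "Crossing k s m" "[z]" "Suc 0" w Y] by (simp add: sum_states_2 sum_states_Suc del: transfer.simps weight.simps)

lemma crossing_right:
  "x < n \<Longrightarrow> transfer ((Suc 0, Crossing k s m) # w) [x, y, z] Y =
    (\<Sum>a<n. \<Sum>c<n. weight (Crossing k s m) [y, z] [a, c] * transfer w [x, a, c] Y)"
  using transfer_step[of "[x]" "Suc 0" "[y, z]" "Crossing k s m" "[]" 0 w Y] by (simp add: sum_states_2 sum_states_Suc del: transfer.simps weight.simps)

lemma crossing_two:
  "transfer ((0, Crossing k s m) # w) [x, y] Y =
    (\<Sum>a<n. \<Sum>c<n. weight (Crossing k s m) [x, y] [a, c] * transfer w [a, c] Y)"
  using transfer_step[of "[]" 0 "[x, y]" "Crossing k s m" "[]" 0 w Y] by (simp add: sum_states_2 sum_states_Suc del: transfer.simps weight.simps)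

lemma maximum_left:
  "z < n \<Longrightarrow> transfer ((0, Maximum h) # w) [x, y, z] Y = weight (Maximum h) [x, y] [] * transfer w [z] Y"
  using transfer_step[of "[]" 0 "[x, y]" "Maximum h" "[z]" "Suc 0" w Y] by (simp del: transfer.simps weight.simps)

lemma maximum_right:
  "x < n \<Longrightarrow> transfer ((Suc 0, Maximum h) # w) [x, y, z] Y = weight (Maximum h) [y, z] [] * transfer w [x] Y"
  using transfer_step[of "[x]" "Suc 0" "[y, z]" "Maximum h" "[]" 0 w Y] by (simp del: transfer.simps weight.simps)

lemma minimum_left:
  "x < n \<Longrightarrow> transfer ((0, Minimum h) # w) [x] Y =
    (\<Sum>a<n. \<Sum>c<n. weight (Minimum h) [] [a, c] * transfer w [a, c, x] Y)"
  using transfer_step[of "[]" 0 "[]" "Minimum h" "[x]" "Suc 0" w Y] by (simp add: sum_states_2 sum_states_Suc del: transfer.simps weight.simps)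

lemma minimum_right:
  "x < n \<Longrightarrow> transfer ((Suc 0, Minimum h) # w) [x] Y =
    (\<Sum>a<n. \<Sum>c<n. weight (Minimum h) [] [a, c] * transfer w [x, a, c] Y)"
  using transfer_step[of "[x]" "Suc 0" "[]" "Minimum h" "[]" 0 w Y] by (simp add: sum_states_2 sum_states_Suc del: transfer.simps weight.simps)

lemmas local_steps = crossing_two maximum_left maximum_right minimum_left minimum_right

lemma sum_indicator:
  "z < n \<Longrightarrow> (\<Sum>c<n. f c * (if c = z then 1 else 0)) = (f z :: 'k)"
  "z < n \<Longrightarrow> (\<Sum>c<n. f c * (if c = z \<and> Q then 1 else 0)) = (if Q then f z else (0 :: 'k))"
  "z < n \<Longrightarrow> (\<Sum>c<n. f c * (if Q \<and> c = z then 1 else 0)) = (if Q then f z else (0 :: 'k))"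
  "z < n \<Longrightarrow> (\<Sum>c<n. if c = z then f c else 0) = (f z :: 'k)"
  by (simp_all add: if_distrib[of "\<lambda>x. _ * x"] cong: if_cong)

definition NW :: "dir \<Rightarrow> dir \<Rightarrow> 'k matrix2" where
  "NW s m i j p q = reduced_factor C (Crossing NWSE s m) (bead s i j) (bead m p q)"

definition SW :: "dir \<Rightarrow> dir \<Rightarrow> 'k matrix2" where
  "SW s m i j p q = reduced_factor C (Crossing SWNE s m) (bead s i j) (bead m p q)"

definition crossing_matrix :: "crossing_line \<Rightarrow> dir \<Rightarrow> dir \<Rightarrow> 'k matrix2" where
  "crossing_matrix k s m = (if k = NWSE then NW s m else SW s m)"

text \<open>The crossing exchanges positions: the SW-NE line runs from \<open>x\<close> to
  \<open>c\<close> and the NW-SE line from \<open>y\<close> to \<open>a\<close>.\<close>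

lemma weight_crossing: "weight (Crossing k s m) [x, y] [a, c] = crossing_matrix k s m x c y a"
  by (cases k) (simp_all add: NW_def SW_def crossing_matrix_def)

lemma NW_simps:
  "NW Up Up = (\<lambda>i j p q. b' (t p q) (t i j))" "NW Down Down = (\<lambda>i j p q. b' (t q p) (t j i))"
  "NW Up Down = (\<lambda>i j p q. b (t q p) (T (t i j)))" "NW Down Up = (\<lambda>i j p q. b (t p q) (t j i))"
  "SW Up Up = (\<lambda>i j p q. b (t i j) (t p q))" "SW Down Down = (\<lambda>i j p q. b (t j i) (t q p))"
  "SW Up Down = (\<lambda>i j p q. b' (T (t i j)) (t q p))" "SW Down Up = (\<lambda>i j p q. b' (t j i) (t p q))"
  by (intro ext; simp add: NW_def SW_def bead_def)+

lemmas cmat = comatrix comatrix_T[OF comatrix]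

lemma ball_states_2: "(\<forall>X\<in>states 2. Q X) \<longleftrightarrow> (\<forall>i<n. \<forall>p<n. Q [i, p])"
  by (auto dest!: states_2E)

lemma ball_states_1: "(\<forall>X\<in>states (Suc 0). Q X) \<longleftrightarrow> (\<forall>i<n. Q [i])"
  by (auto dest!: states_1E)

lemma ball_states_3: "(\<forall>X\<in>states 3. Q X) \<longleftrightarrow> (\<forall>i<n. \<forall>p<n. \<forall>x<n. Q [i, p, x])"
proof -
  have "[i, p, x] \<in> states 3" if "i < n" "p < n" "x < n" for i p x
    using that by (simp add: states_def)
  then show ?thesis by (auto dest!: states_3E)
qed

text \<open>After the first crossing the strands have changed places, hence the exchanged index
  pairs in the second matrix.\<close>

lemma two_crossings:
  "equivalent 2 2 [(0, Crossing k x y), (0, Crossing k' y x)] [] \<longleftrightarrow>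
    (\<forall>i<n. \<forall>p<n. \<forall>j<n. \<forall>q<n. (\<Sum>a<n. \<Sum>c<n. crossing_matrix k x y i a p c * crossing_matrix k' y x c q a j) = one2 i j p q)"
proof -
  have 1: "transfer [(0, Crossing k x y), (0, Crossing k' y x)] [i, p] [j, q] =
    (\<Sum>a<n. \<Sum>c<n. crossing_matrix k x y i a p c * crossing_matrix k' y x c q a j)"
    if "j < n" "q < n" for i j p q
    using that by (simp add: crossing_two weight_crossing sum_indicator del: weight.simps transfer.simps(2))
      (rule sum.swap)
  have 2: "transfer [] [i, p] [j, q] = one2 i j p q" for i j p q
    by (simp add: one2_def)
  show ?thesis
    unfolding equivalent_def ball_states_2 2 by (simp only: 1 cong: conj_cong imp_cong)
qed

end

section \<open>Moves M2 and M3\<close>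

definition braid_left :: "crossing_line \<Rightarrow> dir \<Rightarrow> dir \<Rightarrow> dir \<Rightarrow> layer list" where
  "braid_left k x y z = [(0, Crossing k x y), (1, Crossing k x z), (0, Crossing k y z)]"

definition braid_right :: "crossing_line \<Rightarrow> dir \<Rightarrow> dir \<Rightarrow> dir \<Rightarrow> layer list" where
  "braid_right k x y z = [(1, Crossing k y z), (0, Crossing k x z), (1, Crossing k x y)]"

context coefficients
begin

lemma delta2_one2: "delta2 = one2"
  by (intro ext) (simp add: delta2_def one2_def)

lemmas form_inverse_matrices = form_inverse_comatrix[unfolded delta2_one2]

lemma one2_swap: "one2 j i p q = one2 i j p q" "one2 i j q p = one2 i j p q" "one2 p q i j = one2 i j p q"
  by (auto simp: one2_def)

text \<open>Parallel strands use that \<open>b\<close> and \<open>b'\<close> are inverse to each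
  other, antiparallel ones the mixed axioms. Where the T sits in \<open>b'\<close>, these axioms are
  applied to the comatrix twisted by T, and invariance of \<open>b\<close> removes the
  surplus.\<close>

lemma equivalent_M2: "equivalent 2 2 [(0, Crossing SWNE x y), (0, Crossing NWSE y x)] []"
  unfolding two_crossings
proof (intro allI impI)
  fix i p j q assume i: "i < n" "p < n" "j < n" "q < n"
  note f = form_inverse_matrices[OF cmat(1) cmat(1)] and g = form_inverse_matrices[OF cmat(2) cmat(1)]
  have s: "one2 j i p q = one2 i j p q" "one2 i j q p = one2 i j p q" "one2 j i q p = one2 i j p q"
    by (auto simp: one2_def)
  show "(\<Sum>a<n. \<Sum>c<n. crossing_matrix SWNE x y i a p c * crossing_matrix NWSE y x c q a j) = one2 i j p q"
  proof (cases x; cases y)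
    assume "x = Up" "y = Up"
    then show ?thesis using f(1)[OF i(1,3,2,4)] by (simp add: crossing_matrix_def NW_simps)
  next
    assume "x = Up" "y = Down"
    then show ?thesis using g(4)[OF i(1,3,4,2)] by (simp add: crossing_matrix_def NW_simps b_Td b_Tu s)
  next
    assume "x = Down" "y = Up"
    then show ?thesis using f(3)[OF i(3,1,2,4)] by (simp add: crossing_matrix_def NW_simps s mult.commute)
  next
    assume "x = Down" "y = Down"
    then show ?thesis using f(2)[OF i(3,1,4,2)] by (simp add: crossing_matrix_def NW_simps s mult.commute)
  qed
qed

lemma equivalent_M2rev: "equivalent 2 2 [(0, Crossing NWSE x y), (0, Crossing SWNE y x)] []"
  unfolding two_crossings
proof (intro allI impI)
  fix i p j q assume i: "i < n" "p < n" "j < n" "q < n"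
  note f = form_inverse_matrices[OF cmat(1) cmat(1)] and g = form_inverse_matrices[OF cmat(2) cmat(1)]
  have s: "one2 p q i j = one2 i j p q" "one2 q p i j = one2 i j p q" "one2 p q j i = one2 i j p q"
    "one2 q p j i = one2 i j p q"
    by (auto simp: one2_def)
  have "(\<Sum>a<n. \<Sum>c<n. crossing_matrix NWSE x y i a p c * crossing_matrix SWNE y x c q a j) =
    (\<Sum>c<n. \<Sum>a<n. crossing_matrix NWSE x y i a p c * crossing_matrix SWNE y x c q a j)" by (rule sum.swap)
  also have "\<dots> = one2 i j p q"
  proof (cases x; cases y)
    assume "x = Up" "y = Up"
    then show ?thesis using f(2)[OF i(2,4,1,3)] by (simp add: crossing_matrix_def NW_simps s)
  next
    assume "x = Up" "y = Down"
    then show ?thesis using f(4)[OF i(4,2,1,3)]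
      by (simp add: crossing_matrix_def NW_simps s mult.commute)
  next
    assume "x = Down" "y = Up"
    then show ?thesis using g(3)[OF i(2,4,3,1)]
      by (simp add: crossing_matrix_def NW_simps b_Td b_Tu s)
  next
    assume "x = Down" "y = Down"
    then show ?thesis using f(1)[OF i(4,2,3,1)]
      by (simp add: crossing_matrix_def NW_simps mult.commute s)
  qed
  finally show "(\<Sum>a<n. \<Sum>c<n. crossing_matrix NWSE x y i a p c * crossing_matrix SWNE y x c q a j) = one2 i j p q" .
qed

lemma inverse2_forms:
  assumes "comatrix n u" "comatrix n v"
  shows "inverse2 (\<lambda>i j p q. b (u i j) (v p q)) (\<lambda>i j p q. b' (u i j) (v p q))"
    "inverse2 (\<lambda>i j p q. b (v p q) (u i j)) (\<lambda>i j p q. b' (v p q) (u i j))"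
    "inverse2 (\<lambda>i j p q. b (u i j) (T (v q p))) (\<lambda>i j p q. b' (u i j) (v q p))"
    "inverse2 (\<lambda>i j p q. b (u i j) (v q p)) (\<lambda>i j p q. b' (T (u i j)) (v q p))"
proof -
  note f = form_inverse_matrices[OF assms] and g = form_inverse_matrices[OF comatrix_T[OF assms(1)] assms(2)]
    and h = form_inverse_matrices[OF assms(2,1)]
  show "inverse2 (\<lambda>i j p q. b (u i j) (v p q)) (\<lambda>i j p q. b' (u i j) (v p q))"
    using f(1,2) by (simp add: inverse2_def eq2_def mult2_def)
  show "inverse2 (\<lambda>i j p q. b (v p q) (u i j)) (\<lambda>i j p q. b' (v p q) (u i j))"
    unfolding inverse2_def eq2_def mult2_def
    by (intro conjI allI impI; subst sum.swap) (simp_all add: h(1,2) one2_swap(3))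
  show "inverse2 (\<lambda>i j p q. b (u i j) (T (v q p))) (\<lambda>i j p q. b' (u i j) (v q p))"
    using f(3,4) by (simp add: inverse2_def eq2_def mult2_def one2_swap(2))
  show "inverse2 (\<lambda>i j p q. b (u i j) (v q p)) (\<lambda>i j p q. b' (T (u i j)) (v q p))"
    using g(3,4) by (simp add: inverse2_def eq2_def mult2_def one2_swap(2) b_Td b_Tu)
qed

lemma sum3_reverse: "(\<Sum>a<n. \<Sum>c<n. \<Sum>d<n. F a c d) = (\<Sum>d<n. \<Sum>c<n. \<Sum>a<n. F a c d)"
  for F :: "nat \<Rightarrow> nat \<Rightarrow> nat \<Rightarrow> 'k"
  unfolding sum3_rotate[of F] by (rule sum.swap)

text \<open>For the second claim, number the strands from right to left: the form with its arguments
  exchanged then satisfies the equation because \<open>b\<close> does.\<close>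

lemma yang_baxter3_forms:
  assumes "comatrix n u" "comatrix n v" "comatrix n w"
  shows "yang_baxter3 (\<lambda>i j p q. b (u i j) (v p q)) (\<lambda>i j x y. b (u i j) (w x y)) (\<lambda>p q x y. b (v p q) (w x y))"
    "yang_baxter3 (\<lambda>i j p q. b (v p q) (u i j)) (\<lambda>i j x y. b (w x y) (u i j)) (\<lambda>p q x y. b (w x y) (v p q))"
proof -
  show "yang_baxter3 (\<lambda>i j p q. b (u i j) (v p q)) (\<lambda>i j x y. b (u i j) (w x y)) (\<lambda>p q x y. b (v p q) (w x y))"
    unfolding yang_baxter3_def using yang_baxter_comatrix[OF assms] by (simp add: mult_ac)
  show "yang_baxter3 (\<lambda>i j p q. b (v p q) (u i j)) (\<lambda>i j x y. b (w x y) (u i j)) (\<lambda>p q x y. b (w x y) (v p q))"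
    unfolding yang_baxter3_def
  proof (intro allI impI)
    fix i j p q x y assume i: "i < n" "j < n" "p < n" "q < n" "x < n" "y < n"
    have "(\<Sum>a<n. \<Sum>c<n. \<Sum>d<n. b (v p c) (u i a) * b (w x d) (u a j) * b (w d y) (v c q)) =
      (\<Sum>d<n. \<Sum>c<n. \<Sum>a<n. b (w d y) (v c q) * b (w x d) (u a j) * b (v p c) (u i a))"
      by (subst sum3_reverse) (simp add: mult_ac)
    also have "\<dots> = (\<Sum>d<n. \<Sum>c<n. \<Sum>a<n. b (w x d) (v p c) * b (w d y) (u i a) * b (v c q) (u a j))"
      by (rule yang_baxter_comatrix[OF assms(3,2,1) i(5,6,3,4,1,2), symmetric])
    also have "\<dots> = (\<Sum>a<n. \<Sum>c<n. \<Sum>d<n. b (w x d) (v p c) * b (w d y) (u i a) * b (v c q) (u a j))"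
      by (rule sum3_reverse)
    finally show "(\<Sum>a<n. \<Sum>c<n. \<Sum>d<n. b (v p c) (u i a) * b (w x d) (u a j) * b (w d y) (v c q)) =
      (\<Sum>a<n. \<Sum>c<n. \<Sum>d<n. b (w x d) (v p c) * b (w d y) (u i a) * b (v c q) (u a j))" .
  qed
qed

text \<open>The cases reached by flipping at most one strand, up to reversing all three. With NW-SE
  over lines, the strand of the odd direction is at an end: its flip puts the inverse of
  \<open>b\<close> at the parallel crossing only, as \<open>NW\<close> demands. With SW-NE over
  lines, it is in the middle or absent: the inverses occur at the antiparallel crossings.\<close>

lemma yang_baxter3_crossings:
  "yang_baxter3 (NW Up Up) (NW Up Down) (NW Up Down)"
  "yang_baxter3 (NW Down Up) (NW Down Up) (NW Up Up)"
  "yang_baxter3 (NW Down Down) (NW Down Up) (NW Down Up)"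
  "yang_baxter3 (NW Up Down) (NW Up Down) (NW Down Down)"
  "yang_baxter3 (SW Up Up) (SW Up Up) (SW Up Up)"
  "yang_baxter3 (SW Down Down) (SW Down Down) (SW Down Down)"
  "yang_baxter3 (SW Up Down) (SW Up Up) (SW Down Up)"
  "yang_baxter3 (SW Down Up) (SW Down Down) (SW Up Down)"
proof -
  note t = cmat(1) and Tt = cmat(2)
  show "yang_baxter3 (NW Up Up) (NW Up Down) (NW Up Down)"
    unfolding NW_simps
    using yang_baxter3_flip3[OF yang_baxter3_forms(2)[OF Tt Tt t] inverse2_forms(2)[OF Tt Tt]]
    by (simp add: b'_Td b'_Tu)
  show "yang_baxter3 (NW Down Up) (NW Down Up) (NW Up Up)"
    unfolding NW_simps
    using yang_baxter3_flip1[OF yang_baxter3_forms(2)[OF t t t] inverse2_forms(2)[OF t t]] .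
  show "yang_baxter3 (NW Down Down) (NW Down Up) (NW Down Up)"
    unfolding NW_simps
    using yang_baxter3_transpose[OF yang_baxter3_flip3[OF yang_baxter3_forms(2)[OF t t t] inverse2_forms(2)[OF t t]]] .
  show "yang_baxter3 (NW Up Down) (NW Up Down) (NW Down Down)"
    unfolding NW_simps
    using yang_baxter3_transpose[OF yang_baxter3_flip1[OF yang_baxter3_forms(2)[OF Tt t t] inverse2_forms(2)[OF t t]]] .
  show "yang_baxter3 (SW Up Up) (SW Up Up) (SW Up Up)"
    unfolding NW_simps using yang_baxter3_forms(1)[OF t t t] .
  show "yang_baxter3 (SW Down Down) (SW Down Down) (SW Down Down)"
    unfolding NW_simps using yang_baxter3_transpose[OF yang_baxter3_forms(1)[OF t t t]] .
  show "yang_baxter3 (SW Up Down) (SW Up Up) (SW Down Up)"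
    unfolding NW_simps
    using yang_baxter3_flip2[OF yang_baxter3_forms(1)[OF t t t] inverse2_forms(1)[OF t t] inverse2_forms(4)[OF t t]] .
  show "yang_baxter3 (SW Down Up) (SW Down Down) (SW Up Down)"
    unfolding NW_simps
    using yang_baxter3_transpose[OF yang_baxter3_flip2[OF yang_baxter3_forms(1)[OF t Tt t]
      inverse2_forms(1)[OF Tt t] inverse2_forms(3)[OF t t]]] .
qed

lemma crossing_last:
  "z < n \<Longrightarrow> i < n \<Longrightarrow> j < n \<Longrightarrow> transfer [(0, Crossing k s m)] [x, y, z] [i, j, l] =
    (if z = l then weight (Crossing k s m) [x, y] [i, j] else 0)"
  "x < n \<Longrightarrow> i < n \<Longrightarrow> j < n \<Longrightarrow> transfer [(Suc 0, Crossing k s m)] [x, y, z] [l, i, j] =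
    (if x = l then weight (Crossing k s m) [y, z] [i, j] else 0)"
proof -
  have s: "(\<Sum>a<n. \<Sum>c<n. f a c * (if a = i \<and> c = j \<and> Q then 1 else 0)) = (if Q then f i j else 0)"
    "(\<Sum>a<n. \<Sum>c<n. f a c * (if Q \<and> a = i \<and> c = j then 1 else 0)) = (if Q then f i j else 0)"
    if "i < n" "j < n" for f :: "nat \<Rightarrow> nat \<Rightarrow> 'k" and Q
  proof -
    have "(\<Sum>c<n. f a c * (if a = i \<and> c = j \<and> Q then 1 else 0)) = (if a = i then (if Q then f i j else 0) else 0)" for a
    proof -
      have "(\<Sum>c<n. f a c * (if a = i \<and> c = j \<and> Q then 1 else 0)) =
        (\<Sum>c<n. if c = j then (if a = i \<and> Q then f a c else 0) else 0)"
        by (rule sum.cong) auto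
      then show ?thesis using that by auto
    qed
    then show 1: "(\<Sum>a<n. \<Sum>c<n. f a c * (if a = i \<and> c = j \<and> Q then 1 else 0)) = (if Q then f i j else 0)"
      using that by simp
    have "(if Q \<and> a = i \<and> c = j then 1 else 0) = (if a = i \<and> c = j \<and> Q then 1 else (0::'k))" for a c by auto
    then show "(\<Sum>a<n. \<Sum>c<n. f a c * (if Q \<and> a = i \<and> c = j then 1 else 0)) = (if Q then f i j else 0)"
      using 1 by simp
  qed
  show "z < n \<Longrightarrow> i < n \<Longrightarrow> j < n \<Longrightarrow> transfer [(0, Crossing k s m)] [x, y, z] [i, j, l] =
    (if z = l then weight (Crossing k s m) [x, y] [i, j] else 0)"
    by (simp only: crossing_left transfer.simps(1) list.inject simp_thms s)
  show "x < n \<Longrightarrow> i < n \<Longrightarrow> j < n \<Longrightarrow> transfer [(Suc 0, Crossing k s m)] [x, y, z] [l, i, j] =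
    (if x = l then weight (Crossing k s m) [y, z] [i, j] else 0)"
    by (simp only: crossing_right transfer.simps(1) list.inject simp_thms s)
qed

lemma transfer_braid:
  assumes "i < n" "p < n" "x0 < n" "y0 < n" "q < n" "j < n"
  shows "transfer (braid_left k x y z) [i, p, x0] [y0, q, j] =
      (\<Sum>a<n. \<Sum>c<n. \<Sum>d<n. crossing_matrix k x y i a p c * crossing_matrix k x z a j x0 d * crossing_matrix k y z c q d y0)"
    "transfer (braid_right k x y z) [i, p, x0] [y0, q, j] =
      (\<Sum>a<n. \<Sum>c<n. \<Sum>d<n. crossing_matrix k y z p c x0 d * crossing_matrix k x z i a d y0 * crossing_matrix k x y a j c q)"
proof -
  have "transfer (braid_left k x y z) [i, p, x0] [y0, q, j] =
    (\<Sum>c<n. \<Sum>a<n. crossing_matrix k x y i a p c *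
      (\<Sum>d<n. \<Sum>e<n. crossing_matrix k x z a e x0 d * (if e = j then crossing_matrix k y z c q d y0 else 0)))"
    unfolding braid_left_def One_nat_def
    using assms by (simp add: crossing_left[where w = "L # w" for L w] crossing_right[where w = "L # w" for L w]
        crossing_last weight_crossing del: weight.simps transfer.simps cong: sum.cong_simp if_cong)
  also have "\<dots> = (\<Sum>c<n. \<Sum>a<n. \<Sum>d<n. crossing_matrix k x y i a p c * crossing_matrix k x z a j x0 d * crossing_matrix k y z c q d y0)"
    using assms by (simp add: if_distrib[of "\<lambda>x. _ * x"] sum_distrib_left mult.assoc cong: if_cong)
  finally show "transfer (braid_left k x y z) [i, p, x0] [y0, q, j] =
      (\<Sum>a<n. \<Sum>c<n. \<Sum>d<n. crossing_matrix k x y i a p c * crossing_matrix k x z a j x0 d * crossing_matrix k y z c q d y0)"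
    by (subst (asm) sum.swap)
  have "transfer (braid_right k x y z) [i, p, x0] [y0, q, j] =
    (\<Sum>d<n. \<Sum>c<n. crossing_matrix k y z p c x0 d *
      (\<Sum>f<n. \<Sum>a<n. crossing_matrix k x z i a d f * (if f = y0 then crossing_matrix k x y a j c q else 0)))"
    unfolding braid_right_def One_nat_def
    using assms by (simp add: crossing_left[where w = "L # w" for L w] crossing_right[where w = "L # w" for L w]
        crossing_last weight_crossing del: weight.simps transfer.simps cong: sum.cong_simp if_cong)
  also have "\<dots> = (\<Sum>d<n. \<Sum>c<n. crossing_matrix k y z p c x0 d *
      (\<Sum>a<n. crossing_matrix k x z i a d y0 * crossing_matrix k x y a j c q))"
  proof -
    have "(\<Sum>f<n. \<Sum>a<n. A a f * (if f = y0 then W a else 0)) = (\<Sum>a<n. A a y0 * W a)" for A and W :: "nat \<Rightarrow> 'k"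
    proof -
      have "(\<Sum>f<n. \<Sum>a<n. A a f * (if f = y0 then W a else 0)) = (\<Sum>f<n. if f = y0 then \<Sum>a<n. A a y0 * W a else 0)"
        by (rule sum.cong) auto
      then show ?thesis using assms by simp
    qed
    then show ?thesis by simp
  qed
  also have "\<dots> = (\<Sum>d<n. \<Sum>c<n. \<Sum>a<n. crossing_matrix k y z p c x0 d * crossing_matrix k x z i a d y0 * crossing_matrix k x y a j c q)"
    by (simp add: sum_distrib_left mult.assoc)
  also have "\<dots> = (\<Sum>a<n. \<Sum>c<n. \<Sum>d<n. crossing_matrix k y z p c x0 d * crossing_matrix k x z i a d y0 * crossing_matrix k x y a j c q)"
    by (rule sum3_reverse)
  finally show "transfer (braid_right k x y z) [i, p, x0] [y0, q, j] =
      (\<Sum>a<n. \<Sum>c<n. \<Sum>d<n. crossing_matrix k y z p c x0 d * crossing_matrix k x z i a d y0 * crossing_matrix k x y a j c q)" .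
qed

lemma equivalent_braid:
  assumes "yang_baxter3 (crossing_matrix k x y) (crossing_matrix k x z) (crossing_matrix k y z)"
  shows "equivalent 3 3 (braid_left k x y z) (braid_right k x y z)"
  unfolding equivalent_def ball_states_3
  using assms by (intro allI impI) (simp add: transfer_braid yang_baxter3_def)

lemma braid_words:
  "fits 3 (braid_left k x y z)" "fits 3 (braid_right k x y z)"
  "width_after 3 (braid_left k x y z) = 3" "width_after 3 (braid_right k x y z) = 3"
  by (simp_all add: braid_left_def braid_right_def)

lemma equivalent_refl: "equivalent l l' v v"
  by (simp add: equivalent_def)

lemma equivalent_3_context:
  assumes "equivalent 3 3 v v'" "fits 3 v" "fits 3 v'" "width_after 3 v = 3" "width_after 3 v' = 3"
    and "fits 3 u" "width_after 3 u = 3"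
  shows "equivalent 3 3 (u @ v @ w) (u @ v' @ w)"
  using assms by (intro equivalent_append[where l' = 3] equivalent_refl) auto

text \<open>Multiply the relation for \<open>k\<close> by the inverse crossings \<open>k'\<close> from both sides.\<close>

lemma equivalent_braid_inverse:
  assumes c: "\<And>x y. equivalent 2 2 [(0, Crossing k' x y), (0, Crossing k y x)] []"
    and c': "\<And>x y. equivalent 2 2 [(0, Crossing k x y), (0, Crossing k' y x)] []"
    and e: "equivalent 3 3 (braid_left k x y z) (braid_right k x y z)"
  shows "equivalent 3 3 (braid_left k' z y x) (braid_right k' z y x)"
proof -
  have cancel: "equivalent 3 3 (u @ [(m, Crossing l s r), (m, Crossing l' r s)] @ w) (u @ w)"
    if "\<And>x y. equivalent 2 2 [(0, Crossing l x y), (0, Crossing l' y x)] []" "m \<le> 1" "fits 3 u" "width_after 3 u = 3"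
    for l l' s r m u w
  proof -
    have "equivalent 3 3 [(m, Crossing l s r), (m, Crossing l' r s)] []"
      unfolding equivalent_def
    proof (intro ballI)
      fix X Y assume "X \<in> states 3"
      then show "transfer [(m, Crossing l s r), (m, Crossing l' r s)] X Y = transfer [] X Y"
        using equivalent_shift[OF that(1)[of s r], of X 3 m Y] that(2) by (simp add: shift_def del: transfer.simps)
    qed
    from equivalent_3_context[OF this _ _ _ _ that(3,4), of w] that(2) show ?thesis by simp
  qed
  note equivalent_trans [trans]
  note bw = braid_words
  let ?w1 = "braid_left k' z y x" and ?w2 = "braid_right k' z y x"
  let ?v1 = "braid_left k x y z" and ?v2 = "braid_right k x y z"
  have A: "equivalent 3 3 (?v2 @ ?w2) []"
  proof -
    have "equivalent 3 3 (?v2 @ ?w2) ([(1, Crossing k y z), (0, Crossing k x z)] @ [(0, Crossing k' z x), (1, Crossing k' z y)])"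
      using cancel[OF c', of 1 "[(1, Crossing k y z), (0, Crossing k x z)]" x y "[(0, Crossing k' z x), (1, Crossing k' z y)]"]
      by (simp add: braid_right_def)
    also have "equivalent 3 3 \<dots> ([(1, Crossing k y z)] @ [(1, Crossing k' z y)])"
      using cancel[OF c', of 0 "[(1, Crossing k y z)]" x z "[(1, Crossing k' z y)]"] by simp
    also have "equivalent 3 3 \<dots> []" using cancel[OF c', of 1 "[]" y z "[]"] by simp
    finally show ?thesis .
  qed
  have B: "equivalent 3 3 (?w1 @ ?v1) []"
  proof -
    have "equivalent 3 3 (?w1 @ ?v1) ([(0, Crossing k' z y), (1, Crossing k' z x)] @ [(1, Crossing k x z), (0, Crossing k y z)])"
      using cancel[OF c, of 0 "[(0, Crossing k' z y), (1, Crossing k' z x)]" y x "[(1, Crossing k x z), (0, Crossing k y z)]"]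
      by (simp add: braid_left_def)
    also have "equivalent 3 3 \<dots> ([(0, Crossing k' z y)] @ [(0, Crossing k y z)])"
      using cancel[OF c, of 1 "[(0, Crossing k' z y)]" z x "[(0, Crossing k y z)]"] by simp
    also have "equivalent 3 3 \<dots> []" using cancel[OF c, of 0 "[]" z y "[]"] by simp
    finally show ?thesis .
  qed
  have wa: "width_after l (u @ v) = width_after (width_after l u) v" for l u v
    by (induction u arbitrary: l) auto
  have fa: "fits l (u @ v) \<longleftrightarrow> fits l u \<and> fits (width_after l u) v" for l u v
    by (induction u arbitrary: l) auto
  have "equivalent 3 3 ?w1 (?w1 @ ?v2 @ ?w2)"
    using equivalent_sym[OF equivalent_3_context[OF A, of ?w1 "[]"]] bw by (simp add: wa fa)
  also have "equivalent 3 3 \<dots> (?w1 @ ?v1 @ ?w2)"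
    using equivalent_3_context[OF equivalent_sym[OF e], of ?w1 ?w2] bw by simp
  also have "equivalent 3 3 \<dots> ?w2"
    using equivalent_3_context[OF B, of "[]" ?w2] bw by (simp add: wa fa)
  finally show ?thesis .
qed

text \<open>Inverting a braid word changes the kind of its crossings and reads the directions as z,
  y, x. The condition that separates the two groups of orientations is symmetric under this, so each
  kind of crossing inherits the missing group from the other.\<close>

lemma equivalent_M3: "equivalent 3 3 (braid_left k x y z) (braid_right k x y z)"
proof -
  note yb = yang_baxter3_crossings
  have N: "equivalent 3 3 (braid_left NWSE x y z) (braid_right NWSE x y z)" if "(x = y) \<noteq> (y = z)" for x y z
    by (rule equivalent_braid) (use that yb(1-4) in \<open>cases x; cases y; cases z; simp add: crossing_matrix_def\<close>)
  have S: "equivalent 3 3 (braid_left SWNE x y z) (braid_right SWNE x y z)" if "x = y \<longleftrightarrow> y = z" for x y z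
    by (rule equivalent_braid) (use that yb(5-8) in \<open>cases x; cases y; cases z; simp add: crossing_matrix_def\<close>)
  show ?thesis
  proof (cases k; cases "x = y \<longleftrightarrow> y = z")
    assume k: "k = SWNE" "\<not> (x = y \<longleftrightarrow> y = z)"
    have "equivalent 3 3 (braid_left NWSE z y x) (braid_right NWSE z y x)" by (rule N) (use k in auto)
    then show ?thesis unfolding k(1)
      by (rule equivalent_braid_inverse[OF equivalent_M2 equivalent_M2rev])
  next
    assume k: "k = NWSE" "x = y \<longleftrightarrow> y = z"
    have "equivalent 3 3 (braid_left SWNE z y x) (braid_right SWNE z y x)" by (rule S) (use k in auto)
    then show ?thesis unfolding k(1)
      by (rule equivalent_braid_inverse[OF equivalent_M2rev equivalent_M2])
  qed (use N S in auto)
qed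

section \<open>Moves M1 and M4\<close>

lemma sum_t:
  assumes F: "lin F" and i: "i < n" "j < n"
  shows "(\<Sum>a<n. G (t i a) * F (t a j)) = (\<Sum>a<n. F (T (t i a)) * G (t a j))"
    "(\<Sum>a<n. H (t i a) * F (T (t a j))) = (\<Sum>a<n. F (t i a) * H (t a j))"
proof -
  have conv_t: "conv C f g (t i j) = (\<Sum>a<n. f (t i a) * g (t a j))" if "lin f" "lin g" for f g
    unfolding conv_sweedler
    using comatrix i bilinI[of "\<lambda>x y. f x * g y"] that by (simp add: comatrix_def lin_mult_left lin_mult_right)
  show "(\<Sum>a<n. G (t i a) * F (t a j)) = (\<Sum>a<n. F (T (t i a)) * G (t a j))"
    using fun_cong[OF conv_T_G[OF F], of "t i j"] conv_t[OF lin_G F] conv_t[OF lin_T[OF F] lin_G] by simp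
  show "(\<Sum>a<n. H (t i a) * F (T (t a j))) = (\<Sum>a<n. F (t i a) * H (t a j))"
    using fun_cong[OF conv_H_T[OF F], of "t i j"] conv_t[OF F lin_H] conv_t[OF lin_H lin_T[OF F]] by simp
qed

lemma sum_G_H:
  assumes "i < n" "j < n"
  shows "(\<Sum>a<n. G (t i a) * H (t a j)) = (if i = j then 1 else 0)"
    "(\<Sum>a<n. H (t i a) * G (t a j)) = (if i = j then 1 else 0)"
proof -
  have conv_t: "conv C f g (t i j) = (\<Sum>a<n. f (t i a) * g (t a j))" if "lin f" "lin g" for f g
    unfolding conv_sweedler
    using comatrix assms bilinI[of "\<lambda>x y. f x * g y"] that by (simp add: comatrix_def lin_mult_left lin_mult_right)
  show "(\<Sum>a<n. G (t i a) * H (t a j)) = (if i = j then 1 else 0)"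
    using conv_t[OF lin_G lin_H] by (simp add: conv_G_H counit_t assms)
  show "(\<Sum>a<n. H (t i a) * G (t a j)) = (if i = j then 1 else 0)"
    using conv_t[OF lin_H lin_G] by (simp add: conv_H_G counit_t assms)
qed

lemma last_extremum:
  "z < n \<Longrightarrow> transfer [(0, Maximum h)] [x, y, z] [i] = (if z = i then weight (Maximum h) [x, y] [] else 0)"
  "x < n \<Longrightarrow> transfer [(Suc 0, Maximum h)] [x, y, z] [i] = (if x = i then weight (Maximum h) [y, z] [] else 0)"
  using maximum_left[of z h "[]" x y "[i]"] maximum_right[of x h "[]" y z "[i]"] by auto

lemma sum_if:
  "z < n \<Longrightarrow> (\<Sum>c<n. f c * (if c = z then g c else 0)) = f z * (g z :: 'k)"
  by (simp add: if_distrib[of "\<lambda>x. _ * x"] cong: if_cong)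

lemma equivalent_M1: "equivalent (Suc 0) (Suc 0) [] [(Suc 0, Minimum h), (0, Maximum h)]"
  "equivalent (Suc 0) (Suc 0) [] [(0, Minimum h), (Suc 0, Maximum h)]"
proof -
  have "transfer [(Suc 0, Minimum h), (0, Maximum h)] [i] [j] = (if i = j then 1 else 0)" if "i < n" "j < n" for i j
  proof -
    have "transfer [(Suc 0, Minimum h), (0, Maximum h)] [i] [j] =
        (\<Sum>a<n. weight (Minimum h) [] [a, j] * weight (Maximum h) [i, a] [])"
      using that by (simp add: minimum_right last_extremum sum_if del: weight.simps transfer.simps cong: sum.cong_simp)
    then show ?thesis
      using sum_G_H(1)[OF that] that by (cases h) (simp_all add: counit_t mult.commute if_distrib[of "\<lambda>x. _ * x"] cong: sum.cong_simp if_cong)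
  qed
  then show "equivalent (Suc 0) (Suc 0) [] [(Suc 0, Minimum h), (0, Maximum h)]"
    unfolding equivalent_def ball_states_1 by simp
  have "transfer [(0, Minimum h), (Suc 0, Maximum h)] [i] [j] = (if i = j then 1 else 0)" if "i < n" "j < n" for i j
  proof -
    have "transfer [(0, Minimum h), (Suc 0, Maximum h)] [i] [j] =
        (\<Sum>a<n. \<Sum>c<n. weight (Minimum h) [] [a, c] * (if a = j then weight (Maximum h) [c, i] [] else 0))"
      using that by (simp add: minimum_left last_extremum del: weight.simps transfer.simps cong: sum.cong_simp)
    also have "\<dots> = (\<Sum>c<n. weight (Minimum h) [] [j, c] * weight (Maximum h) [c, i] [])"
      using that by (subst sum.swap) (simp add: sum_if del: weight.simps)
    finally show ?thesis
      using sum_G_H(2)[OF that(2,1)] that by (cases h) (auto simp add: counit_t mult.commute if_distrib[of "\<lambda>x. _ * x"] cong: sum.cong_simp if_cong)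
  qed
  then show "equivalent (Suc 0) (Suc 0) [] [(0, Minimum h), (Suc 0, Maximum h)]"
    unfolding equivalent_def ball_states_1 by simp
qed

end

context coefficients
begin

lemma transfer_M4:
  assumes "i < n" "p < n" "x0 < n" "j < n" "q < n" "y0 < n"
  shows "transfer [(0, Crossing k l x), (Suc 0, Maximum h)] [i, p, x0] [j] =
      (\<Sum>c<n. crossing_matrix k l x i c p j * weight (Maximum h) [c, x0] [])"
    "transfer [(Suc 0, Crossing k x r), (0, Maximum h)] [i, p, x0] [j] =
      (\<Sum>a<n. crossing_matrix k x r p j x0 a * weight (Maximum h) [i, a] [])"
    "transfer [(Suc 0, Minimum h), (0, Crossing k x l)] [i] [y0, q, j] =
      (\<Sum>a<n. weight (Minimum h) [] [a, j] * crossing_matrix k x l i q a y0)"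
    "transfer [(0, Minimum h), (Suc 0, Crossing k r x)] [i] [y0, q, j] =
      (\<Sum>c<n. weight (Minimum h) [] [y0, c] * crossing_matrix k r x c j i q)"
proof -
  have d1: "(\<Sum>a<n. \<Sum>c<n. A a c * (if a = z then W a c else 0)) = (\<Sum>c<n. A z c * W z c)"
    and d2: "(\<Sum>a<n. \<Sum>c<n. A a c * (if c = z then W a c else 0)) = (\<Sum>a<n. A a z * W a z)"
    if "z < n" for z and A W :: "nat \<Rightarrow> nat \<Rightarrow> 'k"
  proof -
    have "(\<Sum>a<n. \<Sum>c<n. A a c * (if a = z then W a c else 0)) = (\<Sum>a<n. if a = z then \<Sum>c<n. A z c * W z c else 0)"
      by (rule sum.cong) auto
    then show "(\<Sum>a<n. \<Sum>c<n. A a c * (if a = z then W a c else 0)) = (\<Sum>c<n. A z c * W z c)"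
      using that by simp
    have "(\<Sum>c<n. A a c * (if c = z then W a c else 0)) = A a z * W a z" for a
    proof -
      have "(\<Sum>c<n. A a c * (if c = z then W a c else 0)) = (\<Sum>c<n. if c = z then A a z * W a z else 0)"
        by (rule sum.cong) auto
      then show ?thesis using that by simp
    qed
    then show "(\<Sum>a<n. \<Sum>c<n. A a c * (if c = z then W a c else 0)) = (\<Sum>a<n. A a z * W a z)" by simp
  qed
  note ls = crossing_left[where w = "L # w" for L w] crossing_right[where w = "L # w" for L w]
    minimum_left[where w = "L # w" for L w] minimum_right[where w = "L # w" for L w]
  show "transfer [(0, Crossing k l x), (Suc 0, Maximum h)] [i, p, x0] [j] =
      (\<Sum>c<n. crossing_matrix k l x i c p j * weight (Maximum h) [c, x0] [])"
    using assms by (simp add: ls last_extremum weight_crossing d1 del: weight.simps transfer.simps cong: sum.cong_simp)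
  show "transfer [(Suc 0, Crossing k x r), (0, Maximum h)] [i, p, x0] [j] =
      (\<Sum>a<n. crossing_matrix k x r p j x0 a * weight (Maximum h) [i, a] [])"
    using assms by (simp add: ls last_extremum weight_crossing d2 del: weight.simps transfer.simps cong: sum.cong_simp)
  show "transfer [(Suc 0, Minimum h), (0, Crossing k x l)] [i] [y0, q, j] =
      (\<Sum>a<n. weight (Minimum h) [] [a, j] * crossing_matrix k x l i q a y0)"
    using assms by (simp add: ls crossing_last d2 del: weight.simps transfer.simps cong: sum.cong_simp)
      (simp add: weight_crossing del: weight.simps)
  show "transfer [(0, Minimum h), (Suc 0, Crossing k r x)] [i] [y0, q, j] =
      (\<Sum>c<n. weight (Minimum h) [] [y0, c] * crossing_matrix k r x c j i q)"
    using assms by (simp add: ls crossing_last d1 del: weight.simps transfer.simps cong: sum.cong_simp)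
      (simp add: weight_crossing del: weight.simps)
qed

lemma sum_delta_mult:
  "z < n \<Longrightarrow> (\<Sum>c<n. (if c = z then 1 else 0) * f c) = (f z :: 'k)"
  "z < n \<Longrightarrow> (\<Sum>c<n. (if z = c then 1 else 0) * f c) = (f z :: 'k)"
proof -
  show 1: "z < n \<Longrightarrow> (\<Sum>c<n. (if c = z then 1 else 0) * f c) = (f z :: 'k)"
    using sum_indicator(1)[of z f] by (simp add: mult.commute)
  show "z < n \<Longrightarrow> (\<Sum>c<n. (if z = c then 1 else 0) * f c) = (f z :: 'k)"
    using 1 by (simp add: eq_commute[of z])
qed

lemma extremum_weights:
  "x < n \<Longrightarrow> y < n \<Longrightarrow> weight (Maximum LR) [x, y] [] = G (t x y)"
  "x < n \<Longrightarrow> y < n \<Longrightarrow> weight (Maximum RL) [x, y] [] = (if x = y then 1 else 0)"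
  "x < n \<Longrightarrow> y < n \<Longrightarrow> weight (Minimum LR) [] [x, y] = H (t x y)"
  "x < n \<Longrightarrow> y < n \<Longrightarrow> weight (Minimum RL) [] [x, y] = (if x = y then 1 else 0)"
  by (auto simp: counit_t)

text \<open>A strand that stays under, or over, an arc meets its two legs with opposite
  slopes.\<close>

definition other_line :: "crossing_line \<Rightarrow> crossing_line" where
  "other_line k = (if k = SWNE then NWSE else SWNE)"

text \<open>For \<open>RL\<close> the extremum is the identity matrix and leaves one term on each
  side. For \<open>LR\<close> it carries G, and pulling the strand to the other leg moves a bead
  past G, which twists it by T: this is \<open>sum_t\<close>.\<close>

lemma equivalent_M4_max:
  assumes "lower (Maximum h) = [l, r]"
  shows "equivalent 3 (Suc 0) [(0, Crossing k l x), (Suc 0, Maximum h)] [(Suc 0, Crossing (other_line k) x r), (0, Maximum h)]"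
  unfolding equivalent_def ball_states_3 ball_states_1
proof (intro allI impI)
  fix i p x0 j assume ij: "i < n" "p < n" "x0 < n" "j < n"
  have lT: "lin (\<lambda>x. b' (T y) x)" "lin (\<lambda>x. b y x)" "lin (\<lambda>x. b x y)" "lin (\<lambda>x. b' x y)" for y
    by (rule lin_b)+
  have "(\<Sum>c<n. crossing_matrix k l x i c p j * weight (Maximum h) [c, x0] []) =
    (\<Sum>a<n. crossing_matrix (other_line k) x r p j x0 a * weight (Maximum h) [i, a] [])"
  proof (cases h)
    case LR
    then have lr: "l = Up" "r = Down" using assms by auto
    show ?thesis
      using sum_t(1)[OF lT(1)[of "t p j"] ij(1,3)] sum_t(1)[OF lT(2)[of "t j p"] ij(1,3)]
        sum_t(1)[OF lT(3)[of "T (t p j)"] ij(1,3)] sum_t(1)[OF lT(4)[of "t j p"] ij(1,3)]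
      by (cases k; cases x)
        (simp_all add: LR lr other_line_def crossing_matrix_def NW_simps extremum_weights ij b_Td b_Tu b'_Td b'_Tu
          mult.commute del: weight.simps cong: sum.cong_simp)
  next
    case RL
    then have lr: "l = Down" "r = Up" using assms by auto
    show ?thesis
      by (cases k; cases x)
        (simp_all add: RL lr other_line_def crossing_matrix_def NW_simps extremum_weights ij mult.commute[of _ "if _ then _ else _"]
          sum_delta_mult del: weight.simps cong: sum.cong_simp)
  qed
  then show "transfer [(0, Crossing k l x), (Suc 0, Maximum h)] [i, p, x0] [j] =
    transfer [(Suc 0, Crossing (other_line k) x r), (0, Maximum h)] [i, p, x0] [j]"
    using ij by (simp only: transfer_M4)
qed

lemma equivalent_M4_min:
  assumes "upper (Minimum h) = [l, r]"
  shows "equivalent (Suc 0) 3 [(Suc 0, Minimum h), (0, Crossing k x l)] [(0, Minimum h), (Suc 0, Crossing (other_line k) r x)]"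
  unfolding equivalent_def ball_states_3 ball_states_1
proof (intro allI impI)
  fix i y0 q j assume ij: "i < n" "y0 < n" "q < n" "j < n"
  have lT: "lin (\<lambda>x. b' (T y) x)" "lin (\<lambda>x. b y x)" "lin (\<lambda>x. b x y)" "lin (\<lambda>x. b' x y)" for y
    by (rule lin_b)+
  have "(\<Sum>a<n. weight (Minimum h) [] [a, j] * crossing_matrix k x l i q a y0) =
    (\<Sum>c<n. weight (Minimum h) [] [y0, c] * crossing_matrix (other_line k) r x c j i q)"
  proof (cases h)
    case LR
    then have lr: "l = Down" "r = Up" using assms by auto
    show ?thesis
      using sum_t(2)[OF lT(1)[of "t i q"] ij(2,4)] sum_t(2)[OF lT(2)[of "t q i"] ij(2,4)]
        sum_t(2)[OF lT(3)[of "T (t i q)"] ij(2,4)] sum_t(2)[OF lT(4)[of "t q i"] ij(2,4)]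
      by (cases k; cases x)
        (simp_all add: LR lr other_line_def crossing_matrix_def NW_simps extremum_weights ij b_Td b_Tu b'_Td b'_Tu
          mult.commute del: weight.simps cong: sum.cong_simp)
  next
    case RL
    then have lr: "l = Up" "r = Down" using assms by auto
    show ?thesis
      by (cases k; cases x)
        (simp_all add: RL lr other_line_def crossing_matrix_def NW_simps extremum_weights ij
          sum_delta_mult del: weight.simps cong: sum.cong_simp)
  qed
  then show "transfer [(Suc 0, Minimum h), (0, Crossing k x l)] [i] [y0, q, j] =
    transfer [(0, Minimum h), (Suc 0, Crossing (other_line k) r x)] [i] [y0, q, j]"
    using ij by (simp only: transfer_M4)
qed

lemma other_line_simps: "other_line SWNE = NWSE" "other_line NWSE = SWNE"
  by (simp_all add: other_line_def)

lemma local_move_equivalent: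
  assumes "local_move v w" "fits m (shift p v)" "fits m (shift p w)"
  shows "\<exists>l l'. equivalent l l' v w \<and> fits l v \<and> fits l w \<and> width_after l v = l' \<and> width_after l w = l' \<and> p + l \<le> m"
  using assms
proof cases
  case (exchange g r h)
  show ?thesis
    by (rule exI[of _ "length (lower g) + (r + length (lower h))"], rule exI[of _ "length (upper g) + (r + length (upper h))"])
      (use assms(2,3) equivalent_exchange[of g r h] in \<open>auto simp: exchange shift_def\<close>)
next
  case (M1 h)
  show ?thesis
    by (rule exI[of _ "Suc 0"], rule exI[of _ "Suc 0"])
      (use assms(2,3) equivalent_M1(1)[of h] in \<open>auto simp: M1 shift_def\<close>)
next
  case (M1_mirror h)
  show ?thesis
    by (rule exI[of _ "Suc 0"], rule exI[of _ "Suc 0"])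
      (use assms(2,3) equivalent_M1(2)[of h] in \<open>auto simp: M1_mirror shift_def\<close>)
next
  case (M2 x y)
  show ?thesis
    by (rule exI[of _ 2], rule exI[of _ 2])
      (use assms(2,3) equivalent_sym[OF equivalent_M2[of x y]] in \<open>auto simp: M2 shift_def\<close>)
next
  case (M2rev x y)
  show ?thesis
    by (rule exI[of _ 2], rule exI[of _ 2])
      (use assms(2,3) equivalent_sym[OF equivalent_M2rev[of x y]] in \<open>auto simp: M2rev shift_def\<close>)
next
  case (M3 x y z)
  show ?thesis
    by (rule exI[of _ 3], rule exI[of _ 3])
      (use assms(2,3) equivalent_M3[of NWSE x y z] in \<open>auto simp: M3 shift_def braid_left_def braid_right_def\<close>)
next
  case (M3rev x y z)
  show ?thesis
    by (rule exI[of _ 3], rule exI[of _ 3])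
      (use assms(2,3) equivalent_M3[of SWNE x y z] in \<open>auto simp: M3rev shift_def braid_left_def braid_right_def\<close>)
next
  case (M4_max h l r x)
  show ?thesis
    by (rule exI[of _ 3], rule exI[of _ "Suc 0"])
      (use assms(2,3) equivalent_M4_max[OF M4_max(3), of SWNE x] in \<open>auto simp: M4_max shift_def other_line_simps\<close>)
next
  case (M4_min h l r x)
  show ?thesis
    by (rule exI[of _ "Suc 0"], rule exI[of _ 3])
      (use assms(2,3) equivalent_M4_min[OF M4_min(3), of NWSE x] in \<open>auto simp: M4_min shift_def other_line_simps\<close>)
next
  case (M4rev_max h l r x)
  show ?thesis
    by (rule exI[of _ 3], rule exI[of _ "Suc 0"])
      (use assms(2,3) equivalent_M4_max[OF M4rev_max(3), of NWSE x] in \<open>auto simp: M4rev_max shift_def other_line_simps\<close>)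
next
  case (M4rev_min h l r x)
  show ?thesis
    by (rule exI[of _ "Suc 0"], rule exI[of _ 3])
      (use assms(2,3) equivalent_M4_min[OF M4rev_min(3), of SWNE x] in \<open>auto simp: M4rev_min shift_def other_line_simps\<close>)
qed

lemma width_after_shift: "fits l w \<Longrightarrow> p + l \<le> m \<Longrightarrow> width_after m (shift p w) = m - l + width_after l w"
proof (induction w arbitrary: l m)
  case (Cons L w)
  obtain q g where L: "L = (q, g)" by fastforce
  have "m - length (lower g) + length (upper g) - (l - length (lower g) + length (upper g)) = m - l"
    using Cons.prems by (auto simp: L)
  then show ?case
    using Cons.IH[of "l - length (lower g) + length (upper g)" "m - length (lower g) + length (upper g)"] Cons.prems
    by (auto simp: L shift_def)
qed (simp add: shift_def)

lemma local_move_transfer: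
  assumes "local_move v w" "fits m (shift p v)" "fits m (shift p w)" "X \<in> states m"
  shows "transfer (shift p v @ u) X Y = transfer (shift p w @ u) X Y"
    and "width_after m (shift p v) = width_after m (shift p w)"
proof -
  obtain l l' where l: "equivalent l l' v w" "fits l v" "fits l w" "width_after l v = l'" "width_after l w = l'" "p + l \<le> m"
    using local_move_equivalent[OF assms(1-3)] by blast
  show wa: "width_after m (shift p v) = width_after m (shift p w)"
    using l by (simp add: width_after_shift)
  have "transfer (shift p v) X Z = transfer (shift p w) X Z" for Z
    by (rule equivalent_shift[OF l(1-5) assms(4) l(6)])
  then show "transfer (shift p v @ u) X Y = transfer (shift p w @ u) X Y"
    unfolding transfer_append[OF assms(4,2)] transfer_append[OF assms(4,3)] wa by simp
qed

end

section \<open>Regular isotopy\<close>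

lemma fits_append: "fits l (u @ v) \<longleftrightarrow> fits l u \<and> fits (width_after l u) v"
  by (induction u arbitrary: l) auto

lemma width_after_append: "width_after l (u @ v) = width_after (width_after l u) v"
  by (induction u arbitrary: l) auto

context fitting_diagram
begin

lemma fits_drop: "i \<le> len \<Longrightarrow> fits (length (lev i)) (drop i (snd D))"
proof (induction "len - i" arbitrary: i)
  case (Suc d)
  then have i: "i < len" by simp
  obtain p g where pg: "snd D ! i = (p, g)" by fastforce
  show ?case
    using Suc.hyps(1)[of "Suc i"] Suc.hyps(2) i fitD(1,4)[OF i pg]
    by (simp add: Cons_nth_drop_Suc[symmetric, OF i] pg)
qed simp

lemma width_take: "i \<le> len \<Longrightarrow> width_after (length (fst D)) (take i (snd D)) = length (lev i)"
proof (induction i)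
  case (Suc i)
  then have i: "i < len" by simp
  obtain p g where pg: "snd D ! i = (p, g)" by fastforce
  show ?case
    using Suc.IH i fitD(4)[OF i pg] by (simp add: take_Suc_conv_app_nth[OF i] width_after_append pg)
qed simp

end

context closed_diagram
begin

text \<open>A piece has the same surplus of upward strands at its lower and upper boundary, and the
  bottom level is empty. Every nonempty level therefore offers an upward strand on which to
  cut.\<close>

lemma balanced_level: "i \<le> length K \<Longrightarrow> (\<Sum>d\<leftarrow>lev i. 2 * upness d - 1) = 0"
proof (induction i)
  case (Suc i)
  then have i: "i < length K" by simp
  obtain p g where pg: "K ! i = (p, g)" by fastforce
  let ?s = "\<lambda>ds. \<Sum>d\<leftarrow>ds. 2 * upness d - 1"
  have "take (length (lower g)) (drop p (lev i)) = lower g"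
    using fit_K i pg by (auto simp: layers_fit_def)
  then have l: "lev i = take p (lev i) @ lower g @ drop (p + length (lower g)) (lev i)"
    by (metis append_take_drop_id drop_drop add.commute)
  have g: "?s (lower g) = ?s (upper g)"
    by (cases g rule: lower.cases; cases g rule: upper.cases) auto
  have "?s (lev (Suc i)) = ?s (take p (lev i)) + ?s (upper g) + ?s (drop (p + length (lower g)) (lev i))"
    using fitD(3)[of i p g] i pg by simp
  also have "\<dots> = ?s (lev i)" unfolding g[symmetric] by (subst (3) l) simp
  finally show ?case using Suc by simp
qed simp

lemma level_has_Up:
  assumes "i \<le> length K" "lev i \<noteq> []" shows "\<exists>j<length (lev i). lev i ! j = Up"
proof (rule ccontr)
  assume "\<not> ?thesis"
  then have "\<forall>d\<in>set (lev i). d = Down" by (auto simp: in_set_conv_nth)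
  then have "(\<Sum>d\<leftarrow>ds. 2 * upness d - 1) = - int (length ds)" if "set ds \<subseteq> set (lev i)" for ds
    using that by (induction ds) auto
  from this[of "lev i"] balanced_level[OF assms(1)] assms(2) show False by simp
qed

end

lemma knot_diagramsD:
  assumes "K \<in> knot_diagrams"
  shows "closed_diagram K" "P \<in> points ([], K) \<Longrightarrow> traversed_diagram K P" "points ([], K) \<noteq> {}"
proof -
  show c: "closed_diagram K" using assms by unfold_locales (auto simp: knot_diagrams_def)
  obtain Q where Q: "single_strand ([], K) Q" using assms by (auto simp: knot_diagrams_def)
  interpret traversed_diagram K Q
    using c Q by (simp add: traversed_diagram_def traversed_diagram_axioms_def)
  show "points ([], K) \<noteq> {}" using P_in by auto
  show "P \<in> points ([], K) \<Longrightarrow> traversed_diagram K P" by (rule traversed_from)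
qed

context twist
begin

lemma knot_scalar_beads:
  assumes "traversed_diagram K P"
  shows "knot_scalar C c K P = beads (traversal ([], K) P) (weight_product (map snd K)) w c"
proof -
  interpret traversed_diagram K P by fact
  let ?E = "traversal ([], K) P" and ?\<Phi> = "weight_product (map snd K)"
  \<comment> \<open>The initial environment is twisted backwards so that the twists in
    \<open>conv_evaluate_beads\<close> turn it into \<open>w\<close>.\<close>
  define v where "v x = Tn (- rest_u ?E x) (w x)" for x
  have w: "(\<lambda>x. Tn (rest_u ?E x) (v x)) = w"
  proof -
    have "Tn k (Tn (- k) x) = x" for k x
      using fun_power_int_add[OF bij_T, of k "- k" x] by simp
    then show ?thesis by (simp add: v_def fun_eq_iff)
  qed
  have "functional C ([], K) P = evaluate (event_lines ?E) (\<lambda>v. ?\<Phi> (\<lambda>x. Tn (rest_u ?E x) (v x))) v"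
  proof
    fix c
    show "functional C ([], K) P c = evaluate (event_lines ?E) (\<lambda>v. ?\<Phi> (\<lambda>x. Tn (rest_u ?E x) (v x))) v c"
      using functional_evaluate[of ?E "([], K)" P "up ([], K) P" c v] distinct_lines set_lines parity by simp
  qed
  then have "knot_scalar C c K P = conv C (dual_power C G (- total_u ?E))
      (evaluate (event_lines ?E) (\<lambda>v. ?\<Phi> (\<lambda>x. Tn (rest_u ?E x) (v x))) v) c"
    by (simp add: knot_scalar_def whitney)
  also have "\<dots> = beads ?E ?\<Phi> (\<lambda>x. Tn (rest_u ?E x) (v x)) c"
    by (rule fun_cong[OF conv_evaluate_beads[OF distinct_lines _ multilinear_weight_product' multilinear_weight_product]])
      (simp_all add: set_lines)
  finally show ?thesis by (simp only: w)
qed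

lemma knot_scalar_independent:
  assumes "traversed_diagram K P" "Q \<in> points ([], K)" "cocommutative C c"
  shows "knot_scalar C c K Q = knot_scalar C c K P"
proof -
  interpret traversed_diagram K P by fact
  obtain E F where EF: "traversal ([], K) P = E @ F" "traversal ([], K) Q = F @ E"
    using traversal_rotate[OF assms(2)] by blast
  show ?thesis
    unfolding knot_scalar_beads[OF assms(1), where w = "\<lambda>x. 0"]
      knot_scalar_beads[OF traversed_from[OF assms(2)], where w = "\<lambda>x. 0"] EF
    by (rule beads_rotate[OF multilinear_weight_product' _ _ assms(3)])
      (use distinct_lines set_lines EF in auto)
qed

end

context coefficients
begin

lemma knot_scalar_cut_sum:
  assumes "traversed_diagram K P" "level ([], K) (fst P) ! snd P = Up"
    and c: "\<And>F. lin F \<Longrightarrow> F c = (\<Sum>i<n. \<Sum>j<n. a i j * F (t i j))"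
  shows "knot_scalar C c K P = cut_sum a K (length (level ([], K) (fst P))) (fst P) (snd P)"
proof -
  interpret state_sum C n t K P
    by (intro state_sum.intro coefficients_axioms assms(1)) (unfold_locales, rule assms(2))
  have "knot_scalar C c K P = beads (traversal ([], K) P) (weight_product (map snd K)) (\<lambda>x. 0) c"
    by (rule knot_scalar_beads[OF assms(1)])
  also have "\<dots> = (\<Sum>i<n. \<Sum>j<n. a i j * beads (traversal ([], K) P) (weight_product (map snd K)) (\<lambda>x. 0) (t i j))"
    by (rule c, rule lin_beads[OF multilinear_weight_product' distinct_lines]) (simp add: set_lines)
  also have "\<dots> = cut_sum a K (length (level ([], K) (fst P))) (fst P) (snd P)"
    by (rule beads_cut_sum)
  finally show ?thesis .
qed

lemma cut_sum_cong:
  assumes "\<And>X. X \<in> states l \<Longrightarrow> transfer (take i K) [] X = transfer (take i' K') [] X"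
    and "\<And>X. X \<in> states l \<Longrightarrow> transfer (drop i K) X [] = transfer (drop i' K') X []"
  shows "cut_sum a K l i j = cut_sum a K' l i' j"
  unfolding cut_sum_def
proof (rule sum.cong[OF HOL.refl])
  fix X assume X: "X \<in> states l"
  have "X[j := m] \<in> states l" if "m < n" for m
    using X that set_update_subset_insert[of X j m] by (auto simp: states_def)
  then show "transfer (take i K) [] X * (\<Sum>m<n. a m (X ! j) * transfer (drop i K) (X[j := m]) []) =
    transfer (take i' K') [] X * (\<Sum>m<n. a m (X ! j) * transfer (drop i' K') (X[j := m]) [])"
    using assms X by simp
qed

text \<open>The cut is placed on the level just below the move: the parts below it coincide, and the
  parts above have equal transfer matrices.\<close>

lemma knot_scalar_step:
  assumes "regular_step K K'"
    and c: "\<And>F. lin F \<Longrightarrow> F c = (\<Sum>i<n. \<Sum>j<n. a i j * F (t i j))"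
  shows "\<exists>P\<in>points ([], K). \<exists>P'\<in>points ([], K'). knot_scalar C c K P = knot_scalar C c K' P'"
  using assms(1)
proof cases
  case (1 v w pre p post)
  note mv = 1(3) and eq = 1(1,2) and knots = 1(4,5)[folded 1(1,2)]
  interpret K: closed_diagram K by (rule knot_diagramsD(1)[OF knots(1)])
  interpret K': closed_diagram K' by (rule knot_diagramsD(1)[OF knots(2)])
  let ?m = "length pre"
  have lev: "level ([], K') ?m = level ([], K) ?m" by (simp add: level_def eq)
  let ?l = "length (level ([], K) ?m)"
  have d: "drop ?m K = shift p v @ post" "drop ?m K' = shift p w @ post" "?m \<le> length K" "?m \<le> length K'"
    by (simp_all add: eq)
  have "fits ?l (shift p v @ post)" "fits ?l (shift p w @ post)"
    using K.fits_drop[of ?m] K'.fits_drop[of ?m] unfolding snd_conv lev d(1,2) using d(3,4) by blast+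
  then have f: "fits ?l (shift p v)" "fits ?l (shift p w)" by (simp_all add: fits_append)
  note tr = local_move_transfer[OF mv f]
  have f0: "fits 0 pre" "width_after 0 pre = ?l"
    using K.fits_drop[of 0] K.width_take[of ?m] by (simp_all add: eq fits_append)
  show ?thesis
  proof (cases "level ([], K) ?m = []")
    case False
    then obtain j where j: "j < ?l" "level ([], K) ?m ! j = Up"
      using K.level_has_Up[of ?m] by (auto simp: eq)
    have P: "(?m, j) \<in> points ([], K)" "(?m, j) \<in> points ([], K')"
      using j lev d(3,4) by (simp_all add: points_def)
    have "knot_scalar C c K (?m, j) = cut_sum a K ?l ?m j"
      using knot_scalar_cut_sum[OF knot_diagramsD(2)[OF knots(1) P(1)] _ c] j by simp
    also have "\<dots> = cut_sum a K' ?l ?m j"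
      by (rule cut_sum_cong) (simp_all add: eq tr(1))
    also have "\<dots> = knot_scalar C c K' (?m, j)"
      using knot_scalar_cut_sum[OF knot_diagramsD(2)[OF knots(2) P(2)] _ c] j by (simp add: lev)
    finally show ?thesis using P by blast
  next
    \<comment> \<open>Among the moves, only the exchange of two minima fits on an empty level. Both
      of its words have two layers and lead to the same nonempty level, so the cut is made there,
      above the move.\<close>
    case True
    then have f': "fits 0 (shift p v)" "fits 0 (shift p w)" using f by simp_all
    have lv: "level ([], pre @ u @ post) (?m + length u) = fold apply_layer u []" for u
      using True by (simp add: level_def eq)
    have "\<exists>D. D \<noteq> [] \<and> length v = length w \<and> fold apply_layer (shift p v) [] = D \<and> fold apply_layer (shift p w) [] = D"
      using mv
    proof cases
      case (exchange g r h)
      obtain hg where g: "g = Minimum hg" using f' exchange by (cases g) (auto simp: shift_def)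
      obtain hh where h: "h = Minimum hh" using f' exchange g by (cases h) (auto simp: shift_def)
      have "p = 0" "r = 0" using f' exchange g h by (simp_all add: shift_def)
      then show ?thesis
        by (cases hg; cases hh) (simp_all add: exchange g h shift_def apply_layer_def numeral_2_eq_2)
    qed (use f' in \<open>auto simp: shift_def\<close>)
    then obtain D where D: "D \<noteq> []" "length v = length w" "fold apply_layer (shift p v) [] = D" "fold apply_layer (shift p w) [] = D"
      by blast
    let ?i = "?m + length v"
    have len: "length (shift p u) = length u" for u by (simp add: shift_def)
    have levD: "level ([], K) ?i = D" "level ([], K') ?i = D"
      using lv[of "shift p v"] lv[of "shift p w"] D by (simp_all add: eq len)
    obtain j where j: "j < length D" "D ! j = Up"
      using K.level_has_Up[of ?i] levD D(1) by (auto simp: eq len)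
    have "?i \<le> length K" "?i \<le> length K'" by (simp_all add: eq len D(2))
    then have P: "(?i, j) \<in> points ([], K)" "(?i, j) \<in> points ([], K')"
      using j levD by (simp_all add: points_def)
    have "knot_scalar C c K (?i, j) = cut_sum a K (length D) ?i j"
      using knot_scalar_cut_sum[OF knot_diagramsD(2)[OF knots(1) P(1)] _ c] j levD by simp
    also have "\<dots> = cut_sum a K' (length D) ?i j"
    proof (rule cut_sum_cong)
      fix X
      have st: "[] \<in> states 0" by simp
      have "transfer (pre @ shift p v) [] X = transfer (pre @ shift p w) [] X"
        unfolding transfer_append[OF st f0(1)] f0(2) using tr(1)[of _ "[]" X] by simp
      then show "transfer (take ?i K) [] X = transfer (take ?i K') [] X"
        by (simp add: eq len D(2))
      show "transfer (drop ?i K) X [] = transfer (drop ?i K') X []"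
        by (simp add: eq len D(2))
    qed
    also have "\<dots> = knot_scalar C c K' (?i, j)"
      using knot_scalar_cut_sum[OF knot_diagramsD(2)[OF knots(2) P(2)] _ c] j levD by simp
    finally show ?thesis using P by blast
  qed
qed

end

context twist
begin

text \<open>The comatrix depends on \<open>c\<close> and not on the diagram, so one choice serves
  all steps. A step yields one pair of starting points with equal scalars; independence of the
  starting point extends this to all pairs.\<close>

theorem knot_scalar_invariant:
  assumes c: "cocommutative C c" and K: "K \<in> knot_diagrams" and iso: "regularly_isotopic K K'"
  shows "K' \<in> knot_diagrams"
    and "P \<in> points ([], K) \<Longrightarrow> P' \<in> points ([], K') \<Longrightarrow> knot_scalar C c K P = knot_scalar C c K' P'"
proof -
  obtain n t a where t: "comatrix n t" and a: "\<And>F. lin F \<Longrightarrow> F c = (\<Sum>i<n. \<Sum>j<n. a i j * F (t i j))"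
    using comatrix_exists[of c] by blast
  interpret coefficients C n t by unfold_locales (rule t)
  have indep: "knot_scalar C c L Q = knot_scalar C c L R"
    if "L \<in> knot_diagrams" "Q \<in> points ([], L)" "R \<in> points ([], L)" for L Q R
    by (rule knot_scalar_independent[OF knot_diagramsD(2)[OF that(1,3)] that(2) c])
  have one: "L \<in> knot_diagrams \<and> L' \<in> knot_diagrams \<and> (\<forall>Q\<in>points ([], L). \<forall>Q'\<in>points ([], L'). knot_scalar C c L Q = knot_scalar C c L' Q')"
    if reg: "regular_step L L'" for L L'
  proof -
    have k: "L \<in> knot_diagrams" "L' \<in> knot_diagrams" using reg by (auto elim: regular_step.cases)
    obtain P P' where "P \<in> points ([], L)" "P' \<in> points ([], L')" "knot_scalar C c L P = knot_scalar C c L' P'"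
      using knot_scalar_step[OF reg a] by blast
    then show ?thesis using indep k by metis
  qed
  have "equivclp regular_step K K'" using iso by (simp add: regularly_isotopic_def)
  then have *: "K' \<in> knot_diagrams \<and> (\<forall>Q\<in>points ([], K). \<forall>Q'\<in>points ([], K'). knot_scalar C c K Q = knot_scalar C c K' Q')"
  proof (induction rule: equivclp_induct)
    case base
    then show ?case using K indep by blast
  next
    case (step L L')
    then obtain Q where Q: "Q \<in> points ([], L)" using knot_diagramsD(3) by fastforce
    have "L' \<in> knot_diagrams \<and> (\<forall>Q'\<in>points ([], L'). knot_scalar C c L Q = knot_scalar C c L' Q')"
      using step(2) one[of L L'] one[of L' L] Q by metis
    then show ?case using step.IH Q by metis
  qed
  show "K' \<in> knot_diagrams" using * by simp
  show "P \<in> points ([], K) \<Longrightarrow> P' \<in> points ([], K') \<Longrightarrow> knot_scalar C c K P = knot_scalar C c K' P'"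
    using * by blast
qed

end

section \<open>Closures of tangles\<close>

text \<open>The two extrema created by M1 turn in opposite senses, and the other moves keep the
  extrema with their types.\<close>

lemma local_move_clockwise:
  "local_move v w \<Longrightarrow> (\<Sum>(p, g)\<leftarrow>v. clockwise g) = (\<Sum>(p, g)\<leftarrow>w. clockwise g)"
proof (induction rule: local_move.induct)
  case (M1 h)
  show ?case by (cases h) simp_all
next
  case (M1_mirror h)
  show ?case by (cases h) simp_all
qed simp_all

lemma whitney_degree_invariant:
  assumes "regularly_isotopic K K'" shows "whitney_degree K = whitney_degree K'"
proof -
  have *: "whitney_degree L = whitney_degree L'" if "regular_step L L'" for L L'
    using that
  proof cases
    case (1 v w pre p post)
    have "(\<Sum>(q, g)\<leftarrow>shift p u. clockwise g) = (\<Sum>(q, g)\<leftarrow>u. clockwise g)" for u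
      by (simp add: shift_def comp_def case_prod_unfold)
    then show ?thesis
      using local_move_clockwise[OF 1(3)] by (simp add: whitney_degree_def 1(1,2))
  qed
  have "equivclp regular_step K K'" using assms by (simp add: regularly_isotopic_def)
  then show ?thesis by (induction rule: equivclp_induct) (use * in metis)+
qed

text \<open>The closure puts one layer below the tangle, so the layer numbers grow by one.\<close>

fun shift_event :: "event \<Rightarrow> event" where
  "shift_event (Line i l) = Line (Suc i) l"
| "shift_event (Extremum g) = Extremum g"

lemma shift_event_lines:
  "event_lines (map shift_event E) = map (\<lambda>(i, l). (Suc i, l)) (event_lines E)"
  by (induction E rule: labelled_lines.induct) simp_all

lemma shift_event_total:
  "total_d (map shift_event E) = total_d E" "total_u (map shift_event E) = total_u E"
proof -
  have "weight_d (shift_event e) = weight_d e" "weight_u (shift_event e) = weight_u e" for e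
    by (cases e; simp)+
  then show "total_d (map shift_event E) = total_d E" "total_u (map shift_event E) = total_u E"
    by (simp_all add: total_d_def total_u_def comp_def)
qed

lemma shift_event_rest:
  assumes "(i, l) \<in> set (event_lines E)"
  shows "rest_d (map shift_event E @ F) (Suc i, l) = rest_d E (i, l) + total_d F"
    and "rest_u (map shift_event E @ F) (Suc i, l) = rest_u E (i, l) + total_u F"
proof -
  have "total_d (E @ F) = total_d E + total_d F" "total_u (E @ F) = total_u E + total_u F" for E F
    by (simp_all add: total_d_def total_u_def)
  note t = this shift_event_total
  show "rest_d (map shift_event E @ F) (Suc i, l) = rest_d E (i, l) + total_d F"
    using assms by (induction E rule: labelled_lines.induct) (auto simp: t)
  show "rest_u (map shift_event E @ F) (Suc i, l) = rest_u E (i, l) + total_u F"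
    using assms by (induction E rule: labelled_lines.induct) (auto simp: t)
qed

text \<open>That the closure is a knot diagram is an assumption here; where the locale is used in
  (b), it holds because the closure is regularly isotopic to a knot diagram.\<close>

locale closed_tangle =
  fixes d :: dir and w :: "layer list"
  assumes tangle: "(d, w) \<in> tangles" and knot: "closure_of (d, w) \<in> knot_diagrams"
begin

abbreviation "K \<equiv> closure_of (d, w)"
abbreviation "W \<equiv> ([d], w)"
abbreviation "L \<equiv> length w"
definition "start = (case d of Up \<Rightarrow> (0::nat, 0::nat) | Down \<Rightarrow> (L, 0))"
definition "final = (case d of Up \<Rightarrow> (L, 0::nat) | Down \<Rightarrow> (0, 0))"
definition "first_extremum = (case d of Up \<Rightarrow> Maximum RL | Down \<Rightarrow> Minimum RL)"
definition "second_extremum = (case d of Up \<Rightarrow> Minimum LR | Down \<Rightarrow> Maximum LR)"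
text \<open>The level of the point with number k on the closing arc, counted from the end of the
  tangle in the order of traversal.\<close>

definition "arc_level k = (case d of Up \<Rightarrow> Suc L - k | Down \<Rightarrow> Suc k)"
definition "sh x = (Suc (fst x), Suc (snd x))" for x :: point

lemma start_eq: "tangle_start (d, w) = start" and diagram_eq: "tangle_diagram (d, w) = W"
  by (simp_all add: tangle_start_def tangle_diagram_def start_def split: dir.splits)

lemma level_L: "level W L = [d]"
  using tangle by (simp add: tangles_def diagram_eq)

lemma single_tangle: "single_strand W start"
  using tangle by (simp add: tangles_def diagram_eq start_eq)

lemma K_eq: "K = (0, Minimum (case d of Up \<Rightarrow> LR | Down \<Rightarrow> RL)) # shift 1 w @
    [(0, Maximum (case d of Up \<Rightarrow> RL | Down \<Rightarrow> LR))]"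
  by (cases d) simp_all

lemma nth_K: "i < L \<Longrightarrow> K ! Suc i = (Suc (fst (w ! i)), snd (w ! i))"
  by (simp add: K_eq nth_append shift_def case_prod_unfold)

lemma length_K: "length K = Suc (Suc L)"
  by (simp add: K_eq shift_def)

lemma level_K: "i \<le> L \<Longrightarrow> level ([], K) (Suc i) = flip d # level W i"
proof (induction i)
  case 0
  show ?case by (cases d) (simp_all add: level_def apply_layer_def)
next
  case (Suc i)
  then show ?case
    using level_Suc[of "Suc i" "([], K)"] level_Suc[of i W] nth_K[of i]
    by (simp add: length_K apply_layer_def case_prod_unfold)
qed

lemma level_K_top: "level ([], K) (Suc (Suc L)) = []"
  using knot by (simp add: knot_diagrams_def length_K)

lemma points_K: "points ([], K) = sh ` points W \<union> (\<lambda>k. (arc_level k, 0)) ` {..L}"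
proof (intro equalityI subsetI)
  fix x assume x: "x \<in> points ([], K)"
  obtain i j where ij: "x = (i, j)" by fastforce
  have i: "i \<noteq> 0" "i \<noteq> Suc (Suc L)" "i \<le> Suc (Suc L)"
    using x level_K_top by (auto simp: ij points_def length_K simp del: closure_of.simps intro!: gr0I)
  then obtain m where m: "i = Suc m" "m \<le> L" by (cases i) auto
  show "x \<in> sh ` points W \<union> (\<lambda>k. (arc_level k, 0)) ` {..L}"
  proof (cases j)
    case 0
    have "x = (arc_level (case d of Up \<Rightarrow> L - m | Down \<Rightarrow> m), 0)"
      using m 0 by (simp add: ij arc_level_def split: dir.splits)
    moreover have "(case d of Up \<Rightarrow> L - m | Down \<Rightarrow> m) \<le> L" using m by (simp split: dir.splits)
    ultimately show ?thesis by blast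
  next
    case (Suc n)
    then have "(m, n) \<in> points W" using x m level_K[of m] by (simp add: ij points_def)
    moreover have "x = sh (m, n)" by (simp add: ij m Suc sh_def)
    ultimately show ?thesis by blast
  qed
next
  fix x assume "x \<in> sh ` points W \<union> (\<lambda>k. (arc_level k, 0)) ` {..L}"
  then consider y where "y \<in> points W" "x = sh y" | k where "k \<le> L" "x = (arc_level k, 0)" by auto
  then show "x \<in> points ([], K)"
  proof cases
    case 1
    then show ?thesis
      using level_K[of "fst y"] by (cases y) (simp add: points_def length_K sh_def)
  next
    case 2
    have "\<exists>m\<le>L. arc_level k = Suc m"
      unfolding arc_level_def using 2(1) by (cases d) (auto simp: Suc_diff_le)
    then show ?thesis
      using level_K 2(2) by (auto simp: points_def length_K)
  qed
qed

lemma card_points_K: "card (points ([], K)) = card (points W) + Suc L"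
proof -
  have inj: "inj_on sh (points W)" "inj_on (\<lambda>k. (arc_level k, 0::nat)) {..L}"
    by (auto simp: inj_on_def sh_def arc_level_def split: dir.splits)
  have fin: "finite (points W)"
    using tangle by (intro fitting_diagram.finite_points) (simp add: fitting_diagram_def tangles_def diagram_eq)
  have "sh ` points W \<inter> (\<lambda>k. (arc_level k, 0::nat)) ` {..L} = {}" by (auto simp: sh_def)
  then have "card (points ([], K)) = card (sh ` points W) + card ((\<lambda>k. (arc_level k, 0::nat)) ` {..L})"
    unfolding points_K using fin by (simp add: card_Un_disjoint)
  then show ?thesis by (simp add: card_image[OF inj(1)] card_image[OF inj(2)])
qed

lemma next_K:
  assumes "x \<in> points W" "x \<noteq> final"
  shows "next_point ([], K) (sh x) = sh (next_point W x)"
    and "events_at ([], K) (sh x) = map shift_event (events_at W x)"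
proof -
  obtain i j where x: "x = (i, j)" by fastforce
  have i: "i \<le> L" "j < length (level W i)" using assms(1) by (simp_all add: x points_def)
  have lev: "level ([], K) (Suc i) ! Suc j = level W i ! j" using level_K[OF i(1)] by simp
  have "next_point ([], K) (sh x) = sh (next_point W x) \<and>
    events_at ([], K) (sh x) = map shift_event (events_at W x)"
  proof (cases "level W i ! j")
    case Up
    have "i \<noteq> L"
    proof
      assume "i = L"
      then have "x = final" unfolding final_def using i(2) Up level_L by (auto simp: x)
      then show False using assms(2) by simp
    qed
    then have "K ! Suc i = (Suc (fst (w ! i)), snd (w ! i))" using i nth_K by simp
    then show ?thesis
      using Up lev by (cases "w ! i") (auto simp: x sh_def other_def split: piece.splits)
  next
    case Down
    have "i \<noteq> 0"
    proof
      assume "i = 0"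
      then have "x = final" unfolding final_def using i(2) Down by (auto simp: x)
      then show False using assms(2) by simp
    qed
    then obtain m where m: "i = Suc m" by (cases i) auto
    then have "K ! Suc m = (Suc (fst (w ! m)), snd (w ! m))" using i nth_K by simp
    then show ?thesis
      using Down lev by (cases "w ! m") (auto simp: x m sh_def other_def split: piece.splits)
  qed
  then show "next_point ([], K) (sh x) = sh (next_point W x)"
    "events_at ([], K) (sh x) = map shift_event (events_at W x)" by blast+
qed

lemma level_K_arc: "k \<le> L \<Longrightarrow> level ([], K) (arc_level k) ! 0 = flip d"
  unfolding arc_level_def using level_K[of "L - k"] level_K[of k] by (cases d) (simp_all add: Suc_diff_le)

lemma nth_K_ends: "K ! 0 = (0, Minimum (case d of Up \<Rightarrow> LR | Down \<Rightarrow> RL))"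
  "K ! Suc L = (0, Maximum (case d of Up \<Rightarrow> RL | Down \<Rightarrow> LR))"
  by (simp_all add: K_eq nth_append shift_def)

lemma next_final:
  "next_point ([], K) (sh final) = (arc_level 0, 0)" "events_at ([], K) (sh final) = [Extremum first_extremum]"
  unfolding final_def sh_def arc_level_def first_extremum_def using level_K[of L] level_K[of 0] level_L nth_K_ends
  by (cases d; simp add: other_def)+

lemma next_arc:
  assumes "k < L"
  shows "next_point ([], K) (arc_level k, 0) = (arc_level (Suc k), 0)" "events_at ([], K) (arc_level k, 0) = []"
proof -
  have "next_point ([], K) (arc_level k, 0) = (arc_level (Suc k), 0) \<and> events_at ([], K) (arc_level k, 0) = []"
  proof (cases d)
    case Up
    have "Suc L - k - 1 = Suc (L - Suc k)" using assms by simp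
    then have "K ! (Suc L - k - 1) = (Suc (fst (w ! (L - Suc k))), snd (w ! (L - Suc k)))"
      using nth_K[of "L - Suc k"] assms by simp
    then show ?thesis
      unfolding arc_level_def using Up level_K_arc[of k, unfolded arc_level_def] assms by simp
  next
    case Down
    then show ?thesis
      unfolding arc_level_def using level_K_arc[of k, unfolded arc_level_def] assms nth_K[of k] by simp
  qed
  then show "next_point ([], K) (arc_level k, 0) = (arc_level (Suc k), 0)" "events_at ([], K) (arc_level k, 0) = []"
    by blast+
qed

lemma next_arc_end:
  "next_point ([], K) (arc_level L, 0) = sh start" "events_at ([], K) (arc_level L, 0) = [Extremum second_extremum]"
  unfolding arc_level_def start_def sh_def second_extremum_def
  using level_K_arc[of L, unfolded arc_level_def] nth_K_ends
  by (cases d; simp add: other_def)+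

lemma start_in: "sh start \<in> points ([], K)"
  using single_tangle by (simp add: points_K single_strand_def)

lemma final_in: "final \<in> points W"
  unfolding final_def using level_L by (cases d) (simp_all add: points_def)

sublocale traversed_diagram K "sh start"
  by (rule knot_diagramsD(2)[OF knot start_in])

definition "tp m = (next_point W ^^ m) start"

lemma traversal_closure:
  "traversal ([], K) (sh start) =
    map shift_event (traversal W start) @ [Extremum first_extremum, Extremum second_extremum]"
proof -
  let ?N = "card (points W)"
  have img: "tp ` {..<?N} = points W"
    using single_tangle by (simp add: single_strand_def tp_def[abs_def])
  \<comment> \<open>At this stage the end of the tangle need not be the last point visited. But the
    traversal of the closure is back at its start after m + L + 2 steps, which must be its number of
    points, and the count of points gives \<open>m = ?N - 1\<close>.\<close>
  define m where "m = (LEAST m. tp m = final)"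
  obtain m0 where m0: "m0 < ?N" "tp m0 = final" using final_in img by (metis imageE lessThan_iff)
  have tm: "tp m = final" unfolding m_def by (rule LeastI[of _ m0]) (rule m0)
  have "m \<le> m0" unfolding m_def by (rule Least_le) (rule m0)
  then have mN: "m < ?N" using m0 by simp
  have less: "tp k \<noteq> final" if "k < m" for k
    using not_less_Least[of k "\<lambda>m. tp m = final"] that by (simp add: m_def)
  have tp_in: "tp k \<in> points W" if "k \<le> m" for k
  proof -
    have "tp k \<in> tp ` {..<?N}" using that mN by simp
    then show ?thesis using img by simp
  qed
  have p1: "pt k = sh (tp k)" if "k \<le> m" for k
    using that
  proof (induction k)
    case 0
    then show ?case by (simp add: tp_def)
  next
    case (Suc k)
    then have "next_point ([], K) (sh (tp k)) = sh (next_point W (tp k))"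
      using less tp_in by (intro next_K) auto
    then show ?case using Suc by (simp add: pt_Suc) (simp add: tp_def)
  qed
  have p2: "pt (Suc m + k) = (arc_level k, 0)" if "k \<le> L" for k
    using that
  proof (induction k)
    case 0
    then show ?case using p1[of m] next_final(1) by (simp add: pt_Suc tm)
  next
    case (Suc k)
    then show ?case using next_arc(1)[of k] by (simp add: pt_Suc)
  qed
  have p3: "pt (Suc (Suc m + L)) = sh start"
    unfolding pt_Suc[of "Suc m + L"] p2[OF order_refl] by (rule next_arc_end(1))
  have "Suc (Suc m + L) = N"
  proof (rule ccontr)
    assume "Suc (Suc m + L) \<noteq> N"
    then have "Suc (Suc m + L) < N" "0 < N" using mN card_points_K by simp_all
    then have "Suc (Suc m + L) = 0" using pt_inj p3 pt_0 by (metis inj_onD lessThan_iff)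
    then show False by simp
  qed
  then have N: "N = Suc m + Suc L" and mN': "m = ?N - 1" using card_points_K by simp_all
  have s1: "seg 0 m = map shift_event (traversal W start)"
  proof -
    have "seg 0 m = concat (map (\<lambda>k. map shift_event (events_at W (tp k))) [0..<m])"
      unfolding seg_def
      by (intro arg_cong[of _ _ concat] map_cong[OF HOL.refl]) (use p1 less tp_in next_K(2) in auto)
    then show ?thesis by (simp add: traversal_def map_concat comp_def mN' tp_def)
  qed
  have s2: "seg m (Suc m) = [Extremum first_extremum]"
    by (simp add: seg_def p1 tm next_final(2))
  have s3: "seg (Suc m) (Suc m + L) = []"
  proof -
    have "ev (pt k) = []" if "k \<in> set [Suc m..<Suc m + L]" for k
    proof -
      have "k = Suc m + (k - Suc m)" "k - Suc m < L" using that by auto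
      then show ?thesis using p2[of "k - Suc m"] next_arc(2)[of "k - Suc m"] by simp
    qed
    then show ?thesis by (simp add: seg_def)
  qed
  have s4: "seg (Suc m + L) (Suc m + Suc L) = [Extremum second_extremum]"
    using p2[of L] next_arc_end(2) by (simp add: seg_def)
  show ?thesis
    unfolding traversal_seg N
    using seg_split[of 0 m "Suc m + Suc L"] seg_split[of m "Suc m" "Suc m + Suc L"]
      seg_split[of "Suc m" "Suc m + L" "Suc m + Suc L"] s1 s2 s3 s4 by simp
qed

text \<open>One closing extremum is of type d and the other of type u, with the same sign, so both
  exponents of every line of the tangle change by the same number.\<close>

lemma total_closing_arc:
  "total_d [Extremum first_extremum, Extremum second_extremum] = 2 * upness d - 1"
  "total_u [Extremum first_extremum, Extremum second_extremum] = 2 * upness d - 1"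
  unfolding first_extremum_def second_extremum_def by (cases d; simp add: total_d_def total_u_def)+

end

context twist
begin

text \<open>The closing arc twists all crossing lines by the same power of \<open>T\<^sub>d T\<^sub>u\<close>.\<close>

lemma functional_closure:
  assumes "(d, w) \<in> tangles" "closure_of (d, w) \<in> knot_diagrams"
  shows "\<exists>P\<in>points ([], closure_of (d, w)). functional C ([], closure_of (d, w)) P = Inv C (d, w)"
proof -
  interpret closed_tangle d w by unfold_locales (fact assms)+
  let ?E = "traversal W start"
  let ?E' = "traversal ([], K) (sh start)"
  let ?\<delta> = "2 * upness d - 1"
  note E' = traversal_closure
  have lines: "event_lines ?E' = map (\<lambda>(i, l). (Suc i, l)) (event_lines ?E)"
    by (simp add: E' shift_event_lines)
  have dist: "distinct (event_lines ?E)"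
    using distinct_lines unfolding lines by (simp add: distinct_map)
  have len: "length (labelled_lines ?E') = length (labelled_lines ?E)"
    using arg_cong[OF lines, of length] by (simp add: event_lines_def)
  have "functional C ([], K) (sh start) c = functional C W start c" for c
  proof (cases "length (labelled_lines ?E) = 0")
    case True
    then show ?thesis using len by (simp add: functional_def)
  next
    case False
    have "(\<Prod>i<length K. crossing_factor C (\<lambda>l. line_value C ?E' cs (i, l)) (snd (K ! i))) =
      (\<Prod>i<L. crossing_factor C (\<lambda>l. line_value C ?E cs (i, l)) (snd (w ! i)))"
      if "cs \<in> set (iter_comult C (length (labelled_lines ?E) - 1) c)" for cs
    proof -
      have cs: "length cs = length (event_lines ?E)"
        using length_iter_comult[OF that] False by (simp add: event_lines_def)
      then have cs': "length cs = length (event_lines ?E')" by (simp add: lines)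
      have mid: "crossing_factor C (\<lambda>l. line_value C ?E' cs (Suc i, l)) (snd (w ! i)) =
        crossing_factor C (\<lambda>l. line_value C ?E cs (i, l)) (snd (w ! i))" if i: "i < L" for i
      proof (cases "is_crossing (snd (w ! i))")
        case True
        have m': "(Suc i, l) \<in> set (event_lines ?E')" for l
          using True i set_lines nth_K by (simp add: crossing_lines_def length_K)
        have m: "(i, l) \<in> set (event_lines ?E)" for l
          using m'[of l] unfolding lines by auto
        have as: "assign v (event_lines ?E') cs (Suc i, l) = assign u (event_lines ?E) cs (i, l)" for v u l
        proof -
          have "map_of (zip (map (\<lambda>(i, l). (Suc i, l)) ls) cs) (Suc i, l) = map_of (zip ls cs) (i, l)"
            for ls :: "line list"
            by (induction ls cs rule: list_induct2') auto
          then show ?thesis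
            using assign_lookup[OF dist cs m[of l], where v = u] assign_lookup[OF distinct_lines cs' m'[of l], where v = v]
            by (simp add: lines)
        qed
        have lv: "line_value C ?E' cs (Suc i, l) p q = Tp ?\<delta> ?\<delta> (line_value C ?E cs (i, l) p q)" for l p q
        proof -
          have r: "rest_d ?E' (Suc i, l) = rest_d ?E (i, l) + ?\<delta>" "rest_u ?E' (Suc i, l) = rest_u ?E (i, l) + ?\<delta>"
            unfolding E' shift_event_rest[OF m] total_closing_arc by simp_all
          show ?thesis
            unfolding line_value_eq[OF distinct_lines cs' m', where v = "\<lambda>x. 0"]
              line_value_eq[OF dist cs m, where v = "\<lambda>x. 0"] r as[of _ _ "\<lambda>x. 0"] Tp_add[symmetric]
            by (simp add: ac_simps)
        qed
        have "(\<lambda>l. line_value C ?E' cs (Suc i, l)) = (\<lambda>l p q. Tp ?\<delta> ?\<delta> (line_value C ?E cs (i, l) p q))"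
          by (intro ext) (rule lv)
        then show ?thesis by (simp only: crossing_factor_Tp)
      next
        case False
        then show ?thesis by (cases "snd (w ! i)") (simp_all add: is_crossing_def)
      qed
      have ends: "crossing_factor C f (snd (K ! 0)) = 1" "crossing_factor C f (snd (K ! Suc L)) = 1" for f
        by (simp_all add: nth_K_ends)
      have sp: "(\<Prod>i<Suc (Suc L). f i) = f 0 * ((\<Prod>i<L. f (Suc i)) * f (Suc L))" for f :: "nat \<Rightarrow> 'k"
        by (subst prod.lessThan_Suc_shift) simp
      show ?thesis unfolding length_K sp ends by (simp add: nth_K mid)
    qed
    then show ?thesis
      using False len unfolding functional_def Let_def
      by (auto intro!: arg_cong[of _ _ sum_list] map_cong)
  qed
  then have "functional C ([], K) (sh start) = Inv C (d, w)"
    by (simp add: fun_eq_iff Inv_def start_eq diagram_eq)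
  then show ?thesis using start_in by blast
qed

theorem knot_scalar_tangle:
  assumes "cocommutative C c" "K \<in> knot_diagrams" "X \<in> tangles" "regularly_isotopic K (closure_of X)"
    "P \<in> points ([], K)"
  shows "knot_scalar C c K P = conv C (dual_power C (tw C) (whitney_degree K)) (Inv C X) c"
proof -
  obtain d w where X: "X = (d, w)" by fastforce
  note inv = knot_scalar_invariant[OF assms(1,2,4)]
  obtain Q where "Q \<in> points ([], closure_of X)" "functional C ([], closure_of X) Q = Inv C X"
    using functional_closure assms(3) inv(1) unfolding X by blast
  then show ?thesis
    using inv(2)[OF assms(5)] whitney_degree_invariant[OF assms(4)] by (simp add: knot_scalar_def)
qed

end

section \<open>Reversed orientation\<close>

lemma tensor_eq_rev: "tensor_eq s xs ys \<Longrightarrow> tensor_eq s (map rev xs) (map rev ys)"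
proof (induction rule: tensor_eq.induct)
  case (scale us a x vs y ws)
  show ?case
    using tensor_eq.sym[OF tensor_eq.scale[of s "rev ws" a y "rev vs" x "rev us"]] by simp
qed (auto intro: tensor_eq.intros)

lemma tensor2_eq_swap:
  assumes "tensor2_eq s xs ys" shows "tensor2_eq s (map prod.swap xs) (map prod.swap ys)"
proof -
  have e: "map (\<lambda>(x, y). [x, y]) (map prod.swap xs) = map rev (map (\<lambda>(x, y). [x, y]) xs)"
    "map (\<lambda>(x, y). [x, y]) (map prod.swap ys) = map rev (map (\<lambda>(x, y). [x, y]) ys)"
    by (auto simp: case_prod_unfold)
  show ?thesis unfolding tensor2_eq_def e by (rule tensor_eq_rev) (use assms in \<open>simp add: tensor2_eq_def\<close>)
qed

lemma tensor2_eq_trans: "tensor2_eq s xs ys \<Longrightarrow> tensor2_eq s ys zs \<Longrightarrow> tensor2_eq s xs zs"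
  unfolding tensor2_eq_def by (rule tensor_eq.trans)

text \<open>\<open>is_coalgebra\<close> puts the scalar on the left factor, and for the opposite
  coproduct this is the right one.\<close>

lemma tensor2_eq_scale: "tensor2_eq s (map (\<lambda>(u, v). (u, s a v)) xs) (map (\<lambda>(u, v). (s a u, v)) xs)"
  unfolding tensor2_eq_def
proof (induction xs)
  case Nil
  show ?case by (simp add: tensor_eq.refl)
next
  case (Cons uv xs)
  obtain u v where uv: "uv = (u, v)" by fastforce
  have "tensor_eq s [[u, s a v]] [[s a u, v]]"
    using tensor_eq.sym[OF tensor_eq.scale[of s "[]" a u "[]" v "[]"]] by simp
  from tensor_eq.cong[OF this Cons.IH] show ?case by (simp add: uv)
qed

lemma sum_list_swap [simp]: "(\<Sum>(x, y)\<leftarrow>map prod.swap xs. f x y) = (\<Sum>(x, y)\<leftarrow>xs. f y x)"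
  by (induction xs) auto

lemma cop_simps [simp]:
  "scl (cop C) = scl C" "comult (cop C) c = map prod.swap (comult C c)" "counit (cop C) = counit C"
  "br (cop C) = br C" "Td (cop C) = Td C" "Tu (cop C) = Tu C" "tw (cop C) = dual_inverse C (tw C)"
  by (simp_all add: cop_def)

lemma linear_form_cop [simp]: "linear_form (cop C) = linear_form C"
  and bilinear_form_cop [simp]: "bilinear_form (cop C) = bilinear_form C"
  by (simp_all add: linear_form_def bilinear_form_def fun_eq_iff)

lemma sweedler_cop: "sweedler (cop C) B c = sweedler C (\<lambda>x y. B y x) c"
  by (simp add: sweedler_def del: map_map list.map_comp)

lemma conv_cop: "conv (cop C) f g = conv C g f"
  by (simp add: fun_eq_iff conv_def mult.commute del: map_map list.map_comp)

lemma hit_cop: "hit_left (cop C) f c = hit_right C c f" "hit_right (cop C) c f = hit_left C f c"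
  by (simp_all add: hit_left_def hit_right_def del: map_map list.map_comp)

lemma coalgebra_automorphism_cop:
  assumes "coalgebra_automorphism C S" shows "coalgebra_automorphism (cop C) S"
proof -
  have "tensor2_eq (scl C) (map prod.swap (comult C (S c))) (map (\<lambda>(x, y). (S x, S y)) (map prod.swap (comult C c)))" for c
  proof -
    have "tensor2_eq (scl C) (comult C (S c)) (map (\<lambda>(x, y). (S x, S y)) (comult C c))"
      using assms by (simp add: coalgebra_automorphism_def)
    from tensor2_eq_swap[OF this] show ?thesis by (simp add: comp_def case_prod_unfold prod.swap_def)
  qed
  then show ?thesis using assms unfolding coalgebra_automorphism_def cop_simps by blast
qed

lemma is_form_inverse_cop: "is_form_inverse C f g \<Longrightarrow> is_form_inverse (cop C) f g"
  unfolding is_form_inverse_def cop_simps bilinear_form_cop sum_list_swap by (auto simp: mult.commute)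

lemma is_coalgebra_cop:
  assumes C: "is_coalgebra C" shows "is_coalgebra (cop C)"
  unfolding is_coalgebra_def cop_simps
proof (intro conjI allI)
  show "vector_space (scl C)" "linear_form (cop C) (counit C)" using C by (simp_all add: is_coalgebra_def)
  show "tensor2_eq (scl C) (map prod.swap (comult C (x + y))) (map prod.swap (comult C x) @ map prod.swap (comult C y))" for x y
    using C tensor2_eq_swap[of "scl C" "comult C (x + y)" "comult C x @ comult C y"] by (simp add: is_coalgebra_def)
  show "tensor2_eq (scl C) (map prod.swap (comult C (scl C a x))) (map (\<lambda>(u, v). (scl C a u, v)) (map prod.swap (comult C x)))" for a x
  proof (rule tensor2_eq_trans)
    have "tensor2_eq (scl C) (comult C (scl C a x)) (map (\<lambda>(u, v). (scl C a u, v)) (comult C x))"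
      using C by (simp add: is_coalgebra_def)
    from tensor2_eq_swap[OF this]
    show "tensor2_eq (scl C) (map prod.swap (comult C (scl C a x))) (map (\<lambda>(u, v). (u, scl C a v)) (map prod.swap (comult C x)))"
      by (simp add: comp_def case_prod_unfold prod.swap_def)
  qed (rule tensor2_eq_scale)
  show "tensor_eq (scl C)
      [[c11, c12, c2]. (c1, c2) \<leftarrow> map prod.swap (comult C c), (c11, c12) \<leftarrow> map prod.swap (comult C c1)]
      [[c1, c21, c22]. (c1, c2) \<leftarrow> map prod.swap (comult C c), (c21, c22) \<leftarrow> map prod.swap (comult C c2)]" for c
  proof -
    have "tensor_eq (scl C)
      [[c1, c21, c22]. (c1, c2) \<leftarrow> comult C c, (c21, c22) \<leftarrow> comult C c2]
      [[c11, c12, c2]. (c1, c2) \<leftarrow> comult C c, (c11, c12) \<leftarrow> comult C c1]"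
      using C unfolding is_coalgebra_def by (blast intro: tensor_eq.sym)
    from tensor_eq_rev[OF this] show ?thesis
      by (simp add: map_concat comp_def case_prod_unfold prod.swap_def)
  qed
  show "(\<Sum>(c1, c2)\<leftarrow>map prod.swap (comult C c). scl C (counit C c1) c2) = c"
    "(\<Sum>(c1, c2)\<leftarrow>map prod.swap (comult C c). scl C (counit C c2) c1) = c" for c
    using C by (simp_all add: is_coalgebra_def del: map_map list.map_comp)
qed

context twist
begin

lemma form_inverse_cop: "form_inverse (cop C) b = b'"
proof -
  interpret cop: coalg "cop C" by unfold_locales (rule is_coalgebra_cop[OF coalg])
  show ?thesis using cop.form_inverse_eq[OF _ is_form_inverse_cop[OF form_inverse]] bilin_b by simp
qed

lemma dual_inverse_cop: "dual_inverse (cop C) H = G" "is_dual_inverse (cop C) H G"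
proof -
  interpret cop: coalg "cop C" by unfold_locales (rule is_coalgebra_cop[OF coalg])
  show i: "is_dual_inverse (cop C) H G"
    by (simp add: is_dual_inverse_def lin_G conv_cop conv_G_H conv_H_G)
  show "dual_inverse (cop C) H = G" by (rule cop.dual_inverse_eq[OF _ i]) (simp add: lin_H)
qed

text \<open>\<open>H \<circ> S\<close> is again an inverse of G, because \<open>S\<close> respects
  the coproduct and fixes G.\<close>

lemma dual_inverse_automorphism:
  assumes S: "coalgebra_automorphism C S" and G: "G \<circ> S = G" shows "H \<circ> S = H"
proof (rule dual_inverse_unique[OF lin_G _ dual_inverse_G])
  have l: "lin (H \<circ> S)" using lin_comp_automorphism[OF S lin_H] by (simp add: comp_def)
  have GS: "G (S x) = G x" for x using fun_cong[OF G, of x] by simp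
  have cS: "\<epsilon> (S x) = \<epsilon> x" for x using S by (simp add: coalgebra_automorphism_def)
  have bil: "bilinear_form C (\<lambda>x y. G x * H y)" "bilinear_form C (\<lambda>x y. H x * G y)"
    by (intro bilinI lin_mult_left lin_mult_right lin_G lin_H)+
  have "conv C G (H \<circ> S) c = \<epsilon> c" "conv C (H \<circ> S) G c = \<epsilon> c" for c
    using coalgebra_automorphism_sweedler[OF S bil(1), of c] coalgebra_automorphism_sweedler[OF S bil(2), of c]
      fun_cong[OF conv_G_H, of "S c"] fun_cong[OF conv_H_G, of "S c"]
    by (simp_all add: conv_sweedler GS cS)
  then show "is_dual_inverse C G (H \<circ> S)" using l by (simp add: is_dual_inverse_def fun_eq_iff)
qed

text \<open>The left and the right action commute. Passing to the opposite coalgebra exchanges the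
  two actions and exchanges G with H, so this is the conjugation axiom there.\<close>

lemma T_hit: "T c = hit_right C (hit_left C H c) G"
proof (rule lin_separates)
  fix F assume F: "lin F"
  have "T c = hit_left C H (hit_right C c G)" using twist by (simp add: twist_oqc_def)
  then show "F (T c) = F (hit_right C (hit_left C H c) G)"
    using F by (simp add: lin_hit_left lin_hit_right lin_conv lin_G lin_H conv_assoc)
qed

text \<open>The opposite coproduct exchanges the two mixed axioms with each other, and likewise the
  two sides of the Yang-Baxter equation.\<close>

lemma twist_oqc_cop: "twist_oqc (cop C)"
  unfolding twist_oqc_def
proof (intro conjI allI)
  let ?f = "\<lambda>c d. \<Sum>(c1, c2)\<leftarrow>comult C c. \<Sum>(d1, d2)\<leftarrow>comult C d. b c1 (Tu C d2) * b' (Td C c2) d1"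
  let ?g = "\<lambda>c d. \<Sum>(c1, c2)\<leftarrow>comult C c. \<Sum>(d1, d2)\<leftarrow>comult C d. b' (Td C c1) d2 * b c2 (Tu C d1)"
  have ax: "\<forall>c d. ?f c d = \<epsilon> c * \<epsilon> d" "\<forall>c d. ?g c d = \<epsilon> c * \<epsilon> d"
    "\<forall>c d. b c d = b (Td C c) (Td C d) \<and> b c d = b (Tu C c) (Tu C d)"
    "\<forall>c d e.
          (\<Sum>(c1, c2)\<leftarrow>comult C c. \<Sum>(d1, d2)\<leftarrow>comult C d. \<Sum>(e1, e2)\<leftarrow>comult C e.
             b c1 d1 * b c2 e1 * b d2 e2)
        = (\<Sum>(c1, c2)\<leftarrow>comult C c. \<Sum>(d1, d2)\<leftarrow>comult C d. \<Sum>(e1, e2)\<leftarrow>comult C e.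
             b c2 d2 * b c1 e2 * b d1 e1)"
    using strict unfolding strict_oqc_def Let_def by blast+
  note is_form_inverse_cop[OF form_inverse]
  moreover have "Td C \<circ> Tu C = Tu C \<circ> Td C" using strict by (simp add: strict_oqc_def)
  moreover note ax
  ultimately show "strict_oqc (cop C)"
    unfolding strict_oqc_def Let_def cop_simps form_inverse_cop sum_list_swap bilinear_form_cop
    using is_coalgebra_cop[OF coalg] coalgebra_automorphism_cop[OF auto_Td] coalgebra_automorphism_cop[OF auto_Tu] bilin_b
    by (auto simp: mult.commute)
  show "linear_form (cop C) (tw (cop C))" by (simp add: lin_H)
  show "\<exists>h. is_dual_inverse (cop C) (tw (cop C)) h" using dual_inverse_cop(2) by auto
  have "G \<circ> Td C = G" "G \<circ> Tu C = G" using twist by (simp_all add: twist_oqc_def)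
  then show "tw (cop C) \<circ> Td (cop C) = tw (cop C)" "tw (cop C) \<circ> Tu (cop C) = tw (cop C)"
    using dual_inverse_automorphism auto_Td auto_Tu by simp_all
  show "Td (cop C) (Tu (cop C) c) = hit_left (cop C) (dual_inverse (cop C) (tw (cop C))) (hit_right (cop C) c (tw (cop C)))" for c
    using T_hit[of c] by (simp add: hit_cop dual_inverse_cop(1))
qed

lemma Tn_add: "Tn (m + n) x = Tn m (Tn n x)"
  by (rule fun_power_int_add[OF bij_T])

text \<open>The common exponent \<open>m\<close> cancels by invariance. For parallel lines so does
  the upness; for antiparallel ones it puts one T on the upward line, which is the T by which the
  factors for Up, Down and Down, Up differ.\<close>

lemma reduced_factor_reverse:
  "reduced_factor C (reverse_piece g) (Tn (k + upness (line_dir g SWNE) + m) x) (Tn (l + upness (line_dir g NWSE) + m) y) =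
    reduced_factor C g (Tn k x) (Tn l y)"
proof -
  have s: "\<beta> (Tn (k + j) x) (Tn (l + j) y) = \<beta> (Tn k x) (Tn l y)"
    if "\<And>m x y. \<beta> (Tp m m x) (Tp m m y) = \<beta> x y" for \<beta> :: "'c \<Rightarrow> 'c \<Rightarrow> 'k" and k l j x y
    by (simp add: add.commute[of _ j] Tn_add) (simp add: Tn_Tp that)
  note s = s[of b, OF b_Tp] s[of b', OF b'_Tp]
  have t: "T (Tn k x) = Tn (k + 1) x" for k x
    by (simp add: Tn_Tp T_Tp)
  note s' = s[of k m x l y] s[of k "1 + m" x l y] s[of "k + 1" m x l y] s[of k m x "l + 1" y]
    s[of l m y k x] s[of l "1 + m" y k x] s[of "l + 1" m y k x] s[of l m y "k + 1" x]
  show ?thesis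
  proof (cases g)
    case (Crossing c u v)
    then show ?thesis using s' by (cases c; cases u; cases v) (simp_all add: t ac_simps)
  qed simp_all
qed

lemma dual_power_cop: "dual_power (cop C) H n = dual_power C G (- n)"
proof -
  interpret cop: twist "cop C" by unfold_locales (rule twist_oqc_cop)
  note [simp] = dual_inverse_cop(1)
  show ?thesis
  proof (induction n rule: int_induct[where k = 0])
    case base
    show ?case using cop.dual_power_0 by simp
  next
    case (step1 i)
    have "dual_power (cop C) H (i + 1) = conv C (dual_power C G (- i)) H"
      using cop.dual_power_succ[of i] step1 by (simp add: conv_cop)
    also have "\<dots> = dual_power C G (- i - 1)" by (simp only: dual_power_pred dual_power_commute(2))
    finally show ?case by simp
  next
    case (step2 i)
    have "dual_power (cop C) H (i - 1) = conv C (dual_power C G (- i)) G"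
      using cop.dual_power_pred[of i] step2 by (simp add: conv_cop)
    also have "\<dots> = dual_power C G (- i + 1)" by (simp only: dual_power_succ dual_power_commute(1))
    finally show ?case by simp
  qed
qed

lemma functional_reverse:
  assumes "traversed_diagram K P"
  shows "functional C ([], reverse_orientation K) P = functional (cop C) ([], K) P"
proof
  fix c
  interpret cop: twist "cop C" by unfold_locales (rule twist_oqc_cop)
  interpret traversed_diagram K P by fact
  interpret R: traversed_diagram "reverse_orientation K" P by (rule traversed_reverse)
  let ?E = "traversal ([], K) P" and ?K = "reverse_orientation K"
  let ?E' = "traversal ([], ?K) P"
  \<comment> \<open>The part of the change of exponents that is the same for all crossing lines:
    reversal turns u_u into u_d minus its total, and parity turns u_d back into u_u.\<close>
  let ?m = "- up ([], K) P - total_d ?E"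
  let ?\<Phi> = "\<lambda>v. weight_product (map snd ?K) (\<lambda>x. Tn (rest_u ?E' x) (v x))"
  have rest: "rest_u ?E' (i, l) = rest_u ?E (i, l) + upness (line_dir (snd (K ! i)) l) + ?m"
    if "(i, l) \<in> set (event_lines ?E)" for i l
    using rest_u_reverse[OF distinct_lines that] parity[OF that] by (simp add: traversal_reverse)
  have pw: "reduced_factor C (map snd ?K ! i) (Tn (rest_u ?E' (i, SWNE)) (v (i, SWNE))) (Tn (rest_u ?E' (i, NWSE)) (v (i, NWSE))) =
      reduced_factor (cop C) (map snd K ! i) (Tn (rest_u ?E (i, SWNE)) (v (i, SWNE))) (Tn (rest_u ?E (i, NWSE)) (v (i, NWSE)))"
    if i: "i < length K" for i v
  proof (cases "is_crossing (snd (K ! i))")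
    case True
    then have "(i, l) \<in> set (event_lines ?E)" for l using i by (simp add: set_lines crossing_lines_def)
    note r = rest[OF this]
    have c: "reduced_factor (cop C) g x y = reduced_factor C g x y" for g x y
      by (cases "(C, g, x, y)" rule: reduced_factor.cases) (simp_all add: form_inverse_cop)
    show ?thesis
      using i by (simp only: r c reduced_factor_reverse reverse_snd nth_map snd_conv)
  next
    case False
    then show ?thesis using i by (cases "snd (K ! i)") (auto simp: is_crossing_def reverse_snd)
  qed
  have \<Phi>: "?\<Phi> v = cop.weight_product (map snd K) (\<lambda>x. cop.Tn (rest_u ?E x) (v x))" for v
    unfolding weight_product_def cop.weight_product_def
    by (rule prod.cong) (use pw in \<open>auto simp: reverse_snd\<close>)
  have ml: "multilinear (crossing_lines (map snd ?K)) ?\<Phi>" by (rule multilinear_weight_product)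
  have ev: "cop.evaluate ls ?\<Phi> v c = evaluate (rev ls) ?\<Phi> v c"
    if "distinct ls" "set ls \<subseteq> crossing_lines (map snd ?K)" for ls v c
    using that
  proof (induction ls arbitrary: v c)
    case (Cons l ls)
    then show ?case using evaluate_snoc[OF ml, of "rev ls" l v c] by (simp add: sweedler_cop)
  qed simp
  have lines: "event_lines ?E' = rev (event_lines ?E)"
    by (simp add: traversal_reverse event_lines_rev)
  let ?v = "\<lambda>x. 0 :: 'c"
  have "functional C ([], ?K) P c = evaluate (event_lines ?E') ?\<Phi> ?v c"
    using functional_evaluate[of ?E' "([], ?K)" P "up ([], ?K) P" c ?v] R.distinct_lines R.set_lines R.parity by simp
  also have "\<dots> = cop.evaluate (event_lines ?E) ?\<Phi> ?v c"
    using ev[OF distinct_lines] R.set_lines by (simp add: lines)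
  also have "\<dots> = functional (cop C) ([], K) P c"
    unfolding \<Phi> using cop.functional_evaluate[of ?E "([], K)" P "up ([], K) P" c ?v] distinct_lines set_lines parity by simp
  finally show "functional C ([], ?K) P c = functional (cop C) ([], K) P c" .
qed

text \<open>Reversal changes the sign of the Whitney degree, and the opposite coalgebra carries the
  inverse of G, so the same power of G occurs on both sides. Since the dual algebra of the opposite
  coalgebra multiplies in the opposite order, this power stands on the other side of the functional;
  cocommutativity exchanges the two factors.\<close>

theorem knot_scalar_reverse:
  assumes c: "cocommutative C c" and K: "K \<in> knot_diagrams"
    and P: "P \<in> points ([], reverse_orientation K)" "P' \<in> points ([], K)"
  shows "knot_scalar C c (reverse_orientation K) P = knot_scalar (cop C) c K P'"
proof -
  interpret traversed_diagram K P' by (rule knot_diagramsD(2)[OF K P(2)])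
  interpret R: traversed_diagram "reverse_orientation K" P' by (rule traversed_reverse)
  let ?E = "traversal ([], K) P'" and ?K = "reverse_orientation K"
  let ?f = "functional C ([], ?K) P'" and ?A = "dual_power C G (- whitney_degree K)"
  have lf: "lin ?f"
  proof -
    have "?f = evaluate (event_lines (traversal ([], ?K) P'))
      (\<lambda>v. weight_product (map snd ?K) (\<lambda>x. Tn (rest_u (traversal ([], ?K) P') x) (v x))) (\<lambda>x. 0)"
      using functional_evaluate[of _ "([], ?K)" P' "up ([], ?K) P'"] R.distinct_lines R.set_lines R.parity
      by (intro ext) simp
    then show ?thesis using lin_evaluate[OF multilinear_weight_product R.distinct_lines] R.set_lines by simp
  qed
  have w: "whitney_degree ?K = - whitney_degree K"
    by (simp add: R.whitney whitney traversal_reverse total_u_reverse total_d_u)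
  have "knot_scalar C c ?K P = knot_scalar C c ?K P'"
    by (rule knot_scalar_independent[OF R.traversed_diagram_axioms P(1) c])
  also have "\<dots> = conv C ?A ?f c" by (simp add: knot_scalar_def w)
  also have "\<dots> = conv C ?f ?A c"
    using cocommutative_sweedler[OF c, of "\<lambda>x y. ?f x * ?A y"] lf lin_dual_power
    by (simp add: conv_sweedler mult.commute bilinI lin_mult_left lin_mult_right)
  also have "\<dots> = knot_scalar (cop C) c K P'"
    by (simp add: knot_scalar_def conv_cop dual_power_cop functional_reverse traversed_diagram_axioms)
  finally show ?thesis .
qed

end

theorem theorem6:
  fixes C :: "('k::field, 'c::ab_group_add) twist_quantum_coalgebra" and c :: 'c
  assumes "twist_oqc C"
    and "cocommutative C c"
    and "(Td C \<circ> Tu C) c = c"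
  shows
    "(\<forall>K\<in>knot_diagrams. \<forall>K'\<in>knot_diagrams. regularly_isotopic K K' \<longrightarrow>
        (\<forall>P\<in>points ([], K). \<forall>P'\<in>points ([], K'). knot_scalar C c K P = knot_scalar C c K' P')) \<and>
     (\<forall>K\<in>knot_diagrams. \<forall>T\<in>tangles. regularly_isotopic K (closure_of T) \<longrightarrow>
        (\<forall>P\<in>points ([], K).
           knot_scalar C c K P = conv C (dual_power C (tw C) (whitney_degree K)) (Inv C T) c)) \<and>
     twist_oqc (cop C) \<and>
     (\<forall>K\<in>knot_diagrams. \<forall>P\<in>points ([], reverse_orientation K). \<forall>P'\<in>points ([], K).
        knot_scalar C c (reverse_orientation K) P = knot_scalar (cop C) c K P')"
proof -
  interpret twist C by unfold_locales (fact assms(1))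
  show ?thesis
    by (intro conjI ballI impI)
      (rule knot_scalar_invariant(2)[OF assms(2)] knot_scalar_tangle[OF assms(2)] twist_oqc_cop
        knot_scalar_reverse[OF assms(2)]; assumption)+
qed

end
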